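(* Let $m\ge 1$, $n\ge 2$ be integers, and let $\varsigma_2,\varsigma_4,\dots,\varsigma_{2m-2}\in\mathbb{Z}[q,q^{-1}]$ be nonzero parameters. Let $\mathbf{U}^{\imath}(\mathfrak{sp}_{2m})\subset\mathbf{U}_q(\mathfrak{sl}_{2m})$ be the $\imath$quantum group of type AII with these parameters, acting on the left on $\mathbb{W}^{\otimes n}$ (write $\Psi'$ for this action), and let $\mathfrak{B}_n(-q^{-1},q^{2m})$ act on the right on $\mathbb{W}^{\otimes n}$ by the explicit formulas given in the context (write $\Phi'$ for this action). Then the left action $\Psi'$ of $\mathbf{U}^{\imath}(\mathfrak{sp}_{2m})$ commutes with the right action $\Phi'$ of $\mathfrak{B}_n(-q^{-1},q^{2m})$. Moreover, the following double centralizer property holds: $$\Psi'(\mathbf{U}^{\imath}(\mathfrak{sp}_{2m}))=\mathrm{End}_{\mathfrak{B}_n(-q^{-1},q^{2m})}(\mathbb{W}^{\otimes n}),\qquad \Phi'(\mathfrak{B}_n(-q^{-1},q^{2m}))=\mathrm{End}_{\mathbf{U}^{\imath}(\mathfrak{sp}_{2m})}(\mathbb{W}^{\otimes n}).$$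
   Context: **Quantum group.** $\mathbf{U}_q(\mathfrak{sl}_{2m})$ is the Drinfeld–Jimbo quantum group over $\mathbb{Q}(q)$ of type $A_{2m-1}$ with generators $E_i,F_i,K_i^{\pm1}$ ($1\le i\le 2m-1$), with $K_iE_jK_i^{-1}=q^{a_{ij}}E_j$, $K_iF_jK_i^{-1}=q^{-a_{ij}}F_j$, $[E_i,F_j]=\delta_{ij}\frac{K_i-K_i^{-1}}{q-q^{-1}}$, the $K_i$ commuting and invertible, and the quantum Serre relations, where $(a_{ij})$ is the Cartan matrix of type $A_{2m-1}$. The comultiplication is $\Delta(E_i)=E_i\otimes1+K_i\otimes E_i$, $\Delta(F_i)=F_i\otimes K_i^{-1}+1\otimes F_i$, $\Delta(K_i^{\pm1})=K_i^{\pm1}\otimes K_i^{\pm1}$. **$\imath$quantum group of type AII.** $\mathbf{U}^{\imath}(\mathfrak{sp}_{2m})$ is the $\mathbb{Q}(q)$-subalgebra of $\mathbf{U}_q(\mathfrak{sl}_{2m})$ generated by $E_j,F_j,K_j^{\pm1}$ for $j=1,3,\dots,2m-1$ and $B_i=F_i+\varsigma_iT_{i-1}T_{i+1}(E_i)K_i^{-1}$ for $i=2,4,\dots,2m-2$. Here $T_i=T''_{i,1}$ is Lusztig's braid group automorphism of $\mathbf{U}_q(\mathfrak{sl}_{2m})$, with $T_i(E_i)=-F_iK_i$ and $T_i(E_j)=\sum_{r+s=-a_{ij}}(-1)^rq^{-r}E_i^{(s)}E_jE_i^{(r)}$ for $j\ne i$ ($E_i^{(s)}=E_i^s/[s]!$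 is the divided power); explicitly $$T_{i-1}T_{i+1}(E_i)=E_{i+1}E_{i-1}E_i-q^{-1}E_{i-1}E_iE_{i+1}-q^{-1}E_{i+1}E_iE_{i-1}+q^{-2}E_iE_{i-1}E_{i+1}.$$ **Representation.** $\mathbb{W}=\bigoplus_{i=1}^{2m}\mathbb{Q}(q)v_i$ is the natural $\mathbf{U}_q(\mathfrak{sl}_{2m})$-module: $E_iv_r=\delta_{r,i+1}v_{r-1}$, $F_iv_r=\delta_{r,i}v_{r+1}$, $K_iv_i=qv_i$, $K_iv_{i+1}=q^{-1}v_{i+1}$, $K_iv_r=v_r$ for $r\ne i,i+1$. $\mathbb{W}^{\otimes n}$ is a left $\mathbf{U}_q(\mathfrak{sl}_{2m})$-module, hence a left $\mathbf{U}^{\imath}(\mathfrak{sp}_{2m})$-module, via iterated $\Delta$. **$q$-Brauer algebra.** For invertible parameters $x,z$, $\mathfrak{B}_n(x,z)$ is the unital associative algebra with generators $H_1,\dots,H_{n-1},e$ and relations (each imposed whenever the generators in it exist): $(H_i-x)(H_i+x^{-1})=0$; $H_iH_{i+1}H_i=H_{i+1}H_iH_{i+1}$; $H_iH_j=H_jH_i$ for $|i-j|>1$; $e^2=\frac{z-z^{-1}}{x-x^{-1}}e$; $H_1e=eH_1=xe$; $eH_2e=ze$; $H_ie=eH_i$ for $i>2$; $H_2H_3H_1^{-1}H_2^{-1}e_{(2)}=e_{(2)}=e_{(2)}H_2H_3H_1^{-1}H_2^{-1}$, where $e_{(2)}=e(H_2H_3H_1^{-1}H_2^{-1})e$. $\mathfrak{B}_n(-q^{-1},q^{2m})$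 is this algebra over $\mathbb{Q}(q)$ with $x=-q^{-1}$, $z=q^{2m}$. **Right action.** Put $\kappa_1=1$ and $\kappa_i=\prod_{j=1}^{i-1}(-\varsigma_{2j})$ for $2\le i\le m$. The right action of $\mathfrak{B}_n(-q^{-1},q^{2m})$ on $\mathbb{W}^{\otimes n}$ is as follows. For $1\le k\le n-1$, $(v_{a_1}\otimes\cdots\otimes v_{a_n})\cdot H_k$ equals - $q\,v_{a_1}\otimes\cdots\otimes v_{a_n}$ if $a_k=a_{k+1}$; - $\cdots\otimes v_{a_{k+1}}\otimes v_{a_k}\otimes\cdots$ (factors $k$ and $k+1$ interchanged) if $a_k>a_{k+1}$; - $\cdots\otimes v_{a_{k+1}}\otimes v_{a_k}\otimes\cdots+(q-q^{-1})v_{a_1}\otimes\cdots\otimes v_{a_n}$ if $a_k<a_{k+1}$; and $(v_{a_1}\otimes\cdots\otimes v_{a_n})\cdot e$ equals - $\sum_{j=1}^m\kappa_i\kappa_j^{-1}q^{2m+1-3i-j}(v_{2j-1}\otimes v_{2j}-q\,v_{2j}\otimes v_{2j-1})\otimes v_{a_3}\otimes\cdots\otimes v_{a_n}$ if $a_1=2i-1$, $a_2=2i$ for some $1\le i\le m$; - $(-q)\,(v_{a_2}\otimes v_{a_1}\otimes v_{a_3}\otimes\cdots\otimes v_{a_n})\cdot e$ if $a_1=2i$, $a_2=2i-1$ for some $1\le i\le m$; - $0$ otherwise. *)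

theory Defs
  imports
    "HOL-Library.Poly_Mapping"
    "HOL-Library.Function_Algebras"
    "HOL-Computational_Algebra.Computational_Algebra"
    "HOL-Algebra.Generated_Rings"
begin

section \<open>The ground field \<open>\<rat>(q)\<close>\<close>

type_synonym qfield = "rat poly fract"

definition qq :: qfield where "qq = Fract [:0, 1:] 1"

text \<open>The subring \<open>\<int>[q, q\<^sup>-\<^sup>1]\<close>: quotients of integer polynomials in \<open>q\<close> by powers of \<open>q\<close>.\<close>

definition laurent_int :: "qfield set" where
  "laurent_int = {poly (map_poly of_int p) qq / qq ^ k | (p :: int poly) (k :: nat). True}"

definition qint :: "nat \<Rightarrow> qfield" where
  "qint s = (qq powi int s - qq powi (- int s)) / (qq - inverse qq)"

definition qfact :: "nat \<Rightarrow> qfield" where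
  "qfact s = (\<Prod>k = 1..s. qint k)"

section \<open>Algebras presented by generators and relations\<close>

text \<open>
  \<open>'g fword \<Rightarrow>\<^sub>0 qfield\<close>, the finitely supported functions on the free monoid over \<open>'g\<close>,
  with the convolution product of \<open>Poly_Mapping\<close>, is the free unital associative
  \<open>\<rat>(q)\<close>-algebra on \<open>'g\<close>.  The addition of \<open>'g fword\<close> is concatenation.
\<close>

datatype 'g fword = Word (letters: "'g list")

instantiation fword :: (type) monoid_add
begin

definition "0 = Word []"

definition "u + v = Word (letters u @ letters v)"

instance
  by standard (auto simp: zero_fword_def plus_fword_def)

end

type_synonym 'g free = "'g fword \<Rightarrow>\<^sub>0 qfield"

definition gen :: "'g \<Rightarrow> 'g free" where
  "gen g = Poly_Mapping.single (Word [g]) 1"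

definition scal :: "qfield \<Rightarrow> 'g free" where
  "scal c = Poly_Mapping.single 0 c"

definition free_alg :: "'g set \<Rightarrow> 'g free ring" where
  "free_alg G = \<lparr>carrier = {p. \<forall>w \<in> Poly_Mapping.keys p. set (letters w) \<subseteq> G},
     mult = (*), one = 1, zero = 0, add = (+)\<rparr>"

text \<open>
  The quotient by the two-sided ideal generated by \<open>R\<close>.  The scalars lie in the free algebra,
  so ring ideals of \<open>free_alg G\<close> are the same as \<open>\<rat>(q)\<close>-algebra ideals.
\<close>

definition pres_ideal :: "'g set \<Rightarrow> 'g free set \<Rightarrow> 'g free set" where
  "pres_ideal G R = Idl\<^bsub>free_alg G\<^esub> R"

definition pres_alg :: "'g set \<Rightarrow> 'g free set \<Rightarrow> 'g free set ring" where
  "pres_alg G R = free_alg G Quot pres_ideal G R"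

definition pres_class :: "'g set \<Rightarrow> 'g free set \<Rightarrow> 'g free \<Rightarrow> 'g free set" where
  "pres_class G R p = pres_ideal G R +>\<^bsub>free_alg G\<^esub> p"

text \<open>The algebra homomorphism between free algebras with prescribed values on generators.\<close>

definition free_hom :: "('g \<Rightarrow> 'h free) \<Rightarrow> 'g free \<Rightarrow> 'h free" where
  "free_hom \<phi> p = (\<Sum>w \<in> Poly_Mapping.keys p.
      scal (Poly_Mapping.lookup p w) * prod_list (map \<phi> (letters w)))"

section \<open>The quantum group \<open>U\<^sub>q(sl\<^sub>2\<^sub>m)\<close>\<close>

datatype ugen = UE nat | UF nat | UK nat | UKinv nat

abbreviation "EE i \<equiv> gen (UE i)"
abbreviation "FF i \<equiv> gen (UF i)"
abbreviation "KK i \<equiv> gen (UK i)"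
abbreviation "KKinv i \<equiv> gen (UKinv i)"

definition cartan :: "nat \<Rightarrow> nat \<Rightarrow> int" where
  "cartan i j = (if i = j then 2 else if i = Suc j \<or> j = Suc i then - 1 else 0)"

definition divpow :: "ugen \<Rightarrow> nat \<Rightarrow> ugen free" where
  "divpow g s = scal (inverse (qfact s)) * gen g ^ s"

definition ugens :: "nat \<Rightarrow> ugen set" where
  "ugens m = (\<Union>i \<in> {1..2*m-1}. {UE i, UF i, UK i, UKinv i})"

definition serre :: "(nat \<Rightarrow> ugen) \<Rightarrow> nat \<Rightarrow> nat \<Rightarrow> ugen free" where
  "serre X i j = (\<Sum>r = 0..nat (1 - cartan i j).
     (- 1) ^ r * divpow (X i) r * gen (X j) * divpow (X i) (nat (1 - cartan i j) - r))"

definition urels :: "nat \<Rightarrow> ugen free set" where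
  "urels m = (let I = {1..2*m-1} in
     {KK i * KKinv i - 1 | i. i \<in> I} \<union>
     {KKinv i * KK i - 1 | i. i \<in> I} \<union>
     {KK i * KK j - KK j * KK i | i j. i \<in> I \<and> j \<in> I} \<union>
     {KK i * EE j * KKinv i - scal (qq powi cartan i j) * EE j | i j. i \<in> I \<and> j \<in> I} \<union>
     {KK i * FF j * KKinv i - scal (qq powi (- cartan i j)) * FF j | i j. i \<in> I \<and> j \<in> I} \<union>
     {EE i * FF j - FF j * EE i
        - (if i = j then scal (inverse (qq - inverse qq)) * (KK i - KKinv i) else 0)
        | i j. i \<in> I \<and> j \<in> I} \<union>
     {serre UE i j | i j. i \<in> I \<and> j \<in> I \<and> i \<noteq> j} \<union>
     {serre UF i j | i j. i \<in> I \<and> j \<in> I \<and> i \<noteq> j})"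

definition Uq :: "nat \<Rightarrow> ugen free set ring" where
  "Uq m = pres_alg (ugens m) (urels m)"

definition Uq_class :: "nat \<Rightarrow> ugen free \<Rightarrow> ugen free set" where
  "Uq_class m = pres_class (ugens m) (urels m)"

section \<open>The iquantum group of type AII\<close>

definition Kpow :: "nat \<Rightarrow> int \<Rightarrow> ugen free" where
  "Kpow i a = (if a \<ge> 0 then KK i ^ nat a else KKinv i ^ nat (- a))"

text \<open>
  Lusztig's automorphism \<open>T''\<^sub>i\<^sub>,\<^sub>1\<close> of \<open>U\<^sub>q\<close> on generators; \<open>braid i\<close> is the endomorphism of the
  free algebra lifting it.  Only its values on words in the generators \<open>UE j\<close> enter below, see
  \<open>braid_explicit\<close>.
\<close>

fun braid_gen :: "nat \<Rightarrow> ugen \<Rightarrow> ugen free" where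
  "braid_gen i (UE j) = (if j = i then - (FF i * KK i)
     else (\<Sum>r = 0..nat (- cartan i j).
       (- 1) ^ r * scal (qq powi (- int r)) * divpow (UE i) (nat (- cartan i j) - r)
         * EE j * divpow (UE i) r))"
| "braid_gen i (UF j) = (if j = i then - (KKinv i * EE i)
     else (\<Sum>r = 0..nat (- cartan i j).
       (- 1) ^ r * scal (qq powi int r) * divpow (UF i) r
         * FF j * divpow (UF i) (nat (- cartan i j) - r)))"
| "braid_gen i (UK j) = (if j = i then KKinv i else KK j * Kpow i (- cartan i j))"
| "braid_gen i (UKinv j) = (if j = i then KK i else KKinv j * Kpow i (cartan i j))"

definition braid :: "nat \<Rightarrow> ugen free \<Rightarrow> ugen free" where
  "braid i = free_hom (braid_gen i)"

definition iB :: "(nat \<Rightarrow> qfield) \<Rightarrow> nat \<Rightarrow> ugen free" where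
  "iB \<sigma> i = FF i + scal (\<sigma> i) * braid (i - 1) (braid (i + 1) (EE i)) * KKinv i"

text \<open>
  The unital subring of \<open>U\<^sub>q\<close> generated by the listed elements together with the scalars, that is,
  the \<open>\<rat>(q)\<close>-subalgebra generated by the listed elements.
\<close>

definition Ui :: "nat \<Rightarrow> (nat \<Rightarrow> qfield) \<Rightarrow> ugen free set set" where
  "Ui m \<sigma> = generate_ring (Uq m) (Uq_class m `
     (range scal \<union>
      (\<Union>j \<in> {j. odd j \<and> 1 \<le> j \<and> j \<le> 2*m-1}. {EE j, FF j, KK j, KKinv j}) \<union>
      {iB \<sigma> i | i. even i \<and> 2 \<le> i \<and> i \<le> 2*m-2}))"

section \<open>The tensor space\<close>

text \<open>
  A vector of \<open>W\<^sup>\<otimes>\<^sup>n\<close> is given by its coordinates: \<open>f [a\<^sub>1, \<dots>, a\<^sub>n]\<close> is the coefficient of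
  \<open>v\<^bsub>a\<^sub>1\<^esub> \<otimes> \<dots> \<otimes> v\<^bsub>a\<^sub>n\<^esub>\<close>.
\<close>

type_synonym 'i vec = "'i \<Rightarrow> qfield"

definition basis_vec :: "'i \<Rightarrow> 'i vec" where
  "basis_vec a = (\<lambda>b. if b = a then 1 else 0)"

definition smul :: "qfield \<Rightarrow> 'i vec \<Rightarrow> 'i vec" where
  "smul c f = (\<lambda>a. c * f a)"

definition lin_ext :: "'i set \<Rightarrow> ('i \<Rightarrow> 'j vec) \<Rightarrow> 'i vec \<Rightarrow> 'j vec" where
  "lin_ext A \<beta> f = (\<Sum>a \<in> A. smul (f a) (\<beta> a))"

definition indices :: "nat \<Rightarrow> nat \<Rightarrow> nat list set" where
  "indices m n = {w. length w = n \<and> set w \<subseteq> {1..2*m}}"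

definition tens :: "nat \<Rightarrow> nat \<Rightarrow> nat list vec set" where
  "tens m n = {f. \<forall>w. w \<notin> indices m n \<longrightarrow> f w = 0}"

text \<open>The ring \<open>End(W\<^sup>\<otimes>\<^sup>n)\<close> of linear endomorphisms, as extensional functions on \<open>tens m n\<close>.\<close>

definition End_tens :: "nat \<Rightarrow> nat \<Rightarrow> (nat list vec \<Rightarrow> nat list vec) ring" where
  "End_tens m n = (let V = tens m n in
     \<lparr>carrier = {T \<in> V \<rightarrow>\<^sub>E V.
        (\<forall>x \<in> V. \<forall>y \<in> V. T (x + y) = T x + T y) \<and> (\<forall>c. \<forall>x \<in> V. T (smul c x) = smul c (T x))},
      mult = compose V, one = (\<lambda>x \<in> V. x),
      zero = (\<lambda>x \<in> V. 0), add = (\<lambda>S T. \<lambda>x \<in> V. S x + T x)\<rparr>)"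

definition opposite :: "'a ring \<Rightarrow> 'a ring" where
  "opposite R = R\<lparr>mult := (\<lambda>x y. y \<otimes>\<^bsub>R\<^esub> x)\<rparr>"

text \<open>
  Action of a free algebra when the generator \<open>g\<close> acts by \<open>op g\<close>: for a left action the word
  \<open>g\<^sub>1 \<dots> g\<^sub>k\<close> acts by \<open>op g\<^sub>1 \<circ> \<dots> \<circ> op g\<^sub>k\<close>, for a right action by \<open>op g\<^sub>k \<circ> \<dots> \<circ> op g\<^sub>1\<close>.
\<close>

definition free_lact :: "('g \<Rightarrow> 'i vec \<Rightarrow> 'i vec) \<Rightarrow> 'g free \<Rightarrow> 'i vec \<Rightarrow> 'i vec" where
  "free_lact op p f = (\<Sum>w \<in> Poly_Mapping.keys p.
      smul (Poly_Mapping.lookup p w) (foldr op (letters w) f))"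

definition free_ract :: "('g \<Rightarrow> 'i vec \<Rightarrow> 'i vec) \<Rightarrow> 'g free \<Rightarrow> 'i vec \<Rightarrow> 'i vec" where
  "free_ract op p f = (\<Sum>w \<in> Poly_Mapping.keys p.
      smul (Poly_Mapping.lookup p w) (fold op (letters w) f))"

text \<open>
  The operator on \<open>tens m n\<close> induced by a residue class \<open>X\<close>; \<open>the_elem\<close> picks the common value of
  the representatives, so this is meaningful only if the action respects the relations.
\<close>

definition class_act ::
  "nat \<Rightarrow> nat \<Rightarrow> ('g free \<Rightarrow> nat list vec \<Rightarrow> nat list vec) \<Rightarrow>
   'g free set \<Rightarrow> nat list vec \<Rightarrow> nat list vec" where
  "class_act m n act X = (\<lambda>f \<in> tens m n. the_elem ((\<lambda>p. act p f) ` X))"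

section \<open>The left action\<close>

fun nat_basis :: "ugen \<Rightarrow> nat \<Rightarrow> nat vec" where
  "nat_basis (UE i) r = (if r = i + 1 then basis_vec (r - 1) else 0)"
| "nat_basis (UF i) r = (if r = i then basis_vec (r + 1) else 0)"
| "nat_basis (UK i) r =
     smul (if r = i then qq else if r = i + 1 then inverse qq else 1) (basis_vec r)"
| "nat_basis (UKinv i) r =
     smul (if r = i then inverse qq else if r = i + 1 then qq else 1) (basis_vec r)"

definition natural :: "nat \<Rightarrow> ugen \<Rightarrow> nat vec \<Rightarrow> nat vec" where
  "natural m g = lin_ext {1..2*m} (nat_basis g)"

text \<open>\<open>\<Delta>(g) = \<Sum> x \<otimes> y\<close>, as the list of the pairs \<open>(x, y)\<close>, each of \<open>x\<close> and \<open>y\<close> a word in the generators.\<close>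

fun coprod :: "ugen \<Rightarrow> (ugen list \<times> ugen list) list" where
  "coprod (UE i) = [([UE i], []), ([UK i], [UE i])]"
| "coprod (UF i) = [([UF i], [UKinv i]), ([], [UF i])]"
| "coprod (UK i) = [([UK i], [UK i])]"
| "coprod (UKinv i) = [([UKinv i], [UKinv i])]"

text \<open>
  \<open>A \<otimes> B\<close> on \<open>W \<otimes> W\<^sup>\<otimes>\<^sup>n\<close>: apply \<open>B\<close> in the last \<open>n\<close> tensor factors, then \<open>A\<close> in the first.
\<close>

fun tens_op :: "(nat vec \<Rightarrow> nat vec) \<Rightarrow> (nat list vec \<Rightarrow> nat list vec) \<Rightarrow>
    nat list vec \<Rightarrow> nat list vec" where
  "tens_op A B f [] = 0"
| "tens_op A B f (a # w) = A (\<lambda>b. B (\<lambda>u. f (b # u)) w) a"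

text \<open>
  The generators on \<open>W\<^sup>\<otimes>\<^sup>n\<close> through the iterated coproduct; \<open>W\<^sup>\<otimes>\<^sup>0\<close> is the trivial module given by
  the counit (\<open>E\<^sub>i, F\<^sub>i \<mapsto> 0\<close>, \<open>K\<^sub>i\<^sup>\<plusminus>\<^sup>1 \<mapsto> 1\<close>).
\<close>

fun counit :: "ugen \<Rightarrow> qfield" where
  "counit (UE i) = 0"
| "counit (UF i) = 0"
| "counit (UK i) = 1"
| "counit (UKinv i) = 1"

fun tens_rep :: "nat \<Rightarrow> nat \<Rightarrow> ugen \<Rightarrow> nat list vec \<Rightarrow> nat list vec" where
  "tens_rep m 0 g f = smul (counit g) f"
| "tens_rep m (Suc n) g f =
     (\<Sum>(x, y) \<leftarrow> coprod g. tens_op (foldr (natural m) x) (foldr (tens_rep m n) y) f)"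

definition Psi :: "nat \<Rightarrow> nat \<Rightarrow> ugen free set \<Rightarrow> nat list vec \<Rightarrow> nat list vec" where
  "Psi m n = class_act m n (free_lact (tens_rep m n))"

section \<open>The q-Brauer algebra\<close>

datatype bgen = BH nat | Be

abbreviation "HH i \<equiv> gen (BH i)"
abbreviation "ee \<equiv> gen Be"

text \<open>The quadratic relation makes \<open>H\<^sub>i\<close> invertible, with inverse \<open>H\<^sub>i - (x - x\<^sup>-\<^sup>1)\<close>; see \<open>HHinv_rel\<close>.\<close>

definition HHinv :: "qfield \<Rightarrow> nat \<Rightarrow> bgen free" where
  "HHinv x i = HH i - scal (x - inverse x)"

definition e2 :: "qfield \<Rightarrow> bgen free" where
  "e2 x = ee * (HH 2 * HH 3 * HHinv x 1 * HHinv x 2) * ee"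

definition bgens :: "nat \<Rightarrow> bgen set" where
  "bgens n = insert Be (BH ` {1..n-1})"

definition brels :: "nat \<Rightarrow> qfield \<Rightarrow> qfield \<Rightarrow> bgen free set" where
  "brels n x z = (let I = {1..n-1}; h = HH 2 * HH 3 * HHinv x 1 * HHinv x 2 in
     {(HH i - scal x) * (HH i + scal (inverse x)) | i. i \<in> I} \<union>
     {HH i * HH (i+1) * HH i - HH (i+1) * HH i * HH (i+1) | i. i \<in> I \<and> i + 1 \<in> I} \<union>
     {HH i * HH j - HH j * HH i | i j. i \<in> I \<and> j \<in> I \<and> \<bar>int i - int j\<bar> > 1} \<union>
     {ee * ee - scal ((z - inverse z) / (x - inverse x)) * ee} \<union>
     (if 1 \<in> I then {HH 1 * ee - scal x * ee, ee * HH 1 - scal x * ee} else {}) \<union>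
     (if 2 \<in> I then {ee * HH 2 * ee - scal z * ee} else {}) \<union>
     {HH i * ee - ee * HH i | i. i \<in> I \<and> i > 2} \<union>
     (if 3 \<in> I then {h * e2 x - e2 x, e2 x * h - e2 x} else {}))"

definition qBrauer :: "nat \<Rightarrow> qfield \<Rightarrow> qfield \<Rightarrow> bgen free set ring" where
  "qBrauer n x z = pres_alg (bgens n) (brels n x z)"

section \<open>The right action\<close>

definition kappa :: "(nat \<Rightarrow> qfield) \<Rightarrow> nat \<Rightarrow> qfield" where
  "kappa \<sigma> i = (\<Prod>j = 1..i-1. - \<sigma> (2*j))"

definition swap :: "nat \<Rightarrow> nat list \<Rightarrow> nat list" where
  "swap k w = w[k - 1 := w ! k, k := w ! (k - 1)]"

text \<open>Tensor positions are numbered from 1, list positions from 0.\<close>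

definition H_basis :: "nat \<Rightarrow> nat list \<Rightarrow> nat list vec" where
  "H_basis k w = (let a = w ! (k - 1); b = w ! k in
     if a = b then smul qq (basis_vec w)
     else if a > b then basis_vec (swap k w)
     else basis_vec (swap k w) + smul (qq - inverse qq) (basis_vec w))"

text \<open>\<open>(v\<^bsub>2i-1\<^esub> \<otimes> v\<^bsub>2i\<^esub> \<otimes> v\<^bsub>w\<^esub>) \<cdot> e\<close>\<close>

definition e_pair :: "nat \<Rightarrow> (nat \<Rightarrow> qfield) \<Rightarrow> nat \<Rightarrow> nat list \<Rightarrow> nat list vec" where
  "e_pair m \<sigma> i w = (\<Sum>j = 1..m.
     smul (kappa \<sigma> i * inverse (kappa \<sigma> j) * qq powi (2 * int m + 1 - 3 * int i - int j))
       (basis_vec ((2*j-1) # (2*j) # w) - smul qq (basis_vec ((2*j) # (2*j-1) # w))))"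

text \<open>For positive \<open>a, b\<close> the two conditions say \<open>(a, b) = (2i-1, 2i)\<close>, respectively \<open>(2i, 2i-1)\<close>.\<close>

fun e_basis :: "nat \<Rightarrow> (nat \<Rightarrow> qfield) \<Rightarrow> nat list \<Rightarrow> nat list vec" where
  "e_basis m \<sigma> (a # b # w) =
     (if odd a \<and> b = a + 1 then e_pair m \<sigma> (b div 2) w
      else if odd b \<and> a = b + 1 then smul (- qq) (e_pair m \<sigma> (a div 2) w)
      else 0)"
| "e_basis m \<sigma> _ = 0"

fun brauer_op :: "nat \<Rightarrow> nat \<Rightarrow> (nat \<Rightarrow> qfield) \<Rightarrow> bgen \<Rightarrow> nat list vec \<Rightarrow> nat list vec" where
  "brauer_op m n \<sigma> (BH k) = lin_ext (indices m n) (H_basis k)"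
| "brauer_op m n \<sigma> Be = lin_ext (indices m n) (e_basis m \<sigma>)"

definition Phi :: "nat \<Rightarrow> nat \<Rightarrow> (nat \<Rightarrow> qfield) \<Rightarrow> bgen free set \<Rightarrow> nat list vec \<Rightarrow> nat list vec"
  where "Phi m n \<sigma> = class_act m n (free_ract (brauer_op m n \<sigma>))"

section \<open>Centralizers\<close>

definition End_commuting ::
  "nat \<Rightarrow> nat \<Rightarrow> 'a set \<Rightarrow> ('a \<Rightarrow> nat list vec \<Rightarrow> nat list vec) \<Rightarrow>
   (nat list vec \<Rightarrow> nat list vec) set" where
  "End_commuting m n A \<rho> = {T \<in> carrier (End_tens m n).
     \<forall>a \<in> A. \<forall>f \<in> tens m n. T (\<rho> a f) = \<rho> a (T f)}"

section \<open>Explicit forms\<close>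

lemma scal_mult: "scal c * scal d = (scal (c * d) :: 'g free)"
  by (simp add: scal_def mult_single)

lemma scal_one: "scal 1 = (1 :: 'g free)"
  by (simp add: scal_def)

lemma scal_diff: "scal (c - d) = (scal c - scal d :: 'g free)"
  by (simp add: scal_def single_diff)

lemma scal_mult_single: "scal c * Poly_Mapping.single w d = (Poly_Mapping.single w (c * d) :: 'g free)"
  by (simp add: scal_def mult_single)

lemma scal_comm_gen: "scal c * gen g = gen g * (scal c :: 'g free)"
  by (simp add: scal_def gen_def mult_single)

lemma HHinv_rel:
  assumes "x \<noteq> 0"
  shows "HH i * HHinv x i - 1 = (HH i - scal x) * (HH i + scal (inverse x))"
    and "HHinv x i * HH i - 1 = (HH i - scal x) * (HH i + scal (inverse x))"
proof -
  have 1: "scal x * scal (inverse x) = (1 :: bgen free)"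
    using assms by (simp add: scal_mult scal_one)
  show "HH i * HHinv x i - 1 = (HH i - scal x) * (HH i + scal (inverse x))"
    and "HHinv x i * HH i - 1 = (HH i - scal x) * (HH i + scal (inverse x))"
    by (simp_all add: HHinv_def scal_diff algebra_simps 1 scal_comm_gen)
qed

lemma qq_neq_inverse: "qq \<noteq> inverse qq"
proof
  assume eq: "qq = inverse qq"
  have "qq = Fract 1 [:0, 1:]"
    using eq by (simp add: qq_def)
  then have "[:0, 1:] * [:0, 1:] = (1 :: rat poly)"
    by (simp add: qq_def eq_fract one_pCons)
  then show False
    by (simp add: one_pCons)
qed

lemma divpow_0: "divpow g 0 = 1"
  by (simp add: divpow_def qfact_def scal_one)

lemma divpow_1: "divpow g (Suc 0) = gen g"
proof -
  have "qfact (Suc 0) = 1"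
    using qq_neq_inverse by (simp add: qfact_def qint_def power_int_minus)
  then show ?thesis
    by (simp add: divpow_def scal_one)
qed

lemma free_hom_superset:
  assumes "finite S" "Poly_Mapping.keys p \<subseteq> S"
  shows "free_hom \<phi> p = (\<Sum>w \<in> S. scal (Poly_Mapping.lookup p w) * prod_list (map \<phi> (letters w)))"
  unfolding free_hom_def
  by (rule sum.mono_neutral_left) (use assms in \<open>auto simp: scal_def in_keys_iff\<close>)

lemma free_hom_diff: "free_hom \<phi> (p - r) = free_hom \<phi> p - free_hom \<phi> r"
proof -
  let ?S = "Poly_Mapping.keys p \<union> Poly_Mapping.keys r"
  have "Poly_Mapping.keys (p - r) \<subseteq> ?S"
    by (auto simp: in_keys_iff lookup_minus)
  then show ?thesis
    by (simp add: free_hom_superset[of ?S] lookup_minus scal_diff sum_subtractf algebra_simps)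
qed

lemma free_hom_single:
  "free_hom \<phi> (Poly_Mapping.single w c) = scal c * prod_list (map \<phi> (letters w))"
  by (simp add: free_hom_superset[of "{w}"])

lemma braid_gen_adjacent:
  assumes "i = Suc j \<or> j = Suc i"
  shows "braid_gen i (UE j) = EE i * EE j - scal (inverse qq) * EE j * EE i"
proof -
  have "i \<noteq> j" "cartan i j = - 1"
    using assms by (auto simp: cartan_def)
  then show ?thesis
    by (simp add: divpow_0 divpow_1 scal_one power_int_minus)
qed

lemma braid_gen_far:
  assumes "i \<noteq> j" "i \<noteq> Suc j" "j \<noteq> Suc i"
  shows "braid_gen i (UE j) = EE j"
  using assms by (simp add: cartan_def divpow_0 scal_one)

lemma braid_explicit:
  assumes "i \<ge> 2"
  shows "braid (i - 1) (braid (i + 1) (EE i)) =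
    EE (i+1) * EE (i-1) * EE i - scal (inverse qq) * EE (i-1) * EE i * EE (i+1)
    - scal (inverse qq) * EE (i+1) * EE i * EE (i-1)
    + scal (inverse qq ^ 2) * EE i * EE (i-1) * EE (i+1)"
proof -
  have 1: "braid (i + 1) (EE i) = EE (i+1) * EE i - scal (inverse qq) * EE i * EE (i+1)"
    unfolding braid_def gen_def[of "UE i"] free_hom_single
    by (simp add: scal_one braid_gen_adjacent flip: gen_def del: braid_gen.simps)
  have w: "EE (i+1) * EE i = Poly_Mapping.single (Word [UE (i+1), UE i]) 1"
    "scal (inverse qq) * EE i * EE (i+1)
       = Poly_Mapping.single (Word [UE i, UE (i+1)]) (inverse qq)"
    by (simp_all add: gen_def scal_def mult_single plus_fword_def zero_fword_def)
  have g: "braid_gen (i - Suc 0) (UE (Suc i)) = EE (Suc i)"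
    "braid_gen (i - Suc 0) (UE i)
       = EE (i - Suc 0) * EE i - scal (inverse qq) * EE i * EE (i - Suc 0)"
    using assms by (auto simp del: braid_gen.simps intro!: braid_gen_far braid_gen_adjacent)
  have "braid (i - 1) (braid (i + 1) (EE i)) =
      EE (i+1) * (EE (i-1) * EE i - scal (inverse qq) * EE i * EE (i-1))
      - scal (inverse qq) * ((EE (i-1) * EE i - scal (inverse qq) * EE i * EE (i-1)) * EE (i+1))"
    unfolding 1 w unfolding braid_def free_hom_diff free_hom_single
    by (simp add: g scal_one del: braid_gen.simps)
  also have "\<dots> = EE (i+1) * EE (i-1) * EE i - scal (inverse qq) * EE (i-1) * EE i * EE (i+1)
      - scal (inverse qq) * EE (i+1) * EE i * EE (i-1)
      + scal (inverse qq ^ 2) * EE i * EE (i-1) * EE (i+1)"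
    by (simp add: gen_def scal_def mult_single plus_fword_def zero_fword_def
        algebra_simps power2_eq_square)
  finally show ?thesis .
qed

end

theory Submission
  imports Defs "HOL-Combinatorics.Transposition"
begin

text \<open>
  The double centralizer property is deduced from its limit at \<open>q = 1\<close>, the classical duality between
  the symplectic Lie algebra \<open>sp\<^sub>2\<^sub>m\<close> and the Brauer algebra on the \<open>n\<close>-th tensor power of the natural
  module, by a semicontinuity argument that needs no representation theory over \<open>\<rat>(q)\<close>.

  Write \<open>A\<close> and \<open>C\<close> for the matrix algebras over \<open>\<rat>(q)\<close> spanned by the two actions.  Once the actions are
  known to commute, \<open>A\<close> is contained in the commutant of \<open>C\<close>.  A matrix in that commutant whose entries
  are regular at \<open>q = 1\<close> reduces there to a rational matrix commuting with the reductions of the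
  generators of \<open>C\<close>.  By the classical theorem this reduction lies in the algebra generated by the
  reductions of the generators of \<open>A\<close>, so it is also the reduction of an element of \<open>A\<close>.
  A subspace whose reduction contains the reduction of a larger subspace is equal to the larger one
  (\<open>subspace_eq_by_specialisation\<close>), hence \<open>A\<close> is the whole commutant of \<open>C\<close>.  The argument is symmetric in
  \<open>A\<close> and \<open>C\<close>; it is carried out in \<open>duality_specialises\<close>, and \<open>image_of_commutant\<close> translates between
  matrices and the actions.

  The parameters \<open>\<sigma>\<^sub>i\<close> may have zeros or poles at \<open>q = 1\<close>, but conjugation by a diagonal matrix replaces
  all of them by \<open>- 1\<close> (the lemmas about \<open>gauge\<close>).  Then \<open>H\<^sub>k\<close> reduces to the exchange of two tensor
  factors and \<open>e\<close> to a contraction followed by an insertion of the symplectic form, while \<open>E\<^sub>j\<close>, \<open>F\<^sub>j\<close>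
  for odd \<open>j\<close> and \<open>B\<^sub>i\<close> for even \<open>i\<close> reduce to root vectors generating \<open>sp\<^sub>2\<^sub>m\<close>.

  The classical duality is proved from scratch.  The first fundamental theorem
  (\<open>symplectic_first_fundamental_theorem\<close>) describes the invariant tensors: a Casimir-type identity
  expresses a positive definite operator applied to an invariant through contractions, which are
  invariants of fewer slots.  It gives the commutant of \<open>sp\<^sub>2\<^sub>m\<close>, and the commutant of the Brauer algebra
  follows from the bicommutant theorem for transpose-closed matrix algebras over an ordered field.

  What remains is that the formulas define actions of the presented algebras and that these actions
  commute.  All operators are given by recursion on the word of basis indices, so the relations
  reduce to a few leading letters.  The image of \<open>e\<close> and the functional defining \<open>e\<close> are an invariant and
  a coinvariant of the iquantum group; the relation for \<open>e\<^sub>(\<^sub>2\<^sub>)\<close> is the most laborious one.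
\<close>

section \<open>Subspaces of coordinate spaces and specialisation at \<open>q = 1\<close>\<close>

definition subsp :: "('x \<Rightarrow> 'a::field) set \<Rightarrow> bool" where
  "subsp S \<longleftrightarrow> (\<lambda>_. 0) \<in> S \<and> (\<forall>f \<in> S. \<forall>g \<in> S. \<forall>c. (\<lambda>x. f x + c * g x) \<in> S)"

lemma subspI:
  assumes "(\<lambda>_. 0) \<in> S" "\<And>f g c. f \<in> S \<Longrightarrow> g \<in> S \<Longrightarrow> (\<lambda>x. f x + c * g x) \<in> S"
  shows "subsp S"
  using assms by (auto simp: subsp_def)

lemma subsp_zero: "subsp S \<Longrightarrow> (\<lambda>_. 0) \<in> S"
  by (simp add: subsp_def)

lemma subsp_comb: "subsp S \<Longrightarrow> f \<in> S \<Longrightarrow> g \<in> S \<Longrightarrow> (\<lambda>x. f x + c * g x) \<in> S"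
  by (simp add: subsp_def)

lemma subsp_scale: "subsp S \<Longrightarrow> g \<in> S \<Longrightarrow> (\<lambda>x. c * g x) \<in> S"
  using subsp_comb[of S "\<lambda>_. 0" g c] subsp_zero[of S] by simp

lemma subsp_sum:
  assumes "subsp S" "\<And>i. i \<in> A \<Longrightarrow> g i \<in> S"
  shows "(\<lambda>x. \<Sum>i\<in>A. c i * g i x) \<in> S"
proof (cases "finite A")
  case True
  then show ?thesis using assms(2)
  proof (induction A)
    case empty
    then show ?case using assms(1) by (simp add: subsp_zero)
  next
    case (insert a A)
    then show ?case
      using subsp_comb[OF assms(1), of "\<lambda>x. \<Sum>i\<in>A. c i * g i x" "g a" "c a"]
      by (simp add: add.commute)
  qed
qed (simp add: subsp_zero[OF assms(1)])

text \<open>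
  Evaluation at \<open>q = 1\<close> as a relation: its domain is the local ring of \<open>\<rat>(q)\<close> at \<open>1\<close>.
\<close>

definition spec :: "qfield \<Rightarrow> rat \<Rightarrow> bool" where
  "spec c r \<longleftrightarrow> (\<exists>p d. poly d 1 \<noteq> 0 \<and> c = Fract p d \<and> r = poly p 1 / poly d 1)"

lemma spec_Fract: "poly d 1 \<noteq> 0 \<Longrightarrow> spec (Fract p d) (poly p 1 / poly d 1)"
  by (auto simp: spec_def)

lemma spec_unique:
  assumes "spec c r" "spec c s"
  shows "r = s"
proof -
  obtain p d where d1: "poly d 1 \<noteq> 0" "c = Fract p d" "r = poly p 1 / poly d 1"
    using assms(1) unfolding spec_def by blast
  obtain p' d' where d2: "poly d' 1 \<noteq> 0" "c = Fract p' d'" "s = poly p' 1 / poly d' 1"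
    using assms(2) unfolding spec_def by blast
  note d = d1(1) d2(1) and c = d1(2) d2(2) and rs = d1(3) d2(3)
  have "d \<noteq> 0" "d' \<noteq> 0"
    using d by auto
  then have "p * d' = p' * d"
    using c by (simp add: eq_fract)
  then have "poly p 1 * poly d' 1 = poly p' 1 * poly d 1"
    by (metis poly_mult)
  then show ?thesis
    using d rs by (simp add: frac_eq_eq)
qed

lemma spec_add:
  assumes "spec c r" "spec c' r'"
  shows "spec (c + c') (r + r')"
proof -
  obtain p d p' d' where d: "poly d 1 \<noteq> 0" "poly d' 1 \<noteq> 0"
    and c: "c = Fract p d" "c' = Fract p' d'" "r = poly p 1 / poly d 1" "r' = poly p' 1 / poly d' 1"
    using assms by (auto simp: spec_def)
  have "d \<noteq> 0" "d' \<noteq> 0"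
    using d by auto
  then show ?thesis
    using spec_Fract[of "d * d'" "p * d' + p' * d"] d by (simp add: c add_frac_eq)
qed

lemma spec_mult:
  assumes "spec c r" "spec c' r'"
  shows "spec (c * c') (r * r')"
proof -
  obtain p d p' d' where d: "poly d 1 \<noteq> 0" "poly d' 1 \<noteq> 0"
    and c: "c = Fract p d" "c' = Fract p' d'" "r = poly p 1 / poly d 1" "r' = poly p' 1 / poly d' 1"
    using assms by (auto simp: spec_def)
  then show ?thesis
    using spec_Fract[of "d * d'" "p * p'"] by simp
qed

lemma spec_0: "spec 0 0" and spec_1: "spec 1 1"
  using spec_Fract[of 1 0] spec_Fract[of 1 1] by (simp_all add: Zero_fract_def One_fract_def)

lemma spec_uminus: "spec c r \<Longrightarrow> spec (- c) (- r)"
proof -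
  assume "spec c r"
  then obtain p d where "poly d 1 \<noteq> 0" "c = Fract p d" "r = poly p 1 / poly d 1"
    unfolding spec_def by blast
  then show ?thesis
    using spec_Fract[of d "- p"] by simp
qed

lemma spec_diff: "spec c r \<Longrightarrow> spec c' r' \<Longrightarrow> spec (c - c') (r - r')"
  using spec_add[OF _ spec_uminus, of c r c' r'] by simp

lemma spec_qq: "spec qq 1"
  using spec_Fract[of 1 "[:0, 1:]"] by (simp add: qq_def)

lemma spec_inverse:
  assumes "spec c r" "r \<noteq> 0"
  shows "spec (inverse c) (inverse r)"
proof -
  obtain p d where d: "poly d 1 \<noteq> 0" and c: "c = Fract p d" "r = poly p 1 / poly d 1"
    using assms by (auto simp: spec_def)
  then have "poly p 1 \<noteq> 0"
    using assms(2) by simp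
  then show ?thesis
    using spec_Fract[of p d] by (simp add: c)
qed

lemma spec_power: "spec c r \<Longrightarrow> spec (c ^ k) (r ^ k)"
  by (induction k) (auto intro: spec_1 spec_mult)

lemma spec_sum:
  assumes "\<And>i. i \<in> A \<Longrightarrow> spec (f i) (g i)"
  shows "spec (\<Sum>i\<in>A. f i) (\<Sum>i\<in>A. g i)"
  using assms by (induction A rule: infinite_finite_induct) (auto intro: spec_0 spec_add)

text \<open>Regularity at \<open>q = 1\<close> defines a valuation ring of \<open>\<rat>(q)\<close>: in a fraction in lowest terms,
  numerator and denominator do not both vanish at \<open>1\<close>.\<close>

lemma spec_or_inverse: "(\<exists>r. spec c r) \<or> (\<exists>r. spec (inverse c) r)"
proof -
  have "(\<exists>r. spec (Fract p d) r) \<or> (\<exists>r. spec (inverse (Fract p d)) r)" if "d \<noteq> 0" for p d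
    using that
  proof (induction "degree d" arbitrary: p d rule: less_induct)
    case less
    show ?case
    proof (cases "poly d 1 = 0 \<and> poly p 1 = 0")
      case False
      then show ?thesis
        using spec_Fract[of d p] spec_Fract[of p d] by auto
    next
      case True
      then obtain d' p' where dp: "d = [:- 1, 1:] * d'" "p = [:- 1, 1:] * p'"
        by (metis dvd_def poly_eq_0_iff_dvd)
      have d': "d' \<noteq> 0"
        using dp less.prems by auto
      then have "degree d = degree ([:- 1, 1:] :: rat poly) + degree d'"
        unfolding dp by (intro degree_mult_eq) auto
      then have "degree d' < degree d"
        by simp
      moreover have "Fract p d = Fract p' d'"
        using less.prems d' by (simp add: dp eq_fract del: mult_pCons_left)
      ultimately show ?thesis
        using less.hyps[of d' p'] d' by simp
    qed
  qed
  then show ?thesis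
    by (cases c) auto
qed

lemma frac_cancel: "b \<noteq> 0 \<Longrightarrow> (a / b) * (b / c) = a / (c :: 'a::field)"
  by simp

text \<open>
  A valuation ring has the property that a nonzero vector becomes regular after division by an entry of
  smallest valuation.
\<close>

lemma spec_pivot:
  assumes "finite X" "\<exists>x \<in> X. f x \<noteq> 0"
  shows "\<exists>i \<in> X. f i \<noteq> 0 \<and> (\<forall>x \<in> X. \<exists>r. spec (f x / f i) r)"
  using assms
proof (induction X)
  case (insert y X)
  show ?case
  proof (cases "\<exists>x \<in> X. f x \<noteq> 0")
    case False
    then have "f y \<noteq> 0" "\<forall>x \<in> X. f x = 0"
      using insert.prems by auto
    then show ?thesis
      using spec_0 spec_1 by (intro bexI[of _ y]) auto
  next
    case True
    then obtain i where i: "i \<in> X" "f i \<noteq> 0" "\<forall>x \<in> X. \<exists>r. spec (f x / f i) r"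
      using insert.IH by blast
    show ?thesis
    proof (cases "\<exists>r. spec (f y / f i) r")
      case True
      then show ?thesis using i by blast
    next
      case False
      then obtain r where r: "spec (f i / f y) r"
        using spec_or_inverse[of "f y / f i"] unfolding inverse_divide by blast
      have "f y \<noteq> 0"
      proof
        assume "f y = 0"
        then have "spec (f y / f i) 0"
          by (simp only: div_0 spec_0)
        then show False
          using False by blast
      qed
      moreover have "\<exists>s. spec (f x / f y) s" if x: "x \<in> X" for x
      proof -
        obtain s where "spec (f x / f i) s"
          using i(3) x by blast
        then have "spec ((f x / f i) * (f i / f y)) (s * r)"
          by (rule spec_mult[OF _ r])
        then have "spec (f x / f y) (s * r)"
          by (simp only: frac_cancel[OF i(2)])
        then show ?thesis
          by (rule exI)
      qed
      moreover have "spec (f y / f y) 1"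
        by (simp only: divide_self[OF \<open>f y \<noteq> 0\<close>] spec_1)
      ultimately show ?thesis
        by (intro bexI[of _ y]) auto
    qed
  qed
qed simp

text \<open>
  A Nakayama-type principle.  Reduction at \<open>q = 1\<close> preserves dimensions, so a subspace whose
  reduction already contains the reduction of a larger subspace is equal to it.  Instead of
  dimensions, the proof eliminates one coordinate at a time: a vector of \<open>S\<close> with an entry \<open>1\<close> in
  position \<open>i\<close> and all entries regular lets one pass to the subspaces of vectors vanishing at \<open>i\<close>.
\<close>

lemma subspace_eq_by_specialisation:
  assumes "finite X" "subsp S" "subsp S'" "S \<subseteq> S'"
    and "\<And>f x. f \<in> S' \<Longrightarrow> x \<notin> X \<Longrightarrow> f x = 0"
    and "\<And>f r. f \<in> S' \<Longrightarrow> (\<And>x. spec (f x) (r x)) \<Longrightarrow> \<exists>g \<in> S. \<forall>x. spec (g x) (r x)"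
  shows "S' \<subseteq> S"
  using assms
proof (induction X arbitrary: S S' rule: finite_psubset_induct)
  case (psubset X)
  note S = psubset.prems(1) and S' = psubset.prems(2) and sub = psubset.prems(3)
    and supp = psubset.prems(4) and red = psubset.prems(5)
  have normal: "\<exists>i \<in> X. (\<lambda>x. inverse (f i) * f x) \<in> T \<and> f i \<noteq> 0
      \<and> (\<exists>r. \<forall>x. spec (inverse (f i) * f x) (r x))"
    if f: "f \<in> T" "f x \<noteq> 0" and T: "subsp T" "T \<subseteq> S'" for f x T
  proof -
    have "x \<in> X"
      using f supp T by blast
    then obtain i where i: "i \<in> X" "f i \<noteq> 0" "\<forall>x \<in> X. \<exists>r. spec (f x / f i) r"
      using spec_pivot[OF \<open>finite X\<close>, of f] f(2) by blast
    have "\<exists>r. spec (inverse (f i) * f x) r" for x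
    proof (cases "x \<in> X")
      case True
      then show ?thesis
        using i(3) by (simp add: divide_inverse mult.commute)
    next
      case False
      then have "f x = 0"
        using supp f(1) T(2) by blast
      then show ?thesis
        using spec_0 by auto
    qed
    then have "\<exists>r. \<forall>x. spec (inverse (f i) * f x) (r x)"
      by metis
    then show ?thesis
      using i subsp_scale[OF T(1) f(1)] by blast
  qed
  show ?case
  proof (cases "\<exists>s \<in> S. \<exists>x. s x \<noteq> 0")
    case False
    show ?thesis
    proof
      fix f assume f: "f \<in> S'"
      have "f x = 0" for x
      proof (rule ccontr)
        assume "f x \<noteq> 0"
        then obtain i r where i: "(\<lambda>x. inverse (f i) * f x) \<in> S'" "f i \<noteq> 0"
          and r: "\<forall>x. spec (inverse (f i) * f x) (r x)"
          using normal[OF f _ S'] by blast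
        obtain g where "g \<in> S" "\<forall>x. spec (g x) (r x)"
          using red[OF i(1)] r by blast
        \<comment> \<open>A normalised vector of \<open>S'\<close> has an entry \<open>1\<close>, whereas only the zero vector is available as a lift.\<close>
        then have "spec 0 (r i)" "spec 1 (r i)"
          using r[rule_format, of i] i(2) False by (metis, simp)
        then show False
          using spec_unique spec_0 spec_1 zero_neq_one by metis
      qed
      then have "f = (\<lambda>_. 0)"
        by auto
      then show "f \<in> S"
        using S by (simp add: subsp_zero)
    qed
  next
    case True
    then obtain s0 x0 where s0: "s0 \<in> S" "s0 x0 \<noteq> 0"
      by blast
    then obtain i r where i: "i \<in> X" "(\<lambda>x. inverse (s0 i) * s0 x) \<in> S" "s0 i \<noteq> 0"
      and r: "\<forall>x. spec (inverse (s0 i) * s0 x) (r x)"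
      using normal[OF s0 S sub] by blast
    define s where "s = (\<lambda>x. inverse (s0 i) * s0 x)"
    have s: "s \<in> S" "s i = 1" "\<And>x. spec (s x) (r x)"
      using i r by (auto simp: s_def)
    define S0 where "S0 = {f \<in> S. f i = 0}"
    define S0' where "S0' = {f \<in> S'. f i = 0}"
    \<comment> \<open>A lift of a reduction vanishing at \<open>i\<close> has an \<open>i\<close>-th entry that reduces to \<open>0\<close>;
      subtracting that multiple of \<open>s\<close> moves the lift into \<open>S0\<close> without changing its reduction.\<close>
    have "S0' \<subseteq> S0"
    proof (rule psubset.IH[of "X - {i}"])
      show "X - {i} \<subset> X" using i by auto
      show "subsp S0" "subsp S0'"
        using S S' by (auto simp: S0_def S0'_def subsp_def)
      show "S0 \<subseteq> S0'"
        using sub by (auto simp: S0_def S0'_def)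
      show "f x = 0" if "f \<in> S0'" "x \<notin> X - {i}" for f x
        using that supp by (auto simp: S0'_def)
      show "\<exists>g\<in>S0. \<forall>x. spec (g x) (\<rho> x)" if f: "f \<in> S0'" "\<And>x. spec (f x) (\<rho> x)" for f \<rho>
      proof -
        obtain g where g: "g \<in> S" "\<And>x. spec (g x) (\<rho> x)"
          using red[of f \<rho>] f by (auto simp: S0'_def)
        have "spec 0 (\<rho> i)"
          using f(1) f(2)[of i] by (simp add: S0'_def)
        then have \<rho>i: "\<rho> i = 0"
          using spec_0 spec_unique by blast
        have "(\<lambda>x. g x + (- g i) * s x) \<in> S0"
          using subsp_comb[OF S g(1) s(1), of "- g i"] s(2) by (simp add: S0_def)
        moreover have "spec (g x + (- g i) * s x) (\<rho> x)" for x
          using spec_add[OF g(2)[of x] spec_mult[OF spec_uminus[OF g(2)[of i]] s(3)[of x]]] \<rho>i by simp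
        ultimately show ?thesis
          by (intro bexI[of _ "\<lambda>x. g x + (- g i) * s x"] allI)
      qed
    qed
    show ?thesis
    proof
      fix f assume f: "f \<in> S'"
      have "(\<lambda>x. f x + (- f i) * s x) \<in> S0'"
        using subsp_comb[OF S' f, of s "- f i"] s sub by (auto simp: S0'_def)
      then have "(\<lambda>x. f x + (- f i) * s x) \<in> S"
        using \<open>S0' \<subseteq> S0\<close> by (auto simp: S0_def)
      then have "(\<lambda>x. (f x + (- f i) * s x) + f i * s x) \<in> S"
        using subsp_comb[OF S _ s(1)] by blast
      then show "f \<in> S" by simp
    qed
  qed
qed

section \<open>Matrix algebras and the bicommutant theorem\<close>

text \<open>
  Matrices are functions on pairs, supported on a finite set, so that a space of matrices is again a
  subspace of a coordinate space.
\<close>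

type_synonym ('x, 'a) mat = "'x \<times> 'x \<Rightarrow> 'a"

definition mmul :: "'x set \<Rightarrow> ('x, 'a::field) mat \<Rightarrow> ('x, 'a) mat \<Rightarrow> ('x, 'a) mat" where
  "mmul X S T = (\<lambda>(u, w). \<Sum>v\<in>X. S (u, v) * T (v, w))"

definition mone :: "'x set \<Rightarrow> ('x, 'a::field) mat" where
  "mone X = (\<lambda>(u, w). if u = w \<and> u \<in> X then 1 else 0)"

definition mats :: "'x set \<Rightarrow> ('x, 'a::field) mat set" where
  "mats X = {T. \<forall>u w. u \<notin> X \<or> w \<notin> X \<longrightarrow> T (u, w) = 0}"

inductive_set malg :: "'x set \<Rightarrow> ('x, 'a::field) mat set \<Rightarrow> ('x, 'a) mat set" for X G where
  malg_one: "mone X \<in> malg X G"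
| malg_gen: "g \<in> G \<Longrightarrow> g \<in> malg X G"
| malg_comb: "S \<in> malg X G \<Longrightarrow> T \<in> malg X G \<Longrightarrow> (\<lambda>x. S x + c * T x) \<in> malg X G"
| malg_mul: "S \<in> malg X G \<Longrightarrow> T \<in> malg X G \<Longrightarrow> mmul X S T \<in> malg X G"

definition mcomm :: "'x set \<Rightarrow> ('x, 'a::field) mat set \<Rightarrow> ('x, 'a) mat set" where
  "mcomm X G = {T \<in> mats X. \<forall>g \<in> G. mmul X T g = mmul X g T}"

definition mtr :: "('x, 'a) mat \<Rightarrow> ('x, 'a) mat" where
  "mtr T = (\<lambda>(u, w). T (w, u))"

lemma malg_subsp: "subsp (malg X G)"
proof (rule subspI)
  show "(\<lambda>_. 0) \<in> malg X G"
  proof -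
    have "(\<lambda>x. mone X x + (- 1) * mone X x) \<in> malg X G"
      by (rule malg_comb[OF malg_one malg_one])
    then show ?thesis by simp
  qed
qed (rule malg_comb)

lemmas malg_scale = subsp_scale[OF malg_subsp]
lemmas malg_sum = subsp_sum[OF malg_subsp]

lemma mats_subsp: "subsp (mats X)"
  by (auto simp: subsp_def mats_def)

lemma mmul_assoc:
  assumes "finite X"
  shows "mmul X (mmul X R S) T = mmul X R (mmul X S T)"
proof -
  have "(\<Sum>v\<in>X. (\<Sum>y\<in>X. R (u, y) * S (y, v)) * T (v, w))
      = (\<Sum>y\<in>X. R (u, y) * (\<Sum>v\<in>X. S (y, v) * T (v, w)))" for u w
    unfolding sum_distrib_left sum_distrib_right mult.assoc by (rule sum.swap)
  then show ?thesis by (simp add: mmul_def)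
qed

lemma mmul_comb_left: "mmul X (\<lambda>x. S x + c * T x) R = (\<lambda>x. mmul X S R x + c * mmul X T R x)"
  by (auto simp: mmul_def fun_eq_iff sum.distrib sum_distrib_left algebra_simps)

lemma mmul_comb_right: "mmul X R (\<lambda>x. S x + c * T x) = (\<lambda>x. mmul X R S x + c * mmul X R T x)"
  by (auto simp: mmul_def fun_eq_iff sum.distrib sum_distrib_left algebra_simps)

lemma mmul_one:
  assumes "finite X" "T \<in> mats X"
  shows "mmul X (mone X) T = T" "mmul X T (mone X) = T"
proof -
  have a: "(if u = v \<and> u \<in> X then 1 else 0) * t = (if v = u then if u \<in> X then t else 0 else 0)"
    and b: "t * (if v = u \<and> v \<in> X then 1 else 0) = (if v = u then if u \<in> X then t else 0 else 0)"
    for u v :: 'a and t :: 'b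
    by auto
  show "mmul X (mone X) T = T" "mmul X T (mone X) = T"
    unfolding mmul_def mone_def prod.case a b
    using assms by (auto simp: fun_eq_iff mats_def sum.delta)
qed

lemma mats_mmul: "S \<in> mats X \<Longrightarrow> T \<in> mats X \<Longrightarrow> mmul X S T \<in> mats X"
  by (auto simp: mats_def mmul_def)

lemma malg_mats:
  assumes "G \<subseteq> mats X" "T \<in> malg X G"
  shows "T \<in> mats X"
  using assms(2)
proof (induction rule: malg.induct)
  case malg_one
  then show ?case by (auto simp: mats_def mone_def)
next
  case (malg_comb S T c)
  then show ?case using subsp_comb[OF mats_subsp] by blast
qed (use assms(1) in \<open>auto intro: mats_mmul\<close>)

lemma malg_subset: "H \<subseteq> malg X G \<Longrightarrow> T \<in> malg X H \<Longrightarrow> T \<in> malg X G"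
  by (rotate_tac, induction rule: malg.induct) (auto intro: malg.intros)

lemma mcomm_subsp: "subsp (mcomm X G)"
  using mats_subsp[of X] by (auto simp: subsp_def mcomm_def mmul_comb_left mmul_comb_right)
     (auto simp: mmul_def)

lemma mcomm_malg:
  assumes "finite X" "T \<in> mcomm X G" "S \<in> malg X G"
  shows "mmul X T S = mmul X S T"
  using assms(3)
proof induction
  case malg_one
  then show ?case using assms by (simp add: mmul_one mcomm_def)
next
  case (malg_gen g)
  then show ?case using assms by (simp add: mcomm_def)
next
  case (malg_comb S S' c)
  then show ?case by (simp add: mmul_comb_left mmul_comb_right)
next
  case (malg_mul S S')
  then show ?case by (metis mmul_assoc[OF assms(1)])
qed

text \<open>Orthonormal bases need not exist over an ordered field, but orthogonal projections do.\<close>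

lemma orthogonal_projection:
  fixes S :: "('x \<Rightarrow> 'a::linordered_field) set"
  assumes "finite X" "subsp S"
  shows "\<exists>s \<in> S. \<forall>t \<in> S. (\<Sum>x\<in>X. (f x - s x) * t x) = 0"
  using assms
proof (induction X arbitrary: S f)
  case empty
  then show ?case using subsp_zero by auto
next
  case (insert i X)
  let ?ip = "\<lambda>f g :: 'x \<Rightarrow> 'a. \<Sum>x\<in>insert i X. f x * g x"
  define S0 where "S0 = {t \<in> S. t i = 0}"
  have S0: "subsp S0"
    using insert.prems by (auto simp: S0_def subsp_def)
  have proj0: "\<exists>s \<in> S0. \<forall>t \<in> S0. (\<Sum>x\<in>insert i X. (f x - s x) * t x) = 0" for f
    using insert.IH[OF S0, of f] insert.hyps by (auto simp: S0_def)
  show ?case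
  proof (cases "\<exists>s \<in> S. s i \<noteq> 0")
    case False
    then have "S0 = S" by (auto simp: S0_def)
    then show ?thesis using proj0 by blast
  next
    case True
    then obtain s1 where s1: "s1 \<in> S" "s1 i \<noteq> 0" by blast
    obtain p where p: "p \<in> S0" "\<forall>t \<in> S0. (\<Sum>x\<in>insert i X. (s1 x - p x) * t x) = 0"
      using proj0 by blast
    define r where "r = (\<lambda>x. s1 x - p x)"
    have r: "r \<in> S" "r i \<noteq> 0"
      using subsp_comb[OF insert.prems s1(1), of p "- 1"] p s1 by (auto simp: r_def S0_def)
    have rt: "?ip r t = 0" if "t \<in> S0" for t
      using p that by (auto simp: r_def)
    \<comment> \<open>Ordered fields enter here: a sum of squares vanishes only if all its terms do.\<close>
    have N: "?ip r r \<noteq> 0"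
      using r(2) insert.hyps by (simp add: sum_nonneg_eq_0_iff add_nonneg_eq_0_iff sum_nonneg)
    obtain p0 where p0: "p0 \<in> S0" "\<forall>t \<in> S0. (\<Sum>x\<in>insert i X. (f x - p0 x) * t x) = 0"
      using proj0 by blast
    define k where "k = ?ip f r / ?ip r r"
    define s where "s = (\<lambda>x. p0 x + k * r x)"
    have "s \<in> S"
      using subsp_comb[OF insert.prems, of p0 r k] p0 r by (auto simp: s_def S0_def)
    moreover have "(\<Sum>x\<in>insert i X. (f x - s x) * t x) = 0" if t: "t \<in> S" for t
    proof -
      define c where "c = t i / r i"
      define t0 where "t0 = (\<lambda>x. t x + (- c) * r x)"
      have t0: "t0 \<in> S0"
        using subsp_comb[OF insert.prems t r(1), of "- c"] r by (simp add: t0_def S0_def c_def)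
      have e1: "(\<Sum>x\<in>insert i X. (f x - p0 x) * t0 x) = 0" and e2: "?ip r t0 = 0" and e3: "?ip r p0 = 0"
        using p0 t0 rt by auto
      have "(\<Sum>x\<in>insert i X. (f x - s x) * t x)
          = (\<Sum>x\<in>insert i X. (f x - p0 x) * t0 x - k * (r x * t0 x) + c * (f x * r x)
              - c * (r x * p0 x) - c * k * (r x * r x))"
        by (rule sum.cong) (auto simp: t0_def s_def algebra_simps)
      also have "\<dots> = (\<Sum>x\<in>insert i X. (f x - p0 x) * t0 x) - k * ?ip r t0 + c * ?ip f r
              - c * ?ip r p0 - c * k * ?ip r r"
        by (simp only: sum.distrib sum_subtractf sum_distrib_left)
      also have "\<dots> = c * (?ip f r - k * ?ip r r)"
        unfolding e1 e2 e3 by (simp add: algebra_simps)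
      also have "\<dots> = 0"
        using N by (simp add: k_def)
      finally show ?thesis .
    qed
    ultimately show ?thesis by blast
  qed
qed

lemma mtr_mmul: "mtr (mmul X S T) = mmul X (mtr T) (mtr S)"
  by (auto simp: mtr_def mmul_def fun_eq_iff mult.commute)

lemma malg_mtr:
  assumes "\<And>g. g \<in> G \<Longrightarrow> mtr g \<in> malg X G" "T \<in> malg X G"
  shows "mtr T \<in> malg X G"
  using assms(2)
proof induction
  case malg_one
  have "mtr (mone X) = mone X" by (auto simp: mtr_def mone_def fun_eq_iff)
  then show ?case by (metis malg.malg_one)
next
  case (malg_comb S T c)
  have "mtr (\<lambda>x. S x + c * T x) = (\<lambda>x. mtr S x + c * mtr T x)"
    by (auto simp: mtr_def)
  then show ?case using malg_comb by (simp add: malg.malg_comb)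
qed (auto simp: assms mtr_mmul malg.malg_mul)

text \<open>
  The orthogonal projection of the matrix space onto a transpose-closed algebra \<open>A\<close> commutes with left
  multiplication by \<open>A\<close>.  Hence its blocks commute with \<open>A\<close>, therefore with every \<open>T\<close> in the
  bicommutant, and so \<open>T = T \<cdot> 1\<close> is its own projection.
\<close>

theorem bicommutant:
  fixes G :: "('x, 'a::linordered_field) mat set"
  assumes X: "finite X" and G: "G \<subseteq> mats X" and tr: "\<And>g. g \<in> G \<Longrightarrow> mtr g \<in> malg X G"
    and T: "T \<in> mcomm X (mcomm X G)"
  shows "T \<in> malg X G"
proof -
  let ?A = "malg X G"
  define ip :: "('x, 'a) mat \<Rightarrow> ('x, 'a) mat \<Rightarrow> 'a"
    where "ip f g = (\<Sum>u\<in>X. \<Sum>w\<in>X. f (u, w) * g (u, w))" for f g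
  have ip_prod: "(\<Sum>x\<in>X \<times> X. f x * g x) = ip f g" for f g
    by (simp add: ip_def sum.cartesian_product case_prod_unfold)
  have ip_comb: "ip (\<lambda>x. f x + c * g x) h = ip f h + c * ip g h" for f g h c
    by (simp add: ip_def sum.distrib sum_distrib_left algebra_simps)
  have AM: "S \<in> mats X" if "S \<in> ?A" for S
    using malg_mats[OF G that] .
  have ip_pos: "S = (\<lambda>_. 0)" if "S \<in> ?A" "ip S S = 0" for S
  proof -
    have "\<forall>x \<in> X \<times> X. S x * S x = 0"
      using that(2) X unfolding ip_prod[symmetric] by (subst (asm) sum_nonneg_eq_0_iff) auto
    then show ?thesis
      using AM[OF that(1)] by (auto simp: mats_def fun_eq_iff)
  qed
  have "\<exists>s. s \<in> ?A \<and> (\<forall>t \<in> ?A. ip (\<lambda>x. f x + (- 1) * s x) t = 0)" for f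
    using orthogonal_projection[OF finite_cartesian_product[OF X X] malg_subsp, of X G f]
    unfolding ip_prod[of "\<lambda>x. f x - _ x"] by auto
  then obtain pr where pr: "\<And>f. pr f \<in> ?A" "\<And>f t. t \<in> ?A \<Longrightarrow> ip (\<lambda>x. f x + (- 1) * pr f x) t = 0"
    by metis
  have pr_unique: "pr f = s" if s: "s \<in> ?A" "\<And>t. t \<in> ?A \<Longrightarrow> ip f t = ip s t" for f s
  proof -
    define d where "d = (\<lambda>x. pr f x + (- 1) * s x)"
    have dA: "d \<in> ?A"
      unfolding d_def by (rule malg_comb[OF pr(1) s(1)])
    have "ip d d = ip (pr f) d - ip s d"
      unfolding ip_comb[of "pr f" "- 1" s d, folded d_def] by simp
    also have "\<dots> = 0"
      using pr(2)[OF dA, of f] s(2)[OF dA] by (simp only: ip_comb)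
    finally have "d = (\<lambda>_. 0)"
      using ip_pos[OF dA] by blast
    then show ?thesis
      by (auto simp: d_def fun_eq_iff)
  qed
  have ip_pr: "ip (pr f) t = ip f t" if "t \<in> ?A" for f t
    using pr(2)[OF that, of f] by (simp add: ip_comb[where c = "- 1", simplified])
  have pr_sum: "pr (\<lambda>x. \<Sum>i\<in>I. c i * f i x) = (\<lambda>x. \<Sum>i\<in>I. c i * pr (f i) x)" for I :: "'x set" and c f
  proof (rule pr_unique)
    show "(\<lambda>x. \<Sum>i\<in>I. c i * pr (f i) x) \<in> ?A"
      by (rule malg_sum) (rule pr(1))
    have ips: "ip (\<lambda>x. \<Sum>i\<in>I. c i * f i x) t = (\<Sum>i\<in>I. c i * ip (f i) t)" for f t
    proof -
      have "ip (\<lambda>x. \<Sum>i\<in>I. c i * f i x) t = (\<Sum>x\<in>X \<times> X. \<Sum>i\<in>I. c i * (f i x * t x))"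
        unfolding ip_prod[symmetric] by (simp add: sum_distrib_right mult.assoc)
      also have "\<dots> = (\<Sum>i\<in>I. \<Sum>x\<in>X \<times> X. c i * (f i x * t x))"
        by (rule sum.swap)
      finally show ?thesis unfolding ip_prod[symmetric] by (simp add: sum_distrib_left)
    qed
    show "ip (\<lambda>x. \<Sum>i\<in>I. c i * f i x) t = ip (\<lambda>x. \<Sum>i\<in>I. c i * pr (f i) x) t" if "t \<in> ?A" for t
      unfolding ips using ip_pr[OF that] by simp
  qed
  have adj: "ip (mmul X a f) t = ip f (mmul X (mtr a) t)" for a f t
  proof -
    have "ip (mmul X a f) t = (\<Sum>u\<in>X. \<Sum>w\<in>X. \<Sum>v\<in>X. a (u, v) * f (v, w) * t (u, w))"
      by (simp add: ip_def mmul_def sum_distrib_right)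
    also have "\<dots> = (\<Sum>u\<in>X. \<Sum>v\<in>X. \<Sum>w\<in>X. a (u, v) * f (v, w) * t (u, w))"
      by (rule sum.cong[OF refl], rule sum.swap)
    also have "\<dots> = (\<Sum>v\<in>X. \<Sum>u\<in>X. \<Sum>w\<in>X. a (u, v) * f (v, w) * t (u, w))"
      by (rule sum.swap)
    also have "\<dots> = (\<Sum>v\<in>X. \<Sum>w\<in>X. \<Sum>u\<in>X. a (u, v) * f (v, w) * t (u, w))"
      by (rule sum.cong[OF refl], rule sum.swap)
    also have "\<dots> = ip f (mmul X (mtr a) t)"
      by (simp add: ip_def mmul_def mtr_def sum_distrib_left mult.assoc mult.left_commute)
    finally show ?thesis .
  qed
  have pr_mul: "pr (mmul X a f) = mmul X a (pr f)" if a: "a \<in> ?A" for a f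
  proof (rule pr_unique)
    show "mmul X a (pr f) \<in> ?A"
      by (rule malg_mul[OF a pr(1)])
    show "ip (mmul X a f) t = ip (mmul X a (pr f)) t" if "t \<in> ?A" for t
      unfolding adj by (rule ip_pr[symmetric]) (rule malg_mul[OF malg_mtr[OF tr a] that])
  qed
  define E :: "'x \<Rightarrow> 'x \<Rightarrow> ('x, 'a) mat" where "E u w = (\<lambda>x. if x = (u, w) then 1 else 0)" for u w
  \<comment> \<open>With the second index of the argument and of the value fixed, the projection is a matrix in the
    first indices.\<close>
  define B where "B w w' = (\<lambda>(u, u'). if u \<in> X \<and> u' \<in> X then pr (E u' w') (u, w) else 0)" for w w'
  have B: "B w w' \<in> mcomm X G" if w: "w \<in> X" "w' \<in> X" for w w'
  proof -
    have "mmul X (B w w') g = mmul X g (B w w')" if g: "g \<in> G" for g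
    proof -
      have gA: "g \<in> ?A" and gM: "g \<in> mats X" using g G malg_gen by blast+
      have gE: "mmul X g (E u' w') = (\<lambda>x. \<Sum>v\<in>X. g (v, u') * E v w' x)" if "u' \<in> X" for u'
      proof -
        have "g (a, v) * E u' w' (v, b) = (if v = u' then (if b = w' then g (a, u') else 0) else 0)" for a b v
          by (auto simp: E_def)
        moreover have "g (v, u') * E v w' (a, b) = (if v = a then (if b = w' then g (a, u') else 0) else 0)" for a b v
          by (auto simp: E_def)
        ultimately show ?thesis
          using X that gM by (auto simp: mmul_def fun_eq_iff sum.delta mats_def)
      qed
      have main: "(\<Sum>v\<in>X. g (u, v) * pr (E u' w') (v, w)) = (\<Sum>v\<in>X. pr (E v w') (u, w) * g (v, u'))"
        if "u' \<in> X" for u u'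
        using arg_cong[OF pr_mul[OF gA, of "E u' w'"], of "\<lambda>h. h (u, w)"]
        unfolding gE[OF that] pr_sum by (simp add: mmul_def mult.commute)
      have "mmul X (B w w') g (u, u') = mmul X g (B w w') (u, u')" for u u'
      proof (cases "u \<in> X \<and> u' \<in> X")
        case True
        then show ?thesis using main[of u' u] by (simp add: mmul_def B_def)
      next
        case False
        then show ?thesis using gM by (auto simp: mmul_def B_def mats_def)
      qed
      then show ?thesis by auto
    qed
    then show ?thesis by (auto simp: mcomm_def mats_def B_def)
  qed
  have TM: "T \<in> mats X" using T by (simp add: mcomm_def)
  have one: "pr (mone X) = mone X"
    by (rule pr_unique) (auto intro: malg_one)
  have E_apply: "E v w (a, b) = (if v = a then if w = b then 1 else 0 else 0)" for v w a b
    by (simp add: E_def)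
  \<comment> \<open>Both \<open>T\<close> and the identity are expanded in matrix units, grouped by columns.\<close>
  have T1: "T = (\<lambda>x. \<Sum>w\<in>X. 1 * (\<Sum>v\<in>X. T (v, w) * E v w x))"
  proof
    fix x :: "'x \<times> 'x"
    obtain a b where x: "x = (a, b)" by fastforce
    have inner: "(\<Sum>v\<in>X. T (v, w) * E v w (a, b)) = (if w = b then T (a, b) else 0)" for w
    proof -
      have "(\<Sum>v\<in>X. T (v, w) * E v w (a, b)) = (\<Sum>v\<in>X. if v = a then if w = b then T (a, b) else 0 else 0)"
        by (rule sum.cong) (simp_all add: E_apply)
      also have "\<dots> = (if w = b then T (a, b) else 0)"
        using X TM by (auto simp: sum.delta mats_def)
      finally show ?thesis .
    qed
    have "T (a, b) = (\<Sum>w\<in>X. if w = b then T (a, b) else 0)"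
      using X TM by (subst sum.delta[OF X]) (auto simp: mats_def)
    then show "T x = (\<Sum>w\<in>X. 1 * (\<Sum>v\<in>X. T (v, w) * E v w x))"
      by (simp only: x inner mult_1)
  qed
  have one1: "mone X = (\<lambda>x. \<Sum>w\<in>X. 1 * E w w x)"
  proof
    fix x :: "'x \<times> 'x"
    obtain a b where x: "x = (a, b)" by fastforce
    have "(\<Sum>w\<in>X. 1 * E w w x) = (\<Sum>w\<in>X. if w = a then if a = b then 1 else 0 else 0)"
      by (rule sum.cong) (simp_all add: E_apply x)
    also have "\<dots> = mone X x"
      using X by (simp add: sum.delta mone_def x)
    finally show "mone X x = (\<Sum>w\<in>X. 1 * E w w x)" ..
  qed
  have "pr T (u, w) = T (u, w)" if uw: "u \<in> X" "w \<in> X" for u w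
  proof -
    have "pr T (u, w) = (\<Sum>w'\<in>X. \<Sum>v\<in>X. pr (E v w') (u, w) * T (v, w'))"
      unfolding fun_cong[OF arg_cong[OF T1, of pr], unfolded pr_sum] by (simp add: mult.commute)
    also have "\<dots> = (\<Sum>w'\<in>X. mmul X (B w w') T (u, w'))"
      using uw by (simp add: mmul_def B_def)
    also have "\<dots> = (\<Sum>w'\<in>X. mmul X T (B w w') (u, w'))"
      using T B uw by (auto simp: mcomm_def intro!: sum.cong)
    also have "\<dots> = (\<Sum>v\<in>X. T (u, v) * (\<Sum>w'\<in>X. pr (E w' w') (v, w)))"
      using uw by (simp add: mmul_def B_def sum_distrib_left) (rule sum.swap)
    also have "\<dots> = (\<Sum>v\<in>X. T (u, v) * pr (mone X) (v, w))"
      unfolding fun_cong[OF arg_cong[OF one1, of pr], unfolded pr_sum] by simp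
    also have "\<dots> = mmul X T (mone X) (u, w)"
      by (simp add: one mmul_def)
    finally show ?thesis by (simp add: mmul_one[OF X TM])
  qed
  moreover have "pr T \<in> mats X"
    by (rule AM[OF pr(1)])
  ultimately have "pr T (u, w) = T (u, w)" for u w
    using TM unfolding mats_def by (cases "u \<in> X \<and> w \<in> X") auto
  then have "pr T = T"
    by (intro ext) (simp add: split_paired_all)
  then show ?thesis
    using pr(1)[of T] by metis
qed

section \<open>Symplectic invariants of tensor powers\<close>

text \<open>
  The symplectic form is normalised so that \<open>v\<^sub>2\<^sub>i\<^sub>-\<^sub>1, v\<^sub>2\<^sub>i\<close> are hyperbolic pairs.  A tensor with slots in
  \<open>I\<close> is a function of the assignments \<open>I \<rightarrow> {1..2m}\<close> of a letter to each slot.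
\<close>

definition partner :: "nat \<Rightarrow> nat" where "partner a = (if odd a then a + 1 else a - 1)"

definition eps :: "nat \<Rightarrow> rat" where "eps a = (if odd a then 1 else - 1)"

definition form :: "nat \<Rightarrow> nat \<Rightarrow> rat" where "form a b = (if b = partner a then eps a else 0)"

abbreviation letters_upto :: "nat \<Rightarrow> nat set" where "letters_upto m \<equiv> {1..2*m}"

lemma partner_partner: "a \<ge> 1 \<Longrightarrow> partner (partner a) = a"
  by (auto simp: partner_def elim!: oddE evenE)

lemma partner_mem: "a \<in> letters_upto m \<Longrightarrow> partner a \<in> letters_upto m"
  unfolding partner_def atLeastAtMost_iff by presburger

lemma partner_neq: "a \<ge> 1 \<Longrightarrow> partner a \<noteq> a"
  by (auto simp: partner_def)

lemma partner_inj: "a \<ge> 1 \<Longrightarrow> b \<ge> 1 \<Longrightarrow> partner a = partner b \<longleftrightarrow> a = b"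
  by (metis partner_partner)

lemma eps_partner: "a \<ge> 1 \<Longrightarrow> eps (partner a) = - eps a"
  by (auto simp: partner_def eps_def)

lemma eps_sq: "eps a * eps a = 1" "eps a * (eps a * c) = c"
  by (auto simp: eps_def)

lemma form_flip: "a \<ge> 1 \<Longrightarrow> b \<ge> 1 \<Longrightarrow> form a b = - form b a"
  by (auto simp: form_def partner_partner eps_partner)

definition contraction :: "nat \<Rightarrow> nat \<Rightarrow> nat \<Rightarrow> ((nat \<Rightarrow> nat) \<Rightarrow> rat) \<Rightarrow> (nat \<Rightarrow> nat) \<Rightarrow> rat" where
  "contraction m i j f a = (\<Sum>y\<in>letters_upto m. eps y * f (a(i := y, j := partner y)))"

text \<open>
  The Lie algebra \<open>sp\<^sub>2\<^sub>m\<close> is isomorphic to the symmetric square of its natural module; this is the action in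
  slot \<open>i\<close> of the element corresponding to the product of the basis vectors with indices \<open>x\<close> and \<open>y\<close>.
\<close>

definition slot_act :: "nat \<Rightarrow> nat \<Rightarrow> ((nat \<Rightarrow> nat) \<Rightarrow> rat) \<Rightarrow> (nat \<Rightarrow> nat) \<Rightarrow> nat \<Rightarrow> rat" where
  "slot_act x y f a i = (if a i = x then eps y * f (a(i := partner y)) else 0)
     + (if a i = y then eps x * f (a(i := partner x)) else 0)"

definition sp_invariant :: "nat \<Rightarrow> nat set \<Rightarrow> ((nat \<Rightarrow> nat) \<Rightarrow> rat) \<Rightarrow> bool" where
  "sp_invariant m I f \<longleftrightarrow> (\<forall>x \<in> letters_upto m. \<forall>y \<in> letters_upto m. \<forall>a \<in> I \<rightarrow>\<^sub>E letters_upto m.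
     (\<Sum>i\<in>I. slot_act x y f a i) = 0)"

lemma upd_mem: "a \<in> I \<rightarrow>\<^sub>E V \<Longrightarrow> i \<in> I \<Longrightarrow> x \<in> V \<Longrightarrow> a(i := x) \<in> I \<rightarrow>\<^sub>E V"
  by (auto simp: PiE_iff extensional_def)

lemma swap_upd: "a \<circ> transpose i j = a(i := a j, j := a i)"
  by (auto simp: fun_eq_iff transpose_def)

lemma swap_mem: "a \<in> I \<rightarrow>\<^sub>E V \<Longrightarrow> i \<in> I \<Longrightarrow> j \<in> I \<Longrightarrow> a \<circ> transpose i j \<in> I \<rightarrow>\<^sub>E V"
  unfolding swap_upd by (auto simp: PiE_iff extensional_def)

text \<open>
  Applying the Lie algebra elements to slot \<open>i\<close> and summing over a letter produces half of the Casimir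
  operator: slot \<open>i\<close> itself contributes a scalar, every other slot \<open>j\<close> the transposition of \<open>i\<close> and \<open>j\<close> and a
  contraction of these two slots.
\<close>

lemma invariant_half_casimir:
  assumes inv: "sp_invariant m I f" and I: "finite I" "i \<in> I" and a: "a \<in> I \<rightarrow>\<^sub>E letters_upto m"
  shows "(2 * of_nat m + 1) * f a + (\<Sum>j\<in>I - {i}. f (a \<circ> transpose i j))
     = (\<Sum>j\<in>I - {i}. form (a i) (a j) * contraction m i j f a)"
proof -
  let ?V = "letters_upto m"
  have ai: "a i \<in> ?V" "a i \<ge> 1" using a I by (auto simp: PiE_iff)
  define x where "x = partner (a i)"
  have x: "x \<in> ?V" "partner x = a i" "eps x = - eps (a i)"
    using ai partner_mem[of "a i" m] by (simp_all add: x_def partner_partner eps_partner)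
  have z: "(\<Sum>j\<in>I. slot_act x y f (a(i := y)) j) = 0" if "y \<in> ?V" for y
    using inv x upd_mem[OF a \<open>i \<in> I\<close> that] that by (auto simp: sp_invariant_def)
  \<comment> \<open>The relation for \<open>x\<close> and \<open>y\<close> is evaluated at \<open>a(i := y)\<close>, so that slot \<open>i\<close> returns to \<open>a i\<close>.\<close>
  have "0 = (\<Sum>y\<in>?V. \<Sum>j\<in>I. slot_act x y f (a(i := y)) j)"
    using z by simp
  also have "\<dots> = (\<Sum>j\<in>I. \<Sum>y\<in>?V. slot_act x y f (a(i := y)) j)"
    by (rule sum.swap)
  also have "\<dots> = (\<Sum>y\<in>?V. slot_act x y f (a(i := y)) i)
      + (\<Sum>j\<in>I - {i}. \<Sum>y\<in>?V. slot_act x y f (a(i := y)) j)"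
    using I by (simp add: sum.remove)
  also have "(\<Sum>y\<in>?V. slot_act x y f (a(i := y)) i)
      = (\<Sum>y\<in>?V. (if y = x then eps x * f a else 0) + eps x * f a)"
    by (rule sum.cong) (auto simp: slot_act_def x)
  also have "\<dots> = (2 * of_nat m + 1) * (eps x * f a)"
    using x(1) by (simp add: sum.distrib sum.delta algebra_simps)
  also have "(\<Sum>j\<in>I - {i}. \<Sum>y\<in>?V. slot_act x y f (a(i := y)) j)
      = (\<Sum>j\<in>I - {i}. eps x * f (a \<circ> transpose i j) - eps x * (form (a i) (a j) * contraction m i j f a))"
  proof (rule sum.cong[OF refl])
    fix j assume j: "j \<in> I - {i}"
    then have aj: "a j \<in> ?V" using a by (auto simp: PiE_iff)
    have "(\<Sum>y\<in>?V. slot_act x y f (a(i := y)) j)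
        = (\<Sum>y\<in>?V. (if a j = x then eps y * f (a(i := y, j := partner y)) else 0)
            + (if y = a j then eps x * f (a(i := y, j := partner x)) else 0))"
      using j by (intro sum.cong) (auto simp: slot_act_def)
    also have "\<dots> = (if a j = x then contraction m i j f a else 0) + eps x * f (a \<circ> transpose i j)"
      using aj by (simp add: sum.distrib sum.delta contraction_def x swap_upd)
    also have "(if a j = x then contraction m i j f a else 0) = - (eps x * (form (a i) (a j) * contraction m i j f a))"
      using x by (auto simp: form_def x_def[symmetric] eps_sq)
    finally show "(\<Sum>y\<in>?V. slot_act x y f (a(i := y)) j)
        = eps x * f (a \<circ> transpose i j) - eps x * (form (a i) (a j) * contraction m i j f a)"
      by (simp only: diff_conv_add_uminus add.commute)
  qed
  finally have "eps x * ((2 * of_nat m + 1) * f a + (\<Sum>j\<in>I - {i}. f (a \<circ> transpose i j))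
     - (\<Sum>j\<in>I - {i}. form (a i) (a j) * contraction m i j f a)) = 0"
    by (simp add: sum_subtractf sum_distrib_left algebra_simps)
  moreover have "eps x \<noteq> 0" by (simp add: eps_def)
  ultimately show ?thesis by simp
qed

text \<open>
  The matrix unit \<open>E\<^sub>x\<^sub>y\<close> acts on the tensor power by the sum \<open>\<Sum>\<^sub>i E\<^sub>x\<^sub>y\<^sup>(\<^sup>i\<^sup>)\<close> over the slots.  The left-hand
  side is the sum over all \<open>x, y\<close> of the squared norms of the images of \<open>g\<close>: the terms pairing a slot
  with itself give the multiple of the norm of \<open>g\<close>, the others give the transpositions.
\<close>

lemma swap_sum_bound:
  fixes g :: "(nat \<Rightarrow> nat) \<Rightarrow> rat"
  assumes I: "finite I"
  shows "(\<Sum>a\<in>I \<rightarrow>\<^sub>E letters_upto m. \<Sum>i\<in>I. \<Sum>j\<in>I - {i}. g a * g (a \<circ> transpose i j))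
     + 2 * of_nat m * of_nat (card I) * (\<Sum>a\<in>I \<rightarrow>\<^sub>E letters_upto m. g a * g a) \<ge> 0"
proof -
  let ?V = "letters_upto m"
  let ?X = "I \<rightarrow>\<^sub>E ?V"
  have X: "finite ?X" using I by (simp add: finite_PiE)
  define h where "h x y a i = (if a i = y then g (a(i := x)) else 0)" for x y a i
  have diag: "(\<Sum>a\<in>?X. \<Sum>x\<in>?V. \<Sum>y\<in>?V. h x y a i * h x y a i) = 2 * of_nat m * (\<Sum>a\<in>?X. g a * g a)"
    if i: "i \<in> I" for i
  proof -
    have "(\<Sum>a\<in>?X. \<Sum>x\<in>?V. \<Sum>y\<in>?V. h x y a i * h x y a i) = (\<Sum>a\<in>?X. \<Sum>x\<in>?V. g (a(i := x)) * g (a(i := x)))"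
    proof (intro sum.cong refl)
      fix a x assume a: "a \<in> ?X"
      then have "a i \<in> ?V" using i by (auto simp: PiE_iff)
      moreover have "h x y a i * h x y a i = (if y = a i then g (a(i := x)) * g (a(i := x)) else 0)" for y
        by (auto simp: h_def)
      ultimately show "(\<Sum>y\<in>?V. h x y a i * h x y a i) = g (a(i := x)) * g (a(i := x))"
        by (simp only: sum.delta finite_atLeastAtMost if_True)
    qed
    also have "\<dots> = (\<Sum>(a, x)\<in>?X \<times> ?V. g (a(i := x)) * g (a(i := x)))"
      by (rule sum.cartesian_product)
    also have "\<dots> = (\<Sum>(b, y)\<in>?X \<times> ?V. g b * g b)"
      using i by (intro sum.reindex_bij_witness[of _ "\<lambda>(b, y). (b(i := y), b i)" "\<lambda>(a, x). (a(i := x), a i)"])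
        (auto simp: PiE_iff extensional_def)
    also have "\<dots> = (\<Sum>b\<in>?X. \<Sum>y\<in>?V. g b * g b)"
      by (rule sum.cartesian_product[symmetric])
    also have "\<dots> = 2 * of_nat m * (\<Sum>a\<in>?X. g a * g a)"
      by (simp add: sum_distrib_left)
    finally show ?thesis .
  qed
  have off: "(\<Sum>a\<in>?X. \<Sum>x\<in>?V. \<Sum>y\<in>?V. h x y a i * h x y a j) = (\<Sum>a\<in>?X. g a * g (a \<circ> transpose i j))"
    if i: "i \<in> I" and j: "j \<in> I - {i}" for i j
  proof -
    have "(\<Sum>a\<in>?X. \<Sum>x\<in>?V. \<Sum>y\<in>?V. h x y a i * h x y a j)
        = (\<Sum>a\<in>?X. if a i = a j then (\<Sum>x\<in>?V. g (a(i := x)) * g (a(j := x))) else 0)"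
    proof (intro sum.cong refl)
      fix a assume a: "a \<in> ?X"
      then have "a i \<in> ?V" using i by (auto simp: PiE_iff)
      moreover have "h x y a i * h x y a j
          = (if y = a i then if a i = a j then g (a(i := x)) * g (a(j := x)) else 0 else 0)" for x y
        by (auto simp: h_def)
      ultimately have "(\<Sum>y\<in>?V. h x y a i * h x y a j)
          = (if a i = a j then g (a(i := x)) * g (a(j := x)) else 0)" for x
        by (simp only: sum.delta finite_atLeastAtMost if_True)
      then show "(\<Sum>x\<in>?V. \<Sum>y\<in>?V. h x y a i * h x y a j)
          = (if a i = a j then \<Sum>x\<in>?V. g (a(i := x)) * g (a(j := x)) else 0)"
        by simp
    qed
    also have "\<dots> = (\<Sum>a\<in>{a \<in> ?X. a i = a j}. \<Sum>x\<in>?V. g (a(i := x)) * g (a(j := x)))"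
      by (rule sum.inter_filter[OF X, symmetric])
    also have "\<dots> = (\<Sum>(a, x)\<in>{a \<in> ?X. a i = a j} \<times> ?V. g (a(i := x)) * g (a(j := x)))"
      by (rule sum.cartesian_product)
    also have "\<dots> = (\<Sum>b\<in>?X. g b * g (b \<circ> transpose i j))"
    proof (rule sum.reindex_bij_witness[of _ "\<lambda>b. (b(i := b j), b i)" "\<lambda>(a, x). a(i := x)"], goal_cases)
      case (1 p)
      then show ?case using i j by (auto simp: PiE_iff extensional_def fun_eq_iff)
    next
      case (2 p)
      then show ?case using i j by (auto simp: PiE_iff extensional_def)
    next
      case (3 b)
      then show ?case by auto
    next
      case (4 b)
      then show ?case using i j by (auto simp: PiE_iff extensional_def)
    next
      case (5 p)
      obtain a x where p: "p = (a, x)" by fastforce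
      have "a(i := x) \<circ> transpose i j = a(j := x)"
        using 5 j unfolding swap_upd by (auto simp: p fun_eq_iff)
      then show ?case by (simp add: p)
    qed
    finally show ?thesis .
  qed
  have "0 \<le> (\<Sum>a\<in>?X. \<Sum>x\<in>?V. \<Sum>y\<in>?V. (\<Sum>i\<in>I. h x y a i) * (\<Sum>j\<in>I. h x y a j))"
    by (intro sum_nonneg) simp
  also have "\<dots> = (\<Sum>a\<in>?X. \<Sum>x\<in>?V. \<Sum>y\<in>?V. \<Sum>i\<in>I. \<Sum>j\<in>I. h x y a i * h x y a j)"
    by (simp add: sum_product)
  also have "\<dots> = (\<Sum>i\<in>I. \<Sum>j\<in>I. \<Sum>a\<in>?X. \<Sum>x\<in>?V. \<Sum>y\<in>?V. h x y a i * h x y a j)"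
  proof -
    have s1: "(\<Sum>x\<in>?V. \<Sum>y\<in>?V. \<Sum>i\<in>I. F x y i) = (\<Sum>i\<in>I. \<Sum>x\<in>?V. \<Sum>y\<in>?V. F x y i)" for F :: "nat \<Rightarrow> nat \<Rightarrow> nat \<Rightarrow> rat"
      by (subst sum.swap[of _ I], subst sum.swap[of _ I]) (rule refl)
    have s2: "(\<Sum>a\<in>?X. \<Sum>x\<in>?V. \<Sum>y\<in>?V. \<Sum>i\<in>I. F a x y i) = (\<Sum>i\<in>I. \<Sum>a\<in>?X. \<Sum>x\<in>?V. \<Sum>y\<in>?V. F a x y i)"
      for F :: "(nat \<Rightarrow> nat) \<Rightarrow> nat \<Rightarrow> nat \<Rightarrow> nat \<Rightarrow> rat"
      unfolding s1 by (rule sum.swap)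
    show ?thesis unfolding s2 by (rule refl)
  qed
  also have "\<dots> = (\<Sum>i\<in>I. 2 * of_nat m * (\<Sum>a\<in>?X. g a * g a)
      + (\<Sum>j\<in>I - {i}. \<Sum>a\<in>?X. g a * g (a \<circ> transpose i j)))"
    using I by (intro sum.cong refl) (simp only: sum.remove diag off cong: sum.cong)
  also have "\<dots> = (\<Sum>i\<in>I. \<Sum>j\<in>I - {i}. \<Sum>a\<in>?X. g a * g (a \<circ> transpose i j))
      + 2 * of_nat m * of_nat (card I) * (\<Sum>a\<in>?X. g a * g a)"
    by (simp add: sum.distrib)
  also have "(\<Sum>i\<in>I. \<Sum>j\<in>I - {i}. \<Sum>a\<in>?X. g a * g (a \<circ> transpose i j))
      = (\<Sum>a\<in>?X. \<Sum>i\<in>I. \<Sum>j\<in>I - {i}. g a * g (a \<circ> transpose i j))"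
    by (subst sum.swap, subst sum.swap) (rule refl)
  finally show ?thesis .
qed

text \<open>
  The pairs of a matching are ordered.  Reversing a pair changes \<open>matching_form\<close> by a sign, which is
  harmless because only the span matters.
\<close>

definition matching :: "nat set \<Rightarrow> (nat \<times> nat) multiset \<Rightarrow> bool" where
  "matching I M \<longleftrightarrow> image_mset fst M + image_mset snd M = mset_set I"

definition matching_form :: "(nat \<times> nat) multiset \<Rightarrow> (nat \<Rightarrow> nat) \<Rightarrow> rat" where
  "matching_form M a = (\<Prod>p\<in>#M. form (a (fst p)) (a (snd p)))"

inductive_set matching_span :: "nat set \<Rightarrow> ((nat \<Rightarrow> nat) \<Rightarrow> rat) set" for I where
  matching_span_zero: "(\<lambda>_. 0) \<in> matching_span I"
| matching_span_step: "f \<in> matching_span I \<Longrightarrow> matching I M \<Longrightarrow> (\<lambda>a. f a + c * matching_form M a) \<in> matching_span I"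

lemma matching_span_subsp: "subsp (matching_span I)"
proof (rule subspI)
  show "(\<lambda>x. f x + c * g x) \<in> matching_span I" if f: "f \<in> matching_span I" and g: "g \<in> matching_span I" for f g c
    using g
  proof induction
    case (matching_span_step g M d)
    have "(\<lambda>a. (f a + c * g a) + (c * d) * matching_form M a) \<in> matching_span I"
      by (rule matching_span.matching_span_step) (rule matching_span_step)+
    then show ?case by (simp add: algebra_simps)
  qed (simp add: f)
qed (rule matching_span_zero)

lemma matching_form_relabel: "matching_form M (a \<circ> \<tau>) = matching_form (image_mset (map_prod \<tau> \<tau>) M) a"
  by (simp add: matching_form_def multiset.map_comp comp_def)

lemma matching_relabel:
  assumes "matching I M" "bij_betw \<tau> I I"
  shows "matching I (image_mset (map_prod \<tau> \<tau>) M)"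
proof -
  have "image_mset fst (image_mset (map_prod \<tau> \<tau>) M) + image_mset snd (image_mset (map_prod \<tau> \<tau>) M)
      = image_mset \<tau> (image_mset fst M + image_mset snd M)"
    by (simp add: multiset.map_comp comp_def)
  also have "\<dots> = mset_set I"
    using assms unfolding matching_def by (metis bij_betw_def image_mset_mset_set)
  finally show ?thesis by (simp add: matching_def)
qed

lemma transpose_bij: "i \<in> I \<Longrightarrow> j \<in> I \<Longrightarrow> bij_betw (transpose i j) I I"
  by (intro bij_betwI[where g = "transpose i j"]) (auto simp: transpose_def)

lemma matching_span_swap:
  assumes "f \<in> matching_span I" "i \<in> I" "j \<in> I"
  shows "(\<lambda>a. f (a \<circ> transpose i j)) \<in> matching_span I"
  using assms(1)
proof induction
  case (matching_span_step f M c)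
  show ?case
    unfolding matching_form_relabel
    by (rule matching_span.matching_span_step[OF matching_span_step.IH matching_relabel[OF matching_span_step.hyps(2) transpose_bij[OF assms(2,3)]]])
qed (rule matching_span_zero)

lemma matching_span_pair:
  assumes "g \<in> matching_span (I - {i, j})" "finite I" "i \<in> I" "j \<in> I" "i \<noteq> j"
  shows "(\<lambda>a. form (a i) (a j) * g a) \<in> matching_span I"
  using assms(1)
proof induction
  case matching_span_zero
  then show ?case by (simp add: matching_span.matching_span_zero)
next
  case (matching_span_step f M c)
  have "mset_set I = add_mset i (add_mset j (mset_set (I - {i, j})))"
    using assms by (metis Diff_insert2 Diff_iff empty_iff finite_Diff insert_iff mset_set.remove)
  then have "matching I (add_mset (i, j) M)"
    using matching_span_step by (simp add: matching_def)
  then have "(\<lambda>a. form (a i) (a j) * f a + c * matching_form (add_mset (i, j) M) a) \<in> matching_span I"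
    by (rule matching_span.matching_span_step[OF matching_span_step.IH])
  then show ?case by (simp add: matching_form_def algebra_simps)
qed

text \<open>
  The form is invariant, so the contributions of the two contracted slots cancel.
\<close>

lemma contraction_invariant:
  assumes inv: "sp_invariant m I f" and I: "finite I" "i \<in> I" "j \<in> I" "i \<noteq> j"
  shows "sp_invariant m (I - {i, j}) (contraction m i j f)"
  unfolding sp_invariant_def
proof (intro ballI)
  let ?V = "letters_upto m" and ?J = "I - {i, j}"
  fix x y b assume x: "x \<in> ?V" and y: "y \<in> ?V" and b: "b \<in> ?J \<rightarrow>\<^sub>E ?V"
  have xy1: "x \<ge> 1" "y \<ge> 1" using x y by auto
  have mem: "b(i := z, j := partner z) \<in> I \<rightarrow>\<^sub>E ?V" if "z \<in> ?V" for z
    using b that partner_mem[OF that] I by (auto simp: PiE_iff extensional_def)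
  have split: "(\<Sum>k\<in>?J. slot_act x y f c k) = - slot_act x y f c i - slot_act x y f c j"
    if "c \<in> I \<rightarrow>\<^sub>E ?V" for c
  proof -
    have "(\<Sum>k\<in>I. slot_act x y f c k) = slot_act x y f c i + (slot_act x y f c j + (\<Sum>k\<in>?J. slot_act x y f c k))"
      using I by (simp add: sum.remove[of I i] sum.remove[of "I - {i}" j] Diff_insert2[symmetric])
    moreover have "(\<Sum>k\<in>I. slot_act x y f c k) = 0"
      using inv x y that by (auto simp: sp_invariant_def)
    ultimately show ?thesis by simp
  qed
  have upd: "b(k := v, i := z, j := w) = b(i := z, j := w, k := v)" if "k \<in> ?J" for k v z w
    using that by (auto simp: fun_eq_iff)
  have "(\<Sum>k\<in>?J. slot_act x y (contraction m i j f) b k)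
      = (\<Sum>k\<in>?J. \<Sum>z\<in>?V. eps z * slot_act x y f (b(i := z, j := partner z)) k)"
    by (rule sum.cong[OF refl])
       (auto simp: slot_act_def contraction_def upd sum_distrib_left algebra_simps sum.distrib intro!: sum.cong)
  also have "\<dots> = (\<Sum>z\<in>?V. eps z * (\<Sum>k\<in>?J. slot_act x y f (b(i := z, j := partner z)) k))"
    by (subst sum.swap) (simp add: sum_distrib_left)
  also have "\<dots> = (\<Sum>z\<in>?V. - eps z * slot_act x y f (b(i := z, j := partner z)) i
      - eps z * slot_act x y f (b(i := z, j := partner z)) j)"
    by (rule sum.cong) (simp_all add: split[OF mem] algebra_simps)
  also have "\<dots> = (\<Sum>z\<in>?V.
       (if z = x then - eps x * eps y * f (b(i := partner y, j := partner x)) else 0)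
     + (if z = y then - eps x * eps y * f (b(i := partner x, j := partner y)) else 0)
     + (if z = partner x then eps x * eps y * f (b(i := partner x, j := partner y)) else 0)
     + (if z = partner y then eps x * eps y * f (b(i := partner y, j := partner x)) else 0))"
  proof (rule sum.cong[OF refl])
    fix z assume "z \<in> ?V"
    then have z: "z \<ge> 1" by simp
    have e: "partner z = x \<longleftrightarrow> z = partner x" "partner z = y \<longleftrightarrow> z = partner y"
      using partner_partner z xy1 by metis+
    have u: "b(i := z, j := w, i := v) = b(i := v, j := w)" "b(i := z, j := w, j := v) = b(i := z, j := v)" for v w
      using I by (auto simp: fun_eq_iff)
    show "- eps z * slot_act x y f (b(i := z, j := partner z)) i - eps z * slot_act x y f (b(i := z, j := partner z)) j
      = (if z = x then - eps x * eps y * f (b(i := partner y, j := partner x)) else 0)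
     + (if z = y then - eps x * eps y * f (b(i := partner x, j := partner y)) else 0)
     + (if z = partner x then eps x * eps y * f (b(i := partner x, j := partner y)) else 0)
     + (if z = partner y then eps x * eps y * f (b(i := partner y, j := partner x)) else 0)"
    proof -
      have t: "- eps z * (if z = x then eps y * f (b(i := partner y, j := partner z)) else 0)
            = (if z = x then - eps x * eps y * f (b(i := partner y, j := partner x)) else 0)"
        "- eps z * (if z = y then eps x * f (b(i := partner x, j := partner z)) else 0)
            = (if z = y then - eps x * eps y * f (b(i := partner x, j := partner y)) else 0)"
        "- eps z * (if z = partner x then eps y * f (b(i := z, j := partner y)) else 0)
            = (if z = partner x then eps x * eps y * f (b(i := partner x, j := partner y)) else 0)"
        "- eps z * (if z = partner y then eps x * f (b(i := z, j := partner x)) else 0)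
            = (if z = partner y then eps x * eps y * f (b(i := partner y, j := partner x)) else 0)"
        using xy1 by (simp_all add: eps_partner)
      have "(b(i := z, j := partner z)) i = z" "(b(i := z, j := partner z)) j = partner z"
        using I by auto
      then show ?thesis
        unfolding slot_act_def u e t[symmetric] by (simp only: u e) (simp only: algebra_simps)
    qed
  qed
  also have "\<dots> = 0"
    using x y partner_mem[OF x] partner_mem[OF y] by (simp add: sum.distrib sum.delta)
  finally show "(\<Sum>k\<in>?J. slot_act x y (contraction m i j f) b k) = 0" .
qed

text \<open>
  Summing the half Casimir identity over all slots gives \<open>D f = rhs\<close>, where the right-hand side is a
  combination of products of the form with contractions of \<open>f\<close>, hence lies in the matching span by
  induction.  The operator \<open>D\<close> preserves the matching span and is positive definite by \<open>swap_sum_bound\<close>.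
  If \<open>g\<close> is the component of \<open>f\<close> orthogonal to the span, then \<open>D g = D f - D b\<close> lies in the span, so \<open>g\<close> is
  orthogonal to \<open>D g\<close> and vanishes.
\<close>

theorem symplectic_first_fundamental_theorem:
  assumes "finite I" "sp_invariant m I f"
  shows "\<exists>g \<in> matching_span I. \<forall>a \<in> I \<rightarrow>\<^sub>E letters_upto m. f a = g a"
  using assms
proof (induction I arbitrary: f rule: finite_psubset_induct)
  case (psubset I)
  let ?V = "letters_upto m"
  let ?X = "I \<rightarrow>\<^sub>E ?V"
  note inv = psubset.prems and fin = psubset.hyps
  have X: "finite ?X" using fin by (simp add: finite_PiE)
  show ?case
  proof (cases "I = {}")
    case True
    have "matching I {#}" using True by (simp add: matching_def)
    then have "(\<lambda>a. 0 + f (\<lambda>_. undefined) * matching_form {#} a) \<in> matching_span I"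
      by (intro matching_span_step matching_span_zero)
    then show ?thesis
      using True by (intro bexI) (auto simp: matching_form_def)
  next
    case False
    have "\<exists>g \<in> matching_span I. \<forall>a \<in> ?X. form (a i) (a j) * contraction m i j f a = g a"
      if ij: "i \<in> I" "j \<in> I" "i \<noteq> j" for i j
    proof -
      have "I - {i, j} \<subset> I" using ij by auto
      then obtain g where g: "g \<in> matching_span (I - {i, j})"
          "\<forall>a \<in> (I - {i, j}) \<rightarrow>\<^sub>E ?V. contraction m i j f a = g a"
        using psubset.IH contraction_invariant[OF inv fin ij] by blast
      \<comment> \<open>A combination of matchings of the remaining slots ignores the letters in the slots \<open>i\<close> and \<open>j\<close>.\<close>
      have loc: "h (restrict a (I - {i, j})) = h a" if "h \<in> matching_span (I - {i, j})" for h and a :: "nat \<Rightarrow> nat"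
        using that
      proof induction
        case (matching_span_step h M c)
        have "fst p \<in> I - {i, j} \<and> snd p \<in> I - {i, j}" if "p \<in># M" for p
        proof -
          have "fst p \<in># image_mset fst M + image_mset snd M" "snd p \<in># image_mset fst M + image_mset snd M"
            using that by auto
          then show ?thesis
            using matching_span_step.hyps(2) fin unfolding matching_def by simp
        qed
        then have "matching_form M (restrict a (I - {i, j})) = matching_form M a"
          unfolding matching_form_def by (intro arg_cong[of _ _ prod_mset] image_mset_cong) (simp add: restrict_def)
        then show ?case by (simp only: matching_span_step.IH)
      qed simp
      have "contraction m i j f a = g a" if a: "a \<in> ?X" for a
      proof -
        have "contraction m i j f a = contraction m i j f (restrict a (I - {i, j}))"
        proof -
          have "a(i := u, j := v) = (restrict a (I - {i, j}))(i := u, j := v)" for u v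
            using a by (auto simp: fun_eq_iff restrict_def PiE_iff extensional_def)
          then show ?thesis by (simp add: contraction_def)
        qed
        also have "\<dots> = g (restrict a (I - {i, j}))"
          using g(2) a by (auto simp: PiE_iff)
        finally show ?thesis by (simp add: loc[OF g(1)])
      qed
      then show ?thesis
        using matching_span_pair[OF g(1) fin ij] by (intro bexI[of _ "\<lambda>a. form (a i) (a j) * g a"]) auto
    qed
    then obtain G where G: "\<And>i j. i \<in> I \<Longrightarrow> j \<in> I - {i} \<Longrightarrow> G i j \<in> matching_span I"
        "\<And>i j a. i \<in> I \<Longrightarrow> j \<in> I - {i} \<Longrightarrow> a \<in> ?X \<Longrightarrow> form (a i) (a j) * contraction m i j f a = G i j a"
      by (metis Diff_iff insertI1)
    define rhs where "rhs = (\<lambda>a. \<Sum>i\<in>I. 1 * (\<Sum>j\<in>I - {i}. 1 * G i j a))"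
    define N where "N = (of_nat (card I) :: rat)"
    define D where "D g a = N * (2 * of_nat m + 1) * g a + (\<Sum>i\<in>I. \<Sum>j\<in>I - {i}. g (a \<circ> transpose i j))"
      for g :: "(nat \<Rightarrow> nat) \<Rightarrow> rat" and a
    have rhs: "rhs \<in> matching_span I"
      unfolding rhs_def by (intro subsp_sum matching_span_subsp G)
    have Df: "D f a = rhs a" if a: "a \<in> ?X" for a
    proof -
      have "D f a = (\<Sum>i\<in>I. (2 * of_nat m + 1) * f a + (\<Sum>j\<in>I - {i}. f (a \<circ> transpose i j)))"
        by (simp add: D_def N_def sum.distrib)
      also have "\<dots> = (\<Sum>i\<in>I. \<Sum>j\<in>I - {i}. G i j a)"
      proof (rule sum.cong[OF refl])
        fix i assume i: "i \<in> I"
        have "(\<Sum>j\<in>I - {i}. form (a i) (a j) * contraction m i j f a) = (\<Sum>j\<in>I - {i}. G i j a)"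
          by (rule sum.cong[OF refl]) (rule G(2)[OF i _ a])
        then show "(2 * of_nat m + 1) * f a + (\<Sum>j\<in>I - {i}. f (a \<circ> transpose i j)) = (\<Sum>j\<in>I - {i}. G i j a)"
          using invariant_half_casimir[OF inv fin i a] by (simp only:)
      qed
      finally show ?thesis by (simp add: rhs_def)
    qed
    obtain b where b: "b \<in> matching_span I" "\<forall>t \<in> matching_span I. (\<Sum>a\<in>?X. (f a - b a) * t a) = 0"
      using orthogonal_projection[OF X matching_span_subsp] by blast
    define g where "g = (\<lambda>a. f a - b a)"
    have Db: "D b \<in> matching_span I"
    proof -
      have "(\<lambda>a. \<Sum>j\<in>I - {i}. 1 * b (a \<circ> transpose i j)) \<in> matching_span I" if i: "i \<in> I" for i
        by (rule subsp_sum[OF matching_span_subsp]) (use i matching_span_swap[OF b(1) i] in blast)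
      then have "(\<lambda>a. \<Sum>i\<in>I. 1 * (\<Sum>j\<in>I - {i}. 1 * b (a \<circ> transpose i j))) \<in> matching_span I"
        by (rule subsp_sum[OF matching_span_subsp])
      then have "(\<lambda>a. (\<Sum>i\<in>I. 1 * (\<Sum>j\<in>I - {i}. 1 * b (a \<circ> transpose i j))) + (N * (2 * of_nat m + 1)) * b a) \<in> matching_span I"
        by (rule subsp_comb[OF matching_span_subsp _ b(1)])
      moreover have "D b = (\<lambda>a. (\<Sum>i\<in>I. 1 * (\<Sum>j\<in>I - {i}. 1 * b (a \<circ> transpose i j))) + (N * (2 * of_nat m + 1)) * b a)"
        by (simp add: D_def fun_eq_iff)
      ultimately show ?thesis by (simp only:)
    qed
    have "(\<Sum>a\<in>?X. g a * D g a) = (\<Sum>a\<in>?X. g a * rhs a) - (\<Sum>a\<in>?X. g a * D b a)"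
    proof -
      have "D g a = D f a - D b a" for a
        by (simp add: D_def g_def sum_subtractf algebra_simps)
      then have "g a * D g a = g a * rhs a - g a * D b a" if "a \<in> ?X" for a
        by (simp only: Df[OF that] right_diff_distrib)
      then show ?thesis
        by (simp only: sum_subtractf[symmetric] cong: sum.cong)
    qed
    also have "\<dots> = 0"
      using b(2) rhs Db by (simp add: g_def)
    finally have "(\<Sum>a\<in>?X. g a * D g a) = 0" .
    moreover have "g a * D g a = N * (g a * g a) + (\<Sum>i\<in>I. \<Sum>j\<in>I - {i}. g a * g (a \<circ> transpose i j))
        + 2 * of_nat m * N * (g a * g a)" for a
      unfolding D_def distrib_left[of "g a"] sum_distrib_left by (simp add: algebra_simps)
    ultimately have "(\<Sum>a\<in>?X. N * (g a * g a)) + (\<Sum>a\<in>?X. \<Sum>i\<in>I. \<Sum>j\<in>I - {i}. g a * g (a \<circ> transpose i j))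
        + 2 * of_nat m * N * (\<Sum>a\<in>?X. g a * g a) = 0"
      by (simp only: sum.distrib sum_distrib_left)
    moreover have "(\<Sum>a\<in>?X. \<Sum>i\<in>I. \<Sum>j\<in>I - {i}. g a * g (a \<circ> transpose i j))
        + 2 * of_nat m * N * (\<Sum>a\<in>?X. g a * g a) \<ge> 0"
      using swap_sum_bound[OF fin, where g = g and m = m] by (simp add: N_def)
    moreover have "N > 0"
      using False fin by (simp add: N_def card_gt_0_iff)
    moreover have "(\<Sum>a\<in>?X. N * (g a * g a)) \<ge> 0"
      using \<open>N > 0\<close> by (intro sum_nonneg) auto
    ultimately have "(\<Sum>a\<in>?X. N * (g a * g a)) = 0" by (simp only: add.assoc)
    then have "\<forall>a \<in> ?X. N * (g a * g a) = 0"
      using \<open>N > 0\<close> X by (subst (asm) sum_nonneg_eq_0_iff) auto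
    then have "\<forall>a \<in> ?X. f a = b a"
      using \<open>N > 0\<close> by (simp add: g_def)
    then show ?thesis using b(1) by blast
  qed
qed

section \<open>Perfect matchings generate from permutations and one contraction\<close>

text \<open>
  A matching of \<open>2n\<close> points describes a Brauer diagram with the points \<open>0, \<dots>, n-1\<close> as outputs and
  \<open>n, \<dots>, 2n-1\<close> as inputs.
\<close>

definition id_matching :: "nat \<Rightarrow> (nat \<times> nat) multiset" where
  "id_matching n = image_mset (\<lambda>k. (k, n + k)) (mset_set {..<n})"

lemma matching_in: "matching I M \<Longrightarrow> finite I \<Longrightarrow> p \<in># M \<Longrightarrow> fst p \<in> I \<and> snd p \<in> I"
  unfolding matching_def by (metis finite_set_mset_mset_set image_eqI set_image_mset union_iff)

lemma matching_distinct:
  assumes "matching I (add_mset p M)" "finite I" "q \<in># M"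
  shows "fst q \<noteq> fst p" "fst q \<noteq> snd p" "snd q \<noteq> fst p" "snd q \<noteq> snd p" "fst p \<noteq> snd p"
proof -
  have c: "count (image_mset fst (add_mset p M) + image_mset snd (add_mset p M)) z \<le> 1" for z
    using assms by (simp add: matching_def count_mset_set')
  obtain M' where M: "M = add_mset q M'" using assms(3) by (metis mset_add)
  show "fst q \<noteq> fst p" "fst q \<noteq> snd p" "snd q \<noteq> fst p" "snd q \<noteq> snd p" "fst p \<noteq> snd p"
    using c[of "fst p"] c[of "snd p"] unfolding M by (auto split: if_splits)
qed

text \<open>
  Each pair contributes the same to both sides, whichever of its end points satisfy \<open>P\<close>.
\<close>

lemma pair_count:
  "size M + size (filter_mset (\<lambda>p. P (fst p) \<and> P (snd p)) M)
   = size (filter_mset P (image_mset fst M + image_mset snd M))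
     + size (filter_mset (\<lambda>p. \<not> P (fst p) \<and> \<not> P (snd p)) M)"
  by (induction M) auto

lemma inner_balance:
  assumes "matching {..<2*n} M"
  shows "size (filter_mset (\<lambda>p. fst p < n \<and> snd p < n) M)
    = size (filter_mset (\<lambda>p. \<not> fst p < n \<and> \<not> snd p < n) M)" "size M = n"
proof -
  have "size (image_mset fst M + image_mset snd M) = 2 * n"
    using assms by (simp add: matching_def)
  then show s: "size M = n" by simp
  have "{x \<in> {..<2 * n}. x < n} = {..<n}" by auto
  then have "size (filter_mset (\<lambda>x. x < n) (image_mset fst M + image_mset snd M)) = n"
    using assms by (simp add: matching_def filter_mset_mset_set)
  then show "size (filter_mset (\<lambda>p. fst p < n \<and> snd p < n) M)
    = size (filter_mset (\<lambda>p. \<not> fst p < n \<and> \<not> snd p < n) M)"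
    using pair_count[of M "\<lambda>x. x < n"] s by simp
qed

lemma matching_form_add: "matching_form (add_mset p M) a = form (a (fst p)) (a (snd p)) * matching_form M a"
  by (simp add: matching_form_def)

text \<open>
  Contracting two edges joins them to one edge.
\<close>

lemma contr_two_form:
  assumes "c \<in> letters_upto m" "d \<in> letters_upto m"
  shows "(\<Sum>y\<in>letters_upto m. eps y * (form y c * form (partner y) d)) = form c d"
proof -
  have "eps y * (form y c * form (partner y) d) = (if y = d then if d = partner c then eps c else 0 else 0)"
    if "y \<in> letters_upto m" for y
  proof -
    have "y \<ge> 1" "c \<ge> 1" "d \<ge> 1" using that assms by auto
    then have "partner (partner y) = y" "partner (partner c) = c" "eps (partner y) = - eps y" "eps (partner c) = - eps c"
      by (simp_all add: partner_partner eps_partner)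
    then show ?thesis by (auto simp: form_def eps_sq)
  qed
  then have "(\<Sum>y\<in>letters_upto m. eps y * (form y c * form (partner y) d))
      = (\<Sum>y\<in>letters_upto m. if y = d then if d = partner c then eps c else 0 else 0)"
    by (rule sum.cong[OF refl])
  also have "\<dots> = form c d"
    using assms by (simp add: sum.delta form_def)
  finally show ?thesis .
qed

context
  \<comment> \<open>\<open>B\<close> stands for the tensors of the matrices in the Brauer algebra.  The last two assumptions are
    left multiplication by an adjacent transposition and by the contraction of the first two factors.\<close>
  fixes m n :: nat and B :: "((nat \<Rightarrow> nat) \<Rightarrow> rat) set"
  assumes B: "subsp B"
    and B_cong: "\<And>g g'. g \<in> B \<Longrightarrow> (\<And>a. a \<in> {..<2*n} \<rightarrow>\<^sub>E letters_upto m \<Longrightarrow> g' a = g a) \<Longrightarrow> g' \<in> B"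
    and B_id: "matching_form (id_matching n) \<in> B"
    and B_adj: "\<And>g k. g \<in> B \<Longrightarrow> Suc k < n \<Longrightarrow> (\<lambda>a. g (a \<circ> transpose k (Suc k))) \<in> B"
    and B_contr: "\<And>g. g \<in> B \<Longrightarrow> 2 \<le> n \<Longrightarrow> (\<lambda>a. form (a 0) (a 1) * contraction m 0 1 g a) \<in> B"
begin

lemma B_transpose: "g \<in> B \<Longrightarrow> i < j \<Longrightarrow> j < n \<Longrightarrow> (\<lambda>a. g (a \<circ> transpose i j)) \<in> B"
proof (induction "j - i" arbitrary: j g rule: less_induct)
  case less
  show ?case
  proof (cases "j = Suc i")
    case True
    then show ?thesis using B_adj less.prems by simp
  next
    case False
    then obtain k where k: "j = Suc k" "i < k" using less.prems by (cases j) auto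
    have "(\<lambda>a. g (a \<circ> transpose k (Suc k))) \<in> B"
      using B_adj less.prems k by simp
    then have "(\<lambda>a. g (a \<circ> transpose i k \<circ> transpose k (Suc k))) \<in> B"
      using less.hyps[of k "\<lambda>a. g (a \<circ> transpose k (Suc k))"] k less.prems by simp
    then have "(\<lambda>a. g (a \<circ> transpose k (Suc k) \<circ> transpose i k \<circ> transpose k (Suc k))) \<in> B"
      using B_adj[of "\<lambda>a. g (a \<circ> transpose i k \<circ> transpose k (Suc k))" k] k less.prems by simp
    moreover have "a \<circ> transpose k (Suc k) \<circ> transpose i k \<circ> transpose k (Suc k) = a \<circ> transpose i j" for a :: "nat \<Rightarrow> nat"
      using k by (auto simp: fun_eq_iff transpose_def)
    ultimately show ?thesis by simp
  qed
qed

lemma B_transpose': "g \<in> B \<Longrightarrow> i < n \<Longrightarrow> j < n \<Longrightarrow> (\<lambda>a. g (a \<circ> transpose i j)) \<in> B"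
proof (induction i j rule: linorder_wlog)
  case (le i j)
  then show ?case
    using B_transpose[of g i j] by (cases "i = j") (simp, meson le_neq_implies_less)
next
  case (sym i j)
  then show ?case by (simp add: transpose_commute)
qed

text \<open>
  Conjugation by a transposition moves the contracted pair of slots.
\<close>

lemma B_contr_conj:
  assumes K: "\<And>g. g \<in> B \<Longrightarrow> (\<lambda>a. form (a i) (a j) * contraction m i j g a) \<in> B"
    and \<tau>: "k < n" "l < n" and g: "g \<in> B"
  shows "(\<lambda>a. form (a (transpose k l i)) (a (transpose k l j)) * contraction m (transpose k l i) (transpose k l j) g a) \<in> B"
proof -
  let ?t = "transpose k l"
  have "(\<lambda>a. form ((a \<circ> ?t) i) ((a \<circ> ?t) j) * contraction m i j (\<lambda>a. g (a \<circ> ?t)) (a \<circ> ?t)) \<in> B"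
    using B_transpose'[OF K[OF B_transpose'[OF g \<tau>]] \<tau>] by simp
  moreover have "((a \<circ> ?t)(i := y, j := z)) \<circ> ?t = a(?t i := y, ?t j := z)" for a :: "nat \<Rightarrow> nat" and y z
    by (auto simp: fun_eq_iff transpose_def)
  ultimately show ?thesis by (simp add: contraction_def)
qed

lemma B_contr':
  assumes "i < n" "j < n" "i \<noteq> j" "g \<in> B"
  shows "(\<lambda>a. form (a i) (a j) * contraction m i j g a) \<in> B"
proof -
  have n2: "2 \<le> n" using assms by linarith
  have K: "(\<lambda>a. form (a i) (a j) * contraction m i j g a) \<in> B"
    if g: "g \<in> B" and i: "i < n" "j < n" "i \<noteq> j" "i \<noteq> 1" for i j g
  proof -
    have 1: "(\<lambda>a. form (a i) (a 1) * contraction m i 1 g a) \<in> B" if "g \<in> B" for g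
      using B_contr_conj[of 0 1 0 i g, OF B_contr] that n2 i by simp
    show ?thesis
      using B_contr_conj[of i 1 1 j g, OF 1] i g n2 by simp
  qed
  show ?thesis
  proof (cases "i = 1")
    case False
    then show ?thesis using K assms by blast
  next
    case True
    show ?thesis
    proof (cases "j = 0")
      case True
      then show ?thesis using \<open>i = 1\<close> B_contr_conj[of 0 1 0 1 g, OF B_contr] n2 assms by simp
    next
      case False
      have "(\<lambda>a. form (a 0) (a j) * contraction m 0 j g a) \<in> B" if "g \<in> B" for g
        using K[of g 0 j] that False assms by simp
      then show ?thesis
        using B_contr_conj[of 0 j 0 1 g] True False assms n2 by simp
    qed
  qed
qed

text \<open>
  If no edge stays within one half, the matching is a permutation, up to the orientation of its edges.
  Transposing two output points puts one more edge into the position of the identity matching.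
\<close>

lemma matching_form_propagating_mem:
  assumes "matching {..<2*n} M" "\<And>p. p \<in># M \<Longrightarrow> fst p < n \<longleftrightarrow> \<not> snd p < n"
  shows "matching_form M \<in> B"
proof -
  let ?ok = "\<lambda>M k. (k, n + k) \<in># M \<or> (n + k, k) \<in># M"
  show ?thesis
    using assms
  proof (induction "card {k. k < n \<and> \<not> ?ok M k}" arbitrary: M rule: less_induct)
    case less
    note M = less.prems(1) and mix = less.prems(2)
    show ?case
    proof (cases "\<forall>k<n. ?ok M k")
      case True
      define o' where "o' k = (if (k, n + k) \<in># M then (k, n + k) else (n + k, k))" for k
      have inj: "inj_on o' {..<n}"
        by (rule inj_onI) (auto simp: o'_def split: if_splits)
      have "mset_set (o' ` {..<n}) \<subseteq># M"
      proof (rule mset_subset_eqI)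
        fix p
        show "count (mset_set (o' ` {..<n})) p \<le> count M p"
        proof (cases "p \<in> o' ` {..<n}")
          case True
          then have "p \<in># M" using \<open>\<forall>k<n. ?ok M k\<close> by (auto simp: o'_def)
          then show ?thesis using True by (simp add: count_mset_set' Suc_leI)
        qed simp
      qed
      moreover have "size (mset_set (o' ` {..<n})) = size M"
        using inj inner_balance(2)[OF M] by (simp add: card_image)
      ultimately have Mo: "M = image_mset o' (mset_set {..<n})"
        using inj by (metis image_mset_mset_set subset_mset.less_le mset_subset_size less_irrefl)
      define s where "s k = (if (k, n + k) \<in># M then 1 else - 1 :: rat)" for k
      have "matching_form M a = (\<Prod>k<n. s k) * matching_form (id_matching n) a" if a: "a \<in> {..<2*n} \<rightarrow>\<^sub>E letters_upto m" for a
      proof -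
        have "matching_form M a = (\<Prod>k<n. form (a (fst (o' k))) (a (snd (o' k))))"
          unfolding matching_form_def by (subst Mo) (simp add: prod_unfold_prod_mset multiset.map_comp comp_def)
        also have "\<dots> = (\<Prod>k<n. s k * form (a k) (a (n + k)))"
        proof (rule prod.cong[OF refl])
          fix k assume k: "k \<in> {..<n}"
          then have "a k \<in> letters_upto m" "a (n + k) \<in> letters_upto m"
            using a by (auto simp: PiE_iff)
          then show "form (a (fst (o' k))) (a (snd (o' k))) = s k * form (a k) (a (n + k))"
            using form_flip[of "a (n + k)" "a k"] by (simp add: o'_def s_def)
        qed
        also have "\<dots> = (\<Prod>k<n. s k) * matching_form (id_matching n) a"
          by (simp add: prod.distrib matching_form_def id_matching_def prod_unfold_prod_mset multiset.map_comp comp_def)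
        finally show ?thesis .
      qed
      then show ?thesis
        using B_cong[OF subsp_scale[OF B B_id]] by blast
    next
      case False
      then obtain k where k: "k < n" "\<not> ?ok M k" by blast
      have "k \<in># image_mset fst M + image_mset snd M"
        using M k(1) by (simp add: matching_def)
      then obtain p where p: "p \<in># M" "fst p = k \<or> snd p = k" by auto
      have p2: "fst p < 2 * n" "snd p < 2 * n" using matching_in[OF M _ p(1)] by auto
      obtain l where l: "l < n" "p = (k, n + l) \<or> p = (n + l, k)"
      proof (cases "fst p = k")
        case True
        then have "\<not> snd p < n" using mix[OF p(1)] k(1) by simp
        then show ?thesis using that[of "snd p - n"] True p2 by (cases p) auto
      next
        case False
        then have "\<not> fst p < n" using mix[OF p(1)] k(1) p(2) by simp
        then show ?thesis using that[of "fst p - n"] False p(2) p2 by (cases p) auto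
      qed
      have lk: "l \<noteq> k" using l k p(1) by auto
      obtain M1 where M1: "M = add_mset p M1" using p(1) by (metis mset_add)
      have lbad: "\<not> ?ok M l"
      proof
        assume "?ok M l"
        then obtain r where r: "r \<in># M1" "r = (l, n + l) \<or> r = (n + l, l)"
          using l lk unfolding M1 by auto
        then show False
          using matching_distinct[of "{..<2*n}" p M1 r] M l unfolding M1 by auto
      qed
      let ?t = "transpose k l"
      define M' where "M' = image_mset (map_prod ?t ?t) M"
      have t: "?t (n + i) = n + i" for i using l k by (simp add: transpose_def)
      have tn: "?t i < n \<longleftrightarrow> i < n" for i using l k by (auto simp: transpose_def)
      have "map_prod ?t ?t p \<in># M'" using p(1) by (simp add: M'_def)
      then have lgood: "?ok M' l" using l by (auto simp: t)
      have keep: "?ok M' i" if "?ok M i" "i < n" "i \<noteq> k" "i \<noteq> l" for i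
      proof -
        have "?t i = i" using that by (simp add: transpose_def)
        then have "map_prod ?t ?t (i, n + i) = (i, n + i)" "map_prod ?t ?t (n + i, i) = (n + i, i)"
          using t by simp_all
        then show ?thesis using that(1) unfolding M'_def by (metis image_eqI set_image_mset)
      qed
      have "{i. i < n \<and> \<not> ?ok M' i} \<subset> {i. i < n \<and> \<not> ?ok M i}"
        using keep lgood lbad l k by blast
      then have "card {i. i < n \<and> \<not> ?ok M' i} < card {i. i < n \<and> \<not> ?ok M i}"
        by (intro psubset_card_mono) auto
      moreover have "matching {..<2*n} M'"
        unfolding M'_def using k l by (intro matching_relabel[OF M] transpose_bij) auto
      moreover have "fst p < n \<longleftrightarrow> \<not> snd p < n" if "p \<in># M'" for p
        using that mix by (auto simp: M'_def tn)
      ultimately have "matching_form M' \<in> B" using less.hyps by blast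
      then have "(\<lambda>a. matching_form M' (a \<circ> ?t)) \<in> B" using B_transpose' k l by blast
      moreover have "matching_form M' (a \<circ> ?t) = matching_form M a" for a
        unfolding matching_form_relabel M'_def
        by (simp add: multiset.map_comp map_prod.comp map_prod.id)
      ultimately show ?thesis by simp
    qed
  qed
qed

text \<open>
  An edge joining two of the first \<open>n\<close> points forces an edge joining two of the last \<open>n\<close> points.
  Rewiring these two edges into two propagating ones gives a matching from which the original one is
  recovered by contracting and reinserting the form.
\<close>

lemma matching_form_mem:
  assumes "matching {..<2*n} M"
  shows "matching_form M \<in> B"
  using assms
proof (induction "size (filter_mset (\<lambda>p. fst p < n \<and> snd p < n) M)" arbitrary: M rule: less_induct)
  case less
  note M = less.prems
  let ?T = "\<lambda>M. filter_mset (\<lambda>p. fst p < n \<and> snd p < n) M"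
  let ?L = "\<lambda>M. filter_mset (\<lambda>p. \<not> fst p < n \<and> \<not> snd p < n) M"
  show ?case
  proof (cases "?T M = {#}")
    case True
    then have "?L M = {#}"
      by (subst size_eq_0_iff_empty[symmetric]) (simp only: inner_balance(1)[OF M, symmetric] size_empty)
    have "fst p < n \<longleftrightarrow> \<not> snd p < n" if "p \<in># M" for p
    proof -
      have "p \<notin># ?T M" "p \<notin># ?L M"
        by (simp_all only: True \<open>?L M = {#}\<close>) simp_all
      then show ?thesis using that by auto
    qed
    then show ?thesis using matching_form_propagating_mem[OF M] by blast
  next
    case False
    then have "?L M \<noteq> {#}"
      by (simp only: size_eq_0_iff_empty[symmetric] inner_balance(1)[OF M] not_False_eq_True)
    then obtain p q where p: "p \<in># ?T M" and q: "q \<in># ?L M" using False by (meson multiset_nonemptyE)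
    have pq: "p \<in># M" "q \<in># M" "p \<noteq> q" using p q by auto
    obtain M1 where M1: "M = add_mset p M1" using pq(1) by (metis mset_add)
    have "q \<in># M1" using pq by (simp add: M1)
    then obtain M2 where "M1 = add_mset q M2" by (metis mset_add)
    then have M2: "M = add_mset p (add_mset q M2)" by (simp add: M1)
    obtain i j k l where ij: "p = (i, j)" and kl: "q = (k, l)" by fastforce
    have lt: "i < n" "j < n" "\<not> k < n" "\<not> l < n" using p q by (auto simp: ij kl)
    have kl2: "k < 2 * n" "l < 2 * n" using matching_in[OF M, of q] by (auto simp: M2 kl)
    define M' where "M' = add_mset (i, k) (add_mset (j, l) M2)"
    have M': "matching {..<2*n} M'"
      using M by (simp add: matching_def M2 M'_def ij kl add_mset_commute)
    have "size (?T M') < size (?T M)" using lt by (simp add: M2 M'_def ij kl)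
    then have inB: "matching_form M' \<in> B" using less.hyps M' by blast
    have ne: "i \<noteq> j" using matching_distinct(5)[of _ p] M by (force simp: M2 ij kl)
    have "(\<lambda>a. form (a i) (a j) * contraction m i j (matching_form M') a) \<in> B"
      using B_contr' lt ne inB by blast
    moreover have "matching_form M a = form (a i) (a j) * contraction m i j (matching_form M') a" if a: "a \<in> {..<2*n} \<rightarrow>\<^sub>E letters_upto m" for a
    proof -
      have rest: "matching_form M2 (a(i := y, j := z)) = matching_form M2 a" for y z
        unfolding matching_form_def
      proof (intro arg_cong[of _ _ prod_mset] image_mset_cong)
        fix r assume "r \<in># M2"
        then have "fst r \<noteq> i \<and> fst r \<noteq> j \<and> snd r \<noteq> i \<and> snd r \<noteq> j"
          using matching_distinct(1-4)[of "{..<2*n}" p "add_mset q M2" r] M by (simp add: M2 ij)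
        then show "form ((a(i := y, j := z)) (fst r)) ((a(i := y, j := z)) (snd r)) = form (a (fst r)) (a (snd r))"
          by simp
      qed
      have "contraction m i j (matching_form M') a = (\<Sum>y\<in>letters_upto m. eps y * (form y (a k) * form (partner y) (a l)) * matching_form M2 a)"
        unfolding contraction_def M'_def matching_form_add rest using lt ne by (intro sum.cong) auto
      also have "\<dots> = form (a k) (a l) * matching_form M2 a"
        using a kl2 by (subst sum_distrib_right[symmetric], subst contr_two_form) (auto simp: PiE_iff)
      finally show ?thesis by (simp add: M2 matching_form_add ij kl)
    qed
    ultimately show ?thesis using B_cong by blast
  qed
qed

lemma matching_span_mem: "g \<in> matching_span {..<2*n} \<Longrightarrow> g \<in> B"
proof (induction rule: matching_span.induct)
  case matching_span_zero
  then show ?case by (rule subsp_zero[OF B])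
next
  case (matching_span_step f M c)
  then show ?case using subsp_comb[OF B _ matching_form_mem] by blast
qed

end

section \<open>Classical symplectic duality over the rationals\<close>

text \<open>
  Basis vectors over an arbitrary field, for use over \<open>\<rat>\<close> and over \<open>\<rat>(q)\<close>.
\<close>

definition unit_vec :: "'x \<Rightarrow> 'x \<Rightarrow> 'a::field" where "unit_vec w = (\<lambda>u. if u = w then 1 else 0)"

definition opmat :: "'x set \<Rightarrow> (('x \<Rightarrow> 'a::field) \<Rightarrow> 'x \<Rightarrow> 'a) \<Rightarrow> ('x, 'a) mat" where
  "opmat X op = (\<lambda>(u, w). if u \<in> X \<and> w \<in> X then op (unit_vec w) u else 0)"

text \<open>
  This contains a locality condition: on \<open>X\<close> the value of \<open>op f\<close> depends only on the restriction of \<open>f\<close> to \<open>X\<close>.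
\<close>

definition lin_on :: "'x set \<Rightarrow> (('x \<Rightarrow> 'a::field) \<Rightarrow> 'x \<Rightarrow> 'a) \<Rightarrow> bool" where
  "lin_on X op \<longleftrightarrow> (\<forall>f. \<forall>u \<in> X. op f u = (\<Sum>v\<in>X. op (unit_vec v) u * f v))"

lemma opmat_mats: "opmat X op \<in> mats X"
  by (auto simp: opmat_def mats_def)

lemma lin_onI:
  fixes op :: "('x \<Rightarrow> 'a::field) \<Rightarrow> 'x \<Rightarrow> 'a"
  assumes X: "finite X" and add: "\<And>f g c u. op (\<lambda>u. f u + c * g u) u = op f u + c * op g u"
    and loc: "\<And>f g u. (\<And>v. v \<in> X \<Longrightarrow> f v = g v) \<Longrightarrow> u \<in> X \<Longrightarrow> op f u = op g u"
  shows "lin_on X op"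
  unfolding lin_on_def
proof (intro allI ballI)
  fix f u assume u: "u \<in> X"
  have zero: "op (\<lambda>_. 0) u = 0"
    using add[of "\<lambda>_. 0" "- 1" "\<lambda>_. 0" u] by simp
  have sum: "op (\<lambda>u. \<Sum>v\<in>A. f v * g v u) u = (\<Sum>v\<in>A. f v * op (g v) u)" if "finite A" for A :: "'x set" and g
    using that
  proof induction
    case (insert a A)
    then show ?case
      using add[of "\<lambda>u. \<Sum>v\<in>A. f v * g v u" "f a" "g a" u] by (simp add: add.commute)
  qed (simp add: zero)
  have "op f u = op (\<lambda>u. \<Sum>v\<in>X. f v * unit_vec v u) u"
  proof (rule loc[OF _ u])
    fix w assume w: "w \<in> X"
    have "(\<Sum>v\<in>X. f v * unit_vec v w) = (\<Sum>v\<in>X. if v = w then f w else 0)"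
      by (rule sum.cong) (auto simp: unit_vec_def)
    then show "f w = (\<Sum>v\<in>X. f v * unit_vec v w)" using X w by simp
  qed
  then show "op f u = (\<Sum>v\<in>X. op (unit_vec v) u * f v)"
    by (simp add: sum[OF X] mult.commute)
qed

lemma lin_on_cong: "lin_on X op \<Longrightarrow> u \<in> X \<Longrightarrow> (\<And>v. v \<in> X \<Longrightarrow> f v = g v) \<Longrightarrow> op f u = op g u"
  unfolding lin_on_def by (metis (no_types, lifting) sum.cong)

lemma opmat_mmul_left:
  assumes "lin_on X op" "T \<in> mats X"
  shows "mmul X (opmat X op) T = (\<lambda>(u, w). if u \<in> X then op (\<lambda>v. T (v, w)) u else 0)"
proof -
  have "(\<Sum>v\<in>X. opmat X op (u, v) * T (v, w)) = (if u \<in> X then op (\<lambda>v. T (v, w)) u else 0)" for u w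
    using assms(1) by (auto simp: lin_on_def opmat_def)
  then show ?thesis by (simp add: mmul_def)
qed

lemma opmat_mmul_right:
  assumes "lin_on X op'" "T \<in> mats X" "mtr (opmat X op) = opmat X op'"
  shows "mmul X T (opmat X op) = (\<lambda>(u, w). if w \<in> X then op' (\<lambda>v. T (u, v)) w else 0)"
proof -
  have "mtr (mmul X T (opmat X op)) = mmul X (opmat X op') (mtr T)"
    by (simp add: mtr_mmul assms)
  also have "\<dots> = (\<lambda>(u, w). if u \<in> X then op' (\<lambda>v. mtr T (v, w)) u else 0)"
    using assms(2) by (intro opmat_mmul_left assms(1)) (auto simp: mats_def mtr_def)
  finally show ?thesis by (auto simp: mtr_def fun_eq_iff)
qed

lemma opmat_comp:
  assumes "lin_on X op"
  shows "mmul X (opmat X op) (opmat X op') = opmat X (op \<circ> op')"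
proof -
  have "op (\<lambda>v. opmat X op' (v, w)) u = op (op' (unit_vec w)) u" if "u \<in> X" "w \<in> X" for u w
    by (rule lin_on_cong[OF assms that(1)]) (simp add: opmat_def that)
  moreover have "op (\<lambda>v. opmat X op' (v, w)) u = 0" if "u \<in> X" "w \<notin> X" for u w
    using assms that by (auto simp: opmat_def lin_on_def)
  ultimately show ?thesis
    by (auto simp: opmat_mmul_left[OF assms opmat_mats] fun_eq_iff opmat_def[of X "op \<circ> op'"])
qed

lemma opmat_comb: "opmat X (\<lambda>f u. c * op f u + d * op' f u) = (\<lambda>x. c * opmat X op x + d * opmat X op' x)"
  by (auto simp: opmat_def fun_eq_iff)

text \<open>
  The derivation of the tensor algebra that extends the matrix unit \<open>v\<^sub>y \<mapsto> v\<^sub>x\<close>, in coordinates.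
\<close>

fun dE :: "nat \<Rightarrow> nat \<Rightarrow> (nat list \<Rightarrow> 'a::field) \<Rightarrow> nat list \<Rightarrow> 'a" where
  "dE x y f [] = 0"
| "dE x y f (a # w) = (if a = x then f (y # w) else 0) + dE x y (\<lambda>u. f (a # u)) w"

lemma dE_zero: "dE x y (\<lambda>u. 0) w = 0"
  by (induction w) auto

lemma dE_comb: "dE x y (\<lambda>u. f u + c * g u) w = dE x y f w + c * dE x y g w"
  by (induction w arbitrary: f g) (auto simp: algebra_simps)

lemma dE_add: "dE x y (\<lambda>u. f u + g u) w = dE x y f w + dE x y g w"
  using dE_comb[of x y f 1 g w] by simp

lemma dE_scale: "dE x y (\<lambda>u. c * g u) w = c * dE x y g w"
  using dE_comb[of x y "\<lambda>_. 0" c g w] by (simp add: dE_zero)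

lemma dE_if: "dE x y (\<lambda>u. if P then f u else 0) w = (if P then dE x y f w else 0)"
  by (simp add: dE_zero)

lemma dE_local:
  assumes "\<And>v. v \<in> indices m n \<Longrightarrow> f v = g v" "w \<in> indices m n" "y \<in> letters_upto m"
  shows "dE x y f w = dE x y g w"
  using assms
proof (induction w arbitrary: f g n)
  case (Cons a w)
  from Cons.prems(2) obtain k where n: "n = Suc k" and w: "w \<in> indices m k" "a \<in> letters_upto m"
    by (cases n) (auto simp: indices_def)
  have "dE x y (\<lambda>u. f (a # u)) w = dE x y (\<lambda>u. g (a # u)) w"
    by (rule Cons.IH[OF _ w(1) Cons.prems(3)])
      (rule Cons.prems(1), use w n in \<open>auto simp: indices_def\<close>)
  moreover have "f (y # w) = g (y # w)"
    by (rule Cons.prems(1)) (use w n Cons.prems(3) in \<open>auto simp: indices_def\<close>)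
  ultimately show ?case by simp
qed simp

lemma finite_indices: "finite (indices m n)"
  using finite_lists_length_eq[of "letters_upto m" n] by (simp add: indices_def conj_commute)

lemma dE_lin: "y \<in> letters_upto m \<Longrightarrow> lin_on (indices m n) (dE x y)"
  by (rule lin_onI[OF finite_indices dE_comb dE_local])

lemma dE_sum: "dE x y f w = (\<Sum>k<length w. if w ! k = x then f (w[k := y]) else 0)"
  by (induction w arbitrary: f) (simp_all add: sum.lessThan_Suc_shift del: sum.lessThan_Suc cong: if_cong)

lemma dE_transpose: "mtr (opmat (indices m n) (dE x y)) = opmat (indices m n) (dE y x)"
proof -
  have "dE x y (unit_vec u) w = (dE y x (unit_vec w) u :: 'a)" if "length u = length w" for u w :: "nat list"
  proof -
    have sym: "(w ! k = x \<and> w[k := y] = u) \<longleftrightarrow> (u ! k = y \<and> u[k := x] = w)" if "k < length w" for k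
      using that \<open>length u = length w\<close>
      by (metis list_update_id list_update_overwrite nth_list_update_eq)
    have "(if w ! k = x then unit_vec u (w[k := y]) else 0) = (if u ! k = y then unit_vec w (u[k := x]) else (0 :: 'a))"
      if "k < length w" for k
    proof -
      have "(if P then if Q then 1 else 0 else 0) = (if P \<and> Q then 1 else (0 :: 'a))" for P Q by simp
      then show ?thesis unfolding unit_vec_def by (simp only: sym[OF that])
    qed
    then show ?thesis
      using that unfolding dE_sum by (intro sum.cong) simp_all
  qed
  then show ?thesis
    by (auto simp: mtr_def opmat_def fun_eq_iff indices_def)
qed

lemma dE_commutator:
  "dE x y (dE z t f) w - dE z t (dE x y f) w
   = (if y = z then dE x t f w else 0) - (if x = t then dE z y f w else 0)"
proof (induction w arbitrary: f)
  case (Cons a w)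
  show ?case
    using Cons.IH[of "\<lambda>u. f (a # u)"] by (auto simp: dE_add dE_if dE_zero algebra_simps)
qed simp

text \<open>
  The element of \<open>sp\<^sub>2\<^sub>m\<close> corresponding to the product of two basis vectors, acting on tensor powers.
\<close>

definition sp_elem :: "nat \<Rightarrow> nat \<Rightarrow> (nat list \<Rightarrow> rat) \<Rightarrow> nat list \<Rightarrow> rat" where
  "sp_elem x y f u = eps y * dE x (partner y) f u + eps x * dE y (partner x) f u"

lemma sp_elem_sym: "sp_elem x y = sp_elem y x"
  by (simp add: sp_elem_def fun_eq_iff add.commute)

text \<open>
  The Poisson bracket of quadratic functions, which is the Lie bracket of \<open>sp\<^sub>2\<^sub>m\<close>.
\<close>

lemma sp_elem_commutator:
  assumes "a \<ge> 1" "b \<ge> 1" "c \<ge> 1" "d \<ge> 1"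
  shows "sp_elem a b (sp_elem c d f) w - sp_elem c d (sp_elem a b f) w
    = form b c * sp_elem a d f w + form a c * sp_elem b d f w + form b d * sp_elem c a f w + form a d * sp_elem c b f w"
proof -
  have K: "dE x y (dE z t f) w = dE z t (dE x y f) w
     + (if y = z then dE x t f w else 0) - (if x = t then dE z y f w else 0)" for x y z t
    using dE_commutator[of x y z t f w] by (simp add: algebra_simps)
  have pe: "a = partner b \<longleftrightarrow> b = partner a" if "a \<ge> 1" "b \<ge> 1" for a b
    using partner_partner[OF that(1)] partner_partner[OF that(2)] by auto
  have p: "a = partner d \<longleftrightarrow> d = partner a" "a = partner c \<longleftrightarrow> c = partner a"
    "b = partner d \<longleftrightarrow> d = partner b" "b = partner c \<longleftrightarrow> c = partner b"
    by (intro pe assms)+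
  have p': "partner a = c \<longleftrightarrow> c = partner a" "partner a = d \<longleftrightarrow> d = partner a"
    "partner b = c \<longleftrightarrow> c = partner b" "partner b = d \<longleftrightarrow> d = partner b"
    by (rule eq_commute)+
  have "sp_elem a b (sp_elem c d f) w - sp_elem c d (sp_elem a b f) w
    = eps b * eps d * (dE a (partner b) (dE c (partner d) f) w - dE c (partner d) (dE a (partner b) f) w)
    + eps b * eps c * (dE a (partner b) (dE d (partner c) f) w - dE d (partner c) (dE a (partner b) f) w)
    + eps a * eps d * (dE b (partner a) (dE c (partner d) f) w - dE c (partner d) (dE b (partner a) f) w)
    + eps a * eps c * (dE b (partner a) (dE d (partner c) f) w - dE d (partner c) (dE b (partner a) f) w)"
    by (simp add: sp_elem_def[abs_def] dE_add dE_scale algebra_simps)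
  also have "\<dots> = eps b * eps d * ((if c = partner b then dE a (partner d) f w else 0) - (if d = partner a then dE c (partner b) f w else 0))
    + eps b * eps c * ((if d = partner b then dE a (partner c) f w else 0) - (if c = partner a then dE d (partner b) f w else 0))
    + eps a * eps d * ((if c = partner a then dE b (partner d) f w else 0) - (if d = partner b then dE c (partner a) f w else 0))
    + eps a * eps c * ((if d = partner a then dE b (partner c) f w else 0) - (if c = partner b then dE d (partner a) f w else 0))"
    by (simp only: dE_commutator p p')
  also have "\<dots> = form b c * sp_elem a d f w + form a c * sp_elem b d f w + form b d * sp_elem c a f w + form a d * sp_elem c b f w"
  proof -
    have e: "c = partner b \<Longrightarrow> eps c = - eps b" "c = partner a \<Longrightarrow> eps c = - eps a"
      "d = partner b \<Longrightarrow> eps d = - eps b" "d = partner a \<Longrightarrow> eps d = - eps a"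
      using assms by (simp_all add: eps_partner)
    have t1: "eps b * eps d * (if c = partner b then dE a (partner d) f w else 0)
        - eps a * eps c * (if c = partner b then dE d (partner a) f w else 0) = form b c * sp_elem a d f w"
      using e by (auto simp: form_def sp_elem_def algebra_simps)
    have t2: "eps a * eps d * (if c = partner a then dE b (partner d) f w else 0)
        - eps b * eps c * (if c = partner a then dE d (partner b) f w else 0) = form a c * sp_elem b d f w"
      using e by (auto simp: form_def sp_elem_def algebra_simps)
    have t3: "eps b * eps c * (if d = partner b then dE a (partner c) f w else 0)
        - eps a * eps d * (if d = partner b then dE c (partner a) f w else 0) = form b d * sp_elem c a f w"
      using e by (auto simp: form_def sp_elem_def algebra_simps)
    have t4: "eps a * eps c * (if d = partner a then dE b (partner c) f w else 0)
        - eps b * eps d * (if d = partner a then dE c (partner b) f w else 0) = form a d * sp_elem c b f w"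
      using e by (auto simp: form_def sp_elem_def algebra_simps)
    show ?thesis unfolding t1[symmetric] t2[symmetric] t3[symmetric] t4[symmetric]
      by (simp only: right_diff_distrib)
  qed
  finally show ?thesis .
qed

definition sp_mats :: "nat \<Rightarrow> nat \<Rightarrow> (nat list, rat) mat set" where
  "sp_mats m n = {opmat (indices m n) (sp_elem x y) | x y. x \<in> letters_upto m \<and> y \<in> letters_upto m}"

definition perm_op :: "nat \<Rightarrow> (nat list \<Rightarrow> 'a::field) \<Rightarrow> nat list \<Rightarrow> 'a" where
  "perm_op k f w = f (swap k w)"

fun contr_op :: "nat \<Rightarrow> (nat list \<Rightarrow> rat) \<Rightarrow> nat list \<Rightarrow> rat" where
  "contr_op m f (a # b # w) = form a b * (\<Sum>y\<in>letters_upto m. eps y * f (y # partner y # w))"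
| "contr_op m f _ = 0"

definition brauer_mats :: "nat \<Rightarrow> nat \<Rightarrow> (nat list, rat) mat set" where
  "brauer_mats m n = insert (opmat (indices m n) (contr_op m))
     {opmat (indices m n) (perm_op k) | k. 1 \<le> k \<and> k < n}"

lemma sp_elem_lin:
  assumes "x \<in> letters_upto m" "y \<in> letters_upto m"
  shows "lin_on (indices m n) (sp_elem x y)"
  unfolding sp_elem_def[abs_def]
proof (rule lin_onI[OF finite_indices], goal_cases)
  case (1 f g c u)
  then show ?case by (simp add: dE_comb algebra_simps)
next
  case (2 f g u)
  then show ?case
    using dE_local[of m n f g u, OF _ _ partner_mem[OF assms(1)]] dE_local[of m n f g u, OF _ _ partner_mem[OF assms(2)]]
    by simp
qed

lemma perm_lin: "1 \<le> k \<Longrightarrow> k < n \<Longrightarrow> lin_on (indices m n) (perm_op k)"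
proof (rule lin_onI[OF finite_indices], goal_cases)
  case (2 f g u)
  have "set (u[k - 1 := u ! k, k := u ! (k - 1)]) = set u"
    using 2 by (intro set_swap[THEN trans]) (auto simp: indices_def)
  then have "swap k u \<in> indices m n" using 2 by (auto simp: swap_def indices_def)
  then show ?case using 2 by (simp add: perm_op_def)
qed (simp add: perm_op_def)

lemma contr_lin: "lin_on (indices m n) (contr_op m)"
proof (rule lin_onI[OF finite_indices], goal_cases)
  case (1 f g c u)
  show ?case
    by (induction m f u rule: contr_op.induct) (auto simp: sum.distrib sum_distrib_left algebra_simps)
next
  case (2 f g u)
  show ?case
  proof (cases "(m, f, u)" rule: contr_op.cases)
    case (1 m' f' a b w)
    have "y # partner y # w \<in> indices m n" if "y \<in> letters_upto m" for y
      using 1 2(2) that partner_mem[OF that] by (auto simp: indices_def)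
    then have "(\<Sum>y\<in>letters_upto m. eps y * f (y # partner y # w)) = (\<Sum>y\<in>letters_upto m. eps y * g (y # partner y # w))"
      by (intro sum.cong refl arg_cong2[of _ _ _ _ "(*)"] 2(1))
    then show ?thesis using 1 by (simp only: prod.inject contr_op.simps)
  qed auto
qed

lemma sp_mats_mats: "sp_mats m n \<subseteq> mats (indices m n)"
  by (auto simp: sp_mats_def opmat_mats)

lemma brauer_mats_mats: "brauer_mats m n \<subseteq> mats (indices m n)"
  by (auto simp: brauer_mats_def opmat_mats)

text \<open>
  The form identifies the module with its dual, so a matrix becomes a tensor with \<open>2n\<close> slots,
  the last \<open>n\<close> of which come from the inputs.
\<close>

definition lower :: "nat \<Rightarrow> (nat list, rat) mat \<Rightarrow> (nat \<Rightarrow> nat) \<Rightarrow> rat" where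
  "lower n T a = (\<Prod>k<n. eps (a (n + k))) *
     T (map a [0..<n], map (\<lambda>k. partner (a (n + k))) [0..<n])"

lemma lower_comb: "lower n (\<lambda>x. S x + c * T x) a = lower n S a + c * lower n T a"
  by (simp add: lower_def algebra_simps)

lemma sum_two_halves: "(\<Sum>i<2*n. F i) = (\<Sum>k<n. F k) + (\<Sum>k<n. F (n + k :: nat) :: rat)"
proof -
  have "(\<Sum>i<n + k. F i) = (\<Sum>i<n. F i) + (\<Sum>i<k. F (n + i))" for k
    by (induction k) (simp_all add: add.assoc)
  then show ?thesis by (simp add: mult_2)
qed

text \<open>
  The elements of \<open>sp\<^sub>2\<^sub>m\<close> are skew with respect to the form.  Hence their action in the input slots is
  right multiplication up to sign, and commuting with them is the same as being annihilated by them.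
\<close>

lemma lower_invariant:
  assumes T: "T \<in> mcomm (indices m n) (sp_mats m n)"
  shows "sp_invariant m {..<2*n} (lower n T)"
  unfolding sp_invariant_def
proof (intro ballI)
  let ?X = "indices m n" and ?V = "letters_upto m"
  fix x y a assume x: "x \<in> ?V" and y: "y \<in> ?V" and a: "a \<in> {..<2*n} \<rightarrow>\<^sub>E ?V"
  have xy1: "x \<ge> 1" "y \<ge> 1" using x y by auto
  have av: "a i \<in> ?V" if "i < 2*n" for i using a that by (auto simp: PiE_iff)
  define u where "u = map a [0..<n]"
  define w where "w = map (\<lambda>k. partner (a (n + k))) [0..<n]"
  have u: "u \<in> ?X" using av by (auto simp: u_def indices_def)
  have "partner (a (n + k)) \<in> ?V" if "k < n" for k
    by (rule partner_mem[OF av]) (use that in simp)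
  then have w: "w \<in> ?X" by (auto simp: w_def indices_def)
  have TM: "T \<in> mats ?X" using T by (simp add: mcomm_def)
  have lenu: "length u = n" and lenw: "length w = n" by (simp_all add: u_def w_def)
  define P where "P = (\<Prod>k<n. eps (a (n + k)))"
  have up: "map (a(k := v)) [0..<n] = u[k := v]" if "k < n" for k v
    by (rule nth_equalityI) (auto simp: u_def nth_list_update)
  have up': "map (a(n + k := v)) [0..<n] = u" for k v
    by (rule nth_equalityI) (auto simp: u_def)
  have wp: "map (\<lambda>l. partner ((a(k := v)) (n + l))) [0..<n] = w" if "k < n" for k v
    using that by (intro nth_equalityI) (auto simp: w_def)
  have wp': "map (\<lambda>l. partner ((a(n + k := v)) (n + l))) [0..<n] = w[k := partner v]" if "k < n" for k v
    using that by (intro nth_equalityI) (auto simp: w_def nth_list_update)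
  have L1: "lower n T (a(k := v)) = P * T (u[k := v], w)" if "k < n" for k v
    unfolding lower_def up[OF that] wp[OF that] P_def using that by simp
  have L2: "lower n T (a(n + k := v)) = eps v * eps (a (n + k)) * P * T (u, w[k := partner v])" if "k < n" for k v
  proof -
    have "(\<Prod>l<n. eps ((a(n + k := v)) (n + l))) = eps v * (\<Prod>l\<in>{..<n} - {k}. eps (a (n + l)))"
      using that by (subst prod.remove[of _ k]) (auto intro!: prod.cong)
    moreover have "P = eps (a (n + k)) * (\<Prod>l\<in>{..<n} - {k}. eps (a (n + l)))"
      unfolding P_def using that by (subst prod.remove[of _ k]) auto
    ultimately have "(\<Prod>l<n. eps ((a(n + k := v)) (n + l))) = eps v * eps (a (n + k)) * P"
      by (simp add: eps_sq)
    then show ?thesis unfolding lower_def up' wp'[OF that] by simp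
  qed
  have "(\<Sum>k<n. slot_act x y (lower n T) a k) = (\<Sum>k<n. P *
      (eps y * (if u ! k = x then T (u[k := partner y], w) else 0)
     + eps x * (if u ! k = y then T (u[k := partner x], w) else 0)))"
    by (rule sum.cong) (auto simp: slot_act_def L1 u_def algebra_simps)
  also have "\<dots> = P * sp_elem x y (\<lambda>u. T (u, w)) u"
    using lenu by (simp only: sp_elem_def dE_sum sum_distrib_left sum.distrib distrib_left)
  finally have h1: "(\<Sum>k<n. slot_act x y (lower n T) a k) = P * sp_elem x y (\<lambda>u. T (u, w)) u" .
  have "(\<Sum>k<n. slot_act x y (lower n T) a (n + k)) = (\<Sum>k<n. - P *
      (eps x * (if w ! k = partner x then T (u, w[k := y]) else 0)
     + eps y * (if w ! k = partner y then T (u, w[k := x]) else 0)))"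
  proof (rule sum.cong[OF refl])
    fix k assume k: "k \<in> {..<n}"
    then have "a (n + k) \<ge> 1" using av[of "n + k"] by simp
    then have "w ! k = partner x \<longleftrightarrow> a (n + k) = x" "w ! k = partner y \<longleftrightarrow> a (n + k) = y"
      using k xy1 by (simp_all add: w_def partner_inj)
    then show "slot_act x y (lower n T) a (n + k) = - P *
      (eps x * (if w ! k = partner x then T (u, w[k := y]) else 0)
     + eps y * (if w ! k = partner y then T (u, w[k := x]) else 0))"
    proof -
      have "eps z * lower n T (a(n + k := partner z)) = - P * (eps (a (n + k)) * T (u, w[k := z]))"
        if "z \<ge> 1" for z
        using k that eps_sq(2)[of z "eps (a (n + k)) * P * T (u, w[k := z])"]
        by (simp add: L2 partner_partner eps_partner mult.assoc mult.left_commute[of P])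
      then show ?thesis
        using xy1 \<open>w ! k = partner x \<longleftrightarrow> a (n + k) = x\<close> \<open>w ! k = partner y \<longleftrightarrow> a (n + k) = y\<close>
        by (auto simp: slot_act_def distrib_left)
    qed
  qed
  also have "\<dots> = - P * (eps x * dE (partner x) y (\<lambda>v. T (u, v)) w + eps y * dE (partner y) x (\<lambda>v. T (u, v)) w)"
    using lenw by (simp only: dE_sum sum_distrib_left sum.distrib distrib_left)
  finally have h2: "(\<Sum>k<n. slot_act x y (lower n T) a (n + k))
      = - P * (eps x * dE (partner x) y (\<lambda>v. T (u, v)) w + eps y * dE (partner y) x (\<lambda>v. T (u, v)) w)" .
  let ?s = "opmat ?X (sp_elem x y)"
  have dec: "?s = (\<lambda>z. eps y * opmat ?X (dE x (partner y)) z + eps x * opmat ?X (dE y (partner x)) z)"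
    unfolding sp_elem_def[abs_def] by (rule opmat_comb)
  have "mmul X S (\<lambda>z. c * A z + d * B z) = (\<lambda>z. c * mmul X S A z + d * mmul X S B z)"
    for X :: "nat list set" and S A B :: "(nat list, rat) mat" and c d
    by (auto simp: mmul_def fun_eq_iff sum.distrib sum_distrib_left algebra_simps)
  then have "mmul ?X T ?s (u, w) = eps y * dE (partner y) x (\<lambda>v. T (u, v)) w + eps x * dE (partner x) y (\<lambda>v. T (u, v)) w"
    unfolding dec using w opmat_mmul_right[OF dE_lin[OF x] TM dE_transpose, of "partner y"]
      opmat_mmul_right[OF dE_lin[OF y] TM dE_transpose, of "partner x"] by simp
  moreover have "mmul ?X ?s T (u, w) = sp_elem x y (\<lambda>v. T (v, w)) u"
    using u by (simp add: opmat_mmul_left[OF sp_elem_lin[OF x y] TM])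
  moreover have "mmul ?X T ?s = mmul ?X ?s T"
    using T x y by (auto simp: mcomm_def sp_mats_def)
  ultimately show "(\<Sum>i<2*n. slot_act x y (lower n T) a i) = 0"
    unfolding sum_two_halves h1 h2 by (simp add: algebra_simps)
qed

lemma lower_inj:
  assumes "S \<in> mats (indices m n)" "T \<in> mats (indices m n)"
    and eq: "\<And>a. a \<in> {..<2*n} \<rightarrow>\<^sub>E letters_upto m \<Longrightarrow> lower n S a = lower n T a"
  shows "S = T"
proof -
  have "S (u, w) = T (u, w)" if u: "u \<in> indices m n" and w: "w \<in> indices m n" for u w
  proof -
    define a where "a = (\<lambda>i\<in>{..<2*n}. if i < n then u ! i else partner (w ! (i - n)))"
    have uv: "u ! i \<in> letters_upto m" "w ! i \<in> letters_upto m" if "i < n" for i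
      using u w that nth_mem[of i u] nth_mem[of i w] unfolding indices_def by (auto simp only: mem_Collect_eq)
    have a: "a \<in> {..<2*n} \<rightarrow>\<^sub>E letters_upto m"
    proof (rule PiE_I)
      show "a i \<in> letters_upto m" if "i \<in> {..<2*n}" for i
      proof (cases "i < n")
        case False
        then have "partner (w ! (i - n)) \<in> letters_upto m"
          using that by (intro partner_mem uv(2)) auto
        then show ?thesis using that False by (simp add: a_def)
      qed (use that uv(1) in \<open>simp add: a_def\<close>)
    qed (simp add: a_def)
    have "map a [0..<n] = u"
      using u by (intro nth_equalityI) (auto simp: a_def indices_def)
    moreover have "partner (partner (w ! i)) = w ! i" if "i < n" for i
      using uv(2)[OF that] by (simp add: partner_partner)
    then have "map (\<lambda>k. partner (a (n + k))) [0..<n] = w"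
      using w by (intro nth_equalityI) (auto simp: a_def indices_def)
    moreover have "(\<Prod>k<n. eps (a (n + k))) \<noteq> 0"
      by (simp add: eps_def)
    ultimately show ?thesis
      using eq[OF a] by (simp add: lower_def)
  qed
  moreover have "S (u, w) = T (u, w)" if "u \<notin> indices m n \<or> w \<notin> indices m n" for u w
    using assms(1,2) that by (auto simp: mats_def)
  ultimately have "S (u, w) = T (u, w)" for u w by blast
  then show ?thesis by (intro ext) (simp add: split_paired_all)
qed

text \<open>
  Under \<open>lower\<close>, matrices commuting with \<open>sp\<^sub>2\<^sub>m\<close> become invariants, hence combinations of matchings, and the
  identity matrix becomes the identity matching up to sign.
\<close>

theorem sp_commutant:
  assumes T: "T \<in> mcomm (indices m n) (sp_mats m n)"
  shows "T \<in> malg (indices m n) (brauer_mats m n)"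
proof -
  let ?X = "indices m n" and ?V = "letters_upto m" and ?A = "malg (indices m n) (brauer_mats m n)"
  define B where "B = {g. \<exists>S \<in> ?A. \<forall>a \<in> {..<2*n} \<rightarrow>\<^sub>E ?V. g a = lower n S a}"
  have AM: "S \<in> mats ?X" if "S \<in> ?A" for S
    by (rule malg_mats[OF brauer_mats_mats that])
  have inX: "map a [0..<n] \<in> ?X" if "a \<in> {..<2*n} \<rightarrow>\<^sub>E ?V" for a
    using that by (auto simp: indices_def PiE_iff)
  obtain g where g: "g \<in> matching_span {..<2*n}" "\<forall>a \<in> {..<2*n} \<rightarrow>\<^sub>E ?V. lower n T a = g a"
    using symplectic_first_fundamental_theorem[OF finite_lessThan lower_invariant[OF T]] by blast
  have "g \<in> B"
  proof (rule matching_span_mem[OF _ _ _ _ _ g(1)])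
    show "subsp B"
    proof (rule subspI)
      show "(\<lambda>_. 0) \<in> B"
        unfolding B_def using subsp_zero[OF malg_subsp, of ?X "brauer_mats m n"]
        by (auto simp: lower_def intro!: bexI[of _ "\<lambda>_. 0"])
      fix f h c assume "f \<in> B" "h \<in> B"
      then obtain S S' where "S \<in> ?A" "S' \<in> ?A" "\<forall>a \<in> {..<2*n} \<rightarrow>\<^sub>E ?V. f a = lower n S a"
        "\<forall>a \<in> {..<2*n} \<rightarrow>\<^sub>E ?V. h a = lower n S' a" by (auto simp: B_def)
      then show "(\<lambda>x. f x + c * h x) \<in> B"
        unfolding B_def using malg_comb[of S ?X "brauer_mats m n" S' c]
        by (auto simp: lower_comb intro!: bexI[of _ "\<lambda>x. S x + c * S' x"])
    qed
    show "f' \<in> B" if "f \<in> B" "\<And>a. a \<in> {..<2*n} \<rightarrow>\<^sub>E ?V \<Longrightarrow> f' a = f a" for f f'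
      using that by (auto simp: B_def)
    show "matching_form (id_matching n) \<in> B"
    proof -
      have "matching_form (id_matching n) a = lower n (\<lambda>x. (- 1) ^ n * mone ?X x) a" if a: "a \<in> {..<2*n} \<rightarrow>\<^sub>E ?V" for a
      proof -
        have a1: "a k \<ge> 1" "a (n + k) \<ge> 1" if "k < n" for k
          using a that by (auto simp: PiE_iff)
        have eqv: "map a [0..<n] = map (\<lambda>k. partner (a (n + k))) [0..<n] \<longleftrightarrow> (\<forall>k<n. a (n + k) = partner (a k))"
        proof -
          have "a k = partner (a (n + k)) \<longleftrightarrow> a (n + k) = partner (a k)" if "k < n" for k
            using partner_partner[OF a1(1)[OF that]] partner_partner[OF a1(2)[OF that]] by auto
          then show ?thesis by (simp add: list_eq_iff_nth_eq)
        qed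
        have "matching_form (id_matching n) a = (\<Prod>k<n. form (a k) (a (n + k)))"
          by (simp add: matching_form_def id_matching_def prod_unfold_prod_mset multiset.map_comp comp_def)
        also have "\<dots> = (if \<forall>k<n. a (n + k) = partner (a k) then \<Prod>k<n. - eps (a (n + k)) else 0)"
        proof (cases "\<forall>k<n. a (n + k) = partner (a k)")
          case True
          then have "form (a k) (a (n + k)) = - eps (a (n + k))" if "k < n" for k
            using a1(1)[OF that] that by (simp add: form_def eps_partner)
          then show ?thesis using True by auto
        next
          case False
          then show ?thesis by (auto simp: form_def)
        qed
        also have "\<dots> = lower n (\<lambda>x. (- 1) ^ n * mone ?X x) a"
          using inX[OF a] eqv by (auto simp: lower_def mone_def prod.distrib prod_uminus)
        finally show ?thesis .
      qed
      then show ?thesis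
        using malg_scale[OF malg_one, of "(- 1) ^ n" ?X "brauer_mats m n"] by (auto simp: B_def)
    qed
    show "(\<lambda>a. f (a \<circ> transpose k (Suc k))) \<in> B" if f: "f \<in> B" and k: "Suc k < n" for f k
    proof -
      obtain S where S: "S \<in> ?A" "\<forall>a \<in> {..<2*n} \<rightarrow>\<^sub>E ?V. f a = lower n S a" using f by (auto simp: B_def)
      have gen: "opmat ?X (perm_op (Suc k)) \<in> ?A"
        using k by (intro malg_gen) (auto simp: brauer_mats_def)
      have "f (a \<circ> transpose k (Suc k)) = lower n (mmul ?X (opmat ?X (perm_op (Suc k))) S) a"
        if a: "a \<in> {..<2*n} \<rightarrow>\<^sub>E ?V" for a
      proof -
        have "swap (Suc k) (map a [0..<n]) = map (a \<circ> transpose k (Suc k)) [0..<n]"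
          using k by (intro nth_equalityI) (auto simp: swap_def nth_list_update transpose_def)
        moreover have "(a \<circ> transpose k (Suc k)) (n + l) = a (n + l)" for l
          using k by (simp add: transpose_def)
        ultimately have "lower n S (a \<circ> transpose k (Suc k)) = lower n (mmul ?X (opmat ?X (perm_op (Suc k))) S) a"
          using inX[OF a] k unfolding opmat_mmul_left[OF perm_lin[of "Suc k" n m] AM[OF S(1)], simplified k]
          by (simp add: lower_def opmat_mmul_left[OF perm_lin AM[OF S(1)]] perm_op_def)
        then show ?thesis
          using S(2) swap_mem[OF a, of k "Suc k"] k by simp
      qed
      then show ?thesis
        using malg_mul[OF gen S(1)] by (auto simp: B_def)
    qed
    show "(\<lambda>a. form (a 0) (a 1) * contraction m 0 1 f a) \<in> B" if f: "f \<in> B" and n2: "2 \<le> n" for f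
    proof -
      obtain S where S: "S \<in> ?A" "\<forall>a \<in> {..<2*n} \<rightarrow>\<^sub>E ?V. f a = lower n S a" using f by (auto simp: B_def)
      have gen: "opmat ?X (contr_op m) \<in> ?A"
        by (intro malg_gen) (auto simp: brauer_mats_def)
      obtain n' where n': "n = Suc (Suc n')" using n2 by (metis add_2_eq_Suc le_Suc_ex)
      have "form (a 0) (a 1) * contraction m 0 1 f a = lower n (mmul ?X (opmat ?X (contr_op m)) S) a"
        if a: "a \<in> {..<2*n} \<rightarrow>\<^sub>E ?V" for a
      proof -
        have l: "map a [0..<n] = a 0 # a 1 # map a [2..<n]" for a :: "nat \<Rightarrow> nat"
          unfolding n' by (simp add: upt_rec[of 0] upt_rec[of "Suc 0"] numeral_2_eq_2 del: upt_Suc)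
        have "f (a(0 := y, 1 := partner y))
            = (\<Prod>k<n. eps (a (n + k))) * S (y # partner y # map a [2..<n], map (\<lambda>k. partner (a (n + k))) [0..<n])"
          if y: "y \<in> ?V" for y
        proof -
          let ?a' = "a(0 := y, 1 := partner y)"
          have "?a' \<in> {..<2*n} \<rightarrow>\<^sub>E ?V"
            using n2 y partner_mem[OF y] by (intro upd_mem a) auto
          then have "f ?a' = lower n S ?a'"
            using S(2) by blast
          moreover have "map ?a' [2..<n] = map a [2..<n]" by auto
          moreover have "?a' (n + k) = a (n + k)" for k using n2 by auto
          moreover have "?a' 0 = y" "?a' 1 = partner y" by simp_all
          ultimately show ?thesis unfolding lower_def l[of ?a'] by (simp only:)
        qed
        then have "contraction m 0 1 f a = (\<Prod>k<n. eps (a (n + k))) * (\<Sum>y\<in>?V. eps y *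
             S (y # partner y # map a [2..<n], map (\<lambda>k. partner (a (n + k))) [0..<n]))"
          unfolding contraction_def sum_distrib_left by (intro sum.cong) (simp_all only: mult.left_commute)
        moreover have "lower n (mmul ?X (opmat ?X (contr_op m)) S) a = (\<Prod>k<n. eps (a (n + k))) *
             contr_op m (\<lambda>v. S (v, map (\<lambda>k. partner (a (n + k))) [0..<n])) (map a [0..<n])"
          unfolding lower_def opmat_mmul_left[OF contr_lin AM[OF S(1)]] using inX[OF a] by simp
        ultimately show ?thesis unfolding l by simp
      qed
      then show ?thesis
        using malg_mul[OF gen S(1)] by (auto simp: B_def)
    qed
  qed
  then obtain S where S: "S \<in> ?A" "\<forall>a \<in> {..<2*n} \<rightarrow>\<^sub>E ?V. g a = lower n S a" by (auto simp: B_def)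
  have "T = S"
    using T AM[OF S(1)] g(2) S(2) by (intro lower_inj[of _ m n]) (auto simp: mcomm_def)
  then show ?thesis using S(1) by simp
qed

text \<open>
  The transpose of the element for \<open>x, y\<close> is, up to sign, the element for the partners of \<open>x, y\<close>.
\<close>

lemma sp_transpose:
  assumes "g \<in> sp_mats m n"
  shows "mtr g \<in> malg (indices m n) (sp_mats m n)"
proof -
  let ?X = "indices m n"
  obtain x y where x: "x \<in> letters_upto m" and y: "y \<in> letters_upto m" and g: "g = opmat ?X (sp_elem x y)"
    using assms by (auto simp: sp_mats_def)
  have xy1: "x \<ge> 1" "y \<ge> 1" using x y by auto
  have dec: "opmat ?X (sp_elem x y) = (\<lambda>z. eps y * opmat ?X (dE x (partner y)) z + eps x * opmat ?X (dE y (partner x)) z)"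
    for x y
    unfolding sp_elem_def[abs_def] by (rule opmat_comb)
  have "mtr g = (\<lambda>z. eps y * mtr (opmat ?X (dE x (partner y))) z + eps x * mtr (opmat ?X (dE y (partner x))) z)"
    unfolding g dec by (auto simp: mtr_def fun_eq_iff)
  also have "\<dots> = (\<lambda>z. (- eps x * eps y) * opmat ?X (sp_elem (partner x) (partner y)) z)"
    unfolding dec dE_transpose using xy1 by (simp add: partner_partner eps_partner eps_sq fun_eq_iff algebra_simps)
  finally have "mtr g = (\<lambda>z. (- eps x * eps y) * opmat ?X (sp_elem (partner x) (partner y)) z)" .
  moreover have "opmat ?X (sp_elem (partner x) (partner y)) \<in> malg ?X (sp_mats m n)"
    using partner_mem[OF x] partner_mem[OF y] by (intro malg_gen) (auto simp: sp_mats_def)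
  ultimately show ?thesis
    using malg_scale by (simp only:)
qed

theorem brauer_commutant:
  assumes T: "T \<in> mcomm (indices m n) (brauer_mats m n)"
  shows "T \<in> malg (indices m n) (sp_mats m n)"
proof (rule bicommutant[OF finite_indices sp_mats_mats sp_transpose])
  show "T \<in> mcomm (indices m n) (mcomm (indices m n) (sp_mats m n))"
    using T mcomm_malg[OF finite_indices T sp_commutant] by (simp add: mcomm_def)
qed

section \<open>Generators of the symplectic Lie algebra\<close>

text \<open>
  The reductions of the generators of the iquantum group: the two root vectors of each of the \<open>m\<close> commuting
  copies of \<open>sl\<^sub>2\<close>, one for each hyperbolic pair, and one element for each two consecutive pairs.
\<close>

definition sp_gens :: "nat \<Rightarrow> nat \<Rightarrow> (nat list, rat) mat set" where
  "sp_gens m n = (\<Union>j \<in> {j. odd j \<and> j < 2*m}.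
       {opmat (indices m n) (dE j (j + 1)), opmat (indices m n) (dE (j + 1) j)})
     \<union> {opmat (indices m n) (sp_elem (2*j + 1) (2*j - 1)) | j. 1 \<le> j \<and> j < m}"

text \<open>
  The Poisson bracket with the square of a basis vector replaces the partner of that vector by the vector
  itself, so one element for two hyperbolic pairs yields all four.  Brackets of elements for consecutive
  pairs reach all pairs of distinct hyperbolic pairs.
\<close>

theorem sp_mats_generated: "sp_mats m n \<subseteq> malg (indices m n) (sp_gens m n)"
proof -
  let ?X = "indices m n" and ?V = "letters_upto m"
  let ?A = "malg ?X (sp_gens m n)"
  let ?O = "\<lambda>x y. opmat ?X (sp_elem x y)"
  define L where "L x y \<longleftrightarrow> ?O x y \<in> ?A" for x y
  have L_sym: "L x y \<longleftrightarrow> L y x" for x y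
    by (simp only: L_def sp_elem_sym)
  have comm: "(\<lambda>z. form b c * ?O a d z + form a c * ?O b d z + form b d * ?O c a z + form a d * ?O c b z) \<in> ?A"
    if L: "L a b" "L c d" and V: "a \<in> ?V" "b \<in> ?V" "c \<in> ?V" "d \<in> ?V" for a b c d
  proof -
    have "(\<lambda>z. mmul ?X (?O a b) (?O c d) z + (- 1) * mmul ?X (?O c d) (?O a b) z) \<in> ?A"
      using L unfolding L_def by (intro malg_comb malg_mul)
    moreover have "mmul ?X (?O a b) (?O c d) z + (- 1) * mmul ?X (?O c d) (?O a b) z
        = form b c * ?O a d z + form a c * ?O b d z + form b d * ?O c a z + form a d * ?O c b z" for z
      using sp_elem_commutator[of a b c d "unit_vec (snd z)" "fst z"] V
      unfolding opmat_comp[OF sp_elem_lin[OF V(1,2)]] opmat_comp[OF sp_elem_lin[OF V(3,4)]]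
      by (cases z) (simp add: opmat_def)
    ultimately show ?thesis by (simp only:)
  qed
  \<comment> \<open>If only one of the four terms of a bracket survives, it can be isolated.\<close>
  have single: "L a d"
    if L: "L a b" "L c d" and V: "a \<in> ?V" "b \<in> ?V" "c \<in> ?V" "d \<in> ?V"
      and nz: "c = partner b" "c \<noteq> partner a" "d \<noteq> partner a" "d \<noteq> partner b" for a b c d
  proof -
    have "(\<lambda>z. form b c * ?O a d z) \<in> ?A"
      using comm[OF L V] nz by (simp add: form_def)
    then have "(\<lambda>z. form b c * (form b c * ?O a d z)) \<in> ?A"
      by (rule malg_scale)
    moreover have "form b c * (form b c * t) = t" for t
      using nz by (simp add: form_def eps_sq)
    ultimately show ?thesis by (simp only: L_def)
  qed
  \<comment> \<open>The element for \<open>x, x\<close> is a multiple of a root vector of the \<open>sl\<^sub>2\<close> belonging to the pair of \<open>x\<close>.\<close>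
  have diag: "L x x" if x: "x \<in> ?V" for x
  proof -
    have "opmat ?X (dE x (partner x)) \<in> ?A"
    proof (cases "odd x")
      case True
      then have "x < 2 * m" using x unfolding atLeastAtMost_iff by presburger
      then show ?thesis
        using True by (intro malg_gen) (auto simp: sp_gens_def partner_def)
    next
      case False
      then have "odd (x - 1)" "x - 1 < 2 * m" "x - 1 + 1 = x" using x by auto
      then show ?thesis
        using False by (intro malg_gen) (force simp: sp_gens_def partner_def)
    qed
    then have "(\<lambda>z. (2 * eps x) * opmat ?X (dE x (partner x)) z) \<in> ?A"
      by (rule malg_scale)
    moreover have "?O x x = (\<lambda>z. (2 * eps x) * opmat ?X (dE x (partner x)) z)"
      by (auto simp: opmat_def sp_elem_def fun_eq_iff)
    ultimately show ?thesis by (simp only: L_def)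
  qed
  have twist: "L (partner x) y" if L: "L x y" and V: "x \<in> ?V" "y \<in> ?V" and "y \<noteq> x" for x y
  proof -
    have px: "partner x \<in> ?V" using V partner_mem by blast
    have x1: "partner (partner x) = x" using V by (simp add: partner_partner)
    have "(\<lambda>z. 2 * eps (partner x) * ?O (partner x) y z) \<in> ?A"
      using comm[OF diag[OF px] L px px V] \<open>y \<noteq> x\<close> by (simp add: form_def x1 mult.assoc)
    then have "(\<lambda>z. (eps (partner x) / 2) * (2 * eps (partner x) * ?O (partner x) y z)) \<in> ?A"
      by (rule malg_scale)
    then show ?thesis by (simp add: L_def eps_sq)
  qed
  have inner: "L (partner x) x" if x: "x \<in> ?V" for x
  proof -
    have px: "partner x \<in> ?V" using x partner_mem by blast
    have x1: "partner (partner x) = x" using x by (simp add: partner_partner)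
    have "(\<lambda>z. 4 * eps (partner x) * ?O (partner x) x z) \<in> ?A"
      using comm[OF diag[OF px] diag[OF x] px px x x] by (simp add: form_def x1 mult.assoc sp_elem_sym[of x])
    then have "(\<lambda>z. (eps (partner x) / 4) * (4 * eps (partner x) * ?O (partner x) x z)) \<in> ?A"
      by (rule malg_scale)
    then show ?thesis by (simp add: L_def eps_sq)
  qed
  have p_odd: "partner (2*i - 1) = 2 * i" "partner (2 * i) = 2*i - 1" if "i \<ge> 1" for i
    using that by (auto simp: partner_def)
  \<comment> \<open>Induction on the distance of two pairs: bracket the generator for the pairs \<open>i, i + 1\<close> with an element
    for the pairs \<open>i + 1, j\<close>.\<close>
  have blocks: "L (2*i - 1) (2*j - 1)" if "1 \<le> i" "i < j" "j \<le> m" for i j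
    using that
  proof (induction "j - i" arbitrary: i rule: less_induct)
    case less
    have gen: "L (2*i - 1) (2*i + 1)"
      unfolding L_sym[of "2*i - 1"] unfolding L_def using less.prems
      by (intro malg_gen) (auto simp: sp_gens_def)
    show ?case
    proof (cases "j = Suc i")
      case True
      then show ?thesis using gen by simp
    next
      case False
      then have "L (2 * Suc i - 1) (2*j - 1)"
        using less.prems by (intro less.hyps) auto
      then have "L (partner (2 * Suc i - 1)) (2*j - 1)"
        using less.prems False by (intro twist) auto
      then show ?thesis
        using less.prems False gen
        by (intro single[of "2*i - 1" "2*i + 1" "partner (2 * Suc i - 1)" "2*j - 1"])
          (auto simp: p_odd partner_def)
    qed
  qed
  have cross: "L x y" if x: "x \<in> {2*i - 1, 2*i}" and y: "y \<in> {2*j - 1, 2*j}" and ij: "1 \<le> i" "i < j" "j \<le> m" for x y i j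
  proof -
    have V: "2*i - 1 \<in> ?V" "2*i \<in> ?V" "2*j - 1 \<in> ?V" "2*j \<in> ?V" using ij by auto
    have 1: "L x (2*j - 1)"
      using blocks[OF ij] twist[OF blocks[OF ij]] V ij x p_odd[of i] by auto
    have "L (2*j - 1) x" using 1 L_sym by blast
    then have "L (partner (2*j - 1)) x"
      using V ij x by (intro twist) auto
    then show ?thesis
      using 1 y ij p_odd[of j] L_sym by auto
  qed
  have "L x y" if x: "x \<in> ?V" and y: "y \<in> ?V" for x y
  proof -
    define i where "i = (x + 1) div 2"
    define j where "j = (y + 1) div 2"
    have i: "x \<in> {2*i - 1, 2*i}" "1 \<le> i" "i \<le> m" using x by (auto simp: i_def)
    have j: "y \<in> {2*j - 1, 2*j}" "1 \<le> j" "j \<le> m" using y by (auto simp: j_def)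
    consider "i < j" | "j < i" | "i = j" by linarith
    then show ?thesis
    proof cases
      case 1
      then show ?thesis using cross i j by blast
    next
      case 2
      then show ?thesis using cross[OF j(1) i(1)] i j L_sym by blast
    next
      case 3
      then have "y = x \<or> y = partner x"
        using i j p_odd[of i] by auto
      then show ?thesis using diag[OF x] inner[OF x] L_sym by blast
    qed
  qed
  then show ?thesis by (auto simp: sp_mats_def L_def)
qed

theorem classical_duality:
  "mcomm (indices m n) (brauer_mats m n) \<subseteq> malg (indices m n) (sp_gens m n)"
  "mcomm (indices m n) (sp_gens m n) \<subseteq> malg (indices m n) (brauer_mats m n)"
proof -
  show "mcomm (indices m n) (brauer_mats m n) \<subseteq> malg (indices m n) (sp_gens m n)"
    using brauer_commutant malg_subset[OF sp_mats_generated] by blast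
  show "mcomm (indices m n) (sp_gens m n) \<subseteq> malg (indices m n) (brauer_mats m n)"
  proof
    fix T assume T: "T \<in> mcomm (indices m n) (sp_gens m n)"
    have "T \<in> mcomm (indices m n) (sp_mats m n)"
      using T mcomm_malg[OF finite_indices T] sp_mats_generated by (auto simp: mcomm_def)
    then show "T \<in> malg (indices m n) (brauer_mats m n)"
      by (rule sp_commutant)
  qed
qed

section \<open>Modules over algebras given by generators and relations\<close>

definition lin_op :: "('i vec \<Rightarrow> 'j vec) \<Rightarrow> bool" where
  "lin_op T \<longleftrightarrow> (\<forall>f g c. T (\<lambda>u. f u + c * g u) = (\<lambda>u. T f u + c * T g u))"

lemma lin_opD: "lin_op T \<Longrightarrow> T (\<lambda>u. f u + c * g u) = (\<lambda>u. T f u + c * T g u)"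
  by (simp add: lin_op_def)

lemma lin_op_zero: "lin_op T \<Longrightarrow> T (\<lambda>u. 0) = (\<lambda>u. 0)"
  using lin_opD[of T "\<lambda>u. 0" "- 1" "\<lambda>u. 0"] by (auto simp: fun_eq_iff)

lemma lin_op_add: "lin_op T \<Longrightarrow> T (f + g) = T f + T g"
  using lin_opD[of T f 1 g] by (auto simp: fun_eq_iff plus_fun_def)

lemma lin_op_smul: "lin_op T \<Longrightarrow> T (smul c g) = smul c (T g)"
  using lin_opD[of T "\<lambda>u. 0" c g] lin_op_zero[of T] by (auto simp: fun_eq_iff smul_def)

lemma lin_op_foldr: "(\<And>g. lin_op (op g)) \<Longrightarrow> lin_op (foldr op xs)"
  by (induction xs) (simp_all add: lin_op_def id_def)

lemma lin_op_fold: "(\<And>g. lin_op (op g)) \<Longrightarrow> lin_op (fold op xs)"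
  by (induction xs) (simp_all add: lin_op_def id_def)

lemma free_induct [case_names zero add]:
  assumes "P 0" "\<And>p w c. P p \<Longrightarrow> P (p + Poly_Mapping.single w c)"
  shows "P (p :: 'g free)"
proof (induction p rule: update_induct)
  case const
  then show ?case using assms(1) by simp
next
  case (update f a b)
  have "Poly_Mapping.update a b f = f + Poly_Mapping.single a b"
    using update by (intro poly_mapping_eqI) (auto simp: lookup_update lookup_add lookup_single in_keys_iff)
  then show ?case using assms(2) update by metis
qed

text \<open>
  The common form of left and right actions of a free algebra: \<open>W xs\<close> is the operator of the word \<open>xs\<close>.
\<close>

definition word_act :: "('g list \<Rightarrow> 'i vec \<Rightarrow> 'i vec) \<Rightarrow> 'g free \<Rightarrow> 'i vec \<Rightarrow> 'i vec" where
  "word_act W p f = (\<lambda>u. \<Sum>w\<in>Poly_Mapping.keys p. Poly_Mapping.lookup p w * W (letters w) f u)"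

lemma sum_fun: "(\<Sum>w\<in>A. g w) = (\<lambda>u. \<Sum>w\<in>A. g w u :: 'a::comm_monoid_add)"
  by (induction A rule: infinite_finite_induct) (auto simp: fun_eq_iff zero_fun_def plus_fun_def)

lemma free_lact_word: "free_lact op = word_act (foldr op)"
  by (intro ext) (simp add: free_lact_def word_act_def sum_fun smul_def)

lemma free_ract_word: "free_ract op = word_act (fold op)"
  by (intro ext) (simp add: free_ract_def word_act_def sum_fun smul_def)

lemma word_act_superset:
  assumes "finite S" "Poly_Mapping.keys p \<subseteq> S"
  shows "word_act W p f = (\<lambda>u. \<Sum>w\<in>S. Poly_Mapping.lookup p w * W (letters w) f u)"
  unfolding word_act_def
  by (intro ext sum.mono_neutral_left) (use assms in \<open>auto simp: in_keys_iff\<close>)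

lemma word_act_add: "word_act W (p + q) f = (\<lambda>u. word_act W p f u + word_act W q f u)"
proof -
  let ?S = "Poly_Mapping.keys p \<union> Poly_Mapping.keys q"
  have "Poly_Mapping.keys (p + q) \<subseteq> ?S"
    by (auto simp: in_keys_iff lookup_add)
  then show ?thesis
    by (simp add: word_act_superset[of ?S] lookup_add sum.distrib algebra_simps)
qed

lemma word_act_single: "word_act W (Poly_Mapping.single w c) f = (\<lambda>u. c * W (letters w) f u)"
  by (simp add: word_act_superset[of "{w}"])

lemma word_act_zero: "word_act W 0 f = (\<lambda>u. 0)"
  by (simp add: word_act_def)

lemma word_act_uminus: "word_act W (- p) f = (\<lambda>u. - word_act W p f u)"
  by (simp add: word_act_def sum_negf)

lemma word_act_diff: "word_act W (p - q) f = (\<lambda>u. word_act W p f u - word_act W q f u)"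
  using word_act_add[of W p "- q" f] by (simp add: word_act_uminus)

lemma word_act_lin:
  assumes "\<And>xs. lin_op (W xs)"
  shows "lin_op (word_act W p)"
  unfolding lin_op_def word_act_def
  by (simp add: lin_opD[OF assms] sum.distrib sum_distrib_left algebra_simps)

lemma word_act_mult_left:
  assumes lin: "\<And>xs. lin_op (W xs)" and W: "\<And>xs ys f. W (xs @ ys) f = W xs (W ys f)"
  shows "word_act W (p * q) f = word_act W p (word_act W q f)"
proof (induction p rule: free_induct)
  case (add p w c)
  have "word_act W (Poly_Mapping.single w c * q) f = (\<lambda>u. c * W (letters w) (word_act W q f) u)"
  proof (induction q rule: free_induct)
    case (add q v d)
    have "word_act W (Poly_Mapping.single w c * (q + Poly_Mapping.single v d)) f
        = (\<lambda>u. c * W (letters w) (word_act W q f) u + c * d * W (letters w) (W (letters v) f) u)"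
      unfolding distrib_left word_act_add add.IH mult_single word_act_single by (simp add: plus_fword_def W)
    then show ?case
      unfolding word_act_add word_act_single by (simp add: lin_opD[OF lin] algebra_simps)
  qed (simp add: word_act_zero lin_op_zero[OF lin])
  then show ?case
    unfolding distrib_right word_act_add word_act_single add.IH by simp
qed (simp add: word_act_zero)

lemma word_act_mult_right:
  assumes lin: "\<And>xs. lin_op (W xs)" and W: "\<And>xs ys f. W (xs @ ys) f = W ys (W xs f)"
  shows "word_act W (p * q) f = word_act W q (word_act W p f)"
proof (induction q rule: free_induct)
  case (add q w c)
  have "word_act W (p * Poly_Mapping.single w c) f = (\<lambda>u. c * W (letters w) (word_act W p f) u)"
  proof (induction p rule: free_induct)
    case (add p v d)
    have "word_act W ((p + Poly_Mapping.single v d) * Poly_Mapping.single w c) f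
        = (\<lambda>u. c * W (letters w) (word_act W p f) u + d * c * W (letters w) (W (letters v) f) u)"
      unfolding distrib_right word_act_add add.IH mult_single word_act_single by (simp add: plus_fword_def W)
    then show ?case
      unfolding word_act_add word_act_single by (simp add: lin_opD[OF lin] algebra_simps)
  qed (simp add: word_act_zero lin_op_zero[OF lin])
  then show ?case
    unfolding distrib_left word_act_add word_act_single add.IH by simp
qed (simp add: word_act_zero)

lemma one_free: "(1 :: 'g free) = Poly_Mapping.single (Word []) 1"
  by (simp add: zero_fword_def flip: single_one)

lemma word_act_one: "(\<And>f. W [] f = f) \<Longrightarrow> word_act W 1 f = f"
  by (simp add: one_free word_act_single)

lemma word_act_scal: "(\<And>f. W [] f = f) \<Longrightarrow> word_act W (scal c) f = (\<lambda>u. c * f u)"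
  by (simp add: scal_def zero_fword_def word_act_single)

lemma word_act_gen: "word_act W (gen g) f = W [g] f"
  by (simp add: gen_def word_act_single)

lemma tens_zero: "(\<lambda>u. 0) \<in> tens m n" and tens_zero': "0 \<in> tens m n"
  by (auto simp: tens_def)

lemma tens_comb: "f \<in> tens m n \<Longrightarrow> g \<in> tens m n \<Longrightarrow> (\<lambda>u. f u + c * g u) \<in> tens m n"
  by (auto simp: tens_def)

lemma tens_add: "f \<in> tens m n \<Longrightarrow> g \<in> tens m n \<Longrightarrow> f + g \<in> tens m n"
  and tens_smul: "g \<in> tens m n \<Longrightarrow> smul c g \<in> tens m n"
  by (auto simp: tens_def smul_def)

lemma tens_sum: "(\<And>i. i \<in> A \<Longrightarrow> g i \<in> tens m n) \<Longrightarrow> (\<lambda>u. \<Sum>i\<in>A. c i * g i u) \<in> tens m n"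
  by (auto simp: tens_def intro!: sum.neutral)

lemma word_act_tens:
  assumes "\<And>xs f. set xs \<subseteq> G \<Longrightarrow> f \<in> tens m n \<Longrightarrow> W xs f \<in> tens m n"
    and "p \<in> carrier (free_alg G)" "f \<in> tens m n"
  shows "word_act W p f \<in> tens m n"
  unfolding word_act_def
  by (rule tens_sum) (use assms in \<open>auto simp: free_alg_def\<close>)

lemma free_alg_simps:
  "carrier (free_alg G) = {p. \<forall>w \<in> Poly_Mapping.keys p. set (letters w) \<subseteq> G}"
  "mult (free_alg G) = (*)" "one (free_alg G) = 1" "zero (free_alg G) = 0" "add (free_alg G) = (+)"
  by (simp_all add: free_alg_def)

lemma free_alg_closed:
  fixes p q :: "'g free"
  shows "0 \<in> carrier (free_alg G)" "1 \<in> carrier (free_alg G)" "scal c \<in> carrier (free_alg G)"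
    "g \<in> G \<Longrightarrow> gen g \<in> carrier (free_alg G)"
    "p \<in> carrier (free_alg G) \<Longrightarrow> q \<in> carrier (free_alg G) \<Longrightarrow> p + q \<in> carrier (free_alg G)"
    "p \<in> carrier (free_alg G) \<Longrightarrow> q \<in> carrier (free_alg G) \<Longrightarrow> p * q \<in> carrier (free_alg G)"
    "p \<in> carrier (free_alg G) \<Longrightarrow> - p \<in> carrier (free_alg G)"
    "p \<in> carrier (free_alg G) \<Longrightarrow> q \<in> carrier (free_alg G) \<Longrightarrow> p - q \<in> carrier (free_alg G)"
    "p \<in> carrier (free_alg G) \<Longrightarrow> p ^ k \<in> carrier (free_alg G)"
proof -
  show one: "1 \<in> carrier (free_alg G)" and "0 \<in> carrier (free_alg G)" "scal c \<in> carrier (free_alg G)"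
    "g \<in> G \<Longrightarrow> gen g \<in> carrier (free_alg G)"
    by (auto simp: free_alg_simps one_free scal_def gen_def zero_fword_def split: if_splits)
  show add: "p + q \<in> carrier (free_alg G)" if "p \<in> carrier (free_alg G)" "q \<in> carrier (free_alg G)" for p q :: "'g free"
    using that keys_add[of p q] unfolding free_alg_simps by blast
  show mult: "p * q \<in> carrier (free_alg G)" if "p \<in> carrier (free_alg G)" "q \<in> carrier (free_alg G)" for p q :: "'g free"
    using that keys_mult[of p q] by (fastforce simp: free_alg_simps plus_fword_def)
  show minus: "- p \<in> carrier (free_alg G)" if "p \<in> carrier (free_alg G)" for p :: "'g free"
    using that by (auto simp: free_alg_simps)
  show "p - q \<in> carrier (free_alg G)" if "p \<in> carrier (free_alg G)" "q \<in> carrier (free_alg G)"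
    using add[OF that(1) minus[OF that(2)]] by simp
  show "p ^ k \<in> carrier (free_alg G)" if "p \<in> carrier (free_alg G)"
    by (induction k) (auto simp: one intro: mult that)
qed

lemma free_alg_ring: "ring (free_alg G)"
proof (rule ringI)
  show "abelian_group (free_alg G)"
  proof (rule abelian_groupI)
    show "\<exists>y\<in>carrier (free_alg G). y \<oplus>\<^bsub>free_alg G\<^esub> x = \<zero>\<^bsub>free_alg G\<^esub>" if "x \<in> carrier (free_alg G)" for x
      using free_alg_closed(7)[OF that] by (intro bexI[of _ "- x"]) (simp add: free_alg_simps)
  qed (simp_all add: free_alg_simps(2-5) free_alg_closed algebra_simps)
  show "Group.monoid (free_alg G)"
    by (rule monoidI) (simp_all add: free_alg_simps(2-5) free_alg_closed algebra_simps)
qed (simp_all add: free_alg_simps(2-5) algebra_simps)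

lemma End_tens_simps:
  "carrier (End_tens m n) = {T \<in> tens m n \<rightarrow>\<^sub>E tens m n.
        (\<forall>x \<in> tens m n. \<forall>y \<in> tens m n. T (x + y) = T x + T y) \<and> (\<forall>c. \<forall>x \<in> tens m n. T (smul c x) = smul c (T x))}"
  "mult (End_tens m n) = compose (tens m n)" "one (End_tens m n) = (\<lambda>x \<in> tens m n. x)"
  "add (End_tens m n) = (\<lambda>S T. \<lambda>x \<in> tens m n. S x + T x)"
  by (simp_all add: End_tens_def Let_def)

text \<open>
  The disjunction \<open>act_mult\<close> admits left as well as right modules: the annihilator of tensor space is a
  two-sided ideal in either case.  Only on \<open>tens m n\<close> do the relations have to hold.
\<close>

locale presented_module =
  fixes G :: "'g set" and R :: "'g free set" and act :: "'g free \<Rightarrow> nat list vec \<Rightarrow> nat list vec"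
    and m n :: nat
  assumes R_sub: "R \<subseteq> carrier (free_alg G)"
    and act_add: "act (p + q) f = (\<lambda>u. act p f u + act q f u)"
    and act_one: "act 1 f = f"
    and act_lin: "lin_op (act p)"
    and act_mult: "(\<forall>p q f. act (p * q) f = act p (act q f)) \<or> (\<forall>p q f. act (p * q) f = act q (act p f))"
    and act_tens: "p \<in> carrier (free_alg G) \<Longrightarrow> f \<in> tens m n \<Longrightarrow> act p f \<in> tens m n"
    and act_rel: "r \<in> R \<Longrightarrow> f \<in> tens m n \<Longrightarrow> act r f = (\<lambda>u. 0)"
begin

lemma act_zero: "act 0 f = (\<lambda>u. 0)"
proof -
  have "act 0 f u = act 0 f u + act 0 f u" for u
    using act_add[of 0 0 f] by (metis add_0)
  then show ?thesis by (metis add_cancel_right_left ext)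
qed

lemma act_uminus: "act (- p) f = (\<lambda>u. - act p f u)"
proof
  fix u
  have "act (- p) f u + act p f u = act 0 f u"
    using act_add[of "- p" p f] by (metis add.left_inverse)
  then show "act (- p) f u = - act p f u"
    by (simp add: act_zero eq_neg_iff_add_eq_0)
qed

lemma ideal_pres: "ideal (pres_ideal G R) (free_alg G)"
  unfolding pres_ideal_def by (rule ring.genideal_ideal[OF free_alg_ring R_sub])

lemma annihilator: "p \<in> pres_ideal G R \<Longrightarrow> f \<in> tens m n \<Longrightarrow> act p f = (\<lambda>u. 0)"
proof -
  let ?N = "{p \<in> carrier (free_alg G). \<forall>f \<in> tens m n. act p f = (\<lambda>u. 0)}"
  interpret F: ring "free_alg G" by (rule free_alg_ring)
  have inv: "inv\<^bsub>add_monoid (free_alg G)\<^esub> p = - p" if "p \<in> carrier (free_alg G)" for p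
  proof -
    have "\<ominus>\<^bsub>free_alg G\<^esub> p = - p"
      using F.minus_equality[of "- p" p] that
      by (simp add: free_alg_closed free_alg_simps(2-5))
    then show ?thesis by (simp only: a_inv_def)
  qed
  have inv': "inv\<^bsub>\<lparr>carrier = carrier (free_alg G), monoid.mult = (+), one = 0\<rparr>\<^esub> p = - p"
    if "p \<in> carrier (free_alg G)" for p
    using inv[OF that] by (simp add: free_alg_simps(2-5))
  have "ideal ?N (free_alg G)"
  proof (rule idealI[OF free_alg_ring])
    show "subgroup ?N (add_monoid (free_alg G))"
      by (rule group.subgroupI[OF F.a_group])
        (auto simp: inv' free_alg_simps(2-5) free_alg_closed act_zero act_add act_uminus intro!: exI[of _ 0])
    show "x \<otimes>\<^bsub>free_alg G\<^esub> a \<in> ?N" "a \<otimes>\<^bsub>free_alg G\<^esub> x \<in> ?N"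
      if "a \<in> ?N" "x \<in> carrier (free_alg G)" for a x
      using that act_mult act_tens lin_op_zero[OF act_lin]
      by (auto simp: free_alg_simps(2-5) free_alg_closed)
  qed
  moreover have "R \<subseteq> ?N" using R_sub act_rel by blast
  ultimately have "pres_ideal G R \<subseteq> ?N"
    unfolding pres_ideal_def by (rule F.genideal_minimal)
  then show "p \<in> pres_ideal G R \<Longrightarrow> f \<in> tens m n \<Longrightarrow> act p f = (\<lambda>u. 0)" by blast
qed

lemma class_act_class:
  assumes "p \<in> carrier (free_alg G)"
  shows "class_act m n act (pres_class G R p) = (\<lambda>f \<in> tens m n. act p f)"
proof -
  interpret I: ideal "pres_ideal G R" "free_alg G" by (rule ideal_pres)
  have "(\<lambda>q. act q f) ` pres_class G R p = {act p f}" if "f \<in> tens m n" for f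
  proof -
    have "q = i + p \<Longrightarrow> i \<in> pres_ideal G R \<Longrightarrow> act q f = act p f" for q i
      using annihilator[OF _ that] by (simp add: act_add)
    moreover have "p \<in> pres_class G R p"
      unfolding pres_class_def by (rule I.a_rcos_self) fact
    ultimately show ?thesis
      by (fastforce simp: pres_class_def a_r_coset_def' free_alg_simps(2-5))
  qed
  then show ?thesis by (auto simp: class_act_def fun_eq_iff)
qed

lemma pres_carrier: "carrier (pres_alg G R) = pres_class G R ` carrier (free_alg G)"
  by (auto simp: pres_alg_def FactRing_def A_RCOSETS_def' pres_class_def)

lemma pres_ops:
  assumes "p \<in> carrier (free_alg G)" "q \<in> carrier (free_alg G)"
  shows "mult (pres_alg G R) (pres_class G R p) (pres_class G R q) = pres_class G R (p * q)"
    "add (pres_alg G R) (pres_class G R p) (pres_class G R q) = pres_class G R (p + q)"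
    "one (pres_alg G R) = pres_class G R 1"
  using ideal.rcoset_mult_add[OF ideal_pres assms] ideal.a_rcos_sum[OF ideal_pres assms]
  by (simp_all add: pres_alg_def FactRing_def pres_class_def free_alg_simps(2-5))

lemma pres_minus:
  assumes "p \<in> carrier (free_alg G)"
  shows "a_inv (pres_alg G R) (pres_class G R p) = pres_class G R (- p)"
proof -
  interpret Q: ring "pres_alg G R"
    unfolding pres_alg_def by (rule ideal.quotient_is_ring[OF ideal_pres])
  have "pres_class G R 0 = zero (pres_alg G R)"
    using Q.zero_closed pres_ops(2)[OF free_alg_closed(1) free_alg_closed(1)] pres_carrier
      free_alg_closed(1) Q.add.l_cancel_one by (metis add_0 imageI)
  then show ?thesis
    using Q.minus_equality[of "pres_class G R (- p)" "pres_class G R p"] assms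
      pres_ops(2)[OF free_alg_closed(7)[OF assms] assms] free_alg_closed(7)[OF assms] pres_carrier
    by simp
qed

lemma class_act_End:
  assumes "p \<in> carrier (free_alg G)"
  shows "class_act m n act (pres_class G R p) \<in> carrier (End_tens m n)"
  unfolding class_act_class[OF assms] End_tens_simps
  using act_tens[OF assms] by (auto simp: tens_add tens_smul lin_op_add[OF act_lin] lin_op_smul[OF act_lin])

lemma class_act_hom_left:
  assumes "\<And>p q f. act (p * q) f = act p (act q f)"
  shows "class_act m n act \<in> ring_hom (pres_alg G R) (End_tens m n)"
proof (rule ring_hom_memI)
  fix x y assume "x \<in> carrier (pres_alg G R)" "y \<in> carrier (pres_alg G R)"
  then obtain p q where p: "p \<in> carrier (free_alg G)" "x = pres_class G R p"
    and q: "q \<in> carrier (free_alg G)" "y = pres_class G R q" by (auto simp: pres_carrier)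
  show "class_act m n act x \<in> carrier (End_tens m n)"
    by (simp add: p class_act_End)
  show "class_act m n act (x \<otimes>\<^bsub>pres_alg G R\<^esub> y) = class_act m n act x \<otimes>\<^bsub>End_tens m n\<^esub> class_act m n act y"
    unfolding p(2) q(2) pres_ops[OF p(1) q(1)]
    by (auto simp: class_act_class p q free_alg_closed End_tens_simps assms act_tens compose_def fun_eq_iff)
  show "class_act m n act (x \<oplus>\<^bsub>pres_alg G R\<^esub> y) = class_act m n act x \<oplus>\<^bsub>End_tens m n\<^esub> class_act m n act y"
    unfolding p(2) q(2) pres_ops[OF p(1) q(1)]
    by (auto simp: class_act_class p q free_alg_closed End_tens_simps act_add fun_eq_iff)
next
  show "class_act m n act \<one>\<^bsub>pres_alg G R\<^esub> = \<one>\<^bsub>End_tens m n\<^esub>"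
    unfolding pres_ops(3)[OF free_alg_closed(1) free_alg_closed(1)]
    by (auto simp: class_act_class free_alg_closed End_tens_simps act_one)
qed

lemma class_act_hom_right:
  assumes "\<And>p q f. act (p * q) f = act q (act p f)"
  shows "class_act m n act \<in> ring_hom (pres_alg G R) (opposite (End_tens m n))"
proof (rule ring_hom_memI)
  fix x y assume "x \<in> carrier (pres_alg G R)" "y \<in> carrier (pres_alg G R)"
  then obtain p q where p: "p \<in> carrier (free_alg G)" "x = pres_class G R p"
    and q: "q \<in> carrier (free_alg G)" "y = pres_class G R q" by (auto simp: pres_carrier)
  show "class_act m n act x \<in> carrier (opposite (End_tens m n))"
    by (simp add: p class_act_End opposite_def)
  show "class_act m n act (x \<otimes>\<^bsub>pres_alg G R\<^esub> y) = class_act m n act x \<otimes>\<^bsub>opposite (End_tens m n)\<^esub> class_act m n act y"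
    unfolding p(2) q(2) pres_ops[OF p(1) q(1)]
    by (auto simp: class_act_class p q free_alg_closed End_tens_simps assms act_tens compose_def fun_eq_iff opposite_def)
  show "class_act m n act (x \<oplus>\<^bsub>pres_alg G R\<^esub> y) = class_act m n act x \<oplus>\<^bsub>opposite (End_tens m n)\<^esub> class_act m n act y"
    unfolding p(2) q(2) pres_ops[OF p(1) q(1)]
    by (auto simp: class_act_class p q free_alg_closed End_tens_simps act_add fun_eq_iff opposite_def)
next
  show "class_act m n act \<one>\<^bsub>pres_alg G R\<^esub> = \<one>\<^bsub>opposite (End_tens m n)\<^esub>"
    unfolding pres_ops(3)[OF free_alg_closed(1) free_alg_closed(1)]
    by (auto simp: class_act_class free_alg_closed End_tens_simps act_one opposite_def)
qed

end

section \<open>The quantum group on tensor powers\<close>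

lemma qq_nz: "qq \<noteq> 0"
  by (simp add: qq_def Zero_fract_def eq_fract)

lemma qq_cancel: "qq * inverse qq = 1" "inverse qq * qq = 1" "qq * (inverse qq * x) = x" "inverse qq * (qq * x) = x"
  using qq_nz by simp_all

lemma qq_diff_nz: "qq - inverse qq \<noteq> 0"
  using qq_neq_inverse by simp

definition kw :: "nat \<Rightarrow> nat \<Rightarrow> qfield" where
  "kw i a = (if a = i then qq else if a = i + 1 then inverse qq else 1)"

definition Kw :: "nat \<Rightarrow> nat list \<Rightarrow> qfield" where "Kw i w = prod_list (map (kw i) w)"

lemma Kw_simps: "Kw i [] = 1" "Kw i (a # w) = kw i a * Kw i w"
  by (simp_all add: Kw_def)

lemma kw_nz: "kw i a \<noteq> 0"
  using qq_nz by (simp add: kw_def)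

lemma Kw_nz: "Kw i w \<noteq> 0"
  by (induction w) (simp_all add: Kw_simps kw_nz)

text \<open>
  The iterated coproduct of \<open>E\<^sub>i\<close> is the sum of the terms \<open>K\<^sub>i \<otimes> \<dots> \<otimes> K\<^sub>i \<otimes> E\<^sub>i \<otimes> 1 \<otimes> \<dots> \<otimes> 1\<close>, that of \<open>F\<^sub>i\<close> the
  sum of \<open>1 \<otimes> \<dots> \<otimes> 1 \<otimes> F\<^sub>i \<otimes> K\<^sub>i\<^sup>-\<^sup>1 \<otimes> \<dots> \<otimes> K\<^sub>i\<^sup>-\<^sup>1\<close>.  Splitting off the first tensor factor gives the recursions; the
  operators are defined on coordinates of arbitrary length, independently of \<open>m\<close> and \<open>n\<close>.
\<close>

fun opE :: "nat \<Rightarrow> nat list vec \<Rightarrow> nat list vec" where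
  "opE i f [] = 0"
| "opE i f (a # w) = (if a = i then f ((i + 1) # w) else 0) + kw i a * opE i (\<lambda>u. f (a # u)) w"

fun opF :: "nat \<Rightarrow> nat list vec \<Rightarrow> nat list vec" where
  "opF i f [] = 0"
| "opF i f (a # w) = (if a = i + 1 then inverse (Kw i w) * f (i # w) else 0) + opF i (\<lambda>u. f (a # u)) w"

definition opK :: "nat \<Rightarrow> nat list vec \<Rightarrow> nat list vec" where "opK i f w = Kw i w * f w"

definition opKi :: "nat \<Rightarrow> nat list vec \<Rightarrow> nat list vec" where "opKi i f w = inverse (Kw i w) * f w"

lemma opE_comb: "opE i (\<lambda>u. f u + c * g u) w = opE i f w + c * opE i g w"
  by (induction w arbitrary: f g) (simp_all add: algebra_simps)

lemma opF_comb: "opF i (\<lambda>u. f u + c * g u) w = opF i f w + c * opF i g w"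
  by (induction w arbitrary: f g) (simp_all add: algebra_simps)

lemma opE_zero: "opE i (\<lambda>u. 0) w = 0"
  and opF_zero: "opF i (\<lambda>u. 0) w = 0"
  by (induction w) auto

lemma opE_add: "opE i (\<lambda>u. f u + g u) w = opE i f w + opE i g w"
  and opF_add: "opF i (\<lambda>u. f u + g u) w = opF i f w + opF i g w"
  using opE_comb[of i f 1 g w] opF_comb[of i f 1 g w] by simp_all

lemma opE_scale: "opE i (\<lambda>u. c * g u) w = c * opE i g w"
  and opF_scale: "opF i (\<lambda>u. c * g u) w = c * opF i g w"
  using opE_comb[of i "\<lambda>_. 0" c g w] opF_comb[of i "\<lambda>_. 0" c g w] by (simp_all add: opE_zero opF_zero)

lemma opE_if: "opE i (\<lambda>u. if P then f u else 0) w = (if P then opE i f w else 0)"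
  and opF_if: "opF i (\<lambda>u. if P then f u else 0) w = (if P then opF i f w else 0)"
  by (simp_all add: opE_zero opF_zero)

lemmas opE_lin = opE_add opE_scale opE_if opE_zero
lemmas opF_lin = opF_add opF_scale opF_if opF_zero

text \<open>
  The scalar \<open>q\<close> to the power \<open>a\<^sub>i\<^sub>j\<close>.
\<close>

definition cq :: "nat \<Rightarrow> nat \<Rightarrow> qfield" where
  "cq i j = (if i = j then qq * qq else if i = Suc j \<or> j = Suc i then inverse qq else 1)"

lemma cq_powi: "qq powi cartan i j = cq i j" "qq powi (- cartan i j) = inverse (cq i j)"
  by (auto simp: cq_def cartan_def power_int_minus power2_eq_square)

lemma cq_sym: "cq i j = cq j i"
  by (auto simp: cq_def)

lemma kw_ratio: "kw i j * inverse (kw i (Suc j)) = cq i j"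
  using qq_nz by (auto simp: kw_def cq_def)

lemma opE_Ki: "opE j (\<lambda>u. inverse (Kw i u) * f u) w = cq i j * inverse (Kw i w) * opE j f w"
proof (induction w arbitrary: f)
  case (Cons a w)
  have "opE j (\<lambda>u. inverse (kw i a) * (inverse (Kw i u) * f (a # u))) w
      = inverse (kw i a) * (cq i j * inverse (Kw i w) * opE j (\<lambda>u. f (a # u)) w)"
    unfolding opE_scale Cons.IH ..
  moreover have "inverse (kw i (Suc j)) = cq i j * inverse (kw i j)"
    unfolding kw_ratio[symmetric] using kw_nz by simp
  ultimately show ?case
    by (simp add: Kw_simps mult.assoc) (simp add: algebra_simps)
qed simp

lemma opF_Ki: "opF j (\<lambda>u. inverse (Kw i u) * f u) w = inverse (cq i j) * inverse (Kw i w) * opF j f w"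
proof (induction w arbitrary: f)
  case (Cons a w)
  have "opF j (\<lambda>u. inverse (kw i a) * (inverse (Kw i u) * f (a # u))) w
      = inverse (kw i a) * (inverse (cq i j) * inverse (Kw i w) * opF j (\<lambda>u. f (a # u)) w)"
    unfolding opF_scale Cons.IH ..
  moreover have "inverse (kw i j) = inverse (cq i j) * inverse (kw i (Suc j))"
    unfolding kw_ratio[symmetric] using kw_nz by simp
  ultimately show ?case
    by (simp add: Kw_simps mult.assoc) (simp add: algebra_simps)
qed simp

lemma opE_opF: "opE i (opF j f) w - opF j (opE i f) w
    = (if i = j then inverse (qq - inverse qq) * (Kw i w - inverse (Kw i w)) * f w else 0)"
proof (induction w arbitrary: f)
  case (Cons a w)
  let ?g = "\<lambda>u. f (a # u)"
  have ih: "opE i (opF j ?g) w = opF j (opE i ?g) w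
      + (if i = j then inverse (qq - inverse qq) * (Kw i w - inverse (Kw i w)) * f (a # w) else 0)"
    using Cons.IH[of ?g] by (simp add: algebra_simps)
  have sl: "opE i (opF j f) (a # w) = (if a = i then opF j f ((i + 1) # w) else 0)
      + kw i a * ((if a = j + 1 then cq j i * inverse (Kw j w) * opE i (\<lambda>u. f (j # u)) w else 0) + opE i (opF j ?g) w)"
    by (simp add: opE_lin opE_Ki)
  have sr: "opF j (opE i f) (a # w) = (if a = j + 1 then inverse (Kw j w) * opE i f (j # w) else 0)
      + ((if a = i then opF j (\<lambda>u. f ((i + 1) # u)) w else 0) + kw i a * opF j (opE i ?g) w)"
    by (simp add: opF_lin)
  have k: "kw i (Suc j) * cq j i = kw i j"
    using kw_ratio[of i j] kw_nz[of i "Suc j"] by (simp add: cq_sym field_simps)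
  show ?case
  proof (cases "i = j")
    case False
    have t: "kw i a * (if a = j + 1 then cq j i * inverse (Kw j w) * x else 0)
        = (if a = j + 1 then inverse (Kw j w) * (kw i j * x) else 0)" for x
      unfolding k[symmetric] by simp
    have ji: "opE i f (j # w) = kw i j * opE i (\<lambda>u. f (j # u)) w"
      using False by simp
    show ?thesis
      unfolding sl sr ih distrib_left[of "kw i a"] t ji using False by simp
  next
    case True
    note k' = k[unfolded True]
    have K2: "kw j (Suc j) = inverse qq" "kw j j = qq" by (simp_all add: kw_def)
    have d: "inverse (qq - inverse qq) * (qq - inverse qq) = 1"
      using qq_diff_nz by simp
    have x1: "(qq * x - inverse qq * y) * inverse (qq - inverse qq)
        = qq * (x - y) * inverse (qq - inverse qq) + y" for x y
    proof -
      have "qq * x - inverse qq * y = qq * (x - y) + (qq - inverse qq) * y"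
        by (simp add: algebra_simps)
      moreover have "(qq - inverse qq) * y * inverse (qq - inverse qq) = y"
        using d by (metis mult.assoc mult.commute mult_1)
      ultimately show ?thesis by (simp only: distrib_right)
    qed
    have x2: "(inverse qq * x - qq * y) * inverse (qq - inverse qq)
        = inverse qq * (x - y) * inverse (qq - inverse qq) - y" for x y
    proof -
      have "inverse qq * x - qq * y = inverse qq * (x - y) - (qq - inverse qq) * y"
        by (simp add: algebra_simps)
      moreover have "(qq - inverse qq) * y * inverse (qq - inverse qq) = y"
        using d by (metis mult.assoc mult.commute mult_1)
      ultimately show ?thesis by (simp only: left_diff_distrib)
    qed
    consider "a = j" | "a = Suc j" | "a \<noteq> j" "a \<noteq> Suc j" by blast
    then show ?thesis
    proof cases
      case 1
      have "inverse (qq - inverse qq) * (Kw j (j # w) - inverse (Kw j (j # w))) * f (j # w)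
          = (qq * (Kw j w - inverse (Kw j w)) * inverse (qq - inverse qq) + inverse (Kw j w)) * f (j # w)"
        using x1[of "Kw j w" "inverse (Kw j w)"] by (simp add: Kw_simps K2 mult.commute)
      then show ?thesis
        unfolding sl sr ih using 1 True by (simp add: K2 algebra_simps)
    next
      case 2
      have e: "inverse (qq - inverse qq) * (Kw j (Suc j # w) - inverse (Kw j (Suc j # w))) * f (Suc j # w)
          = (inverse qq * (Kw j w - inverse (Kw j w)) * inverse (qq - inverse qq) - inverse (Kw j w)) * f (Suc j # w)"
        using x2[of "Kw j w" "inverse (Kw j w)"] by (simp add: Kw_simps K2 mult.commute)
      have cjj: "cq j j = qq * qq"
        by (simp add: cq_def)
      show ?thesis
        unfolding sl sr ih unfolding 2 True e by (simp add: K2 cjj algebra_simps qq_cancel)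
    next
      case 3
      then have "kw j a = 1" by (simp add: kw_def)
      then show ?thesis
        unfolding sl sr ih using 3 True by (simp add: Kw_simps algebra_simps)
    qed
  qed
qed (simp add: Kw_simps)

lemma opE_far:
  assumes "i \<noteq> j" "i \<noteq> Suc j" "j \<noteq> Suc i"
  shows "opE i (opE j f) w = opE j (opE i f) w"
proof (induction w arbitrary: f)
  case (Cons a w)
  have "kw i (Suc j) = 1" "kw i j = 1" "kw j (Suc i) = 1" "kw j i = 1"
    using assms by (auto simp: kw_def)
  then show ?case
    using assms Cons.IH[of "\<lambda>u. f (a # u)"] by (auto simp: opE_lin algebra_simps)
qed simp

lemma opF_far:
  assumes "i \<noteq> j" "i \<noteq> Suc j" "j \<noteq> Suc i"
  shows "opF i (opF j f) w = opF j (opF i f) w"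
proof (induction w arbitrary: f)
  case (Cons a w)
  have "kw i (Suc j) = 1" "kw i j = 1" "kw j (Suc i) = 1" "kw j i = 1" "cq i j = 1" "cq j i = 1"
    using assms by (auto simp: kw_def cq_def)
  then show ?case
    using assms Cons.IH[of "\<lambda>u. f (a # u)"] by (auto simp: opF_lin opF_Ki Kw_simps algebra_simps)
qed simp

lemma opE_serre:
  assumes "i = Suc j \<or> j = Suc i"
  shows "opE j (opE i (opE i f)) w + opE i (opE i (opE j f)) w = (qq + inverse qq) * opE i (opE j (opE i f)) w"
proof (induction w arbitrary: f)
  case (Cons a w)
  have ih: "opE j (opE i (opE i (\<lambda>u. f (a # u)))) w
     = (qq + inverse qq) * opE i (opE j (opE i (\<lambda>u. f (a # u)))) w - opE i (opE i (opE j (\<lambda>u. f (a # u)))) w"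
    using Cons.IH[of "\<lambda>u. f (a # u)"] by (simp add: algebra_simps)
  from assms show ?case
  proof
    assume ij: "i = Suc j"
    consider "a = j" | "a = Suc j" | "a = Suc (Suc j)" | "a \<noteq> j" "a \<noteq> Suc j" "a \<noteq> Suc (Suc j)" by blast
    then show ?thesis
      by cases (use ih qq_nz in \<open>simp add: ij opE_lin kw_def; simp add: field_simps\<close>)+
  next
    assume ij: "j = Suc i"
    consider "a = i" | "a = Suc i" | "a = Suc (Suc i)" | "a \<noteq> i" "a \<noteq> Suc i" "a \<noteq> Suc (Suc i)" by blast
    then show ?thesis
      by cases (use ih qq_nz in \<open>simp add: ij opE_lin kw_def; simp add: field_simps\<close>)+
  qed
qed simp

lemma opF_serre:
  assumes "i = Suc j \<or> j = Suc i"
  shows "opF j (opF i (opF i f)) w + opF i (opF i (opF j f)) w = (qq + inverse qq) * opF i (opF j (opF i f)) w"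
proof (induction w arbitrary: f)
  case (Cons a w)
  have ih: "opF j (opF i (opF i (\<lambda>u. f (a # u)))) w
     = (qq + inverse qq) * opF i (opF j (opF i (\<lambda>u. f (a # u)))) w - opF i (opF i (opF j (\<lambda>u. f (a # u)))) w"
    using Cons.IH[of "\<lambda>u. f (a # u)"] by (simp add: algebra_simps)
  from assms show ?case
  proof
    assume ij: "i = Suc j"
    consider "a = j" | "a = Suc j" | "a = Suc (Suc j)" | "a \<noteq> j" "a \<noteq> Suc j" "a \<noteq> Suc (Suc j)" by blast
    then show ?thesis
      by cases (use ih in \<open>simp add: ij opF_lin opF_Ki Kw_simps kw_def cq_def; simp add: algebra_simps qq_cancel\<close>)+
  next
    assume ij: "j = Suc i"
    consider "a = i" | "a = Suc i" | "a = Suc (Suc i)" | "a \<noteq> i" "a \<noteq> Suc i" "a \<noteq> Suc (Suc i)" by blast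
    then show ?thesis
      by cases (use ih in \<open>simp add: ij opF_lin opF_Ki Kw_simps kw_def cq_def; simp add: algebra_simps qq_cancel\<close>)+
  qed
qed simp

section \<open>The module over the quantum group\<close>

lemma natural_apply: "natural m g f b = (\<Sum>a=1..2*m. f a * nat_basis g a b)"
  by (simp add: natural_def lin_ext_def sum_fun smul_def)

lemma natural_lin: "lin_op (natural m g)"
  by (simp add: lin_op_def natural_apply sum.distrib sum_distrib_left algebra_simps fun_eq_iff)

lemma natural_gens:
  "natural m (UE i) f b = (if b = i \<and> i + 1 \<le> 2*m then f (i + 1) else 0)"
  "natural m (UF i) f b = (if b = i + 1 \<and> 1 \<le> i \<and> i \<le> 2*m then f i else 0)"
  "natural m (UK i) f b = (if b \<in> {1..2*m} then kw i b * f b else 0)"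
  "natural m (UKinv i) f b = (if b \<in> {1..2*m} then inverse (kw i b) * f b else 0)"
proof -
  have *: "(\<Sum>a=1..2*m. if a = c then g a else 0) = (if c \<in> {1..2*m} then g c else 0)" for c and g :: "nat \<Rightarrow> qfield"
    by (simp add: sum.delta)
  have "f a * nat_basis (UE i) a b = (if a = i + 1 then if b = i then f a else 0 else 0)"
    "f a * nat_basis (UF i) a b = (if a = i then if b = i + 1 then f a else 0 else 0)"
    "f a * nat_basis (UK i) a b = (if a = b then kw i a * f a else 0)"
    "f a * nat_basis (UKinv i) a b = (if a = b then inverse (kw i a) * f a else 0)" for a
    by (auto simp: basis_vec_def smul_def kw_def)
  then show
    "natural m (UE i) f b = (if b = i \<and> i + 1 \<le> 2*m then f (i + 1) else 0)"
    "natural m (UF i) f b = (if b = i + 1 \<and> 1 \<le> i \<and> i \<le> 2*m then f i else 0)"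
    "natural m (UK i) f b = (if b \<in> {1..2*m} then kw i b * f b else 0)"
    "natural m (UKinv i) f b = (if b \<in> {1..2*m} then inverse (kw i b) * f b else 0)"
    unfolding natural_apply by (simp_all only: *) auto
qed

lemma tens_op_lin: "lin_op A \<Longrightarrow> lin_op B \<Longrightarrow> lin_op (tens_op A B)"
  unfolding lin_op_def
proof (intro allI ext)
  fix f g c u assume A: "\<forall>f g c. A (\<lambda>u. f u + c * g u) = (\<lambda>u. A f u + c * A g u)"
    and B: "\<forall>f g c. B (\<lambda>u. f u + c * g u) = (\<lambda>u. B f u + c * B g u)"
  show "tens_op A B (\<lambda>u. f u + c * g u) u = tens_op A B f u + c * tens_op A B g u"
    by (cases u) (simp_all add: A B)
qed

lemma lin_op_plus: "lin_op S \<Longrightarrow> lin_op T \<Longrightarrow> lin_op (\<lambda>f u. S f u + T f u)"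
  by (simp add: lin_op_def algebra_simps fun_eq_iff)

lemma tens_rep_lin: "lin_op (tens_rep m n g)"
proof (induction n arbitrary: g)
  case 0
  then show ?case by (simp add: lin_op_def smul_def algebra_simps fun_eq_iff)
next
  case (Suc n)
  have f: "lin_op (foldr (natural m) xs)" "lin_op (foldr (tens_rep m n) xs)" for xs
    by (intro lin_op_foldr natural_lin Suc.IH)+
  show ?case
    using tens_op_lin[OF f(1) f(2)] f(1)[of "[]"] f(2)[of "[]"] Suc.IH natural_lin
    by (cases g) (auto simp: comp_def id_def intro!: lin_op_plus tens_op_lin)
qed

lemma tens_slice: "f \<in> tens m (Suc n) \<Longrightarrow> (\<lambda>u. f (a # u)) \<in> tens m n"
  by (auto simp: tens_def indices_def)

lemma tens_slice_out: "f \<in> tens m (Suc n) \<Longrightarrow> a \<notin> {1..2*m} \<Longrightarrow> f (a # u) = 0"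
  by (auto simp: tens_def indices_def)

lemma tens_0_Cons: "f \<in> tens m 0 \<Longrightarrow> f (a # u) = 0"
  and tens_Suc_Nil: "f \<in> tens m (Suc n) \<Longrightarrow> f [] = 0"
  by (auto simp: tens_def indices_def)

text \<open>
  The truncation to letters at most \<open>2m\<close> in the natural representation is invisible on \<open>tens m n\<close>.
\<close>

lemma tens_rep_gens:
  assumes "1 \<le> i" "i \<le> 2*m - 1" "f \<in> tens m n"
  shows "tens_rep m n (UE i) f = opE i f" "tens_rep m n (UF i) f = opF i f"
    "tens_rep m n (UK i) f = opK i f" "tens_rep m n (UKinv i) f = opKi i f"
proof -
  have "tens_rep m n (UE i) f w = opE i f w \<and> tens_rep m n (UF i) f w = opF i f w
    \<and> tens_rep m n (UK i) f w = opK i f w \<and> tens_rep m n (UKinv i) f w = opKi i f w" for w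
    using assms(3)
  proof (induction n arbitrary: f w)
    case 0
    then have "(\<lambda>u. f (a # u)) = (\<lambda>u. 0)" for a by (simp add: tens_0_Cons fun_eq_iff)
    then show ?case
      using 0 by (cases w) (simp_all add: smul_def opE_zero opF_zero opK_def opKi_def Kw_simps tens_0_Cons)
  next
    case (Suc n)
    note ih = Suc.IH[OF tens_slice[OF Suc.prems]]
    show ?case
    proof (cases w)
      case Nil
      then show ?thesis using tens_Suc_Nil[OF Suc.prems] by (simp add: opK_def opKi_def)
    next
      case (Cons a w')
      have out: "opE i (\<lambda>u. f (a # u)) w' = 0" "f (a # w') = 0" if "a \<notin> {1..2*m}"
        using tens_slice_out[OF Suc.prems that] by (simp_all add: opE_zero)
      show ?thesis
        unfolding Cons using assms(1,2) ih out
        by (cases "a \<in> {1..2*m}") (auto simp: natural_gens opK_def opKi_def Kw_simps)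
    qed
  qed
  then show "tens_rep m n (UE i) f = opE i f" "tens_rep m n (UF i) f = opF i f"
    "tens_rep m n (UK i) f = opK i f" "tens_rep m n (UKinv i) f = opKi i f" by auto
qed

lemma opE_tens:
  assumes "1 \<le> i" "i \<le> 2*m - 1" "f \<in> tens m n"
  shows "opE i f \<in> tens m n"
proof -
  have "opE i f w = 0" if "w \<notin> indices m n" for w
    using that assms(3)
  proof (induction w arbitrary: f n)
    case (Cons a w)
    show ?case
    proof (cases n)
      case 0
      then have "(\<lambda>u. f (a # u)) = (\<lambda>u. 0)" for a using Cons.prems by (simp add: tens_0_Cons fun_eq_iff)
      then show ?thesis using 0 Cons.prems by (simp add: opE_zero tens_0_Cons)
    next
      case (Suc k)
      have "f (Suc i # w) = 0" if "a = i"
        using Cons.prems assms(1,2) that Suc by (auto simp: tens_def indices_def)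
      moreover have "opE i (\<lambda>u. f (a # u)) w = 0"
      proof (cases "w \<in> indices m k")
        case True
        then have "a \<notin> {1..2*m}" using Cons.prems Suc by (auto simp: indices_def)
        then have "(\<lambda>u. f (a # u)) = (\<lambda>u. 0)"
          using tens_slice_out[of f m k a] Cons.prems(2) Suc by blast
        then show ?thesis by (simp add: opE_zero)
      next
        case False
        then show ?thesis using Cons.IH[OF False tens_slice] Cons.prems Suc by simp
      qed
      ultimately show ?thesis by simp
    qed
  qed simp
  then show ?thesis by (simp add: tens_def)
qed

lemma opF_tens:
  assumes "1 \<le> i" "i \<le> 2*m - 1" "f \<in> tens m n"
  shows "opF i f \<in> tens m n"
proof -
  have "opF i f w = 0" if "w \<notin> indices m n" for w
    using that assms(3)
  proof (induction w arbitrary: f n)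
    case (Cons a w)
    show ?case
    proof (cases n)
      case 0
      then have "(\<lambda>u. f (a # u)) = (\<lambda>u. 0)" for a using Cons.prems by (simp add: tens_0_Cons fun_eq_iff)
      then show ?thesis using 0 Cons.prems by (simp add: opF_zero tens_0_Cons)
    next
      case (Suc k)
      have "f (i # w) = 0" if "a = i + 1"
        using Cons.prems assms(1,2) that Suc by (auto simp: tens_def indices_def)
      moreover have "opF i (\<lambda>u. f (a # u)) w = 0"
      proof (cases "w \<in> indices m k")
        case True
        then have "a \<notin> {1..2*m}" using Cons.prems Suc by (auto simp: indices_def)
        then have "(\<lambda>u. f (a # u)) = (\<lambda>u. 0)"
          using tens_slice_out[of f m k a] Cons.prems(2) Suc by blast
        then show ?thesis by (simp add: opF_zero)
      next
        case False
        then show ?thesis using Cons.IH[OF False tens_slice] Cons.prems Suc by simp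
      qed
      ultimately show ?thesis by simp
    qed
  qed simp
  then show ?thesis by (simp add: tens_def)
qed

lemma opK_tens: "f \<in> tens m n \<Longrightarrow> opK i f \<in> tens m n" "f \<in> tens m n \<Longrightarrow> opKi i f \<in> tens m n"
  by (simp_all add: tens_def opK_def opKi_def)

lemma tens_scale: "f \<in> tens m n \<Longrightarrow> (\<lambda>u. c * f u) \<in> tens m n"
  by (simp add: tens_def)

lemma tens_rep_tens:
  assumes "g \<in> ugens m" "f \<in> tens m n"
  shows "tens_rep m n g f \<in> tens m n"
  using assms by (auto simp: ugens_def tens_rep_gens opE_tens opF_tens opK_tens)

definition uact :: "nat \<Rightarrow> nat \<Rightarrow> ugen free \<Rightarrow> nat list vec \<Rightarrow> nat list vec" where
  "uact m n = free_lact (tens_rep m n)"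

lemma uact_mult: "uact m n (p * q) f = uact m n p (uact m n q f)"
  unfolding uact_def free_lact_word
  by (rule word_act_mult_left) (simp_all add: lin_op_foldr tens_rep_lin)

lemma uact_basic:
  "uact m n (p + q) f = (\<lambda>u. uact m n p f u + uact m n q f u)"
  "uact m n (p - q) f = (\<lambda>u. uact m n p f u - uact m n q f u)"
  "uact m n (- p) f = (\<lambda>u. - uact m n p f u)"
  "uact m n 1 f = f" "uact m n 0 f = (\<lambda>u. 0)" "uact m n (scal c) f = (\<lambda>u. c * f u)"
  "uact m n (gen g) f = tens_rep m n g f"
  unfolding uact_def free_lact_word
  by (simp_all add: word_act_add word_act_diff word_act_uminus word_act_one word_act_zero word_act_scal word_act_gen)

lemma uact_lin: "lin_op (uact m n p)"
  unfolding uact_def free_lact_word by (intro word_act_lin lin_op_foldr tens_rep_lin)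

lemma uact_tens: "p \<in> carrier (free_alg (ugens m)) \<Longrightarrow> f \<in> tens m n \<Longrightarrow> uact m n p f \<in> tens m n"
  unfolding uact_def free_lact_word
proof (rule word_act_tens)
  show "foldr (tens_rep m n) xs f \<in> tens m n" if "set xs \<subseteq> ugens m" "f \<in> tens m n" for xs f
    using that by (induction xs) (auto simp: tens_rep_tens)
qed

lemma qfact_2: "qfact 2 = qq + inverse qq"
proof -
  have "(qq ^ 2 - inverse qq ^ 2) = (qq + inverse qq) * (qq - inverse qq)"
    by (simp add: power2_eq_square algebra_simps)
  then have "qint 2 = qq + inverse qq"
    using qq_diff_nz by (simp add: qint_def power_int_minus power_inverse)
  moreover have "qint 1 = 1"
    using qq_diff_nz by (simp add: qint_def power_int_minus)
  moreover have "{1..2::nat} = {1, 2}" by auto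
  ultimately show ?thesis by (simp add: qfact_def)
qed

lemma serre_adjacent:
  assumes "i = Suc j \<or> j = Suc i"
  shows "serre X i j = gen (X j) * (scal (inverse (qq + inverse qq)) * (gen (X i) * gen (X i)))
     - gen (X i) * gen (X j) * gen (X i)
     + scal (inverse (qq + inverse qq)) * (gen (X i) * gen (X i)) * gen (X j)"
proof -
  have c: "cartan i j = - 1" using assms by (auto simp: cartan_def)
  have d: "divpow g 2 = scal (inverse (qq + inverse qq)) * (gen g * gen g)" for g
    by (simp add: divpow_def qfact_2 power2_eq_square)
  have "{0..2::nat} = {0, 1, 2}" by auto
  then show ?thesis
    by (simp add: serre_def c divpow_0 divpow_1 d)
qed

lemma serre_far:
  assumes "i \<noteq> j" "i \<noteq> Suc j" "j \<noteq> Suc i"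
  shows "serre X i j = gen (X j) * gen (X i) - gen (X i) * gen (X j)"
  using assms by (simp add: serre_def cartan_def divpow_0 divpow_1)

lemma serre_zero:
  fixes x y z c :: qfield
  assumes "x + y = c * z" "z \<noteq> 0 \<longrightarrow> c \<noteq> 0"
  shows "inverse c * x - z + inverse c * y = 0"
proof (cases "z = 0")
  case True
  then have "x = - y" using assms by (simp add: eq_neg_iff_add_eq_0)
  then show ?thesis using True by simp
next
  case False
  have "inverse c * x + inverse c * y = z"
    unfolding distrib_left[symmetric] assms(1) using False assms(2) by simp
  then show ?thesis by (simp add: algebra_simps)
qed

lemma q_sum_nz: "qq + inverse qq \<noteq> 0"
proof
  assume "qq + inverse qq = 0"
  then have "spec 0 (1 + inverse 1)"
    using spec_add[OF spec_qq spec_inverse[OF spec_qq]] by simp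
  then show False using spec_unique[OF spec_0] by fastforce
qed

lemma Uq_module: "presented_module (ugens m) (urels m) (uact m n) m n"
proof
  note gens = free_alg_closed(1-8)
  have "serre X i j \<in> carrier (free_alg (ugens m))"
    if "i \<noteq> j" "X i \<in> ugens m" "X j \<in> ugens m" for X i j
  proof (cases "i = Suc j \<or> j = Suc i")
    case True
    then show ?thesis unfolding serre_adjacent[OF True] using that by (intro gens)
  next
    case False
    then show ?thesis using that serre_far[of i j X] by (auto intro!: gens)
  qed
  then show "urels m \<subseteq> carrier (free_alg (ugens m))"
    unfolding urels_def Let_def
    by (auto intro!: gens simp: ugens_def split: if_splits)
  show "uact m n r f = (\<lambda>u. 0)" if r: "r \<in> urels m" and f: "f \<in> tens m n" for r f
  proof -
    have KK: "Kw i w * (inverse (Kw i w) * x) = x" "inverse (Kw i w) * (Kw i w * x) = x" for i w x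
      using Kw_nz[of i w] by simp_all
    have fold: "(\<lambda>w. inverse (Kw i w) * h w) = opKi i h" "(\<lambda>w. Kw i w * h w) = opK i h" for i h
      by (simp_all add: opKi_def[abs_def] opK_def[abs_def])
    note simps = uact_basic uact_mult tens_rep_gens opE_tens opF_tens opK_tens tens_scale f
    show ?thesis
      using r unfolding urels_def Let_def
    proof (elim UnE CollectE exE conjE, goal_cases)
      case (1 i) then show ?case by (simp add: simps) (simp add: opK_def opKi_def KK)
    next
      case (2 i) then show ?case by (simp add: simps) (simp add: opK_def opKi_def KK)
    next
      case (3 i j) then show ?case by (simp add: simps) (simp add: opK_def mult.left_commute)
    next
      case (4 i j)
      then show ?case
        by (simp add: simps) (simp add: opK_def opKi_def[abs_def] opE_Ki cq_powi mult.assoc mult.left_commute[of "cq i j"] KK)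
    next
      case (5 i j)
      then show ?case
        by (simp add: simps) (simp add: opK_def opKi_def[abs_def] opF_Ki cq_powi mult.assoc mult.left_commute[of "inverse (cq i j)"] KK)
    next
      case (6 i j)
      then show ?case
        using opE_opF[of i j f]
        by (cases "i = j") (simp_all add: simps, simp_all add: opK_def opKi_def algebra_simps)
    next
      case (7 i j)
      show ?case
      proof (cases "i = Suc j \<or> j = Suc i")
        case True
        show ?thesis
          unfolding 7(1) serre_adjacent[OF True] using 7
          by (simp add: simps) (simp add: opE_scale serre_zero opE_serre[OF True] q_sum_nz)
      next
        case False
        then show ?thesis
          unfolding 7(1) using 7 serre_far[of i j UE] opE_far[of i j f] by (simp add: simps)
      qed
    next
      case (8 i j)
      show ?case
      proof (cases "i = Suc j \<or> j = Suc i")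
        case True
        show ?thesis
          unfolding 8(1) serre_adjacent[OF True] using 8
          by (simp add: simps) (simp add: opF_scale serre_zero opF_serre[OF True] q_sum_nz)
      next
        case False
        then show ?thesis
          unfolding 8(1) using 8 serre_far[of i j UF] opF_far[of i j f] by (simp add: simps)
      qed
    qed
  qed
qed (use uact_mult uact_tens uact_lin in \<open>auto simp: uact_basic\<close>)

section \<open>The Hecke generators on tensor powers\<close>

abbreviation dq :: qfield where "dq \<equiv> qq - inverse qq"

text \<open>
  The action of a Hecke generator on two adjacent letters, transposed to coordinates.
\<close>

definition hh :: "(nat \<Rightarrow> nat \<Rightarrow> qfield) \<Rightarrow> nat \<Rightarrow> nat \<Rightarrow> qfield" where
  "hh f a b = (if a = b then qq * f a b else f b a + (if a < b then dq * f a b else 0))"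

lemma hh_comb: "hh (\<lambda>a b. f a b + c * g a b) x y = hh f x y + c * hh g x y"
  by (simp add: hh_def algebra_simps)

lemma hh_quadratic: "hh (hh f) a b = dq * hh f a b + f a b"
  by (simp add: hh_def algebra_simps qq_cancel)

lemma hh_braid:
  "hh (\<lambda>a b. hh (\<lambda>b c. hh (\<lambda>a b. f a b c) a b) b c) a b
   = hh (\<lambda>b c. hh (\<lambda>a b. hh (\<lambda>b c. f a b c) b c) a b) b c"
  by (cases rule: linorder_cases[of a b]; cases rule: linorder_cases[of b c]; cases rule: linorder_cases[of a c])
     (simp_all add: hh_def algebra_simps qq_cancel)

text \<open>
  Positions are counted from \<open>0\<close>: this is the action of \<open>H\<^sub>k\<^sub>+\<^sub>1\<close>.
\<close>

fun opH :: "nat \<Rightarrow> nat list vec \<Rightarrow> nat list vec" where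
  "opH 0 f (a # b # w) = hh (\<lambda>a b. f (a # b # w)) a b"
| "opH 0 f _ = 0"
| "opH (Suc k) f [] = 0"
| "opH (Suc k) f (a # w) = opH k (\<lambda>u. f (a # u)) w"

lemma opH_comb: "opH k (\<lambda>u. f u + c * g u) w = opH k f w + c * opH k g w"
  by (induction k f w arbitrary: g rule: opH.induct) (simp_all add: hh_comb)

lemma opH_zero: "opH k (\<lambda>u. 0) w = 0"
  using opH_comb[of k "\<lambda>_. 0" "- 1" "\<lambda>_. 0" w] by simp

lemma opH_add: "opH k (\<lambda>u. f u + g u) w = opH k f w + opH k g w"
  and opH_scale: "opH k (\<lambda>u. c * g u) w = c * opH k g w"
  using opH_comb[of k f 1 g w] opH_comb[of k "\<lambda>_. 0" c g w] by (simp_all add: opH_zero)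

lemma opH_sum: "opH k (\<lambda>u. \<Sum>i\<in>A. c i * g i u) w = (\<Sum>i\<in>A. c i * opH k (g i) w)"
proof (induction A rule: infinite_finite_induct)
  case (insert x F)
  then show ?case using opH_comb[of k "\<lambda>u. \<Sum>i\<in>F. c i * g i u" "c x" "g x" w] by (simp add: add.commute)
qed (simp_all add: opH_zero)

lemma length3E:
  assumes "3 \<le> length w"
  obtains a b c v where "w = a # b # c # v"
proof (cases w)
  case (Cons a w1)
  note w1 = Cons
  show ?thesis
  proof (cases w1)
    case (Cons b w2)
    then show ?thesis using that w1 assms by (cases w2) auto
  qed (use w1 assms in simp)
qed (use assms in simp)

lemma length4E:
  assumes "4 \<le> length w"
  obtains a b c d v where "w = a # b # c # d # v"
proof -
  obtain a b c v where w: "w = a # b # c # v"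
    by (rule length3E[of w]) (use assms in auto)
  then show ?thesis using that assms by (cases v) auto
qed

lemma opH_quadratic: "Suc k < length w \<Longrightarrow> opH k (opH k f) w = dq * opH k f w + f w"
proof (induction k arbitrary: f w)
  case 0
  then obtain a b u where "w = a # b # u" by (cases w rule: opH.cases[of "(0, undefined, w)" for w]) auto
  then show ?case by (simp add: hh_quadratic)
next
  case (Suc k)
  then show ?case by (cases w) auto
qed

lemma opH_braid: "opH k (opH (Suc k) (opH k f)) w = opH (Suc k) (opH k (opH (Suc k) f)) w"
proof (induction k arbitrary: f w)
  case 0
  consider "w = []" | a where "w = [a]" | a b where "w = [a, b]" | a b c u where "w = a # b # c # u"
    by (metis list.exhaust)
  then show ?case
  proof cases
    case 4
    show ?thesis unfolding 4 using hh_braid[where f = "\<lambda>a b c. f (a # b # c # u)" and a = a and b = b and c = c] by simp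
  qed (simp_all add: hh_def)
next
  case (Suc k)
  then show ?case by (cases w) auto
qed

lemma opH_far: "opH i (opH (i + Suc (Suc j)) f) w = opH (i + Suc (Suc j)) (opH i f) w"
proof (induction i arbitrary: f w)
  case 0
  consider "w = []" | a where "w = [a]" | a b u where "w = a # b # u"
    by (metis list.exhaust)
  then show ?case
  proof cases
    case 3
    have "opH j (\<lambda>u. hh (\<lambda>a b. f (a # b # u)) a b) u = hh (\<lambda>a b. opH j (\<lambda>u. f (a # b # u)) u) a b"
      by (simp add: hh_def opH_add opH_scale opH_zero)
    then show ?thesis unfolding 3 by simp
  qed simp_all
next
  case (Suc k)
  then show ?case by (cases w) auto
qed

lemma opH_nth:
  "Suc k < length w \<Longrightarrow> opH k f w = (if w ! k = w ! Suc k then qq * f w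
     else f (swap (Suc k) w) + (if w ! k < w ! Suc k then dq * f w else 0))"
proof (induction k arbitrary: f w)
  case 0
  then obtain a b v where "w = a # b # v" by (cases w rule: opH.cases[of "(0, undefined, w)" for w]) auto
  then show ?case by (auto simp: hh_def swap_def)
next
  case (Suc k)
  then obtain a v where w: "w = a # v" by (cases w) auto
  have "swap (Suc (Suc k)) (a # v) = a # swap (Suc k) v"
    by (simp add: swap_def)
  then show ?case using Suc by (simp add: w)
qed

lemma swap_indices: "Suc k < n \<Longrightarrow> w \<in> indices m n \<Longrightarrow> swap (Suc k) w \<in> indices m n"
proof -
  assume k: "Suc k < n" and w: "w \<in> indices m n"
  have "set (w[k := w ! Suc k, Suc k := w ! k]) = set w"
    using k w by (intro set_swap[THEN trans]) (auto simp: indices_def)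
  then show ?thesis using w by (auto simp: swap_def indices_def)
qed

lemma swap_swap: "Suc k < length w \<Longrightarrow> swap (Suc k) (swap (Suc k) w) = w"
  by (rule nth_equalityI) (auto simp: swap_def nth_list_update)

lemma opH_short: "length w \<le> Suc k \<Longrightarrow> opH k f w = 0"
  by (induction k f w rule: opH.induct) auto

lemma opH_tens: "Suc k < n \<Longrightarrow> f \<in> tens m n \<Longrightarrow> opH k f \<in> tens m n"
proof -
  assume k: "Suc k < n" and f: "f \<in> tens m n"
  have "opH k f w = 0" if w: "w \<notin> indices m n" for w
  proof (cases "Suc k < length w")
    case True
    have "swap (Suc k) w \<notin> indices m n"
      using swap_indices[OF k, of "swap (Suc k) w" m] w swap_swap[OF True] by auto
    then show ?thesis using f w True by (simp add: opH_nth tens_def)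
  next
    case False
    then show ?thesis using f by (simp add: opH_short)
  qed
  then show ?thesis by (simp add: tens_def)
qed

lemma brauer_op_H:
  assumes k: "Suc k < n" and f: "f \<in> tens m n"
  shows "brauer_op m n \<sigma> (BH (Suc k)) f = opH k f"
proof
  fix u
  let ?X = "indices m n"
  have B: "brauer_op m n \<sigma> (BH (Suc k)) f u = (\<Sum>w\<in>?X. f w * H_basis (Suc k) w u)"
    by (simp add: lin_ext_def sum_fun smul_def)
  show "brauer_op m n \<sigma> (BH (Suc k)) f u = opH k f u"
  proof (cases "u \<in> ?X")
    case False
    have "H_basis (Suc k) w u = 0" if "w \<in> ?X" for w
      using False that swap_indices[OF k that] by (auto simp: H_basis_def Let_def basis_vec_def smul_def)
    then show ?thesis
      using opH_tens[OF k f] False unfolding B by (simp add: tens_def)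
  next
    case True
    then have len: "length u = n" by (simp add: indices_def)
    let ?c = "if u ! k = u ! Suc k then qq else if u ! k < u ! Suc k then dq else 0"
    have "f w * H_basis (Suc k) w u = (if w = u then ?c * f u else 0)
        + (if w = swap (Suc k) u then if u ! k \<noteq> u ! Suc k then f (swap (Suc k) u) else 0 else 0)"
      if w: "w \<in> ?X" for w
    proof -
      have lw: "length w = n" using w by (simp add: indices_def)
      have sw: "u = swap (Suc k) w \<longleftrightarrow> w = swap (Suc k) u"
        using swap_swap[of k w] swap_swap[of k u] lw len k by auto
      have sn: "swap (Suc k) u ! k = u ! Suc k" "swap (Suc k) u ! Suc k = u ! k"
        using k len by (simp_all add: swap_def)
      have Hb: "H_basis (Suc k) w u = (if w ! k = w ! Suc k then if u = w then qq else 0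
          else (if u = swap (Suc k) w then 1 else 0) + (if w ! k < w ! Suc k then if u = w then dq else 0 else 0))" for w
        by (auto simp: H_basis_def Let_def basis_vec_def smul_def)
      have ne: "u ! k \<noteq> u ! Suc k \<Longrightarrow> u \<noteq> swap (Suc k) u"
        using sn by metis
      have eq: "u ! k = u ! Suc k \<Longrightarrow> swap (Suc k) u = u"
        using list_update_id[of u k] list_update_id[of u "Suc k"] by (simp add: swap_def)
      consider "w = u" | "w = swap (Suc k) u" "w \<noteq> u" | "w \<noteq> u" "w \<noteq> swap (Suc k) u" by blast
      then show ?thesis
      proof cases
        case 1
        show ?thesis unfolding 1 Hb using ne by (cases "u ! k = u ! Suc k") auto
      next
        case 2
        then have "u ! k \<noteq> u ! Suc k" using eq by metis
        then show ?thesis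
          using 2 swap_swap[of k u] len k unfolding Hb by (simp add: sn)
      next
        case 3
        then have "u \<noteq> swap (Suc k) w" using sw by blast
        then show ?thesis using 3 unfolding Hb by auto
      qed
    qed
    then have "brauer_op m n \<sigma> (BH (Suc k)) f u = (\<Sum>w\<in>?X. (if w = u then ?c * f u else 0)
        + (if w = swap (Suc k) u then if u ! k \<noteq> u ! Suc k then f (swap (Suc k) u) else 0 else 0))"
      unfolding B by (rule sum.cong[OF refl])
    also have "\<dots> = ?c * f u + (if u ! k \<noteq> u ! Suc k then f (swap (Suc k) u) else 0)"
      using True swap_indices[OF k True] finite_indices by (simp only: sum.distrib sum.delta if_True)
    also have "\<dots> = opH k f u"
      using k len by (simp add: opH_nth)
    finally show ?thesis .
  qed
qed

section \<open>The generator \<open>e\<close> on tensor powers\<close>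

text \<open>
  The operator \<open>e\<close> contracts the first two factors with the functional with coefficients \<open>t\<close> and inserts the
  vector with coefficients \<open>u\<close>.  The relations only involve the products of \<open>t\<close> and \<open>u\<close>; the assumptions are
  symmetric in \<open>t\<close> and \<open>u\<close>, so the transposed operator satisfies them, too.
\<close>

locale brauer_coeffs =
  fixes m :: nat and u t :: "nat \<Rightarrow> qfield"
  assumes m1: "m \<ge> 1"
    and u_even: "i \<in> {1..m} \<Longrightarrow> u (2*i) = - qq * u (2*i - 1)"
    and t_even: "i \<in> {1..m} \<Longrightarrow> t (2*i) = - qq * t (2*i - 1)"
    and tu: "i \<in> {1..m} \<Longrightarrow> t (2*i - 1) * u (2*i - 1) = qq powi (2 * int m + 1 - 4 * int i)"
begin

definition U :: "nat \<Rightarrow> nat \<Rightarrow> qfield" where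
  "U a b = (if a \<in> letters_upto m \<and> b = partner a then u a else 0)"

definition theta :: "nat list vec \<Rightarrow> nat list vec" where
  "theta f w = (\<Sum>a\<in>letters_upto m. t a * f (a # partner a # w))"

fun ope :: "nat list vec \<Rightarrow> nat list vec" where
  "ope f (a # b # w) = U a b * theta f w"
| "ope f _ = 0"

definition s :: "nat \<Rightarrow> qfield" where "s i = qq powi (2 * int m + 1 - 4 * int i)"

lemma s_Suc: "s i = qq ^ 4 * s (Suc i)"
proof -
  have "s i = qq powi (4 + (2 * int m + 1 - 4 * int (Suc i)))"
    unfolding s_def by (rule arg_cong[of _ _ "(powi) qq"]) simp
  also have "\<dots> = qq ^ 4 * s (Suc i)"
    using qq_nz unfolding s_def by (subst power_int_add) simp_all
  finally show ?thesis .
qed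

text \<open>
  A telescoping sum.  The case \<open>k = m\<close> gives the eigenvalue of \<open>e\<close>, and the intermediate cases give the scalar in
  \<open>e H\<^sub>2 e\<close>.
\<close>

lemma partial_sum: "dq * (1 + qq^2) * (\<Sum>i=1..<Suc k. s i) + qq^3 * s (Suc k) = qq ^ (2*m)"
proof (induction k)
  case 0
  have "qq ^ 3 * s 1 = qq powi (3 + (2 * int m + 1 - 4 * int 1))"
    using qq_nz unfolding s_def by (subst power_int_add) simp_all
  also have "\<dots> = qq ^ (2*m)"
    using power_int_of_nat[of qq "2*m"] by simp
  finally show ?case by simp
next
  case (Suc k)
  have "dq * (1 + qq^2) * s (Suc k) + qq^3 * s (Suc (Suc k)) = qq^3 * s (Suc k)"
    unfolding s_Suc[of "Suc k"] by (simp add: power2_eq_square power3_eq_cube power4_eq_xxxx algebra_simps qq_cancel)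
  then show ?case
    using Suc.IH by (simp add: algebra_simps)
qed

lemma partial_sum': "k \<ge> 1 \<Longrightarrow> dq * (1 + qq^2) * (\<Sum>i=1..<k. s i) + qq^3 * s k = qq ^ (2*m)"
  using partial_sum[of "k - 1"] by simp

lemma sum_pairs: "(\<Sum>a\<in>letters_upto k. F a) = (\<Sum>i=1..k. F (2*i - 1) + F (2*i) :: qfield)"
  by (induction k) (simp_all add: sum.cl_ivl_Suc algebra_simps)

lemma letter_cases:
  assumes "a \<in> letters_upto m"
  obtains i where "i \<in> {1..m}" "a = 2*i - 1" "partner a = 2*i"
    | i where "i \<in> {1..m}" "a = 2*i" "partner a = 2*i - 1"
proof (cases "odd a")
  case True
  then obtain b where "a = 2 * b + 1" by (auto elim: oddE)
  then show ?thesis using assms by (intro that(1)[of "b + 1"]) (auto simp: partner_def)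
next
  case False
  then obtain b where "a = 2 * b" by (auto elim: evenE)
  then show ?thesis using assms by (intro that(2)[of b]) (auto simp: partner_def)
qed

lemma U_skew: "U b a + (if a < b then dq * U a b else 0) = - inverse qq * U a b" if "a \<noteq> b"
proof (cases "a \<in> letters_upto m \<and> b = partner a")
  case True
  then have a: "a \<in> letters_upto m" and b: "b = partner a" by auto
  have U: "U a b = u a" "U b a = u b"
    using a b partner_mem[OF a] by (auto simp: U_def partner_partner)
  from a show ?thesis
  proof (cases rule: letter_cases)
    case (1 i)
    then have "u b = - qq * u a" "a < b" using u_even[of i] b by auto
    then show ?thesis unfolding U by (simp add: left_diff_distrib)
  next
    case (2 i)
    then have "u a = - qq * u b" "\<not> a < b" using u_even[of i] b by auto
    then show ?thesis unfolding U by (simp add: qq_cancel)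
  qed
next
  case False
  then have "U a b = 0" "U b a = 0"
    using partner_mem[of b m] by (auto simp: U_def partner_partner)
  then show ?thesis by simp
qed

lemma U_diag: "U a a = 0"
  by (auto simp: U_def partner_neq dest!: sym[of a])

lemma hh_U: "hh (\<lambda>a b. U a b * c) a b = - inverse qq * (U a b * c)"
proof (cases "a = b")
  case False
  have "U b a * c + (if a < b then dq * (U a b * c) else 0) = (U b a + (if a < b then dq * U a b else 0)) * c"
    by (simp add: distrib_right mult.assoc)
  then show ?thesis
    using False unfolding U_skew[OF False] by (simp add: hh_def mult.assoc)
qed (simp add: hh_def U_diag)

lemma theta_comb: "theta (\<lambda>u. f u + c * g u) w = theta f w + c * theta g w"
  by (simp add: theta_def sum.distrib sum_distrib_left algebra_simps)

lemma ope_comb: "ope (\<lambda>u. f u + c * g u) w = ope f w + c * ope g w"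
  by (induction f w rule: ope.induct) (simp_all add: theta_comb algebra_simps)

lemma ope_zero: "ope (\<lambda>u. 0) w = 0"
  using ope_comb[of "\<lambda>_. 0" "- 1" "\<lambda>_. 0" w] by simp

lemma opH0_ope: "opH 0 (ope f) w = - inverse qq * ope f w"
proof -
  consider "w = []" | a where "w = [a]" | a b v where "w = a # b # v"
    by (metis list.exhaust)
  then show ?thesis
    by cases (simp_all add: hh_U)
qed

lemma theta_opH0: "theta (opH 0 f) w = - inverse qq * theta f w"
proof -
  have "theta (opH 0 f) w = (\<Sum>i=1..m. - inverse qq * (t (2*i - 1) * f ((2*i - 1) # (2*i) # w) + t (2*i) * f ((2*i) # (2*i - 1) # w)))"
    unfolding theta_def sum_pairs
  proof (rule sum.cong[OF refl])
    fix i assume i: "i \<in> {1..m}"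
    then have p: "partner (2*i - 1) = 2*i" "partner (2*i) = 2*i - 1" by (auto simp: partner_def)
    have l: "2*i - 1 < 2*i" "2*i - 1 \<noteq> 2*i" "\<not> 2*i < 2*i - 1" "2*i \<noteq> 2*i - 1" using i by auto
    show "t (2*i - 1) * opH 0 f ((2*i - 1) # partner (2*i - 1) # w) + t (2*i) * opH 0 f ((2*i) # partner (2*i) # w)
      = - inverse qq * (t (2*i - 1) * f ((2*i - 1) # (2*i) # w) + t (2*i) * f ((2*i) # (2*i - 1) # w))"
      unfolding p opH.simps hh_def t_even[OF i] using l by (simp add: algebra_simps qq_cancel)
  qed
  also have "\<dots> = - inverse qq * theta f w"
    unfolding theta_def sum_pairs sum_distrib_left
    by (rule sum.cong[OF refl]) (auto simp: partner_def)
  finally show ?thesis .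
qed

lemma ope_opH0: "ope (opH 0 f) w = - inverse qq * ope f w"
  by (induction f w rule: ope.induct) (simp_all add: theta_opH0)

lemma ope_opH_far: "ope (opH (Suc (Suc k)) f) w = opH (Suc (Suc k)) (ope f) w"
proof -
  consider "w = []" | a where "w = [a]" | a b v where "w = a # b # v"
    by (metis list.exhaust)
  then show ?thesis
  proof cases
    case 3
    have "opH k (\<lambda>w. U a b * theta f w) v = U a b * theta (opH (Suc (Suc k)) f) v"
      unfolding opH_scale theta_def opH_sum by simp
    then show ?thesis by (simp add: 3)
  qed simp_all
qed

lemma tu_value:
  assumes "i \<in> {1..m}"
  shows "t (2*i - 1) * u (2*i - 1) = s i" "t (2*i) * u (2*i) = qq^2 * s i"
proof -
  show "t (2*i - 1) * u (2*i - 1) = s i"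
    unfolding s_def by (rule tu[OF assms])
  moreover have "t (2*i) * u (2*i) = qq^2 * (t (2*i - 1) * u (2*i - 1))"
    unfolding u_even[OF assms] t_even[OF assms] by (simp add: power2_eq_square mult.assoc mult.left_commute)
  ultimately show "t (2*i) * u (2*i) = qq^2 * s i" by simp
qed

lemma ope_square: "ope (ope f) w = ((qq ^ (2*m) - inverse (qq ^ (2*m))) / dq) * ope f w"
proof -
  have th: "theta (ope f) w = (\<Sum>a\<in>letters_upto m. t a * u a) * theta f w" for w
    unfolding theta_def[of "ope f"] sum_distrib_right
    by (rule sum.cong) (simp_all add: U_def)
  have sum: "(\<Sum>a\<in>letters_upto m. t a * u a) = (1 + qq^2) * (\<Sum>i=1..m. s i)"
    unfolding sum_pairs sum_distrib_left
    by (rule sum.cong[OF refl]) (simp only: tu_value distrib_right mult_1)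
  have "qq^3 * s (Suc m) = inverse (qq ^ (2*m))"
  proof -
    have "qq ^ 3 * s (Suc m) = qq powi (3 + (2 * int m + 1 - 4 * int (Suc m)))"
      using qq_nz unfolding s_def by (subst power_int_add) simp_all
    also have "3 + (2 * int m + 1 - 4 * int (Suc m)) = - int (2 * m)" by simp
    also have "qq powi (- int (2*m)) = inverse (qq ^ (2*m))"
      using power_int_of_nat[of qq "2*m"] by (simp only: power_int_minus)
    finally show ?thesis .
  qed
  moreover have "{1..<Suc m} = {1..m}" by auto
  ultimately have "dq * (\<Sum>a\<in>letters_upto m. t a * u a) = qq ^ (2*m) - inverse (qq ^ (2*m))"
    using partial_sum[of m] unfolding sum by (simp add: algebra_simps)
  then have "(\<Sum>a\<in>letters_upto m. t a * u a) = (qq ^ (2*m) - inverse (qq ^ (2*m))) / dq"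
    using qq_diff_nz by (metis nonzero_mult_div_cancel_left)
  then have th': "theta (ope f) v = (qq ^ (2*m) - inverse (qq ^ (2*m))) / dq * theta f v" for v
    unfolding th by (simp only:)
  consider "w = []" | a where "w = [a]" | a b v where "w = a # b # v"
    by (metis list.exhaust)
  then show ?thesis
    by cases (simp_all only: ope.simps th' mult_zero_right zero_fun_def mult.left_commute)
qed

text \<open>
  The partners of the letters below \<open>c\<close> contribute \<open>q - q\<^sup>-\<^sup>1\<close> and \<open>c\<close> itself contributes \<open>q\<close>, which makes the sum
  an instance of \<open>partial_sum\<close>.
\<close>

lemma theta_H1:
  assumes c: "c \<in> letters_upto m"
  shows "(\<Sum>a\<in>letters_upto m. t a * hh (\<lambda>b c. U a b * g c) (partner a) c) = qq ^ (2*m) * g c"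
proof -
  obtain k where k: "k \<in> {1..m}" "c = 2*k - 1 \<or> c = 2*k"
    using c by (metis letter_cases)
  define wt where "wt b = (if b = c then qq else if b < c then dq else 0)" for b
  have pt: "t a * hh (\<lambda>b c. U a b * g c) (partner a) c = t a * u a * (wt (partner a) * g c)"
    if "a \<in> letters_upto m" for a
    using that by (auto simp: hh_def wt_def U_def)
  have wt: "wt (2*i) + qq^2 * wt (2*i - 1) = (if i < k then dq * (1 + qq^2) else 0) + (if i = k then qq^3 else 0)"
    if i: "i \<in> {1..m}" for i
  proof -
    have q3: "qq + qq^2 * dq = qq^3" "qq^2 * qq = qq^3" "dq + qq^2 * dq = dq * (1 + qq^2)"
      by (simp_all add: power2_eq_square power3_eq_cube algebra_simps qq_cancel)
    consider "i < k" | "i = k" | "i > k" by linarith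
    then show ?thesis
    proof cases
      case 1
      then have "2*i < c" "2*i - 1 < c" using k by auto
      then show ?thesis using 1 q3 by (simp add: wt_def)
    next
      case 2
      then have "c = 2*i - 1 \<or> c = 2*i" "2*i - 1 < 2*i" "\<not> 2*i < 2*i - 1" "2*i \<noteq> 2*i - 1" using k i by auto
      then show ?thesis using 2 q3 by (auto simp: wt_def)
    next
      case 3
      then have "2*i > c" "2*i - 1 > c" using k by auto
      then show ?thesis using 3 by (simp add: wt_def)
    qed
  qed
  have "(\<Sum>a\<in>letters_upto m. t a * hh (\<lambda>b c. U a b * g c) (partner a) c)
    = (\<Sum>a\<in>letters_upto m. t a * u a * (wt (partner a) * g c))"
    by (rule sum.cong[OF refl pt])
  also have "\<dots> = (\<Sum>i=1..m. s i * (wt (2*i) + qq^2 * wt (2*i - 1)) * g c)"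
    unfolding sum_pairs
  proof (rule sum.cong[OF refl])
    fix i assume i: "i \<in> {1..m}"
    then have p: "partner (2*i - 1) = 2*i" "partner (2*i) = 2*i - 1" by (auto simp: partner_def)
    show "t (2*i - 1) * u (2*i - 1) * (wt (partner (2*i - 1)) * g c) + t (2*i) * u (2*i) * (wt (partner (2*i)) * g c)
        = s i * (wt (2*i) + qq^2 * wt (2*i - 1)) * g c"
      unfolding p tu_value[OF i] by (simp only: distrib_left distrib_right ac_simps)
  qed
  also have "\<dots> = (\<Sum>i=1..m. (if i < k then dq * (1 + qq^2) * s i * g c else 0) + (if i = k then qq^3 * s i * g c else 0))"
    by (rule sum.cong[OF refl]) (simp only: wt, simp add: mult.assoc mult.left_commute mult.commute)
  also have "\<dots> = (dq * (1 + qq^2) * (\<Sum>i=1..<k. s i) + qq^3 * s k) * g c"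
  proof -
    have "(\<Sum>i=1..m. if i < k then dq * (1 + qq^2) * s i * g c else 0) = (\<Sum>i=1..<k. dq * (1 + qq^2) * s i * g c)"
      using k by (intro sum.mono_neutral_cong_right) auto
    moreover have "(\<Sum>i=1..m. if i = k then qq^3 * s i * g c else 0) = qq^3 * s k * g c"
      using k by simp
    ultimately show ?thesis
      by (simp only: sum.distrib sum_distrib_left sum_distrib_right distrib_right)
  qed
  also have "\<dots> = qq ^ (2*m) * g c"
    using partial_sum'[of k] k by simp
  finally show ?thesis .
qed

lemma theta_opH1_ope:
  assumes "c \<in> letters_upto m"
  shows "theta (opH 1 (ope f)) (c # w) = qq ^ (2*m) * theta f (c # w)"
  unfolding theta_def[of "opH 1 (ope f)"]
  using theta_H1[OF assms, of "\<lambda>c. theta f (c # w)"] by simp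

lemma theta_outside:
  assumes "f \<in> tens m (Suc (Suc (Suc n)))" "c \<notin> letters_upto m"
  shows "theta f (c # w) = 0"
  unfolding theta_def
proof (intro sum.neutral ballI)
  fix a assume "a \<in> letters_upto m"
  have "a # partner a # c # w \<notin> indices m (Suc (Suc (Suc n)))"
    using assms(2) by (auto simp: indices_def)
  then show "t a * f (a # partner a # c # w) = 0"
    using assms(1) by (simp add: tens_def)
qed

lemma ope_H1_ope:
  assumes n: "n \<ge> 3" and f: "f \<in> tens m n" and w: "length w = n"
  shows "ope (opH 1 (ope f)) w = qq ^ (2*m) * ope f w"
proof -
  define k where "k = n - 3"
  have k: "n = Suc (Suc (Suc k))" using n by (simp add: k_def)
  have "3 \<le> length w" using w n by simp
  then obtain a b c v where w': "w = a # b # c # v" by (rule length3E)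
  have "theta (opH 1 (ope f)) (c # v) = qq ^ (2*m) * theta f (c # v)"
  proof (cases "c \<in> letters_upto m")
    case True
    then show ?thesis by (rule theta_opH1_ope)
  next
    case False
    have z: "theta f (c # x) = 0" for x
      using theta_outside f False k by blast
    have "theta (opH 1 (ope f)) (c # v) = 0"
      unfolding theta_def
    proof (intro sum.neutral ballI)
      fix x assume x: "x \<in> letters_upto m"
      have px: "partner x \<noteq> c" using False partner_mem[OF x] by auto
      have "U x c = 0" using px by (auto simp: U_def)
      then show "t x * opH 1 (ope f) (x # partner x # c # v) = 0"
        using px by (simp add: hh_def z)
    qed
    then show ?thesis using z by simp
  qed
  then show ?thesis by (simp add: w')
qed

lemma ope_tens: "n \<ge> 2 \<Longrightarrow> f \<in> tens m n \<Longrightarrow> ope f \<in> tens m n"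
proof -
  assume n: "n \<ge> 2" and f: "f \<in> tens m n"
  have "ope f w = 0" if w: "w \<notin> indices m n" for w
  proof (cases "\<exists>a b v. w = a # b # v")
    case True
    then obtain a b v where ab: "w = a # b # v" by blast
    show ?thesis
    proof (cases "a \<in> letters_upto m \<and> b = partner a")
      case True
      then have "x # partner x # v \<notin> indices m n" if "x \<in> letters_upto m" for x
        using w ab partner_mem[of a m] by (auto simp: indices_def)
      then have "theta f v = 0"
        using f by (auto simp: theta_def tens_def intro!: sum.neutral)
      then show ?thesis by (simp add: ab)
    next
      case False
      then show ?thesis by (auto simp: ab U_def)
    qed
  next
    case False
    then show ?thesis by (metis list.exhaust ope.simps(2,3))
  qed
  then show ?thesis by (simp add: tens_def)
qed

end

section \<open>The last relation of the \<open>q\<close>-Brauer algebra\<close>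

text \<open>
  The relations for \<open>e\<^sub>(\<^sub>2\<^sub>)\<close> concern the first four tensor factors.  The element \<open>H\<^sub>2H\<^sub>3H\<^sub>1\<^sup>-\<^sup>1H\<^sub>2\<^sup>-\<^sup>1\<close> deforms the
  permutation that exchanges the first two factors with the next two.  It fixes the vector \<open>U \<otimes> U\<close>
  (\<open>shift_UU\<close>) and maps \<open>U \<otimes> g\<close> to a vector whose contraction in the first pair is \<open>U\<close> times the contraction
  of \<open>g\<close> (\<open>theta_shift\<close>).  Therefore \<open>e\<^sub>(\<^sub>2\<^sub>)\<close> contracts both pairs and inserts \<open>U \<otimes> U\<close>, and the transposed
  statement of \<open>shift_UU\<close> gives the other half of the relation.
\<close>

type_synonym fun4 = "nat \<Rightarrow> nat \<Rightarrow> nat \<Rightarrow> nat \<Rightarrow> qfield"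

definition h12 :: "fun4 \<Rightarrow> fun4" where "h12 F a b c d = hh (\<lambda>x y. F x y c d) a b"
definition h23 :: "fun4 \<Rightarrow> fun4" where "h23 F a b c d = hh (\<lambda>x y. F a x y d) b c"
definition h34 :: "fun4 \<Rightarrow> fun4" where "h34 F a b c d = hh (\<lambda>x y. F a b x y) c d"

lemmas h_defs = h12_def[abs_def] h23_def[abs_def] h34_def[abs_def]

definition sub4 :: "fun4 \<Rightarrow> qfield \<Rightarrow> fun4 \<Rightarrow> fun4" where
  "sub4 F k G = (\<lambda>a b c d. F a b c d - k * G a b c d)"

lemma h_sub4: "h12 (sub4 F k G) = sub4 (h12 F) k (h12 G)" "h23 (sub4 F k G) = sub4 (h23 F) k (h23 G)"
  "h34 (sub4 F k G) = sub4 (h34 F) k (h34 G)"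
  by (simp_all add: h_defs sub4_def hh_def fun_eq_iff algebra_simps)

lemma h_quadratic: "h12 (h12 F) = sub4 F (- dq) (h12 F)" "h23 (h23 F) = sub4 F (- dq) (h23 F)"
  "h34 (h34 F) = sub4 F (- dq) (h34 F)"
  by (simp_all add: h_defs sub4_def hh_quadratic fun_eq_iff algebra_simps)

lemma h_braid: "h12 (h23 (h12 F)) = h23 (h12 (h23 F))" "h23 (h34 (h23 F)) = h34 (h23 (h34 F))"
proof -
  show "h12 (h23 (h12 F)) = h23 (h12 (h23 F))"
  proof (intro ext)
    fix a b c d
    show "h12 (h23 (h12 F)) a b c d = h23 (h12 (h23 F)) a b c d"
      unfolding h12_def h23_def by (rule hh_braid)
  qed
  show "h23 (h34 (h23 F)) = h34 (h23 (h34 F))"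
  proof (intro ext)
    fix a b c d
    show "h23 (h34 (h23 F)) a b c d = h34 (h23 (h34 F)) a b c d"
      unfolding h34_def h23_def by (rule hh_braid)
  qed
qed

lemma h_far: "h12 (h34 F) = h34 (h12 F)"
  by (simp add: h_defs hh_def fun_eq_iff algebra_simps)

text \<open>
  The inverses of \<open>h12\<close> and \<open>h23\<close>.
\<close>

definition k12 :: "fun4 \<Rightarrow> fun4" where "k12 F = sub4 (h12 F) dq F"
definition k23 :: "fun4 \<Rightarrow> fun4" where "k23 F = sub4 (h23 F) dq F"

definition shift4 :: "fun4 \<Rightarrow> fun4" where "shift4 F = k23 (k12 (h34 (h23 F)))"

context brauer_coeffs
begin

definition UU :: fun4 where "UU a b c d = U a b * U c d"

lemma U_swap: "x < y \<Longrightarrow> U y x = - qq * U x y"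
  using U_skew[of x y] by (simp add: algebra_simps)

lemma U_chain:
  assumes "x < y" "y < z"
  shows "U x y * U y z = 0" "U y z * U x y = 0"
proof -
  have "partner (partner x) = x" if "x \<in> letters_upto m" using that by (simp add: partner_partner)
  then show "U x y * U y z = 0" "U y z * U x y = 0"
    using assms by (auto simp: U_def)
qed

lemma U_gap: "x < z \<Longrightarrow> z < y \<Longrightarrow> U x y = 0"
  by (auto simp: U_def partner_def)

text \<open>
  For permutations both sides are \<open>U\<close> in the factors \<open>1, 4\<close> times \<open>U\<close> in the factors \<open>2, 3\<close>.  In general, as
  \<open>U x y\<close> vanishes unless \<open>x\<close> and \<open>y\<close> are neighbours, few terms remain for each relative order of the letters.
\<close>

lemma UU_shift: "h34 (h23 UU) = h12 (h23 UU)"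
proof (intro ext)
  fix a b c d
  note gaps = U_gap[of a b c] U_gap[of a b d] U_gap[of a c b] U_gap[of a c d] U_gap[of a d b] U_gap[of a d c]
    U_gap[of b a c] U_gap[of b a d] U_gap[of b c a] U_gap[of b c d] U_gap[of b d a] U_gap[of b d c]
    U_gap[of c a b] U_gap[of c a d] U_gap[of c b a] U_gap[of c b d] U_gap[of c d a] U_gap[of c d b]
    U_gap[of d a b] U_gap[of d a c] U_gap[of d b a] U_gap[of d b c] U_gap[of d c a] U_gap[of d c b]
  show "h34 (h23 UU) a b c d = h12 (h23 UU) a b c d"
    by (cases rule: linorder_cases[of a b]; cases rule: linorder_cases[of b c]; cases rule: linorder_cases[of a c];
        (linarith)?; cases rule: linorder_cases[of c d]; cases rule: linorder_cases[of b d]; (linarith)?;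
        cases rule: linorder_cases[of a d]; (linarith)?;
        (simp add: h_defs hh_def UU_def gaps U_swap U_diag U_chain;
          (simp add: algebra_simps qq_cancel U_chain; fail)?; (metis U_chain(1) mult_eq_0_iff)?))
qed

lemma h_UU: "h12 UU a b c d = - inverse qq * UU a b c d" "h34 UU a b c d = - inverse qq * UU a b c d"
  unfolding h12_def h34_def UU_def
  using hh_U[of "U c d" a b] hh_U[of "U a b" c d] by (simp_all add: mult.commute)

definition FU :: "(nat \<Rightarrow> nat \<Rightarrow> qfield) \<Rightarrow> fun4" where "FU g a b c d = U a b * g c d"

definition theta4 :: "fun4 \<Rightarrow> nat \<Rightarrow> nat \<Rightarrow> qfield" where
  "theta4 G c d = (\<Sum>x\<in>letters_upto m. t x * G x (partner x) c d)"

lemma theta4_sub: "theta4 (sub4 F k G) c d = theta4 F c d - k * theta4 G c d"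
  by (simp add: theta4_def sub4_def sum_subtractf sum_distrib_left algebra_simps)

lemma theta4_h12: "theta4 (h12 G) c d = - inverse qq * theta4 G c d"
  using theta_opH0[of "\<lambda>w. G (w ! 0) (w ! 1) c d" "[]"]
  by (simp add: theta_def theta4_def h12_def)

lemma theta4_h34: "theta4 (h34 G) c d = hh (theta4 G) c d"
  by (simp add: theta4_def h34_def hh_def sum.distrib sum_distrib_left algebra_simps)

lemma theta4_h23: "c \<in> letters_upto m \<Longrightarrow> theta4 (h23 (FU g)) c d = qq ^ (2*m) * g c d"
  using theta_H1[of c "\<lambda>c. g c d"] by (simp add: theta4_def h23_def FU_def)

lemma h12_FU: "h12 (FU g) a b c d = - inverse qq * FU g a b c d"
  unfolding h12_def FU_def by (rule hh_U)

lemma h34_FU: "h34 (FU g) = FU (hh g)"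
  by (simp add: h34_def FU_def hh_def fun_eq_iff algebra_simps)

text \<open>
  This is \<open>shift4 (FU g)\<close> with the two inverses replaced by the generators themselves.
\<close>

definition RU :: "(nat \<Rightarrow> nat \<Rightarrow> qfield) \<Rightarrow> fun4" where
  "RU g = h23 (h12 (h34 (h23 (FU g))))"

lemma h_scale: "h12 (\<lambda>a b c d. k * F a b c d) = (\<lambda>a b c d. k * h12 F a b c d)"
  "h23 (\<lambda>a b c d. k * F a b c d) = (\<lambda>a b c d. k * h23 F a b c d)"
  "h34 (\<lambda>a b c d. k * F a b c d) = (\<lambda>a b c d. k * h34 F a b c d)"
  by (simp_all add: h_defs hh_def fun_eq_iff algebra_simps)

text \<open>
  The braid relations move the generator for factors three and four to the front, where \<open>U\<close> is an eigenvector.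
\<close>

lemma RU_skew: "h34 (RU g) = (\<lambda>a b c d. - inverse qq * RU g a b c d)"
proof -
  have "h34 (RU g) = h23 (h34 (h12 (h23 (h12 (FU g)))))"
    unfolding RU_def h_far h_braid(2)[symmetric] h_braid(1) by (simp only: h_braid(1)[symmetric])
  also have "h12 (FU g) = (\<lambda>a b c d. - inverse qq * FU g a b c d)"
    by (intro ext) (rule h12_FU)
  finally show ?thesis
    unfolding h_scale RU_def h_far .
qed

lemma theta_RU_skew: "hh (theta4 (RU g)) c d = - inverse qq * theta4 (RU g) c d"
  unfolding theta4_h34[symmetric] RU_skew by (simp add: theta4_def sum_distrib_left mult.left_commute sum_negf)

text \<open>A multiple of the component of \<open>g\<close> on which the Hecke generator acts by \<open>- q\<^sup>-\<^sup>1\<close>, at letters \<open>c < d\<close>.\<close>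

abbreviation skew_part :: "(nat \<Rightarrow> nat \<Rightarrow> qfield) \<Rightarrow> nat \<Rightarrow> nat \<Rightarrow> qfield" where
  "skew_part g c d \<equiv> inverse qq * inverse qq * g c d - inverse qq * g d c"

text \<open>
  The values of \<open>RU g a b c d\<close> for partners \<open>a, b\<close> and \<open>c < d\<close>, according to the position of \<open>a\<close> and \<open>b\<close>
  relative to \<open>c\<close> and \<open>d\<close>.
\<close>

lemma RU_below:
  assumes "a < c" "b < c" "c < d" "a \<noteq> b"
    and "U a c = 0" "U a d = 0" "U b c = 0" "U b d = 0" "U c a = 0" "U c b = 0"
  shows "RU g a b c d = U a b * (dq * dq * skew_part g c d) + U c d * g a b"
proof -
  have "a < d" "b < d" using assms by auto
  consider "a < b" | "b < a" using \<open>a \<noteq> b\<close> by linarith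
  then show ?thesis
    by cases (use assms \<open>a < d\<close> \<open>b < d\<close> in \<open>simp add: RU_def h_defs hh_def FU_def U_swap; simp add: algebra_simps qq_cancel\<close>)+
qed

lemma RU_above:
  assumes "c < a" "c < b" "c < d" "a \<noteq> b"
    and "U a c = 0" "U b c = 0" "U c a = 0" "U c b = 0"
    and "(a < d \<and> b < d) \<or> (d < a \<and> d < b) \<or> ((a = d \<or> b = d) \<and> U c d = 0)"
  shows "RU g a b c d = U c d * g a b"
  using assms(9)
proof (elim disjE conjE)
  assume "a < d" "b < d"
  then show ?thesis
    using assms(1-8) by (simp add: RU_def h_defs hh_def FU_def)
next
  assume "d < a" "d < b"
  then show ?thesis
    using assms(1-8) by (simp add: RU_def h_defs hh_def FU_def)
next
  assume "a = d" "U c d = 0"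
  then show ?thesis
    using assms(1-8) by (simp add: RU_def h_defs hh_def FU_def)
next
  assume "b = d" "U c d = 0"
  then show ?thesis
    using assms(1-8) by (simp add: RU_def h_defs hh_def FU_def)
qed

lemma RU_same_odd:
  assumes "c < b" "b < d" "U c d = 0" "U b d = 0"
  shows "RU g c b c d = qq * dq * U c b * g c d" "RU g b c c d = qq * dq * U c b * g d c"
proof -
  have "c < d" using assms by simp
  then show "RU g c b c d = qq * dq * U c b * g c d" "RU g b c c d = qq * dq * U c b * g d c"
    using assms by (simp_all add: RU_def h_defs hh_def FU_def U_swap U_diag)
qed

lemma RU_same_even:
  assumes "b < c" "c < d" "U c d = 0" "U b d = 0"
  shows "RU g c b c d = U b c * (dq * dq * (g d c + qq * g c d) - qq * qq * dq * g c d)"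
    "RU g b c c d = U b c * (qq * dq * dq * (g d c + qq * g c d) - qq * qq * dq * (g d c + dq * g c d))"
proof -
  have "b < d" using assms by simp
  then show "RU g c b c d = U b c * (dq * dq * (g d c + qq * g c d) - qq * qq * dq * g c d)"
    "RU g b c c d = U b c * (qq * dq * dq * (g d c + qq * g c d) - qq * qq * dq * (g d c + dq * g c d))"
    using assms by (simp_all add: RU_def h_defs hh_def FU_def U_swap U_diag) (simp_all add: algebra_simps)
qed

lemma RU_partner:
  assumes "c < d"
  shows "RU g c d c d = qq * qq * U c d * g c d" "RU g d c c d = qq * qq * U c d * g d c"
  using assms by (simp_all add: RU_def h_defs hh_def FU_def U_diag)

definition theta2 :: "(nat \<Rightarrow> nat \<Rightarrow> qfield) \<Rightarrow> qfield" where
  "theta2 g = (\<Sum>x\<in>letters_upto m. t x * g x (partner x))"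

text \<open>
  Only the pairs \<open>{a, partner a}\<close> below \<open>c\<close> and the pair of \<open>c\<close> contribute to the difference of \<open>theta4 (RU g)\<close> and the
  main term; their contributions add up to an instance of \<open>partial_sum\<close>.
\<close>

lemma theta_RU:
  assumes c: "c \<in> letters_upto m" and d: "d \<in> letters_upto m" and cd: "c < d"
  shows "theta4 (RU g) c d = U c d * theta2 g + dq * qq ^ (2*m) * skew_part g c d"
proof -
  obtain k where k: "k \<in> {1..m}" "c = 2*k - 1 \<or> c = 2*k"
    using c by (metis letter_cases)
  have Uz: "U x y = 0" if "y \<noteq> partner x" for x y using that by (simp add: U_def)
  let ?r = "\<lambda>a. t a * (RU g a (partner a) c d - U c d * g a (partner a))"
  have pair: "?r (2*i - 1) + ?r (2*i)
      = (if i < k then dq * (dq * (1 + qq^2) * s i) * skew_part g c d else 0) + (if i = k then dq * (qq^3 * s i) * skew_part g c d else 0)"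
    if i: "i \<in> {1..m}" for i
  proof -
    define a where "a = 2*i - 1"
    define b where "b = 2*i"
    have p: "partner a = b" "partner b = a" using i by (auto simp: partner_def a_def b_def)
    have ab: "a < b" using i by (simp add: a_def b_def)
    have Uab: "U a b = u a" "U b a = u b" using i p by (auto simp: U_def a_def b_def)
    have tab: "t b = - qq * t a" using t_even[OF i] by (simp add: a_def b_def)
    have su: "t a * U a b = s i" "t b * U b a = qq * qq * s i"
      using tu_value[OF i] unfolding Uab by (simp_all add: a_def b_def power2_eq_square)
    have dp: "partner c \<noteq> d \<Longrightarrow> U c d = 0" using Uz by metis
    consider "i < k" | "i > k" | "i = k" by linarith
    then have "?r a + ?r b = (if i < k then dq * (dq * (1 + qq^2) * s i) * skew_part g c d else 0)
       + (if i = k then dq * (qq^3 * s i) * skew_part g c d else 0)"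
    proof cases
      case 1
      have o: "a < c" "b < c" using 1 k by (auto simp: a_def b_def)
      have pc: "partner c \<noteq> a" "partner c \<noteq> b"
        using 1 k by (auto simp: a_def b_def partner_def)
      have z: "U a c = 0" "U a d = 0" "U b c = 0" "U b d = 0" "U c a = 0" "U c b = 0"
        using o cd p pc by (auto intro!: Uz)
      have "RU g a b c d = U a b * (dq * dq * skew_part g c d) + U c d * g a b"
        "RU g b a c d = U b a * (dq * dq * skew_part g c d) + U c d * g b a"
        using o cd ab z by (intro RU_below; simp)+
      then have "?r a + ?r b = (t a * U a b + t b * U b a) * (dq * dq * skew_part g c d)"
        unfolding p by (simp only: add_diff_cancel_right' distrib_right mult.assoc)
      also have "\<dots> = dq * (dq * (1 + qq^2) * s i) * skew_part g c d"
        unfolding su by (simp only: power2_eq_square distrib_left distrib_right mult_1 mult_1_right ac_simps)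
      finally show ?thesis using 1 by simp
    next
      case 2
      have o: "c < a" "c < b" using 2 k by (auto simp: a_def b_def)
      have pc: "partner c \<noteq> a" "partner c \<noteq> b"
        using 2 k by (auto simp: a_def b_def partner_def)
      have z: "U a c = 0" "U b c = 0" "U c a = 0" "U c b = 0"
        using o p pc by (auto intro!: Uz)
      have w: "(a < d \<and> b < d) \<or> (d < a \<and> d < b) \<or> ((a = d \<or> b = d) \<and> U c d = 0)"
        using dp pc by (cases "a = d \<or> b = d") (auto simp: a_def b_def)
      have "RU g a b c d = U c d * g a b" "RU g b a c d = U c d * g b a"
        using o cd ab z w by (intro RU_above; auto)+
      then show ?thesis using 2 unfolding p by simp
    next
      case 3
      have q3: "qq^3 = qq * qq * qq" by (simp add: power3_eq_cube)
      show ?thesis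
      proof (cases "c = a")
        case True
        show ?thesis
        proof (cases "d = b")
          case db: True
          have r: "RU g a b c d = qq * qq * U a b * g a b" "RU g b a c d = qq * qq * U a b * g b a"
            using RU_partner[OF cd, of g] by (simp_all add: True db)
          have "?r a + ?r b = (t a * U a b) * ((qq * qq - 1) * (g a b - qq * g b a))"
            unfolding p r tab unfolding True db by (simp add: algebra_simps)
          also have "\<dots> = dq * (qq^3 * s i) * skew_part g c d"
            unfolding su q3 unfolding True db by (simp add: algebra_simps qq_cancel)
          finally show ?thesis using 3 by simp
        next
          case False
          then have bd: "b < d" using cd True ab by (auto simp: a_def b_def)
          have z: "U c d = 0" "U b d = 0" using False True p bd cd by (auto intro!: Uz)
          have r: "RU g a b c d = qq * dq * U a b * g c d" "RU g b a c d = qq * dq * U a b * g d c"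
            using RU_same_odd[OF _ bd z, of g] ab by (simp_all add: True)
          have "?r a + ?r b = (t a * U a b) * (qq * dq * (g c d - qq * g d c))"
            unfolding p r z tab by (simp add: algebra_simps)
          also have "\<dots> = dq * (qq^3 * s i) * skew_part g c d"
            unfolding su q3 by (simp add: algebra_simps qq_cancel)
          finally show ?thesis using 3 by simp
        qed
      next
        case False
        then have cb: "c = b" using k 3 by (auto simp: a_def b_def)
        have z: "U c d = 0" "U a d = 0" using p cb cd ab by (auto intro!: Uz)
        have r: "RU g b a c d = U a b * (dq * dq * (g d c + qq * g c d) - qq * qq * dq * g c d)"
          "RU g a b c d = U a b * (qq * dq * dq * (g d c + qq * g c d) - qq * qq * dq * (g d c + dq * g c d))"
          using RU_same_even[OF _ cd z, of g] ab by (simp_all add: cb)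
        have "?r a + ?r b = (t a * U a b) * (qq * dq * dq * (g d c + qq * g c d) - qq * qq * dq * (g d c + dq * g c d)
            - qq * (dq * dq * (g d c + qq * g c d) - qq * qq * dq * g c d))"
          unfolding p r z tab by (simp add: algebra_simps)
        also have "\<dots> = dq * (qq^3 * s i) * skew_part g c d"
          unfolding su q3 by (simp add: algebra_simps qq_cancel)
        finally show ?thesis using 3 by simp
      qed
    qed
    then show ?thesis by (simp only: a_def b_def)
  qed
  have "theta4 (RU g) c d - U c d * theta2 g = (\<Sum>a\<in>letters_upto m. ?r a)"
    by (simp add: theta4_def theta2_def sum_subtractf sum_distrib_left right_diff_distrib mult.left_commute)
  also have "\<dots> = (\<Sum>i=1..m. (if i < k then dq * (dq * (1 + qq^2) * s i) * skew_part g c d else 0)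
      + (if i = k then dq * (qq^3 * s i) * skew_part g c d else 0))"
    unfolding sum_pairs by (rule sum.cong[OF refl pair])
  also have "\<dots> = dq * (dq * (1 + qq^2) * (\<Sum>i=1..<k. s i) + qq^3 * s k) * skew_part g c d"
  proof -
    have "(\<Sum>i=1..m. if i < k then dq * (dq * (1 + qq^2) * s i) * skew_part g c d else 0)
        = (\<Sum>i=1..<k. dq * (dq * (1 + qq^2) * s i) * skew_part g c d)"
      using k by (intro sum.mono_neutral_cong_right) auto
    moreover have "(\<Sum>i=1..m. if i = k then dq * (qq^3 * s i) * skew_part g c d else 0) = dq * (qq^3 * s k) * skew_part g c d"
      using k by simp
    ultimately show ?thesis
      by (simp only: sum.distrib sum_distrib_left sum_distrib_right distrib_right distrib_left)
  qed
  also have "\<dots> = dq * qq ^ (2*m) * skew_part g c d"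
    using partial_sum'[of k] k by simp
  finally show ?thesis by (simp add: algebra_simps)
qed

text \<open>
  Both sides are eigenvectors of the Hecke generator for the eigenvalue \<open>- q\<^sup>-\<^sup>1\<close>, so letters \<open>c < d\<close> suffice.
\<close>

lemma theta_RU_all:
  assumes c: "c \<in> letters_upto m" and d: "d \<in> letters_upto m"
  shows "theta4 (RU g) c d = U c d * theta2 g + dq * qq ^ (2*m) * (g c d - inverse qq * hh g c d)"
proof -
  have B: "g c d - inverse qq * hh g c d = skew_part g c d" if "c < d" for c d
    using that by (simp add: hh_def algebra_simps qq_cancel)
  consider "c < d" | "c = d" | "d < c" by linarith
  then show ?thesis
  proof cases
    case 1
    then show ?thesis using theta_RU[OF c d] B by simp
  next
    case 2
    have "(qq + inverse qq) * theta4 (RU g) c d = 0"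
      using theta_RU_skew[of g c d] 2 by (simp add: hh_def algebra_simps)
    then have "theta4 (RU g) c d = 0" using q_sum_nz by simp
    then show ?thesis using 2 by (simp add: U_diag hh_def qq_cancel)
  next
    case 3
    have "theta4 (RU g) c d = - qq * theta4 (RU g) d c"
      using theta_RU_skew[of g d c] 3 by (simp add: hh_def algebra_simps)
    also have "\<dots> = - qq * (U d c * theta2 g) + dq * qq ^ (2*m) * (- qq * skew_part g d c)"
      unfolding theta_RU[OF d c 3] by (simp add: algebra_simps)
    also have "- qq * skew_part g d c = g c d - inverse qq * hh g c d"
      using 3 by (simp add: hh_def algebra_simps qq_cancel)
    also have "- qq * (U d c * theta2 g) = U c d * theta2 g"
      using U_swap[OF 3] by simp
    finally show ?thesis .
  qed
qed

text \<open>
  Writing the two inverses as \<open>H - (q - q\<^sup>-\<^sup>1)\<close> leaves \<open>RU\<close> and three shorter products.  The latter cancel the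
  second summand of \<open>theta_RU_all\<close>.
\<close>

lemma theta_shift:
  assumes c: "c \<in> letters_upto m" and d: "d \<in> letters_upto m"
  shows "theta4 (shift4 (FU g)) c d = U c d * theta2 g"
proof -
  let ?z = "qq ^ (2*m)"
  let ?Y = "h34 (h23 (FU g))"
  have hz: "hh (theta4 (h23 (FU g))) c d = ?z * hh g c d" for g
    using theta4_h23[OF c] theta4_h23[OF d] by (simp add: hh_def algebra_simps)
  have hz2: "hh (theta4 (h23 (FU (hh g)))) c d = ?z * (dq * hh g c d + g c d)"
    unfolding hz hh_quadratic ..
  have Y: "theta4 ?Y c d = ?z * hh g c d"
    unfolding theta4_h34 by (rule hz)
  have Y2: "theta4 (h23 ?Y) c d = ?z * (dq * hh g c d + g c d)"
    unfolding h_braid(2) theta4_h34 h34_FU by (rule hz2)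
  have Y3: "theta4 (h23 (h12 ?Y)) c d = theta4 (RU g) c d"
    by (simp add: RU_def)
  show ?thesis
    unfolding shift4_def k23_def k12_def h_sub4 theta4_sub theta4_h12 Y Y2 Y3 theta_RU_all[OF c d]
    by (simp add: algebra_simps qq_cancel)
qed

lemma k_inverse: "k12 (h12 F) = F" "k23 (h23 F) = F"
  unfolding k12_def k23_def h_quadratic by (simp_all add: sub4_def fun_eq_iff algebra_simps)

lemma shift_UU: "shift4 UU = UU"
  unfolding shift4_def UU_shift k_inverse ..

lemma h12_UU: "h12 UU = (\<lambda>a b c d. - inverse qq * UU a b c d)" and h34_UU: "h34 UU = (\<lambda>a b c d. - inverse qq * UU a b c d)"
  by (intro ext h_UU)+

text \<open>The transpose of \<^term>\<open>shift4\<close> also fixes \<^term>\<open>UU\<close>.\<close>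

lemma shift_transpose_UU: "h23 (h34 (k12 (k23 UU))) = UU"
proof -
  have "h34 (k23 UU) = h12 (k23 UU)"
    unfolding k23_def h_sub4 UU_shift h12_UU h34_UU ..
  then have "h34 (k12 (k23 UU)) = k12 (h12 (k23 UU))"
    unfolding k12_def h_sub4 h_far[symmetric] by simp
  then have "h34 (k12 (k23 UU)) = k23 UU"
    unfolding k_inverse .
  moreover have "h23 (k23 UU) = UU"
    unfolding k23_def h_sub4 h_quadratic by (simp add: sub4_def fun_eq_iff algebra_simps)
  ultimately show ?thesis by simp
qed

end

definition pair4 :: "nat set \<Rightarrow> fun4 \<Rightarrow> fun4 \<Rightarrow> qfield" where
  "pair4 V F G = (\<Sum>a\<in>V. \<Sum>b\<in>V. \<Sum>c\<in>V. \<Sum>d\<in>V. F a b c d * G a b c d)"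

text \<open>
  The exchange of two letters has a symmetric matrix, and the other terms of a Hecke generator are diagonal.
\<close>

lemma hh_symmetric:
  assumes "finite V"
  shows "(\<Sum>a\<in>V. \<Sum>b\<in>V. f a b * hh g a b) = (\<Sum>a\<in>V. \<Sum>b\<in>V. hh f a b * g a b)"
proof -
  have *: "f a b * hh g a b = (if a = b then qq * f a b * g a b else if a < b then dq * f a b * g a b else 0)
      + (if a \<noteq> b then f a b * g b a else 0)"
    "hh f a b * g a b = (if a = b then qq * f a b * g a b else if a < b then dq * f a b * g a b else 0)
      + (if a \<noteq> b then f b a * g a b else 0)" for a b
    by (auto simp: hh_def algebra_simps)
  have "(\<Sum>a\<in>V. \<Sum>b\<in>V. if a \<noteq> b then f a b * g b a else 0) = (\<Sum>a\<in>V. \<Sum>b\<in>V. if a \<noteq> b then f b a * g a b else 0)"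
    by (subst sum.swap) (intro sum.cong refl, auto)
  then show ?thesis
    unfolding * sum.distrib by simp
qed

lemma pair4_symmetric:
  assumes V: "finite V"
  shows "pair4 V F (h12 G) = pair4 V (h12 F) G" "pair4 V F (h23 G) = pair4 V (h23 F) G"
    "pair4 V F (h34 G) = pair4 V (h34 F) G"
proof -
  have sw: "(\<Sum>a\<in>V. \<Sum>b\<in>V. \<Sum>c\<in>V. \<Sum>d\<in>V. X a b c d) = (\<Sum>c\<in>V. \<Sum>d\<in>V. \<Sum>a\<in>V. \<Sum>b\<in>V. X a b c d)"
    "(\<Sum>a\<in>V. \<Sum>b\<in>V. \<Sum>c\<in>V. \<Sum>d\<in>V. X a b c d) = (\<Sum>a\<in>V. \<Sum>d\<in>V. \<Sum>b\<in>V. \<Sum>c\<in>V. X a b c d)"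
    for X :: "nat \<Rightarrow> nat \<Rightarrow> nat \<Rightarrow> nat \<Rightarrow> qfield"
  proof -
    have mv: "(\<Sum>b\<in>V. \<Sum>c\<in>V. \<Sum>d\<in>V. Z b c d) = (\<Sum>c\<in>V. \<Sum>d\<in>V. \<Sum>b\<in>V. Z b c d)"
      for Z :: "nat \<Rightarrow> nat \<Rightarrow> nat \<Rightarrow> qfield"
    proof -
      have "(\<Sum>b\<in>V. \<Sum>c\<in>V. \<Sum>d\<in>V. Z b c d) = (\<Sum>c\<in>V. \<Sum>b\<in>V. \<Sum>d\<in>V. Z b c d)"
        by (rule sum.swap)
      also have "\<dots> = (\<Sum>c\<in>V. \<Sum>d\<in>V. \<Sum>b\<in>V. Z b c d)"
        by (rule sum.cong[OF refl], rule sum.swap)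
      finally show ?thesis .
    qed
    have "(\<Sum>a\<in>V. \<Sum>b\<in>V. \<Sum>c\<in>V. \<Sum>d\<in>V. X a b c d) = (\<Sum>a\<in>V. \<Sum>c\<in>V. \<Sum>d\<in>V. \<Sum>b\<in>V. X a b c d)"
      by (rule sum.cong[OF refl], rule mv)
    also have "\<dots> = (\<Sum>c\<in>V. \<Sum>d\<in>V. \<Sum>a\<in>V. \<Sum>b\<in>V. X a b c d)"
      by (rule mv)
    finally show "(\<Sum>a\<in>V. \<Sum>b\<in>V. \<Sum>c\<in>V. \<Sum>d\<in>V. X a b c d) = (\<Sum>c\<in>V. \<Sum>d\<in>V. \<Sum>a\<in>V. \<Sum>b\<in>V. X a b c d)" .
    show "(\<Sum>a\<in>V. \<Sum>b\<in>V. \<Sum>c\<in>V. \<Sum>d\<in>V. X a b c d) = (\<Sum>a\<in>V. \<Sum>d\<in>V. \<Sum>b\<in>V. \<Sum>c\<in>V. X a b c d)"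
    proof (rule sum.cong[OF refl])
      fix a
      have "(\<Sum>b\<in>V. \<Sum>c\<in>V. \<Sum>d\<in>V. X a b c d) = (\<Sum>b\<in>V. \<Sum>d\<in>V. \<Sum>c\<in>V. X a b c d)"
        by (rule sum.cong[OF refl], rule sum.swap)
      also have "\<dots> = (\<Sum>d\<in>V. \<Sum>b\<in>V. \<Sum>c\<in>V. X a b c d)"
        by (rule sum.swap)
      finally show "(\<Sum>b\<in>V. \<Sum>c\<in>V. \<Sum>d\<in>V. X a b c d) = (\<Sum>d\<in>V. \<Sum>b\<in>V. \<Sum>c\<in>V. X a b c d)" .
    qed
  qed
  show "pair4 V F (h12 G) = pair4 V (h12 F) G"
    unfolding pair4_def
    by (subst (1 2) sw(1)) (unfold h12_def, intro sum.cong refl hh_symmetric V)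
  show "pair4 V F (h23 G) = pair4 V (h23 F) G"
    unfolding pair4_def
    by (subst (1 2) sw(2)) (unfold h23_def, intro sum.cong refl hh_symmetric V)
  show "pair4 V F (h34 G) = pair4 V (h34 F) G"
    unfolding pair4_def h34_def by (intro sum.cong refl hh_symmetric V)
qed

lemma pair4_sub: "pair4 V F (sub4 G k H) = pair4 V F G - k * pair4 V F H"
  "pair4 V (sub4 G k H) F = pair4 V G F - k * pair4 V H F"
  by (simp_all add: pair4_def sub4_def sum_subtractf sum_distrib_left algebra_simps)

lemma pair4_k:
  assumes "finite V"
  shows "pair4 V F (k12 G) = pair4 V (k12 F) G" "pair4 V F (k23 G) = pair4 V (k23 F) G"
  by (simp_all add: k12_def k23_def pair4_sub pair4_symmetric[OF assms])

context brauer_coeffs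
begin

definition inv_H :: "nat \<Rightarrow> nat list vec \<Rightarrow> nat list vec" where
  "inv_H k f w = opH k f w - dq * f w"

definition shift_op :: "nat list vec \<Rightarrow> nat list vec" where
  "shift_op f = inv_H 1 (inv_H 0 (opH 2 (opH 1 f)))"

lemma slice_h:
  "opH 0 f (a # b # c # d # v) = h12 (\<lambda>a b c d. f (a # b # c # d # v)) a b c d"
  "opH 1 f (a # b # c # d # v) = h23 (\<lambda>a b c d. f (a # b # c # d # v)) a b c d"
  "opH 2 f (a # b # c # d # v) = h34 (\<lambda>a b c d. f (a # b # c # d # v)) a b c d"
  "inv_H 0 f (a # b # c # d # v) = k12 (\<lambda>a b c d. f (a # b # c # d # v)) a b c d"
  "inv_H 1 f (a # b # c # d # v) = k23 (\<lambda>a b c d. f (a # b # c # d # v)) a b c d"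
proof -
  show "opH 0 f (a # b # c # d # v) = h12 (\<lambda>a b c d. f (a # b # c # d # v)) a b c d"
    and "opH 1 f (a # b # c # d # v) = h23 (\<lambda>a b c d. f (a # b # c # d # v)) a b c d"
    by (simp_all add: h12_def h23_def)
  then show "inv_H 0 f (a # b # c # d # v) = k12 (\<lambda>a b c d. f (a # b # c # d # v)) a b c d"
    and "inv_H 1 f (a # b # c # d # v) = k23 (\<lambda>a b c d. f (a # b # c # d # v)) a b c d"
    by (simp_all add: k12_def k23_def sub4_def inv_H_def)
  show "opH 2 f (a # b # c # d # v) = h34 (\<lambda>a b c d. f (a # b # c # d # v)) a b c d"
    by (simp add: h34_def numeral_2_eq_2)
qed

lemma slice_shift: "shift_op f (a # b # c # d # v) = shift4 (\<lambda>a b c d. f (a # b # c # d # v)) a b c d"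
  unfolding shift_op_def shift4_def slice_h ..

definition supp4 :: "nat set \<Rightarrow> fun4 \<Rightarrow> bool" where
  "supp4 L F \<longleftrightarrow> (\<forall>a b c d. \<not> {a, b, c, d} \<subseteq> L \<longrightarrow> F a b c d = 0)"

lemma supp4_shift: "supp4 L F \<Longrightarrow> supp4 L (shift4 F)"
proof -
  have h: "supp4 L (h12 F)" "supp4 L (h23 F)" "supp4 L (h34 F)" "supp4 L (k12 F)" "supp4 L (k23 F)" if "supp4 L F" for F
    using that by (simp_all add: supp4_def h12_def h23_def h34_def k12_def k23_def sub4_def hh_def) blast
  show "supp4 L F \<Longrightarrow> supp4 L (shift4 F)" unfolding shift4_def by (intro h)
qed

definition e2_op :: "nat list vec \<Rightarrow> nat list vec" where
  "e2_op f = ope (shift_op (ope f))"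

definition theta_theta :: "nat list vec \<Rightarrow> nat list vec" where
  "theta_theta f v = (\<Sum>x\<in>letters_upto m. \<Sum>y\<in>letters_upto m. t x * t y * f (x # partner x # y # partner y # v))"

lemma tens4:
  assumes "f \<in> tens m (Suc (Suc (Suc (Suc n))))"
  shows "supp4 (letters_upto m) (\<lambda>a b c d. f (a # b # c # d # v))"
  using assms by (auto simp: supp4_def tens_def indices_def)

text \<open>
  Although \<open>e\<^sub>(\<^sub>2\<^sub>)\<close> is built from contractions of the first two factors only, it contracts the factors \<open>1, 2\<close>
  and \<open>3, 4\<close> at once.
\<close>

lemma e2_op_apply:
  assumes f: "f \<in> tens m (Suc (Suc (Suc (Suc n))))"
  shows "e2_op f (a # b # c # d # v) = UU a b c d * theta_theta f v"
proof -
  define g where "g c d = theta f (c # d # v)" for c d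
  have F: "(\<lambda>a b c d. ope f (a # b # c # d # v)) = FU g"
    by (simp add: fun_eq_iff FU_def g_def)
  have th: "theta (shift_op (ope f)) (c # d # v) = theta4 (shift4 (FU g)) c d"
    unfolding theta_def[of "shift_op (ope f)"] theta4_def slice_shift F ..
  also have "\<dots> = U c d * theta2 g"
  proof (cases "c \<in> letters_upto m \<and> d \<in> letters_upto m")
    case True
    then show ?thesis by (simp add: theta_shift)
  next
    case False
    have "g c d = 0" if "\<not> {c, d} \<subseteq> letters_upto m" for c d
      using tens4[OF f, of v] that by (auto simp: g_def theta_def supp4_def intro!: sum.neutral)
    then have "supp4 (letters_upto m) (FU g)"
      using partner_mem by (auto simp: supp4_def FU_def U_def)
    then have S: "supp4 (letters_upto m) (shift4 (FU g))" by (rule supp4_shift)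
    have "shift4 (FU g) a b c d = 0" for a b
      using S[unfolded supp4_def, rule_format, of a b c d] False by auto
    then have "theta4 (shift4 (FU g)) c d = 0"
      by (simp add: theta4_def)
    moreover have "U c d = 0"
      using False partner_mem by (auto simp: U_def)
    ultimately show ?thesis by simp
  qed
  also have "theta2 g = theta_theta f v"
    unfolding theta2_def theta_theta_def g_def theta_def sum_distrib_left
    by (subst sum.swap) (simp add: mult.assoc mult.left_commute)
  finally show ?thesis
    by (simp add: e2_op_def UU_def mult.assoc)
qed

lemma theta_theta_pair4:
  assumes "\<And>x y. cf x y = (if y = partner x then t x else 0)"
  shows "theta_theta f v = pair4 (letters_upto m) (\<lambda>a b c d. cf a b * cf c d) (\<lambda>a b c d. f (a # b # c # d # v))"
proof -
  have in1: "(\<Sum>b\<in>letters_upto m. if b = partner a then F b else 0) = F (partner a)"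
    if "a \<in> letters_upto m" for a and F :: "nat \<Rightarrow> qfield"
    using partner_mem[OF that] by simp
  have "(\<Sum>b\<in>letters_upto m. \<Sum>c\<in>letters_upto m. \<Sum>d\<in>letters_upto m. cf a b * cf c d * f (a # b # c # d # v))
      = (\<Sum>y\<in>letters_upto m. t a * t y * f (a # partner a # y # partner y # v))"
    if a: "a \<in> letters_upto m" for a
  proof -
    have "(\<Sum>d\<in>letters_upto m. cf a b * cf c d * f (a # b # c # d # v))
        = cf a b * t c * f (a # b # c # partner c # v)" if "c \<in> letters_upto m" for b c
    proof -
      have "cf a b * cf c d * f (a # b # c # d # v) = (if d = partner c then cf a b * t c * f (a # b # c # d # v) else 0)" for d
        by (simp add: assms)
      then show ?thesis by (simp only: in1[OF that])
    qed
    then have "(\<Sum>b\<in>letters_upto m. \<Sum>c\<in>letters_upto m. \<Sum>d\<in>letters_upto m. cf a b * cf c d * f (a # b # c # d # v))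
      = (\<Sum>b\<in>letters_upto m. if b = partner a then (\<Sum>c\<in>letters_upto m. t a * t c * f (a # b # c # partner c # v)) else 0)"
      by (intro sum.cong refl) (simp add: assms)
    also have "\<dots> = (\<Sum>y\<in>letters_upto m. t a * t y * f (a # partner a # y # partner y # v))"
      by (rule in1[OF a])
    finally show ?thesis .
  qed
  then show ?thesis
    unfolding theta_theta_def pair4_def by simp
qed

lemma brauer_coeffs_t: "brauer_coeffs m t u"
  using m1 t_even u_even tu by unfold_locales (simp_all add: mult.commute)

text \<open>
  The Hecke generators have symmetric matrices, so \<open>shift_op\<close> can be moved to the coefficients \<open>t \<otimes> t\<close>, which
  its transpose fixes because \<open>t\<close> satisfies the assumptions made on \<open>u\<close>.
\<close>

lemma theta_theta_shift: "theta_theta (shift_op f) v = theta_theta f v"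
proof -
  interpret T: brauer_coeffs m t u by (rule brauer_coeffs_t)
  let ?V = "letters_upto m"
  let ?G = "\<lambda>a b c d. f (a # b # c # d # v)"
  define cf where "cf x y = (if y = partner x then t x else 0)" for x y
  have TU: "pair4 ?V (\<lambda>a b c d. cf a b * cf c d) G = pair4 ?V T.UU G" for G
    unfolding pair4_def by (intro sum.cong refl) (simp add: cf_def T.UU_def T.U_def)
  have "theta_theta (shift_op f) v = pair4 ?V T.UU (shift4 ?G)"
    unfolding theta_theta_pair4[OF cf_def] TU slice_shift ..
  also have "\<dots> = pair4 ?V (h23 (h34 (k12 (k23 T.UU)))) ?G"
    unfolding shift4_def by (simp add: pair4_k pair4_symmetric)
  also have "\<dots> = theta_theta f v"
    unfolding T.shift_transpose_UU theta_theta_pair4[OF cf_def] TU ..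
  finally show ?thesis .
qed

lemma inv_H_tens: "Suc k < n \<Longrightarrow> f \<in> tens m n \<Longrightarrow> inv_H k f \<in> tens m n"
  using opH_tens[of k n f m] by (simp add: tens_def inv_H_def)

lemma shift_tens: "n \<ge> 4 \<Longrightarrow> f \<in> tens m n \<Longrightarrow> shift_op f \<in> tens m n"
  unfolding shift_op_def by (intro opH_tens inv_H_tens) auto

lemma e2_tens: "n \<ge> 4 \<Longrightarrow> f \<in> tens m n \<Longrightarrow> e2_op f \<in> tens m n"
  unfolding e2_op_def by (intro ope_tens shift_tens) auto

lemma e2_relations:
  assumes n: "n \<ge> 4" and f: "f \<in> tens m n"
  shows "e2_op (shift_op f) = e2_op f" "shift_op (e2_op f) = e2_op f"
proof -
  define k where "k = n - 4"
  have k: "n = Suc (Suc (Suc (Suc k)))" using n by (simp add: k_def)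
  note f' = f[unfolded k] and sf = shift_tens[OF n f, unfolded k]
  show "e2_op (shift_op f) = e2_op f"
  proof
    fix w
    show "e2_op (shift_op f) w = e2_op f w"
    proof (cases "length w = n")
      case True
      then obtain a b c d v where w: "w = a # b # c # d # v" using n by (metis length4E)
      show ?thesis unfolding w e2_op_apply[OF f'] e2_op_apply[OF sf] theta_theta_shift ..
    next
      case False
      then show ?thesis
        using e2_tens[OF n f] e2_tens[OF n shift_tens[OF n f]] by (auto simp: tens_def indices_def)
    qed
  qed
  show "shift_op (e2_op f) = e2_op f"
  proof
    fix w
    show "shift_op (e2_op f) w = e2_op f w"
    proof (cases "length w = n")
      case True
      then obtain a b c d v where w: "w = a # b # c # d # v" using n by (metis length4E)
      have "(\<lambda>a b c d. e2_op f (a # b # c # d # v)) = (\<lambda>a b c d. theta_theta f v * UU a b c d)"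
        by (simp add: e2_op_apply[OF f'] mult.commute)
      moreover have "shift4 (\<lambda>a b c d. r * UU a b c d) = (\<lambda>a b c d. r * shift4 UU a b c d)" for r
        by (simp add: shift4_def k12_def k23_def sub4_def h_defs hh_def fun_eq_iff algebra_simps)
      ultimately show ?thesis
        unfolding w slice_shift by (simp add: shift_UU e2_op_apply[OF f'] mult.commute)
    next
      case False
      then show ?thesis
        using e2_tens[OF n f] shift_tens[OF n e2_tens[OF n f]] by (auto simp: tens_def indices_def)
    qed
  qed
qed

end

section \<open>The module over the \<open>q\<close>-Brauer algebra\<close>

text \<open>
  The coefficients in the formula for \<open>e\<close> factor into a part depending on the output letter and one
  depending on the input letter.
\<close>

definition u_coeff :: "(nat \<Rightarrow> qfield) \<Rightarrow> nat \<Rightarrow> qfield" where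
  "u_coeff \<sigma> a = (let j = (a + 1) div 2 in
     (if odd a then 1 else - qq) * (inverse (kappa \<sigma> j) * qq powi (- int j)))"

definition t_coeff :: "nat \<Rightarrow> (nat \<Rightarrow> qfield) \<Rightarrow> nat \<Rightarrow> qfield" where
  "t_coeff m \<sigma> a = (let i = (a + 1) div 2 in
     (if odd a then 1 else - qq) * (kappa \<sigma> i * qq powi (2 * int m + 1 - 3 * int i)))"

text \<open>
  Nonzero parameters make the coefficients \<open>\<kappa>\<^sub>i\<close> invertible.
\<close>

locale brauer_action =
  fixes m n :: nat and \<sigma> :: "nat \<Rightarrow> qfield"
  assumes m: "m \<ge> 1" and n: "n \<ge> 2"
    and \<sigma>: "\<And>i. \<lbrakk>even i; 2 \<le> i; i \<le> 2*m-2\<rbrakk> \<Longrightarrow> \<sigma> i \<noteq> 0"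
begin

lemma kappa_nz: "i \<le> m \<Longrightarrow> kappa \<sigma> i \<noteq> 0"
proof -
  assume i: "i \<le> m"
  have "\<sigma> (2 * a) \<noteq> 0" if "a \<in> {1..i - 1}" for a
    using that i by (intro \<sigma>) auto
  then show ?thesis
    unfolding kappa_def by auto
qed

end

sublocale brauer_action \<subseteq> C: brauer_coeffs m "u_coeff \<sigma>" "t_coeff m \<sigma>"
proof
  show "1 \<le> m" by (rule m)
  fix i assume i: "i \<in> {1..m}"
  have d: "(2*i - 1 + 1) div 2 = i" "(2*i + 1) div 2 = i" "odd (2*i - 1)" using i by auto
  show "u_coeff \<sigma> (2*i) = - qq * u_coeff \<sigma> (2*i - 1)" "t_coeff m \<sigma> (2*i) = - qq * t_coeff m \<sigma> (2*i - 1)"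
    unfolding u_coeff_def t_coeff_def Let_def d using d by simp_all
  have "qq powi (2 * int m + 1 - 3 * int i) * qq powi (- int i) = qq powi (2 * int m + 1 - 4 * int i)"
    using qq_nz by (subst power_int_add[symmetric]) auto
  moreover have kk: "kappa \<sigma> i * A * (inverse (kappa \<sigma> i) * B) = A * B" for A B
    using kappa_nz[of i] i by (simp add: field_simps)
  ultimately show "t_coeff m \<sigma> (2*i - 1) * u_coeff \<sigma> (2*i - 1) = qq powi (2 * int m + 1 - 4 * int i)"
    unfolding u_coeff_def t_coeff_def Let_def d using d(3) by (simp only: if_True mult_1 kk not_False_eq_True)
qed

context brauer_action
begin

lemma e_pair_apply:
  assumes i: "i \<in> {1..m}"
  shows "e_pair m \<sigma> i v (a # b # v') = (if v' = v then t_coeff m \<sigma> (2*i - 1) * C.U a b else 0)"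
proof -
  let ?T = "kappa \<sigma> i * qq powi (2 * int m + 1 - 3 * int i)"
  have T: "t_coeff m \<sigma> (2*i - 1) = ?T"
  proof -
    have d: "(2*i - 1 + 1) div 2 = i" "odd (2*i - 1)" using i by auto
    show ?thesis unfolding t_coeff_def Let_def d using d by simp
  qed
  have co: "kappa \<sigma> i * inverse (kappa \<sigma> j) * qq powi (2 * int m + 1 - 3 * int i - int j)
      = ?T * (inverse (kappa \<sigma> j) * qq powi (- int j))" for j
  proof -
    have "qq powi (2 * int m + 1 - 3 * int i) * qq powi (- int j) = qq powi (2 * int m + 1 - 3 * int i - int j)"
      using qq_nz by (subst power_int_add[symmetric]) auto
    then show ?thesis by (simp only: ac_simps)
  qed
  let ?w = "\<lambda>j. inverse (kappa \<sigma> j) * qq powi (- int j)"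
  have "e_pair m \<sigma> i v (a # b # v') = (\<Sum>j=1..m. ?T * ?w j *
      ((if a = 2*j - 1 \<and> b = 2*j \<and> v' = v then 1 else 0) - qq * (if a = 2*j \<and> b = 2*j - 1 \<and> v' = v then 1 else 0)))"
    unfolding e_pair_def sum_fun co by (simp add: smul_def basis_vec_def)
  also have "\<dots> = (if v' = v then ?T * C.U a b else 0)"
  proof (cases "a \<in> letters_upto m \<and> b = partner a \<and> v' = v")
    case True
    then obtain k where k: "k \<in> {1..m}" "a = 2*k - 1 \<and> b = 2*k \<or> a = 2*k \<and> b = 2*k - 1"
      by (metis C.letter_cases)
    have k1: "k \<ge> 1" using k by auto
    have eqs: "2*k - 1 = 2*j - 1 \<longleftrightarrow> j = k" "2*k = 2*j \<longleftrightarrow> j = k" "2*k - 1 \<noteq> 2*j" "2*k \<noteq> 2*j - 1" if "j \<ge> 1" for j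
      using that k1 by presburger+
    have d: "(2*k - 1 + 1) div 2 = k" "(2*k + 1) div 2 = k" "odd (2*k - 1)" using k1 by auto
    have "(\<Sum>j=1..m. ?T * ?w j *
      ((if a = 2*j - 1 \<and> b = 2*j \<and> v' = v then 1 else 0) - qq * (if a = 2*j \<and> b = 2*j - 1 \<and> v' = v then 1 else 0)))
      = (\<Sum>j=1..m. if j = k then ?T * u_coeff \<sigma> a else 0)"
    proof (rule sum.cong[OF refl])
      fix j assume "j \<in> {1..m}"
      then have "j \<ge> 1" by simp
      note eqs[OF this]
      then show "?T * ?w j * ((if a = 2*j - 1 \<and> b = 2*j \<and> v' = v then 1 else 0)
          - qq * (if a = 2*j \<and> b = 2*j - 1 \<and> v' = v then 1 else 0)) = (if j = k then ?T * u_coeff \<sigma> a else 0)"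
        using k(2) True d by (elim disjE conjE) (simp_all only: u_coeff_def Let_def, simp_all)
    qed
    also have "\<dots> = ?T * u_coeff \<sigma> a"
      using k(1) by simp
    finally show ?thesis
      using True by (simp add: C.U_def)
  next
    case False
    have no: "(a = 2*j - 1 \<and> b = 2*j \<and> v' = v) = False" "(a = 2*j \<and> b = 2*j - 1 \<and> v' = v) = False" if "j \<in> {1..m}" for j
      using False that by (auto simp: partner_def)
    have "(\<Sum>j=1..m. ?T * ?w j *
      ((if a = 2*j - 1 \<and> b = 2*j \<and> v' = v then 1 else 0) - qq * (if a = 2*j \<and> b = 2*j - 1 \<and> v' = v then 1 else 0))) = 0"
    proof (intro sum.neutral ballI)
      fix j assume "j \<in> {1..m}"
      note no[OF this]
      then show "?T * ?w j * ((if a = 2*j - 1 \<and> b = 2*j \<and> v' = v then 1 else 0)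
          - qq * (if a = 2*j \<and> b = 2*j - 1 \<and> v' = v then 1 else 0)) = 0"
        by (simp only: if_False mult_zero_right diff_0_right)
    qed
    then show ?thesis using False by (auto simp: C.U_def)
  qed
  finally show ?thesis by (simp only: T)
qed

text \<open>
  The two orders of a pair of partners in the definition of the action of \<open>e\<close> are uniform in terms of
  \<open>t_coeff\<close>, whose values on even letters absorb the factor \<open>- q\<close>.
\<close>

lemma e_basis_apply:
  assumes x: "x \<in> letters_upto m"
  shows "e_basis m \<sigma> (x # y # v) (a # b # v')
    = (if y = partner x \<and> v' = v then t_coeff m \<sigma> x * C.U a b else 0)"
  using x
proof (cases rule: C.letter_cases)
  case (1 i)
  have o: "odd x" "x + 1 = 2*i" using 1 by auto
  have y: "(odd y \<and> x = y + 1) = False" using o by auto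
  show ?thesis
    using e_pair_apply[OF 1(1), of v a b v'] 1 o y by (auto simp: partner_def)
next
  case (2 i)
  have o: "even x" using 2 by auto
  have t: "t_coeff m \<sigma> x = - qq * t_coeff m \<sigma> (2*i - 1)"
    using C.t_even[OF 2(1)] 2 by simp
  have y: "(odd y \<and> x = y + 1) \<longleftrightarrow> y = partner x" using 2 by (auto simp: partner_def)
  show ?thesis
    using e_pair_apply[OF 2(1), of v a b v'] o t 2 unfolding e_basis.simps y by (auto simp: smul_def)
qed

lemma brauer_op_e:
  assumes f: "f \<in> tens m n"
  shows "brauer_op m n \<sigma> Be f = C.ope f"
proof
  fix w
  let ?X = "indices m n"
  define k where "k = n - 2"
  have k: "n = Suc (Suc k)" using n by (simp add: k_def)
  have B: "brauer_op m n \<sigma> Be f w = (\<Sum>z\<in>?X. f z * e_basis m \<sigma> z w)"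
    by (simp add: lin_ext_def sum_fun smul_def)
  have X: "\<exists>x y v. z = x # y # v \<and> x \<in> letters_upto m" if "z \<in> ?X" for z
    using that by (cases z; cases "tl z") (auto simp: indices_def k)
  show "brauer_op m n \<sigma> Be f w = C.ope f w"
  proof (cases "\<exists>a b v'. w = a # b # v'")
    case False
    have short: "(x # y # v = w) = False" "(w = x # y # v) = False" for x y :: nat and v using False by auto
    have "e_basis m \<sigma> z w = 0" if "z \<in> ?X" for z
      using X[OF that] short by (auto simp: e_pair_def sum_fun smul_def basis_vec_def)
    moreover have "C.ope f w = 0"
      using False by (metis list.exhaust C.ope.simps(2,3))
    ultimately show ?thesis unfolding B by simp
  next
    case True
    then obtain a b v' where w: "w = a # b # v'" by blast
    let ?I = "{x \<in> letters_upto m. x # partner x # v' \<in> ?X}"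
    have "(\<Sum>z\<in>?X. f z * e_basis m \<sigma> z w) = (\<Sum>z\<in>(\<lambda>x. x # partner x # v') ` ?I. f z * e_basis m \<sigma> z w)"
    proof (rule sum.mono_neutral_right[OF finite_indices])
      show "\<forall>z\<in>?X - (\<lambda>x. x # partner x # v') ` ?I. f z * e_basis m \<sigma> z w = 0"
        proof
        fix z assume z: "z \<in> ?X - (\<lambda>x. x # partner x # v') ` ?I"
        then obtain x y v where xy: "z = x # y # v" "x \<in> letters_upto m" using X by blast
        then have no: "(y = partner x \<and> v' = v) = False" using z by auto
        show "f z * e_basis m \<sigma> z w = 0"
          unfolding w xy(1) e_basis_apply[OF xy(2)] no by simp
      qed
    qed auto
    also have "\<dots> = (\<Sum>x\<in>?I. f (x # partner x # v') * (t_coeff m \<sigma> x * C.U a b))"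
      by (subst sum.reindex) (auto simp: inj_on_def w e_basis_apply simp del: e_basis.simps)
    also have "\<dots> = (\<Sum>x\<in>letters_upto m. f (x # partner x # v') * (t_coeff m \<sigma> x * C.U a b))"
      using f by (intro sum.mono_neutral_left) (auto simp: tens_def)
    also have "\<dots> = C.ope f w"
      by (simp add: w C.theta_def sum_distrib_left ac_simps)
    finally show ?thesis unfolding B .
  qed
qed

definition bact :: "bgen free \<Rightarrow> nat list vec \<Rightarrow> nat list vec" where
  "bact = free_ract (brauer_op m n \<sigma>)"

lemma lin_ext_lin: "lin_op (lin_ext A \<beta>)"
  by (simp add: lin_op_def lin_ext_def sum_fun smul_def fun_eq_iff sum.distrib sum_distrib_left algebra_simps)

lemma brauer_op_lin: "lin_op (brauer_op m n \<sigma> g)"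
  by (cases g) (simp_all add: lin_ext_lin)

lemma bact_mult: "bact (p * q) f = bact q (bact p f)"
  unfolding bact_def free_ract_word
  by (rule word_act_mult_right) (simp_all add: lin_op_fold brauer_op_lin)

lemma bact_basic:
  "bact (p + q) f = (\<lambda>u. bact p f u + bact q f u)"
  "bact (p - q) f = (\<lambda>u. bact p f u - bact q f u)"
  "bact 1 f = f" "bact 0 f = (\<lambda>u. 0)" "bact (scal c) f = (\<lambda>u. c * f u)"
  "bact (gen g) f = brauer_op m n \<sigma> g f"
  unfolding bact_def free_ract_word
  by (simp_all add: word_act_add word_act_diff word_act_one word_act_zero word_act_scal word_act_gen)

lemma bact_lin: "lin_op (bact p)"
  unfolding bact_def free_ract_word by (intro word_act_lin lin_op_fold brauer_op_lin)

lemma bgens_cases: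
  assumes "g \<in> bgens n"
  obtains "g = Be" | k where "g = BH (Suc k)" "Suc k < n"
proof -
  have "g = Be \<or> (\<exists>i. g = BH i \<and> 1 \<le> i \<and> i \<le> n - 1)" using assms by (auto simp: bgens_def)
  moreover have "\<exists>k. i = Suc k \<and> Suc k < n" if "1 \<le> i" "i \<le> n - 1" for i
    using that n by (intro exI[of _ "i - 1"]) auto
  ultimately show ?thesis using that by blast
qed

lemma brauer_op_tens: "g \<in> bgens n \<Longrightarrow> f \<in> tens m n \<Longrightarrow> brauer_op m n \<sigma> g f \<in> tens m n"
  by (erule bgens_cases)
     (simp_all only: brauer_op_e brauer_op_H C.ope_tens[OF n] opH_tens)

lemma bact_tens: "p \<in> carrier (free_alg (bgens n)) \<Longrightarrow> f \<in> tens m n \<Longrightarrow> bact p f \<in> tens m n"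
  unfolding bact_def free_ract_word
proof (rule word_act_tens)
  show "fold (brauer_op m n \<sigma>) xs f \<in> tens m n" if "set xs \<subseteq> bgens n" "f \<in> tens m n" for xs f
    using that by (induction xs arbitrary: f) (auto simp: brauer_op_tens simp del: brauer_op.simps)
qed

end

context brauer_action
begin

lemma bact_H: "Suc k < n \<Longrightarrow> f \<in> tens m n \<Longrightarrow> bact (HH (Suc k)) f = opH k f"
  by (simp add: bact_basic brauer_op_H del: brauer_op.simps)

lemma bact_e: "f \<in> tens m n \<Longrightarrow> bact ee f = C.ope f"
  by (simp add: bact_basic brauer_op_e del: brauer_op.simps)

lemma x_diff: "- inverse qq - inverse (- inverse qq) = dq"
  by simp

lemma bact_Hinv: "Suc k < n \<Longrightarrow> f \<in> tens m n \<Longrightarrow> bact (HHinv (- inverse qq) (Suc k)) f = C.inv_H k f"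
  unfolding HHinv_def x_diff by (simp add: bact_basic(2,5) bact_H C.inv_H_def fun_eq_iff)

lemma brels_carrier: "brels n x z \<subseteq> carrier (free_alg (bgens n))"
proof -
  note gens = free_alg_closed(1-8)
  have H: "HH i \<in> carrier (free_alg (bgens n))" if "i \<in> {1..n-1}" for i
    using that by (intro gens) (auto simp: bgens_def)
  have H': "HH (Suc i) \<in> carrier (free_alg (bgens n))" if "Suc i \<in> {1..n-1}" for i
    by (rule H[OF that])
  have e: "ee \<in> carrier (free_alg (bgens n))"
    by (intro gens) (auto simp: bgens_def)
  show ?thesis
    unfolding brels_def Let_def e2_def HHinv_def
    by (auto intro!: gens e H)
qed

lemma brauer_module: "presented_module (bgens n) (brels n (- inverse qq) (qq ^ (2*m))) bact m n"
proof
  show "brels n (- inverse qq) (qq ^ (2*m)) \<subseteq> carrier (free_alg (bgens n))"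
    by (rule brels_carrier)
  show "bact r f = (\<lambda>u. 0)" if r: "r \<in> brels n (- inverse qq) (qq ^ (2*m))" and f: "f \<in> tens m n" for r f
  proof -
    note tens = f opH_tens C.ope_tens[OF n] C.inv_H_tens
    have len: "w = w" for w :: "nat list" ..
    have zero: "g \<in> tens m n \<Longrightarrow> length w \<noteq> n \<Longrightarrow> g w = 0" for g and w
      by (auto simp: tens_def indices_def)
    have sc: "(\<lambda>u. c * g u) \<in> tens m n" if "g \<in> tens m n" for c g
      using tens_scale that .
    have idx: "\<exists>k. i = Suc k \<and> Suc k < n" if "i \<in> {1..n-1}" for i
      using that n by (intro exI[of _ "i - 1"]) auto
    show ?thesis
      using r unfolding brels_def Let_def
    proof (elim UnE CollectE exE conjE, goal_cases)
      case (1 i)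
      then obtain k where k: "i = Suc k" "Suc k < n" using idx by blast
      have inv: "inverse (- inverse qq) = - qq" by simp
      define g where "g = (\<lambda>u. opH k f u - - inverse qq * f u)"
      have g: "bact (HH i - scal (- inverse qq)) f = g"
        unfolding k bact_basic(2,5) bact_H[OF k(2) f] g_def ..
      have gt: "g \<in> tens m n"
        using opH_tens[OF k(2) f] f by (simp add: g_def tens_def)
      have "opH k g w + - qq * g w = 0" for w
      proof (cases "length w = n")
        case True
        have "opH k g w = opH k (opH k f) w + inverse qq * opH k f w"
          unfolding g_def using opH_comb[of k "opH k f" "inverse qq" f w] by simp
        then show ?thesis
          using opH_quadratic[of k w f] True k(2) by (simp add: g_def algebra_simps qq_cancel)
      next
        case False
        then show ?thesis by (simp add: zero[OF gt] zero[OF opH_tens[OF k(2) gt]])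
      qed
      then show ?case
        unfolding 1(1) bact_mult g bact_basic(1,5) inv unfolding k(1) bact_H[OF k(2) gt] by simp
    next
      case (2 i)
      then obtain k where k: "i = Suc k" "Suc k < n" using idx by blast
      have k': "Suc (Suc k) < n" using 2(3) k by simp
      show ?case
        unfolding 2(1) k
        by (simp add: bact_basic(2) bact_mult bact_H tens k k' opH_braid)
    next
      case (3 i j)
      obtain k where k: "i = Suc k" "Suc k < n" using idx 3 by blast
      obtain l where l: "j = Suc l" "Suc l < n" using idx 3 by blast
      have "opH k (opH l f) = opH l (opH k f)"
      proof -
        have "k + Suc (Suc (l - k - 2)) = l \<or> l + Suc (Suc (k - l - 2)) = k"
          using 3(4) k l by auto
        then show ?thesis
          using opH_far[of k "l - k - 2" f] opH_far[of l "k - l - 2" f] by (metis ext)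
      qed
      then show ?case
        unfolding 3(1) k l by (simp add: bact_basic(2) bact_mult bact_H tens k l)
    next
      case 4
      then have r: "r = ee * ee - scal ((qq ^ (2*m) - inverse (qq ^ (2*m))) / (- inverse qq - inverse (- inverse qq))) * ee"
        by simp
      have "C.ope (C.ope f) = (\<lambda>w. ((qq ^ (2*m) - inverse (qq ^ (2*m))) / dq) * C.ope f w)"
        by (intro ext) (rule C.ope_square)
      moreover have "C.ope (\<lambda>w. c * f w) = (\<lambda>w. c * C.ope f w)" for c
        using C.ope_comb[of "\<lambda>_. 0" c f] by (simp add: C.ope_zero fun_eq_iff)
      ultimately show ?case
        unfolding r x_diff bact_basic(2,5) bact_mult bact_e[OF f] bact_e[OF C.ope_tens[OF n f]] bact_e[OF sc[OF f]]
        by (simp only: diff_self)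
    next
      case 5
      then have r: "r = HH 1 * ee - scal (- inverse qq) * ee \<or> r = ee * HH 1 - scal (- inverse qq) * ee"
        by (auto split: if_splits)
      have n1: "Suc 0 < n" using n by simp
      have sce: "C.ope (\<lambda>w. c * f w) = (\<lambda>w. c * C.ope f w)" for c
        using C.ope_comb[of "\<lambda>_. 0" c f] by (simp add: C.ope_zero fun_eq_iff)
      have H1: "bact (HH 1) g = opH 0 g" if "g \<in> tens m n" for g
        using bact_H[OF n1 that] by simp
      have sc1: "(\<lambda>u. - inverse qq * f u) \<in> tens m n" by (rule sc[OF f])
      from r show ?case
      proof
        assume r: "r = HH 1 * ee - scal (- inverse qq) * ee"
        show ?thesis
          unfolding r bact_basic(2,5) bact_mult H1[OF f] bact_e[OF opH_tens[OF n1 f]] bact_e[OF sc1] sce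
          by (simp add: C.ope_opH0)
      next
        assume r: "r = ee * HH 1 - scal (- inverse qq) * ee"
        show ?thesis
          unfolding r bact_basic(2,5) bact_mult bact_e[OF f] H1[OF C.ope_tens[OF n f]] bact_e[OF sc1] sce
          by (simp add: C.opH0_ope)
      qed
    next
      case 6
      then have r: "r = ee * HH 2 * ee - scal (qq ^ (2*m)) * ee" and n3: "3 \<le> n"
        by (auto split: if_splits)
      have sce: "C.ope (\<lambda>w. c * f w) = (\<lambda>w. c * C.ope f w)" for c
        using C.ope_comb[of "\<lambda>_. 0" c f] by (simp add: C.ope_zero fun_eq_iff)
      have H2: "bact (HH 2) g = opH 1 g" if "g \<in> tens m n" for g
        using bact_H[of 1 g] that n3 by (simp add: numeral_2_eq_2)
      have t1: "C.ope f \<in> tens m n" "opH 1 (C.ope f) \<in> tens m n"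
        using n3 by (intro C.ope_tens opH_tens f n; simp)+
      have "C.ope (opH 1 (C.ope f)) w = qq ^ (2*m) * C.ope f w" for w
      proof (cases "length w = n")
        case True
        then show ?thesis by (rule C.ope_H1_ope[OF n3 f])
      next
        case False
        show ?thesis unfolding zero[OF t1(1) False] zero[OF C.ope_tens[OF n t1(2)] False] by simp
      qed
      then show ?case
        unfolding r bact_basic(2,5) bact_mult bact_e[OF f] H2[OF t1(1)] bact_e[OF t1(2)] bact_e[OF sc[OF f]] sce
        by simp
    next
      case (7 i)
      obtain k where k: "i = Suc k" "Suc k < n" using idx 7 by blast
      obtain l where l: "k = Suc (Suc l)" using 7(3) k by (cases k; cases "k - 1") auto
      have "C.ope (opH k f) = opH k (C.ope f)"
        unfolding l by (intro ext) (rule C.ope_opH_far)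
      then show ?case
        unfolding 7(1) k(1) by (simp add: bact_basic(2) bact_mult bact_e bact_H[OF k(2)] tens k(2))
    next
      case 8
      let ?x = "- inverse qq"
      let ?h = "HH 2 * HH 3 * HHinv ?x 1 * HHinv ?x 2"
      from 8 have r: "r = ?h * e2 ?x - e2 ?x \<or> r = e2 ?x * ?h - e2 ?x" and n4: "4 \<le> n"
        by (auto split: if_splits)
      have H: "bact (HH 2) g = opH 1 g" "bact (HH 3) g = opH 2 g"
        "bact (HHinv ?x 1) g = C.inv_H 0 g" "bact (HHinv ?x 2) g = C.inv_H 1 g" if "g \<in> tens m n" for g
        using bact_H[of 1 g] bact_H[of 2 g] bact_Hinv[of 0 g] bact_Hinv[of 1 g] that n4
        by (simp_all add: numeral_2_eq_2 numeral_3_eq_3)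
      have h: "bact ?h g = C.shift_op g" if g: "g \<in> tens m n" for g
      proof -
        have t: "opH 1 g \<in> tens m n" "opH 2 (opH 1 g) \<in> tens m n" "C.inv_H 0 (opH 2 (opH 1 g)) \<in> tens m n"
          using n4 by (intro C.inv_H_tens opH_tens g; simp)+
        show ?thesis
          unfolding bact_mult H(1)[OF g] H(2)[OF t(1)] H(3)[OF t(2)] H(4)[OF t(3)] C.shift_op_def ..
      qed
      have e2': "bact (e2 ?x) g = C.e2_op g" if g: "g \<in> tens m n" for g
      proof -
        have t: "C.ope g \<in> tens m n" "C.shift_op (C.ope g) \<in> tens m n"
          using n4 by (intro C.shift_tens C.ope_tens g n; simp)+
        show ?thesis
          unfolding e2_def bact_mult[of "ee * ?h" ee] bact_mult[of ee ?h] bact_e[OF g] h[OF t(1)] bact_e[OF t(2)] C.e2_op_def ..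
      qed
      from r show ?case
        using C.e2_relations[OF n4 f]
        by (elim disjE) (simp_all only: bact_basic(2) bact_mult[of ?h "e2 ?x"] bact_mult[of "e2 ?x" ?h]
          h[OF f] e2'[OF f] h[OF C.e2_tens[OF n4 f]] e2'[OF C.shift_tens[OF n4 f]] diff_self)
    qed
  qed
qed (use bact_mult bact_tens bact_lin in \<open>auto simp: bact_basic\<close>)

end

section \<open>The two actions commute\<close>

lemma opH_Kw: "opH k (\<lambda>u. inverse (Kw i u) * g u) w = inverse (Kw i w) * opH k g w"
proof (induction k g w rule: opH.induct)
  case (1 f a b w)
  then show ?case by (simp add: hh_def Kw_simps algebra_simps)
next
  case (4 k f a w)
  then show ?case by (simp add: Kw_simps opH_scale mult.assoc)
qed (simp_all)

lemma opH_Kw': "opH k (\<lambda>u. Kw i u * g u) w = Kw i w * opH k g w"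
proof -
  have "opH k (\<lambda>u. inverse (Kw i u) * (Kw i u * g u)) w = inverse (Kw i w) * opH k (\<lambda>u. Kw i u * g u) w"
    by (rule opH_Kw)
  moreover have "(\<lambda>u. inverse (Kw i u) * (Kw i u * g u)) = g"
    using Kw_nz by (simp add: fun_eq_iff)
  ultimately show ?thesis using Kw_nz[of i w] by simp
qed

text \<open>
  With two factors this is the intertwining property of the \<open>R\<close>-matrix; further factors only contribute
  weights that the exchange leaves alone.
\<close>

lemma opH_opE: "opH k (opE i f) w = opE i (opH k f) w"
proof (induction k arbitrary: f w)
  case 0
  consider "w = []" | a where "w = [a]" | a b v where "w = a # b # v"
    by (metis list.exhaust)
  then show ?case
  proof cases
    case 3
    have E: "opE i (\<lambda>u. hh (\<lambda>a b. f (a # b # u)) a b) v = hh (\<lambda>a b. opE i (\<lambda>u. f (a # b # u)) v) a b" for a b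
      by (simp add: hh_def opE_lin)
    have l: "opH 0 (opE i f) (a # b # v) = hh (\<lambda>a b. (if a = i then f (Suc i # b # v) else 0)
        + kw i a * ((if b = i then f (a # Suc i # v) else 0) + kw i b * opE i (\<lambda>u. f (a # b # u)) v)) a b"
      by (simp add: hh_def)
    have r: "opE i (opH 0 f) (a # b # v) = (if a = i then hh (\<lambda>a b. f (a # b # v)) (Suc i) b else 0)
       + kw i a * ((if b = i then hh (\<lambda>a b. f (a # b # v)) a (Suc i) else 0)
       + kw i b * hh (\<lambda>a b. opE i (\<lambda>u. f (a # b # u)) v) a b)"
      by (simp add: E)
    have "a = b \<or> a < b \<or> b < a" by linarith
    then show ?thesis
      unfolding 3 l r by (elim disjE) (auto simp: hh_def kw_def algebra_simps qq_cancel)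
  qed simp_all
next
  case (Suc k)
  show ?case
    by (cases w) (simp_all add: opH_add opH_scale opH_zero Suc.IH)
qed

lemma opH_opF: "opH k (opF i f) w = opF i (opH k f) w"
proof (induction k arbitrary: f w)
  case 0
  consider "w = []" | a where "w = [a]" | a b v where "w = a # b # v"
    by (metis list.exhaust)
  then show ?case
  proof cases
    case 3
    have E: "opF i (\<lambda>u. hh (\<lambda>a b. f (a # b # u)) a b) v = hh (\<lambda>a b. opF i (\<lambda>u. f (a # b # u)) v) a b" for a b
      by (simp add: hh_def opF_lin)
    let ?K = "inverse (Kw i v)"
    have l: "opH 0 (opF i f) (a # b # v) = hh (\<lambda>a b. (if a = Suc i then inverse (kw i b) * (?K * f (i # b # v)) else 0)
        + ((if b = Suc i then ?K * f (a # i # v) else 0) + opF i (\<lambda>u. f (a # b # u)) v)) a b"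
      by (simp add: hh_def Kw_simps)
    have r: "opF i (opH 0 f) (a # b # v) = (if a = Suc i then inverse (kw i b) * (?K * hh (\<lambda>a b. f (a # b # v)) i b) else 0)
       + ((if b = Suc i then ?K * hh (\<lambda>a b. f (a # b # v)) a i else 0)
       + hh (\<lambda>a b. opF i (\<lambda>u. f (a # b # u)) v) a b)"
      by (simp add: E Kw_simps)
    have "a = b \<or> a < b \<or> b < a" by linarith
    then show ?thesis
      unfolding 3 l r by (elim disjE) (auto simp: hh_def kw_def algebra_simps qq_cancel)
  qed simp_all
next
  case (Suc k)
  show ?case
    by (cases w) (simp_all add: opH_add opH_scale opH_zero opH_Kw Suc.IH)
qed

lemma opH_opK: "opH k (opK i f) w = opK i (opH k f) w" "opH k (opKi i f) w = opKi i (opH k f) w"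
  unfolding opK_def[abs_def] opKi_def[abs_def] by (rule opH_Kw' opH_Kw)+

text \<open>
  Let \<open>i = p + 1\<close>.  The element \<open>T\<^sub>i\<^sub>-\<^sub>1T\<^sub>i\<^sub>+\<^sub>1(E\<^sub>i)K\<^sub>i\<^sup>-\<^sup>1\<close> acts by \<open>opY p\<close>.  Its coproduct involves the two shorter
  \<open>q\<close>-commutators \<open>E\<^sub>i\<^sub>+\<^sub>1E\<^sub>i - q\<^sup>-\<^sup>1E\<^sub>iE\<^sub>i\<^sub>+\<^sub>1\<close> and \<open>E\<^sub>i\<^sub>-\<^sub>1E\<^sub>i - q\<^sup>-\<^sup>1E\<^sub>iE\<^sub>i\<^sub>-\<^sub>1\<close>, which with \<open>K\<^sub>i\<^sup>-\<^sup>1\<close> act by \<open>opYp p\<close> and \<open>opYm p\<close>.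
\<close>

definition opYp :: "nat \<Rightarrow> nat list vec \<Rightarrow> nat list vec" where
  "opYp p g w = opE (Suc (Suc p)) (opE (Suc p) (opKi (Suc p) g)) w
     - inverse qq * opE (Suc p) (opE (Suc (Suc p)) (opKi (Suc p) g)) w"

definition opYm :: "nat \<Rightarrow> nat list vec \<Rightarrow> nat list vec" where
  "opYm p g w = opE p (opE (Suc p) (opKi (Suc p) g)) w
     - inverse qq * opE (Suc p) (opE p (opKi (Suc p) g)) w"

definition opY :: "nat \<Rightarrow> nat list vec \<Rightarrow> nat list vec" where
  "opY p g w = opE (Suc (Suc p)) (opE p (opE (Suc p) (opKi (Suc p) g))) w
     - inverse qq * opE p (opE (Suc p) (opE (Suc (Suc p)) (opKi (Suc p) g))) w
     - inverse qq * opE (Suc (Suc p)) (opE (Suc p) (opE p (opKi (Suc p) g))) w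
     + inverse qq ^ 2 * opE (Suc p) (opE p (opE (Suc (Suc p)) (opKi (Suc p) g))) w"

lemma opKi_Cons: "opKi i f (a # w) = inverse (kw i a) * opKi i (\<lambda>u. f (a # u)) w"
  by (simp add: opKi_def Kw_simps)

lemma kw_five:
  "kw p p = qq" "kw p (Suc p) = inverse qq" "kw p (Suc (Suc p)) = 1" "kw p (Suc (Suc (Suc p))) = 1"
  "kw (Suc p) p = 1" "kw (Suc p) (Suc p) = qq" "kw (Suc p) (Suc (Suc p)) = inverse qq" "kw (Suc p) (Suc (Suc (Suc p))) = 1"
  "kw (Suc (Suc p)) p = 1" "kw (Suc (Suc p)) (Suc p) = 1" "kw (Suc (Suc p)) (Suc (Suc p)) = qq" "kw (Suc (Suc p)) (Suc (Suc (Suc p))) = inverse qq"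
  by (simp_all add: kw_def)

lemma kw_other:
  assumes "a \<notin> {p, Suc p, Suc (Suc p), Suc (Suc (Suc p))}"
  shows "kw p a = 1" "kw (Suc p) a = 1" "kw (Suc (Suc p)) a = 1"
  using assms by (simp_all add: kw_def)

lemma five_cases:
  obtains "a = p" | "a = Suc p" | "a = Suc (Suc p)" | "a = Suc (Suc (Suc p))"
  | "a \<notin> {p, Suc p, Suc (Suc p), Suc (Suc (Suc p))}"
  by blast

lemma opE_neighbours_commute:
  "opE (Suc (Suc p)) (opE p g) w = opE p (opE (Suc (Suc p)) g) w"
  by (rule opE_far) auto

lemma opYp_Cons: "opYp p f (a # v) =
   (if a = Suc p then - inverse qq * opKi (Suc p) (\<lambda>u. f (Suc (Suc (Suc p)) # u)) v else 0)
   + (if a = Suc (Suc p) then (1 - inverse qq ^ 2) * opE (Suc p) (opKi (Suc p) (\<lambda>u. f (Suc (Suc (Suc p)) # u))) v else 0)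
   + kw (Suc (Suc p)) a * opYp p (\<lambda>u. f (a # u)) v"
  by (cases a p rule: five_cases)
     (simp_all add: opYp_def opKi_Cons kw_five kw_other opE_lin power2_eq_square algebra_simps qq_cancel)

lemma opYm_Cons: "opYm p f (a # v) =
   (if a = p then qq * opKi (Suc p) (\<lambda>u. f (Suc (Suc p) # u)) v else 0)
   + (if a = p then (1 - inverse qq ^ 2) * opE (Suc p) (opKi (Suc p) (\<lambda>u. f (Suc p # u))) v else 0)
   + kw p a * opYm p (\<lambda>u. f (a # u)) v"
  by (cases a p rule: five_cases)
     (simp_all add: opYm_def opKi_Cons kw_five kw_other opE_lin power2_eq_square algebra_simps qq_cancel)

text \<open>
  Of the terms of the coproduct, the natural representation leaves those in which the first tensor factor
  is moved from \<open>i + 2\<close> to \<open>i - 1\<close>, from \<open>i\<close> to \<open>i - 1\<close> or from \<open>i + 2\<close> to \<open>i + 1\<close>, or not at all.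
\<close>

lemma opY_Cons: "opY p f (a # v) =
   (if a = p then - inverse qq * opKi (Suc p) (\<lambda>u. f (Suc (Suc (Suc p)) # u)) v
      + (1 - inverse qq ^ 2) * opYp p (\<lambda>u. f (Suc p # u)) v else 0)
   + (if a = Suc (Suc p) then (1 - inverse qq ^ 2) * opYm p (\<lambda>u. f (Suc (Suc (Suc p)) # u)) v else 0)
   + kw p a * kw (Suc (Suc p)) a * opY p (\<lambda>u. f (a # u)) v"
  by (cases a p rule: five_cases)
     (simp_all add: opY_def opYp_def opYm_def opKi_Cons kw_five kw_other opE_lin opE_neighbours_commute power2_eq_square algebra_simps qq_cancel)

lemma opE_fun:
  "opE i (\<lambda>u. c * g u) = (\<lambda>w. c * opE i g w)"
  "opE i (\<lambda>u. f u + c * g u) = (\<lambda>w. opE i f w + c * opE i g w)"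
  by (simp_all add: fun_eq_iff opE_scale opE_comb)

lemma opKi_fun:
  "opKi i (\<lambda>u. c * g u) = (\<lambda>w. c * opKi i g w)"
  "opKi i (\<lambda>u. f u + c * g u) = (\<lambda>w. opKi i f w + c * opKi i g w)"
  by (simp_all add: opKi_def fun_eq_iff algebra_simps)

lemma opYp_scale: "opYp p (\<lambda>u. c * g u) w = c * opYp p g w"
  unfolding opYp_def opKi_fun opE_fun by (simp add: algebra_simps)

lemma opYm_scale: "opYm p (\<lambda>u. c * g u) w = c * opYm p g w"
  unfolding opYm_def opKi_fun opE_fun by (simp add: algebra_simps)

lemma opY_comb: "opY p (\<lambda>u. f u + c * g u) w = opY p f w + c * opY p g w"
  unfolding opY_def opKi_fun opE_fun by (simp add: algebra_simps)

lemma opY_scale: "opY p (\<lambda>u. c * g u) w = c * opY p g w"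
  unfolding opY_def opKi_fun opE_fun by (simp add: algebra_simps)

lemma comb_sum:
  assumes "\<And>f g c. T (\<lambda>u. f u + c * g u) = (\<lambda>u. T f u + c * T g u)"
  shows "T (\<lambda>u. \<Sum>i\<in>A. c i * g i u) w = (\<Sum>i\<in>A. c i * T (g i) (w :: 'w) :: qfield)"
proof -
  have z: "T (\<lambda>u. 0) = (\<lambda>u. 0)"
    using assms[of "\<lambda>_. 0" "- 1" "\<lambda>_. 0"] by simp
  show ?thesis
  proof (induction A rule: infinite_finite_induct)
    case (insert x A)
    have "T (\<lambda>u. \<Sum>i\<in>insert x A. c i * g i u) w = T (\<lambda>u. (\<Sum>i\<in>A. c i * g i u) + c x * g x u) w"
      using insert by (simp add: add.commute)
    also have "\<dots> = (\<Sum>i\<in>insert x A. c i * T (g i) w)"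
      using insert by (subst assms) simp
    finally show ?case .
  qed (simp_all add: z)
qed

context brauer_coeffs
begin

text \<open>
  An operator that changes only a few letters has to be compared with its action on the remaining factors
  only where the contracted letters are among these.
\<close>

lemma theta_local:
  assumes "P \<subseteq> letters_upto m" "\<And>a. a \<in> letters_upto m \<Longrightarrow> a \<notin> P \<Longrightarrow> G a = H a"
    and "(\<Sum>a\<in>P. t a * G a) = (\<Sum>a\<in>P. t a * H a)"
  shows "(\<Sum>a\<in>letters_upto m. t a * G a) = (\<Sum>a\<in>letters_upto m. t a * H a)"
proof -
  have "(\<Sum>a\<in>letters_upto m - P. t a * G a) = (\<Sum>a\<in>letters_upto m - P. t a * H a)"
    using assms(2) by (intro sum.cong) auto
  then show ?thesis
    unfolding sum.subset_diff[OF assms(1) finite_atLeastAtMost] assms(3) by simp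
qed

lemma pair_index:
  assumes "odd p" "p < 2*m"
  obtains l where "l \<in> {1..m}" "p = 2*l - 1" "Suc p = 2*l"
  using assms by (intro that[of "Suc p div 2"]) (auto elim!: oddE)

lemma pair_coeffs:
  assumes "odd p" "p < 2*m"
  shows "u (Suc p) = - qq * u p" "t (Suc p) = - qq * t p"
    "U p b = (if b = Suc p then u p else 0)" "U (Suc p) b = (if b = p then u (Suc p) else 0)"
    "U b p = (if b = Suc p then u (Suc p) else 0)" "U b (Suc p) = (if b = p then u p else 0)"
    "partner p = Suc p" "partner (Suc p) = p"
    "b \<noteq> p \<Longrightarrow> b \<noteq> Suc p \<Longrightarrow> partner b \<noteq> p \<and> partner b \<noteq> Suc p"
proof -
  obtain l where l: "l \<in> {1..m}" "p = 2*l - 1" "Suc p = 2*l" using assms by (rule pair_index)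
  show "u (Suc p) = - qq * u p" "t (Suc p) = - qq * t p"
    using u_even[OF l(1)] t_even[OF l(1)] l by auto
  show P: "partner p = Suc p" "partner (Suc p) = p" using assms by (auto simp: partner_def)
  have p1: "p \<ge> 1" using assms by (auto intro: Suc_leI odd_pos)
  show Q: "b \<noteq> p \<Longrightarrow> b \<noteq> Suc p \<Longrightarrow> partner b \<noteq> p \<and> partner b \<noteq> Suc p" for b
    using assms(1) by (cases b) (auto simp: partner_def split: if_splits)
  have mem: "p \<in> letters_upto m" "Suc p \<in> letters_upto m" using p1 assms(2) by auto
  show "U p b = (if b = Suc p then u p else 0)" "U (Suc p) b = (if b = p then u (Suc p) else 0)"
    using mem P by (auto simp: U_def)
  show "U b p = (if b = Suc p then u (Suc p) else 0)" "U b (Suc p) = (if b = p then u p else 0)"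
    using mem P Q[of b] by (cases "b = p"; cases "b = Suc p"; auto simp: U_def)+
qed

lemma pair_kw:
  assumes "odd p" "p < 2*m"
  shows "kw p a * kw p b * U a b = U a b"
proof -
  have "kw p a * kw p b = 1" if "U a b \<noteq> 0"
    using pair_coeffs(5,6)[OF assms, of a] pair_coeffs(3,4)[OF assms, of b] that
    by (cases "a = p"; cases "a = Suc p"; cases "b = p"; cases "b = Suc p") (auto simp: kw_def qq_cancel)
  then show ?thesis by (cases "U a b = 0") simp_all
qed

text \<open>
  The vector with coordinates \<open>U\<close> and the functional with coefficients \<open>t\<close> are annihilated by \<open>E\<^sub>p\<close> for odd \<open>p\<close>.
  Hence \<open>E\<^sub>p\<close> passes through \<open>ope\<close> to the remaining tensor factors.  The same pattern applies to the other
  generators.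
\<close>

lemma opE_ope:
  assumes "odd p" "p < 2*m"
  shows "opE p (ope f) (a # b # v) = ope (opE p f) (a # b # v)"
proof -
  note P = pair_coeffs(1-8)[OF assms]
  have "theta (opE p f) v = (\<Sum>a\<in>letters_upto m. t a * opE p (\<lambda>u. f (a # partner a # u)) v)"
    unfolding theta_def
  proof (rule theta_local[where P = "{p, Suc p}"])
    show "{p, Suc p} \<subseteq> letters_upto m" using assms odd_pos[OF assms(1)] by auto
    show "opE p f (a # partner a # v) = opE p (\<lambda>u. f (a # partner a # u)) v" if "a \<notin> {p, Suc p}" for a
      using that pair_coeffs(9)[OF assms, of a] by (simp add: kw_def)
  qed (simp add: P kw_def algebra_simps qq_cancel)
  also have "\<dots> = opE p (theta f) v"
    unfolding theta_def[of f, abs_def] by (rule comb_sum[symmetric]) (simp add: opE_comb fun_eq_iff)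
  finally have th: "theta (opE p f) v = opE p (theta f) v" .
  have "opE p (ope f) (a # b # v) = (if a = p then U (Suc p) b * theta f v else 0)
     + kw p a * ((if b = p then U a (Suc p) * theta f v else 0) + kw p b * (U a b * opE p (theta f) v))"
    by (simp add: opE_lin)
  also have "\<dots> = U a b * opE p (theta f) v"
    using pair_kw[OF assms, of a b] by (auto simp: P kw_def algebra_simps)
  finally show ?thesis by (simp add: th)
qed

lemma pair_kw1:
  assumes "odd p" "p < 2*m"
  shows "kw p a * kw p (partner a) = 1"
  using pair_coeffs(7,8)[OF assms] pair_coeffs(9)[OF assms, of a]
  by (cases "a = p"; cases "a = Suc p") (auto simp: kw_def qq_cancel)

lemma opF_ope:
  assumes "odd p" "p < 2*m"
  shows "opF p (ope f) (a # b # v) = ope (opF p f) (a # b # v)"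
proof -
  note P = pair_coeffs(1-8)[OF assms]
  have "theta (opF p f) v = (\<Sum>a\<in>letters_upto m. t a * opF p (\<lambda>u. f (a # partner a # u)) v)"
    unfolding theta_def
  proof (rule theta_local[where P = "{p, Suc p}"])
    show "{p, Suc p} \<subseteq> letters_upto m" using assms odd_pos[OF assms(1)] by auto
    show "opF p f (a # partner a # v) = opF p (\<lambda>u. f (a # partner a # u)) v" if "a \<notin> {p, Suc p}" for a
      using that pair_coeffs(9)[OF assms, of a] by simp
  qed (simp add: P Kw_simps kw_def algebra_simps qq_cancel)
  also have "\<dots> = opF p (theta f) v"
    unfolding theta_def[of f, abs_def] by (rule comb_sum[symmetric]) (simp add: opF_comb fun_eq_iff)
  finally have th: "theta (opF p f) v = opF p (theta f) v" .
  have "opF p (ope f) (a # b # v) = (if a = Suc p then inverse (kw p b * Kw p v) * (U p b * theta f v) else 0)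
     + ((if b = Suc p then inverse (Kw p v) * (U a p * theta f v) else 0) + U a b * opF p (theta f) v)"
    by (simp add: opF_lin Kw_simps)
  also have "\<dots> = U a b * opF p (theta f) v"
    by (auto simp: P kw_def algebra_simps qq_cancel)
  finally show ?thesis by (simp add: th)
qed

lemma opK_ope:
  assumes "odd p" "p < 2*m"
  shows "opK p (ope f) (a # b # v) = ope (opK p f) (a # b # v)"
    and "opKi p (ope f) (a # b # v) = ope (opKi p f) (a # b # v)"
proof -
  have k: "Kw p (a # partner a # v) = Kw p v" for a
    using pair_kw1[OF assms, of a] by (simp add: Kw_simps flip: mult.assoc)
  have th: "theta (opK p f) v = Kw p v * theta f v" "theta (opKi p f) v = inverse (Kw p v) * theta f v"
    by (simp_all only: theta_def opK_def opKi_def k sum_distrib_left mult.left_commute)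
  have U: "Kw p (a # b # v) * (U a b * x) = Kw p v * (U a b * x)"
    "inverse (Kw p (a # b # v)) * (U a b * x) = inverse (Kw p v) * (U a b * x)" for x
    using k[of a] by (auto simp: U_def)
  show "opK p (ope f) (a # b # v) = ope (opK p f) (a # b # v)"
    and "opKi p (ope f) (a # b # v) = ope (opKi p f) (a # b # v)"
    by (simp_all only: opK_def opKi_def ope.simps th U) (simp_all only: mult.left_commute)
qed

text \<open>
  Here both the vector and the functional involve the two pairs \<open>{p, p + 1}\<close> and \<open>{p + 2, p + 3}\<close>, and the
  assumptions on \<open>u\<close> and \<open>t\<close> are exactly what makes the contributions of \<open>F\<^sub>i\<close> and of the deformed part cancel.
\<close>

lemma opY_ope:
  assumes p: "odd p" "Suc (Suc p) < 2*m"
    and u: "u p = - (sg * (qq * u (Suc (Suc p))))"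
    and t: "t (Suc (Suc p)) = - (sg * (inverse qq * (inverse qq * (inverse qq * t p))))"
  shows "opF (Suc p) (ope f) (a # b # v) + sg * opY p (ope f) (a # b # v)
    = ope (\<lambda>w. opF (Suc p) f w + sg * opY p f w) (a # b # v)"
proof -
  let ?B = "\<lambda>f w. opF (Suc p) f w + sg * opY p f w"
  have p1: "odd p" "p < 2*m" and p2: "odd (Suc (Suc p))" "Suc (Suc p) < 2*m" using p by auto
  note P = pair_coeffs(1-8)[OF p1] pair_coeffs(1-8)[OF p2]
  have comb: "?B (\<lambda>u. f u + c * g u) = (\<lambda>u. ?B f u + c * ?B g u)" for f g c
    by (simp add: opF_comb opY_comb algebra_simps)
  have "theta (?B f) v = (\<Sum>a\<in>letters_upto m. t a * ?B (\<lambda>u. f (a # partner a # u)) v)"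
    unfolding theta_def
  proof (rule theta_local[where P = "{p, Suc p, Suc (Suc p), Suc (Suc (Suc p))}"])
    show "{p, Suc p, Suc (Suc p), Suc (Suc (Suc p))} \<subseteq> letters_upto m"
      using p odd_pos[OF p1(1)] by auto
    show "?B f (a # partner a # v) = ?B (\<lambda>u. f (a # partner a # u)) v"
      if "a \<notin> {p, Suc p, Suc (Suc p), Suc (Suc (Suc p))}" for a
      using that pair_coeffs(9)[OF p1, of a] pair_coeffs(9)[OF p2, of a]
      by (simp add: opY_Cons opYp_Cons opYm_Cons kw_other)
    show "(\<Sum>a\<in>{p, Suc p, Suc (Suc p), Suc (Suc (Suc p))}. t a * ?B f (a # partner a # v))
       = (\<Sum>a\<in>{p, Suc p, Suc (Suc p), Suc (Suc (Suc p))}. t a * ?B (\<lambda>u. f (a # partner a # u)) v)"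
      by (simp add: P t opY_Cons opYp_Cons opYm_Cons opKi_def Kw_simps kw_five power2_eq_square algebra_simps qq_cancel)
  qed
  also have "\<dots> = ?B (theta f) v"
    unfolding theta_def[of f, abs_def] by (rule comb_sum[symmetric, where T = ?B]) (rule comb)
  finally have th: "theta (?B f) v = ?B (theta f) v" .
  have "?B (ope f) (a # b # v) = U a b * ?B (theta f) v"
    by (cases a p rule: five_cases; cases b p rule: five_cases)
       (simp_all add: opY_Cons opYp_Cons opYm_Cons opKi_fun opE_lin opF_lin opYp_scale opYm_scale opY_scale
          opKi_Cons Kw_simps kw_five kw_other,
        simp_all add: P u opKi_def power2_eq_square algebra_simps qq_cancel)
  then show ?thesis unfolding ope.simps th .
qed

end

section \<open>Endomorphisms of tensor space and their matrices\<close>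

text \<open>
  Linearity is required only on \<open>tens m n\<close>, since the elements of \<open>End_tens m n\<close> are extensional functions.
\<close>

definition endo :: "nat \<Rightarrow> nat \<Rightarrow> (nat list vec \<Rightarrow> nat list vec) \<Rightarrow> bool" where
  "endo m n T \<longleftrightarrow> (\<forall>f \<in> tens m n. T f \<in> tens m n) \<and>
     (\<forall>f \<in> tens m n. \<forall>g \<in> tens m n. \<forall>c. T (\<lambda>u. f u + c * g u) = (\<lambda>u. T f u + c * T g u))"

lemma endoI:
  assumes "\<And>f. f \<in> tens m n \<Longrightarrow> T f \<in> tens m n"
    and "\<And>f g c w. T (\<lambda>u. f u + c * g u) w = T f w + c * T g w"
  shows "endo m n T"
  using assms by (simp add: endo_def fun_eq_iff)

lemma unit_vec_tens: "w \<in> indices m n \<Longrightarrow> unit_vec w \<in> tens m n"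
  by (auto simp: tens_def unit_vec_def)

lemma endo_expand:
  assumes T: "endo m n T" and f: "f \<in> tens m n"
  shows "T f u = (\<Sum>w\<in>indices m n. T (unit_vec w) u * f w)"
proof -
  have z: "T (\<lambda>u. 0) = (\<lambda>u. 0)"
  proof -
    have "T (\<lambda>u. g u + (- 1) * g u) = (\<lambda>u. T g u + (- 1) * T g u)" if "g \<in> tens m n" for g
      using T that unfolding endo_def by blast
    from this[OF tens_zero] show ?thesis by simp
  qed
  have sums: "(\<lambda>u. \<Sum>w\<in>A. f w * unit_vec w u) \<in> tens m n \<and>
      T (\<lambda>u. \<Sum>w\<in>A. f w * unit_vec w u) = (\<lambda>u. \<Sum>w\<in>A. f w * T (unit_vec w) u)"
    if "finite A" "A \<subseteq> indices m n" for A
    using that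
  proof (induction A)
    case empty
    then show ?case by (simp add: z tens_zero)
  next
    case (insert w A)
    let ?g = "\<lambda>u. \<Sum>w\<in>A. f w * unit_vec w u"
    have g: "?g \<in> tens m n" "T ?g = (\<lambda>u. \<Sum>w\<in>A. f w * T (unit_vec w) u)" and w: "unit_vec w \<in> tens m n"
      using insert by (auto intro: unit_vec_tens)
    have e: "(\<lambda>u. \<Sum>w\<in>insert w A. f w * unit_vec w u) = (\<lambda>u. ?g u + f w * unit_vec w u)"
      using insert by (simp add: add.commute)
    have "T (\<lambda>u. ?g u + f w * unit_vec w u) = (\<lambda>u. T ?g u + f w * T (unit_vec w) u)"
      using T g(1) w by (simp only: endo_def)
    then show ?case
      unfolding e g(2) using tens_comb[OF g(1) w] insert by (simp add: add.commute)
  qed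
  have all: "(\<lambda>u. \<Sum>w\<in>indices m n. f w * unit_vec w u) = f"
  proof
    fix u
    have "(\<Sum>w\<in>indices m n. f w * unit_vec w u) = (\<Sum>w\<in>indices m n. if w = u then f w else 0)"
      by (intro sum.cong) (auto simp: unit_vec_def)
    also have "\<dots> = f u"
      using f by (simp add: finite_indices tens_def)
    finally show "(\<Sum>w\<in>indices m n. f w * unit_vec w u) = f u" .
  qed
  have "T f = (\<lambda>u. \<Sum>w\<in>indices m n. f w * T (unit_vec w) u)"
    using sums[OF finite_indices order_refl] unfolding all by (rule conjunct2)
  then show ?thesis by (simp add: mult.commute)
qed

lemma endo_expand_mat:
  assumes "endo m n T" "f \<in> tens m n" "u \<in> indices m n"
  shows "T f u = (\<Sum>w\<in>indices m n. opmat (indices m n) T (u, w) * f w)"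
  unfolding endo_expand[OF assms(1,2)] using assms(3) by (intro sum.cong) (auto simp: opmat_def)

lemma endo_mmul:
  assumes "endo m n S" "endo m n T"
  shows "mmul (indices m n) (opmat (indices m n) S) (opmat (indices m n) T) = opmat (indices m n) (\<lambda>f. S (T f))"
proof -
  let ?X = "indices m n"
  have "(\<Sum>v\<in>?X. opmat ?X S (u, v) * opmat ?X T (v, w)) = (if u \<in> ?X \<and> w \<in> ?X then S (T (unit_vec w)) u else 0)" for u w
  proof (cases "u \<in> ?X \<and> w \<in> ?X")
    case True
    then have "T (unit_vec w) \<in> tens m n" using assms(2) by (simp add: endo_def unit_vec_tens)
    then have "S (T (unit_vec w)) u = (\<Sum>v\<in>?X. opmat ?X S (u, v) * T (unit_vec w) v)"
      using True by (intro endo_expand_mat[OF assms(1)]) auto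
    also have "\<dots> = (\<Sum>v\<in>?X. opmat ?X S (u, v) * opmat ?X T (v, w))"
      using True by (intro sum.cong) (auto simp: opmat_def)
    finally show ?thesis using True by simp
  qed (auto simp: opmat_def intro!: sum.neutral)
  then show ?thesis by (simp add: mmul_def opmat_def fun_eq_iff)
qed

lemma endo_eq:
  assumes "endo m n S" "endo m n T" "opmat (indices m n) S = opmat (indices m n) T" "f \<in> tens m n"
  shows "S f = T f"
proof
  fix u
  show "S f u = T f u"
  proof (cases "u \<in> indices m n")
    case True
    then show ?thesis
      using endo_expand_mat[OF assms(1,4)] endo_expand_mat[OF assms(2,4)] assms(3) by simp
  next
    case False
    then show ?thesis using assms by (simp add: endo_def tens_def)
  qed
qed

lemma opmat_eqI:
  assumes "\<And>f. f \<in> tens m n \<Longrightarrow> S f = T f"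
  shows "opmat (indices m n) S = opmat (indices m n) T"
  using assms unit_vec_tens by (auto simp: opmat_def fun_eq_iff)

lemma End_tens_endo: "T \<in> carrier (End_tens m n) \<Longrightarrow> endo m n T"
  unfolding End_tens_simps
proof (elim CollectE conjE, unfold endo_def, intro conjI ballI allI, goal_cases)
  case (2 f g c)
  have e: "(\<lambda>u. f u + c * g u) = f + smul c g" by (simp add: fun_eq_iff smul_def)
  have "T (f + smul c g) = T f + smul c (T g)"
    using 2 tens_smul by metis
  then show ?case unfolding e by (simp add: fun_eq_iff smul_def)
qed auto

lemma End_tens_eqI:
  assumes "S \<in> carrier (End_tens m n)" "T \<in> carrier (End_tens m n)" "\<And>f. f \<in> tens m n \<Longrightarrow> S f = T f"
  shows "S = T"
  using assms unfolding End_tens_simps by (auto intro: PiE_ext)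

text \<open>
  A double centralizer property of generators gives one for the algebras acting: commuting with
  the family \<open>\<rho>'\<close> puts the matrix of \<open>T\<close> into the algebra generated by \<open>G\<close>, and this algebra
  consists of matrices of operators \<open>\<rho> a\<close>.
\<close>

lemma image_of_commutant:
  assumes End: "\<And>a. a \<in> A \<Longrightarrow> \<rho> a \<in> carrier (End_tens m n)"
    and one: "\<exists>a \<in> A. \<forall>f \<in> tens m n. \<rho> a f = f"
    and comb: "\<And>a b c. a \<in> A \<Longrightarrow> b \<in> A \<Longrightarrow> \<exists>d \<in> A. \<forall>f \<in> tens m n. \<rho> d f = (\<lambda>u. \<rho> a f u + c * \<rho> b f u)"
    and comp: "\<And>a b. a \<in> A \<Longrightarrow> b \<in> A \<Longrightarrow> \<exists>d \<in> A. \<forall>f \<in> tens m n. \<rho> d f = \<rho> a (\<rho> b f)"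
    and gens: "\<And>g. g \<in> G \<Longrightarrow> \<exists>a \<in> A. g = opmat (indices m n) (\<rho> a)"
    and End': "\<And>b. b \<in> B \<Longrightarrow> endo m n (\<rho>' b)"
    and gens': "\<And>h. h \<in> H \<Longrightarrow> \<exists>b \<in> B. h = opmat (indices m n) (\<rho>' b)"
    and duality: "mcomm (indices m n) H \<subseteq> malg (indices m n) G"
    and T: "T \<in> End_commuting m n B \<rho>'"
  shows "T \<in> \<rho> ` A"
proof -
  let ?X = "indices m n"
  have T_End: "T \<in> carrier (End_tens m n)" using T by (simp add: End_commuting_def)
  note Te = End_tens_endo[OF T_End]
  have "opmat ?X T \<in> mcomm ?X H"
  proof -
    have "mmul ?X (opmat ?X T) h = mmul ?X h (opmat ?X T)" if h: "h \<in> H" for h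
    proof -
      obtain b where b: "b \<in> B" "h = opmat ?X (\<rho>' b)" using gens'[OF h] by blast
      show ?thesis
        unfolding b(2) endo_mmul[OF Te End'[OF b(1)]] endo_mmul[OF End'[OF b(1)] Te]
        by (rule opmat_eqI) (use T b in \<open>simp add: End_commuting_def\<close>)
    qed
    then show ?thesis by (simp add: mcomm_def opmat_mats)
  qed
  then have "opmat ?X T \<in> malg ?X G" using duality by blast
  moreover have "\<exists>a \<in> A. M = opmat ?X (\<rho> a)" if "M \<in> malg ?X G" for M
    using that
  proof induction
    case malg_one
    obtain a where a: "a \<in> A" "\<forall>f \<in> tens m n. \<rho> a f = f" using one by blast
    have "mone ?X = opmat ?X (\<rho> a)"
      using a(2) unit_vec_tens by (auto simp: mone_def opmat_def unit_vec_def fun_eq_iff)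
    then show ?case using a(1) by blast
  next
    case (malg_gen g)
    then show ?case by (rule gens)
  next
    case (malg_comb S T c)
    then obtain a b where ab: "a \<in> A" "S = opmat ?X (\<rho> a)" "b \<in> A" "T = opmat ?X (\<rho> b)" by blast
    obtain d where d: "d \<in> A" "\<forall>f \<in> tens m n. \<rho> d f = (\<lambda>u. \<rho> a f u + c * \<rho> b f u)"
      using comb[OF ab(1,3)] by blast
    have "opmat ?X (\<rho> d) = (\<lambda>x. S x + c * T x)"
      using d(2) unit_vec_tens by (auto simp: ab opmat_def fun_eq_iff)
    then show ?case using d(1) by metis
  next
    case (malg_mul S T)
    then obtain a b where ab: "a \<in> A" "S = opmat ?X (\<rho> a)" "b \<in> A" "T = opmat ?X (\<rho> b)" by blast
    obtain d where d: "d \<in> A" "\<forall>f \<in> tens m n. \<rho> d f = \<rho> a (\<rho> b f)"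
      using comp[OF ab(1,3)] by blast
    have "mmul ?X S T = opmat ?X (\<lambda>f. \<rho> a (\<rho> b f))"
      unfolding ab by (intro endo_mmul End_tens_endo End ab)
    also have "\<dots> = opmat ?X (\<rho> d)"
      by (rule opmat_eqI) (simp add: d)
    finally show ?case using d(1) by blast
  qed
  ultimately obtain a where a: "a \<in> A" "opmat ?X T = opmat ?X (\<rho> a)" by blast
  have "T = \<rho> a"
    by (intro End_tens_eqI[OF T_End End[OF a(1)]] endo_eq[OF Te End_tens_endo[OF End[OF a(1)]] a(2)])
  then show ?thesis using a(1) by blast
qed

section \<open>The two families of generating operators\<close>

text \<open>
  The action of \<open>B\<^sub>i\<close>.
\<close>

definition opB :: "(nat \<Rightarrow> qfield) \<Rightarrow> nat \<Rightarrow> nat list vec \<Rightarrow> nat list vec" where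
  "opB \<sigma> i f w = opF i f w + \<sigma> i * opY (i - 1) f w"

definition e_op :: "nat \<Rightarrow> (nat \<Rightarrow> qfield) \<Rightarrow> nat list vec \<Rightarrow> nat list vec" where
  "e_op m \<sigma> = brauer_coeffs.ope m (u_coeff \<sigma>) (t_coeff m \<sigma>)"

text \<open>
  The generators of the iquantum group whose reductions at \<open>q = 1\<close> generate the symplectic Lie algebra.
\<close>

inductive_set i_ops :: "nat \<Rightarrow> (nat \<Rightarrow> qfield) \<Rightarrow> (nat list vec \<Rightarrow> nat list vec) set" for m \<sigma> where
  i_E: "odd j \<Longrightarrow> j < 2*m \<Longrightarrow> opE j \<in> i_ops m \<sigma>"
| i_F: "odd j \<Longrightarrow> j < 2*m \<Longrightarrow> opF j \<in> i_ops m \<sigma>"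
| i_B: "1 \<le> j \<Longrightarrow> j < m \<Longrightarrow> opB \<sigma> (2*j) \<in> i_ops m \<sigma>"

inductive_set b_ops :: "nat \<Rightarrow> nat \<Rightarrow> (nat \<Rightarrow> qfield) \<Rightarrow> (nat list vec \<Rightarrow> nat list vec) set" for m n \<sigma> where
  b_e: "e_op m \<sigma> \<in> b_ops m n \<sigma>"
| b_H: "Suc k < n \<Longrightarrow> opH k \<in> b_ops m n \<sigma>"

lemma opY_tens:
  assumes "1 \<le> p" "p + 3 \<le> 2*m" "f \<in> tens m n"
  shows "opY p f \<in> tens m n"
proof -
  have E: "opE j g \<in> tens m n" if "j \<in> {p, Suc p, Suc (Suc p)}" "g \<in> tens m n" for j g
    using that assms by (intro opE_tens) auto
  have "opE (Suc (Suc p)) (opE p (opE (Suc p) (opKi (Suc p) f))) \<in> tens m n"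
    "opE p (opE (Suc p) (opE (Suc (Suc p)) (opKi (Suc p) f))) \<in> tens m n"
    "opE (Suc (Suc p)) (opE (Suc p) (opE p (opKi (Suc p) f))) \<in> tens m n"
    "opE (Suc p) (opE p (opE (Suc (Suc p)) (opKi (Suc p) f))) \<in> tens m n"
    by (intro E opK_tens assms; simp)+
  then show ?thesis by (simp add: tens_def opY_def)
qed

lemma even_index:
  assumes "1 \<le> j" "j < m"
  obtains p where "2 * j = Suc p" "odd p" "1 \<le> p" "p + 3 \<le> 2*m" "2 * j \<le> 2*m - 2"
  using assms by (intro that[of "2*j - 1"]) auto

lemma opB_tens:
  assumes "1 \<le> j" "j < m" "f \<in> tens m n"
  shows "opB \<sigma> (2*j) f \<in> tens m n"
proof -
  obtain p where p: "2 * j = Suc p" "odd p" "1 \<le> p" "p + 3 \<le> 2*m" "2 * j \<le> 2*m - 2"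
    using assms(1,2) by (rule even_index)
  have "opF (Suc p) f \<in> tens m n" "opY p f \<in> tens m n"
    using p assms(3) by (intro opF_tens opY_tens; simp)+
  then show ?thesis unfolding p(1) by (simp add: tens_def opB_def)
qed

lemma i_ops_endo: "T \<in> i_ops m \<sigma> \<Longrightarrow> endo m n T"
proof (induction rule: i_ops.induct)
  case (i_E j)
  then show ?case by (intro endoI opE_tens opE_comb) (auto intro: odd_pos Suc_leI)
next
  case (i_F j)
  then show ?case by (intro endoI opF_tens opF_comb) (auto intro: odd_pos Suc_leI)
next
  case (i_B j)
  then show ?case by (intro endoI opB_tens) (auto simp: opB_def opF_comb opY_comb algebra_simps)
qed

lemma opH_opY: "opH k (opY p f) w = opY p (opH k f) w"
proof -
  have Y: "opY p f = (\<lambda>w. ((opE (Suc (Suc p)) (opE p (opE (Suc p) (opKi (Suc p) f))) w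
     + (- inverse qq) * opE p (opE (Suc p) (opE (Suc (Suc p)) (opKi (Suc p) f))) w)
     + (- inverse qq) * opE (Suc (Suc p)) (opE (Suc p) (opE p (opKi (Suc p) f))) w)
     + inverse qq ^ 2 * opE (Suc p) (opE p (opE (Suc (Suc p)) (opKi (Suc p) f))) w)" for f
    by (simp add: opY_def fun_eq_iff)
  have E: "opH k (opE i g) = opE i (opH k g)" and K: "opH k (opKi i g) = opKi i (opH k g)" for i g
    by (simp_all add: fun_eq_iff opH_opE opH_opK)
  show ?thesis unfolding Y opH_comb E K ..
qed

context brauer_action
begin

lemma e_op_ope: "e_op m \<sigma> = C.ope"
  by (simp add: e_op_def)

lemma b_ops_endo: "T \<in> b_ops m n \<sigma> \<Longrightarrow> endo m n T"
  by (induction rule: b_ops.induct)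
    (auto intro!: endoI simp: e_op_ope C.ope_tens[OF n] C.ope_comb opH_tens opH_comb)

text \<open>
  The recursion \<open>\<kappa>\<^sub>j\<^sub>+\<^sub>1 = - \<sigma>\<^sub>2\<^sub>j \<kappa>\<^sub>j\<close> relates the coefficients of consecutive pairs.
\<close>

lemma u_t_step:
  assumes "1 \<le> j" "j < m"
  shows "u_coeff \<sigma> (2*j - 1) = - (\<sigma> (2*j) * (qq * u_coeff \<sigma> (2*j + 1)))"
    and "t_coeff m \<sigma> (2*j + 1) = - (\<sigma> (2*j) * (inverse qq * (inverse qq * (inverse qq * t_coeff m \<sigma> (2*j - 1)))))"
proof -
  have d: "(2*j - 1 + 1) div 2 = j" "(2*j + 1 + 1) div 2 = Suc j" "odd (2*j - 1)" "odd (2*j + 1)" using assms by auto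
  have k: "kappa \<sigma> (Suc j) = kappa \<sigma> j * - \<sigma> (2*j)"
    using assms by (cases j) (simp_all add: kappa_def)
  have s: "\<sigma> (2*j) \<noteq> 0" using assms by (intro \<sigma>) auto
  have q1: "qq powi (- int j) = qq * qq powi (- int (Suc j))"
  proof -
    have "qq powi (- int j) = qq powi (1 + - int (Suc j))" by simp
    also have "\<dots> = qq * qq powi (- int (Suc j))" using qq_nz by (subst power_int_add) simp_all
    finally show ?thesis .
  qed
  have q3: "qq powi (2 * int m + 1 - 3 * int (Suc j))
      = inverse qq * (inverse qq * (inverse qq * qq powi (2 * int m + 1 - 3 * int j)))"
  proof -
    have "qq powi (2 * int m + 1 - 3 * int (Suc j)) = qq powi (- 3 + (2 * int m + 1 - 3 * int j))" by simp
    also have "\<dots> = qq powi (- 3) * qq powi (2 * int m + 1 - 3 * int j)" using qq_nz by (subst power_int_add) simp_all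
    also have "qq powi (- 3) = inverse qq * (inverse qq * inverse qq)"
      by (simp add: power_int_minus power3_eq_cube)
    finally show ?thesis by (simp add: mult.assoc)
  qed
  show "u_coeff \<sigma> (2*j - 1) = - (\<sigma> (2*j) * (qq * u_coeff \<sigma> (2*j + 1)))"
    unfolding u_coeff_def Let_def d k q1 using d s by simp
  show "t_coeff m \<sigma> (2*j + 1) = - (\<sigma> (2*j) * (inverse qq * (inverse qq * (inverse qq * t_coeff m \<sigma> (2*j - 1)))))"
    unfolding t_coeff_def Let_def d k q3 using d by simp
qed

lemma commutes_eI:
  assumes T: "\<And>f. f \<in> tens m n \<Longrightarrow> T f \<in> tens m n" and f: "f \<in> tens m n"
    and eq: "\<And>a b v. T (C.ope f) (a # b # v) = C.ope (T f) (a # b # v)"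
  shows "T (C.ope f) = C.ope (T f)"
proof
  fix w
  have t: "T (C.ope f) \<in> tens m n" "C.ope (T f) \<in> tens m n"
    by (intro T C.ope_tens[OF n] f)+
  show "T (C.ope f) w = C.ope (T f) w"
  proof (cases "\<exists>a b v. w = a # b # v")
    case True
    then show ?thesis using eq by blast
  next
    case False
    then have "length w < 2" by (metis One_nat_def length_Cons less_2_cases_iff not_less_eq list.size(3) list.exhaust zero_less_Suc)
    then have "w \<notin> indices m n" using n by (auto simp: indices_def)
    then show ?thesis using t by (simp add: tens_def)
  qed
qed

lemma ops_commute:
  assumes "T \<in> i_ops m \<sigma>" "R \<in> b_ops m n \<sigma>" "f \<in> tens m n"
  shows "T (R f) = R (T f)"
proof -
  have Tt: "T g \<in> tens m n" if "g \<in> tens m n" for g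
    using i_ops_endo[OF assms(1)] that by (simp add: endo_def)
  from assms(2) show ?thesis
  proof cases
    case b_e
    have "T (C.ope f) (a # b # v) = C.ope (T f) (a # b # v)" for a b v
      using assms(1)
    proof cases
      case (i_E j)
      then show ?thesis using C.opE_ope by simp
    next
      case (i_F j)
      then show ?thesis using C.opF_ope by simp
    next
      case (i_B j)
      obtain p where p: "2 * j = Suc p" "odd p" "1 \<le> p" "p + 3 \<le> 2*m"
        using i_B(2,3) by (rule even_index)
      have "2 * j - 1 = p" "2 * j + 1 = Suc (Suc p)" using p(1) by auto
      note ut = u_t_step[OF i_B(2,3), unfolded this, unfolded p(1)]
      have "opB \<sigma> (2 * j) = (\<lambda>f w. opF (Suc p) f w + \<sigma> (Suc p) * opY p f w)"
        unfolding p(1) by (simp add: opB_def fun_eq_iff)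
      then show ?thesis
        unfolding i_B(1) using C.opY_ope[OF p(2) _ ut] p(4) by simp
    qed
    then show ?thesis
      unfolding b_e e_op_ope using Tt assms(3) by (intro commutes_eI)
  next
    case (b_H k)
    from assms(1) show ?thesis
    proof cases
      case (i_B j)
      then show ?thesis
        unfolding b_H i_B(1) by (intro ext) (simp only: opB_def[abs_def] opH_comb opH_opF opH_opY)
    next
      case (i_E j)
      then show ?thesis unfolding b_H i_E(1) by (intro ext) (simp only: opH_opE)
    next
      case (i_F j)
      then show ?thesis unfolding b_H i_F(1) by (intro ext) (simp only: opH_opF)
    qed
  qed
qed

end

section \<open>Double centralizers survive a generic deformation\<close>

definition conj_mat :: "('x \<Rightarrow> 'a::field) \<Rightarrow> ('x, 'a) mat \<Rightarrow> ('x, 'a) mat" where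
  "conj_mat \<delta> M = (\<lambda>(u, w). inverse (\<delta> u) * M (u, w) * \<delta> w)"

lemma conj_mat_comb: "conj_mat \<delta> (\<lambda>x. S x + c * T x) = (\<lambda>x. conj_mat \<delta> S x + c * conj_mat \<delta> T x)"
  by (simp add: conj_mat_def fun_eq_iff algebra_simps)

text \<open>
  Conjugation by the diagonal matrix with entries \<open>\<delta>\<close> is an algebra automorphism.
\<close>

lemma conj_mat_mmul:
  assumes "\<And>u. u \<in> X \<Longrightarrow> \<delta> u \<noteq> 0"
  shows "conj_mat \<delta> (mmul X S T) = mmul X (conj_mat \<delta> S) (conj_mat \<delta> T)"
proof -
  have "inverse (\<delta> u) * (\<Sum>v\<in>X. S (u, v) * T (v, w)) * \<delta> w
      = (\<Sum>v\<in>X. (inverse (\<delta> u) * S (u, v) * \<delta> v) * (inverse (\<delta> v) * T (v, w) * \<delta> w))" for u w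
    unfolding sum_distrib_left sum_distrib_right
    by (intro sum.cong refl) (use assms in \<open>simp add: field_simps\<close>)
  then show ?thesis by (simp add: conj_mat_def mmul_def)
qed

lemma conj_mat_one:
  assumes "\<And>u. u \<in> X \<Longrightarrow> \<delta> u \<noteq> 0"
  shows "conj_mat \<delta> (mone X) = mone X"
  using assms by (auto simp: conj_mat_def mone_def fun_eq_iff)

lemma conj_mat_inj:
  assumes nz: "\<And>u. u \<in> X \<Longrightarrow> \<delta> u \<noteq> 0"
    and "S \<in> mats X" "T \<in> mats X" "conj_mat \<delta> S = conj_mat \<delta> T"
  shows "S = T"
proof
  fix x :: "'a \<times> 'a"
  obtain u w where x: "x = (u, w)" by (cases x)
  show "S x = T x"
  proof (cases "u \<in> X \<and> w \<in> X")
    case True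
    have "inverse (\<delta> u) * S (u, w) * \<delta> w = inverse (\<delta> u) * T (u, w) * \<delta> w"
      using fun_cong[OF assms(4), of "(u, w)"] by (simp add: conj_mat_def)
    then show ?thesis using True nz[of u] nz[of w] by (simp add: x)
  next
    case False
    then show ?thesis using assms(2,3) by (auto simp: mats_def x)
  qed
qed

lemma spec_eq: "spec c r \<Longrightarrow> r = r' \<Longrightarrow> spec c r'"
  by simp

lemma spec_mmul:
  assumes "\<And>x. spec (S x) (s x)" "\<And>x. spec (T x) (t x)"
  shows "spec (mmul X S T x) (mmul X s t x)"
  using assms by (cases x) (auto simp: mmul_def intro!: spec_sum spec_mult)

lemma spec_const: "\<exists>c. spec c r"
  using spec_Fract[of 1 "[:r:]"] by auto

text \<open>
  \<open>A\<close> and \<open>C\<close> are sets of generators at \<open>q = 1\<close>, and \<open>GA\<close> and \<open>GC\<close> generate algebras containing lifts of them,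
  after conjugation.  Only lifts in the generated algebras are required, which leaves room for rescaling.
\<close>

theorem duality_specialises:
  fixes \<delta> :: "'x \<Rightarrow> qfield" and A C :: "('x, rat) mat set"
  assumes X: "finite X" and nz: "\<And>u. u \<in> X \<Longrightarrow> \<delta> u \<noteq> 0"
    and mats: "GA \<subseteq> mats X" "GC \<subseteq> mats X"
    and comm: "\<And>g h. g \<in> GA \<Longrightarrow> h \<in> GC \<Longrightarrow> mmul X g h = mmul X h g"
    and A: "\<And>a. a \<in> A \<Longrightarrow> \<exists>g \<in> malg X GA. \<forall>x. spec (conj_mat \<delta> g x) (a x)"
    and C: "\<And>c. c \<in> C \<Longrightarrow> \<exists>g \<in> malg X GC. \<forall>x. spec (conj_mat \<delta> g x) (c x)"
    and dual: "mcomm X C \<subseteq> malg X A"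
  shows "mcomm X GC \<subseteq> malg X GA"
proof -
  let ?c = "conj_mat \<delta>"
  have cm: "?c (mmul X S T) = mmul X (?c S) (?c T)" for S T
    by (rule conj_mat_mmul) (rule nz)
  have lift: "\<exists>g \<in> malg X GA. \<forall>x. spec (?c g x) (a x)" if "a \<in> malg X A" for a
    using that
  proof induction
    case malg_one
    have one: "?c (mone X) = mone X"
      by (rule conj_mat_one) (rule nz)
    have "spec (?c (mone X) x) (mone X x)" for x
      unfolding one by (auto simp: mone_def spec_0 spec_1 split: prod.split)
    then show ?case using malg.malg_one by blast
  next
    case (malg_gen g)
    then show ?case by (rule A)
  next
    case (malg_comb s t r)
    then obtain S T where S: "S \<in> malg X GA" "\<forall>x. spec (?c S x) (s x)" and T: "T \<in> malg X GA" "\<forall>x. spec (?c T x) (t x)"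
      by blast
    obtain c where c: "spec c r" using spec_const by blast
    have "spec (?c (\<lambda>x. S x + c * T x) x) (s x + r * t x)" for x
      unfolding conj_mat_comb by (intro spec_add spec_mult c S(2)[rule_format] T(2)[rule_format])
    then show ?case using malg.malg_comb[OF S(1) T(1)] by blast
  next
    case (malg_mul s t)
    then obtain S T where S: "S \<in> malg X GA" "\<forall>x. spec (?c S x) (s x)" and T: "T \<in> malg X GA" "\<forall>x. spec (?c T x) (t x)"
      by blast
    have "spec (?c (mmul X S T) x) (mmul X s t x)" for x
      unfolding cm by (intro spec_mmul S(2)[rule_format] T(2)[rule_format])
    then show ?case using malg.malg_mul[OF S(1) T(1)] by blast
  qed
  have subsp_image: "subsp (?c ` S)" if "subsp S" for S
  proof (rule subspI)
    have "?c (\<lambda>_. 0) = (\<lambda>_. 0)" by (simp add: conj_mat_def fun_eq_iff)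
    then show "(\<lambda>_. 0) \<in> ?c ` S" using subsp_zero[OF that] by (metis imageI)
    show "(\<lambda>x. f x + c * g x) \<in> ?c ` S" if fg: "f \<in> ?c ` S" "g \<in> ?c ` S" for f g c
    proof -
      obtain F H where "F \<in> S" "f = ?c F" "H \<in> S" "g = ?c H" using fg by blast
      then have "(\<lambda>x. f x + c * g x) = ?c (\<lambda>x. F x + c * H x)" "(\<lambda>x. F x + c * H x) \<in> S"
        using subsp_comb[OF \<open>subsp S\<close>] by (simp_all add: conj_mat_comb)
      then show ?thesis by (rule image_eqI)
    qed
  qed
  have sub: "malg X GA \<subseteq> mcomm X GC"
  proof
    fix T assume T: "T \<in> malg X GA"
    have "mmul X T h = mmul X h T" if h: "h \<in> GC" for h
    proof -
      have "h \<in> mcomm X GA" using h mats(2) comm[OF _ h, symmetric] by (auto simp: mcomm_def)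
      then show ?thesis using mcomm_malg[OF X _ T] by simp
    qed
    then show "T \<in> mcomm X GC" using malg_mats[OF mats(1) T] by (simp add: mcomm_def)
  qed
  have "?c ` mcomm X GC \<subseteq> ?c ` malg X GA"
  proof (rule subspace_eq_by_specialisation[of "X \<times> X"])
    show "finite (X \<times> X)" using X by simp
    show "subsp (?c ` malg X GA)" "subsp (?c ` mcomm X GC)"
      by (intro subsp_image malg_subsp mcomm_subsp)+
    show "?c ` malg X GA \<subseteq> ?c ` mcomm X GC" using sub by blast
    show zero: "f x = 0" if "f \<in> ?c ` mcomm X GC" "x \<notin> X \<times> X" for f x
      using that by (cases x) (auto simp: mcomm_def mats_def conj_mat_def)
    \<comment> \<open>The reduction \<open>r\<close> of a matrix in the commutant lies in the classical commutant, by uniqueness of reductions.\<close>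
    fix f r assume f: "f \<in> ?c ` mcomm X GC" and r: "\<And>x. spec (f x) (r x)"
    then obtain F where F: "F \<in> mcomm X GC" "f = ?c F" by blast
    have "r \<in> mcomm X C"
    proof -
      have "r (u, w) = 0" if "u \<notin> X \<or> w \<notin> X" for u w
      proof -
        have "f (u, w) = 0" using that by (intro zero[OF f]) auto
        then show ?thesis using r[of "(u, w)"] spec_unique[OF spec_0] by metis
      qed
      moreover have "mmul X r c = mmul X c r" if c: "c \<in> C" for c
      proof
        fix x
        obtain g where g: "g \<in> malg X GC" "\<forall>x. spec (?c g x) (c x)" using C[OF c] by blast
        have "mmul X f (?c g) = mmul X (?c g) f"
          unfolding F(2) cm[symmetric] mcomm_malg[OF X F(1) g(1)] ..
        then show "mmul X r c x = mmul X c r x"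
          using spec_mmul[of f r "?c g" c X x] spec_mmul[of "?c g" c f r X x] r g(2) spec_unique by metis
      qed
      ultimately show ?thesis by (simp add: mcomm_def mats_def)
    qed
    then obtain g where "g \<in> malg X GA" "\<forall>x. spec (?c g x) (r x)" using dual lift by blast
    then show "\<exists>g \<in> ?c ` malg X GA. \<forall>x. spec (g x) (r x)" by blast
  qed
  then show ?thesis
  proof (intro subsetI)
    fix T assume T: "T \<in> mcomm X GC"
    then obtain g where g: "g \<in> malg X GA" "?c T = ?c g"
      using \<open>?c ` mcomm X GC \<subseteq> ?c ` malg X GA\<close> by blast
    have "T \<in> mats X" using T by (simp add: mcomm_def)
    then have "T = g"
      by (rule conj_mat_inj[rotated]) (rule malg_mats[OF mats(1) g(1)] g(2) nz)+
    then show "T \<in> malg X GA" using g(1) by simp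
  qed
qed

text \<open>
  Conjugation by \<open>\<delta>\<close> turns \<open>op\<close> into a multiple of \<open>op'\<close>, which is regular at \<open>q = 1\<close> with value \<open>op0\<close>.
\<close>

lemma opmat_specialises:
  fixes op0 :: "('x \<Rightarrow> rat) \<Rightarrow> 'x \<Rightarrow> rat"
  assumes nz: "\<And>u. u \<in> X \<Longrightarrow> \<delta> u \<noteq> 0"
    and scale: "\<And>c f u. op (\<lambda>v. c * f v) u = c * op f u"
    and gauge: "\<And>f u. u \<in> X \<Longrightarrow> c * op (\<lambda>v. \<delta> v * f v) u = c' * (\<delta> u * op' f u)"
    and c: "c' \<noteq> 0"
    and spec: "\<And>f r u. (\<And>v. spec (f v) (r v)) \<Longrightarrow> u \<in> X \<Longrightarrow> spec (op' f u) (op0 r u)"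
    and mem: "opmat X op \<in> G"
  shows "\<exists>g \<in> malg X G. \<forall>x. spec (conj_mat \<delta> g x) (opmat X op0 x)"
proof (intro bexI allI)
  show "(\<lambda>x. (c / c') * opmat X op x) \<in> malg X G"
    by (intro malg_scale malg_gen mem)
  fix x :: "'x \<times> 'x"
  obtain u w where x: "x = (u, w)" by (cases x)
  show "spec (conj_mat \<delta> (\<lambda>x. (c / c') * opmat X op x) x) (opmat X op0 x)"
  proof (cases "u \<in> X \<and> w \<in> X")
    case True
    have "(\<lambda>v. \<delta> v * unit_vec w v) = (\<lambda>v. \<delta> w * unit_vec w v)"
      by (auto simp: unit_vec_def)
    then have "c * (\<delta> w * op (unit_vec w) u) = c' * (\<delta> u * op' (unit_vec w) u)"
      using gauge[of u "unit_vec w"] True by (simp add: scale)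
    then have "inverse (\<delta> u) * ((c / c') * op (unit_vec w) u) * \<delta> w = op' (unit_vec w) u"
      using c nz[of u] True by (simp add: field_simps)
    moreover have "spec (op' (unit_vec w) u) (op0 (unit_vec w) u)"
      using True by (intro spec) (auto simp: unit_vec_def spec_0 spec_1)
    ultimately show ?thesis using True by (simp add: x conj_mat_def opmat_def)
  qed (auto simp: x conj_mat_def opmat_def spec_0)
qed

section \<open>Specialising the generating operators at \<open>q = 1\<close>\<close>

lemma spec_kw: "spec (kw i a) 1"
  using spec_inverse[OF spec_qq] by (simp add: kw_def spec_qq spec_1)

lemma spec_Kw: "spec (Kw i w) 1"
  by (induction w) (auto simp: Kw_simps spec_1 intro: spec_eq[OF spec_mult[OF spec_kw]])

lemma spec_opKi: "(\<And>v. spec (f v) (r v)) \<Longrightarrow> spec (opKi i f w) (r w)"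
  unfolding opKi_def using spec_mult[OF spec_inverse[OF spec_Kw]] by (rule spec_eq) auto

lemma spec_opE:
  assumes "\<And>v. spec (f v) (r v)"
  shows "spec (opE j f w) (dE j (Suc j) r w)"
  using assms
proof (induction w arbitrary: f r)
  case (Cons a w)
  have 1: "spec (opE j (\<lambda>u. f (a # u)) w) (dE j (Suc j) (\<lambda>u. r (a # u)) w)"
    by (rule Cons.IH) (rule Cons.prems)
  have 2: "spec (if a = j then f (Suc j # w) else 0) (if a = j then r (Suc j # w) else 0)"
    by (simp add: Cons.prems spec_0)
  show ?case
    using spec_add[OF 2 spec_mult[OF spec_kw[of j a] 1]] by (simp only: opE.simps dE.simps mult_1 Suc_eq_plus1)
qed (simp add: spec_0)

lemma spec_opF:
  assumes "\<And>v. spec (f v) (r v)"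
  shows "spec (opF j f w) (dE (Suc j) j r w)"
  using assms
proof (induction w arbitrary: f r)
  case (Cons a w)
  have 1: "spec (opF j (\<lambda>u. f (a # u)) w) (dE (Suc j) j (\<lambda>u. r (a # u)) w)"
    by (rule Cons.IH) (rule Cons.prems)
  have 2: "spec (if a = Suc j then inverse (Kw j w) * f (j # w) else 0) (if a = Suc j then r (j # w) else 0)"
    using spec_mult[OF spec_inverse[OF spec_Kw[of j w]] Cons.prems[of "j # w"]] by (simp add: spec_0)
  show ?case using spec_add[OF 2 1] by simp
qed (simp add: spec_0)

text \<open>
  Only regularity matters, as these operators enter \<open>opY\<close> with the coefficient \<open>1 - q\<^sup>-\<^sup>2\<close>.
\<close>

lemma spec_opYp_opYm:
  assumes "\<And>v. spec (f v) (r v)"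
  shows "\<exists>s. spec (opYp p f w) s" "\<exists>s. spec (opYm p f w) s"
proof -
  have q: "spec (inverse qq) 1" using spec_inverse[OF spec_qq] by simp
  have E: "spec (opE i (opE j (opKi k f)) w) (dE i (Suc i) (dE j (Suc j) r) w)" for i j k w
    by (intro spec_opE spec_opKi assms)
  show "\<exists>s. spec (opYp p f w) s"
    unfolding opYp_def using spec_diff[OF E spec_mult[OF q E]] by blast
  show "\<exists>s. spec (opYm p f w) s"
    unfolding opYm_def using spec_diff[OF E spec_mult[OF q E]] by blast
qed

text \<open>
  At \<open>q = 1\<close> the element \<open>T\<^sub>i\<^sub>-\<^sub>1T\<^sub>i\<^sub>+\<^sub>1(E\<^sub>i)\<close> is a nested commutator of derivations, hence a derivation; on the natural
  module it is \<open>v\<^sub>i\<^sub>+\<^sub>2 \<mapsto> - v\<^sub>i\<^sub>-\<^sub>1\<close>.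
\<close>

lemma spec_opY:
  assumes "\<And>v. spec (f v) (r v)"
  shows "spec (opY p f w) (- dE p (Suc (Suc (Suc p))) r w)"
  using assms
proof (induction w arbitrary: f r)
  case Nil
  then show ?case by (simp add: opY_def spec_0)
next
  case (Cons a w)
  let ?z = "1 - inverse qq ^ 2"
  have q: "spec (inverse qq) 1" using spec_inverse[OF spec_qq] by simp
  have z: "spec ?z 0" using spec_diff[OF spec_1 spec_power[OF q, of 2]] by simp
  have small: "spec (?z * opYp p (\<lambda>u. f (b # u)) w) 0" "spec (?z * opYm p (\<lambda>u. f (b # u)) w) 0" for b
    using spec_mult[OF z] spec_opYp_opYm[of "\<lambda>u. f (b # u)" "\<lambda>u. r (b # u)" p w] Cons.prems by fastforce+
  have 1: "spec (opY p (\<lambda>u. f (a # u)) w) (- dE p (Suc (Suc (Suc p))) (\<lambda>u. r (a # u)) w)"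
    by (rule Cons.IH) (rule Cons.prems)
  have K: "spec (opKi (Suc p) (\<lambda>u. f (Suc (Suc (Suc p)) # u)) w) (r (Suc (Suc (Suc p)) # w))"
    by (rule spec_opKi) (rule Cons.prems)
  have 2: "spec (- inverse qq * opKi (Suc p) (\<lambda>u. f (Suc (Suc (Suc p)) # u)) w + ?z * opYp p (\<lambda>u. f (Suc p # u)) w)
      (- 1 * r (Suc (Suc (Suc p)) # w) + 0)"
    by (intro spec_add spec_mult spec_uminus q K small)
  then have 3: "spec (if a = p then - inverse qq * opKi (Suc p) (\<lambda>u. f (Suc (Suc (Suc p)) # u)) w + ?z * opYp p (\<lambda>u. f (Suc p # u)) w else 0)
      (if a = p then - r (Suc (Suc (Suc p)) # w) else 0)"
    by (simp add: spec_0)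
  have 4: "spec (if a = Suc (Suc p) then ?z * opYm p (\<lambda>u. f (Suc (Suc (Suc p)) # u)) w else 0) 0"
    by (simp add: spec_0 small)
  show ?case
    unfolding opY_Cons
    by (rule spec_eq[OF spec_add[OF spec_add[OF 3 4] spec_mult[OF spec_mult[OF spec_kw spec_kw] 1]]]) simp
qed

lemma spec_opB:
  assumes "1 \<le> j" and f: "\<And>v. spec (f v) (r v)"
  shows "spec (opB (\<lambda>_. - 1) (2*j) f w) (sp_elem (2*j + 1) (2*j - 1) r w)"
proof -
  define p where "p = 2 * j - 1"
  have p: "2 * j = Suc p" "odd p" using assms(1) by (auto simp: p_def)
  have i: "2*j - 1 = p" "2*j + 1 = Suc (Suc p)" using p by auto
  have s: "sp_elem (Suc (Suc p)) p r w = dE (Suc (Suc p)) (Suc p) r w + dE p (Suc (Suc (Suc p))) r w"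
    using p(2) by (simp add: sp_elem_def eps_def partner_def)
  have B: "opB (\<lambda>_. - 1) (2*j) f w = opF (Suc p) f w + - opY p f w"
    unfolding p(1) by (simp add: opB_def)
  show ?thesis
    unfolding i s B by (rule spec_eq[OF spec_add[OF spec_opF[OF f] spec_uminus[OF spec_opY[OF f]]]]) simp
qed

lemma spec_opH:
  assumes "Suc k < length w" and f: "\<And>v. spec (f v) (r v)"
  shows "spec (opH k f w) (perm_op (Suc k) r w)"
proof (cases "w ! k = w ! Suc k")
  case True
  then have "swap (Suc k) w = w"
    by (simp add: swap_def) (metis list_update_id)
  then show ?thesis
    using True spec_mult[OF spec_qq f] by (simp add: opH_nth[OF assms(1)] perm_op_def)
next
  case False
  have dq: "spec dq 0" using spec_diff[OF spec_qq spec_inverse[OF spec_qq]] by simp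
  have "spec (if w ! k < w ! Suc k then dq * f w else 0) 0"
    using spec_mult[OF dq f[of w]] by (simp add: spec_0)
  from spec_add[OF f[of "swap (Suc k) w"] this] show ?thesis
    using False by (simp add: opH_nth[OF assms(1)] perm_op_def)
qed

lemma spec_powi: "spec (qq powi k) 1"
proof (cases k rule: int_cases2)
  case (nonneg n)
  then show ?thesis using spec_power[OF spec_qq, of n] by simp
next
  case (nonpos n)
  then show ?thesis
    using spec_inverse[OF spec_power[OF spec_qq, of n]] by (simp add: power_int_minus)
qed

lemma kappa_normal: "kappa (\<lambda>_. - 1) j = 1"
  by (simp add: kappa_def)

lemma spec_coeffs: "spec (u_coeff (\<lambda>_. - 1) a) (eps a)" "spec (t_coeff m (\<lambda>_. - 1) a) (eps a)"
  using spec_powi spec_mult[OF spec_uminus[OF spec_qq] spec_powi]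
  by (simp_all add: u_coeff_def t_coeff_def Let_def kappa_normal eps_def)

section \<open>Gauging away the parameters\<close>

text \<open>
  The weight of the letters \<open>2j\<close> and \<open>2j + 1\<close> is \<open>gauge \<sigma> j\<close>.  Equal weights on these letters keep \<open>F\<^sub>2\<^sub>j\<close> unchanged,
  and the recursion rescales the part of \<open>B\<^sub>2\<^sub>j\<close> that moves \<open>2j + 2\<close> to \<open>2j - 1\<close> by \<open>- 1 / \<sigma>\<^sub>2\<^sub>j\<close>.
\<close>

fun gauge :: "(nat \<Rightarrow> qfield) \<Rightarrow> nat \<Rightarrow> qfield" where
  "gauge \<sigma> 0 = 1"
| "gauge \<sigma> (Suc 0) = 1"
| "gauge \<sigma> (Suc (Suc j)) = - gauge \<sigma> j / \<sigma> (2 * Suc j)"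

definition dw :: "(nat \<Rightarrow> qfield) \<Rightarrow> nat \<Rightarrow> qfield" where "dw \<sigma> a = gauge \<sigma> (a div 2)"

definition wt :: "(nat \<Rightarrow> qfield) \<Rightarrow> nat list \<Rightarrow> qfield" where "wt \<sigma> w = prod_list (map (dw \<sigma>) w)"

lemma wt_simps: "wt \<sigma> [] = 1" "wt \<sigma> (a # w) = dw \<sigma> a * wt \<sigma> w"
  by (simp_all add: wt_def)

text \<open>
  The inserted vector of \<open>e\<close> contains \<open>\<kappa>\<close> through its inverse and the contracting functional contains \<open>\<kappa>\<close>
  itself, so the same weights remove the parameters from \<open>e\<close>.
\<close>

lemma gauge_kappa: "gauge \<sigma> j * gauge \<sigma> (Suc j) = inverse (kappa \<sigma> (Suc j))"
proof (induction j)
  case (Suc j)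
  have "kappa \<sigma> (Suc (Suc j)) = kappa \<sigma> (Suc j) * - \<sigma> (2 * Suc j)"
    by (simp add: kappa_def)
  then show ?case using Suc.IH by (simp add: divide_inverse mult.commute mult.left_commute)
qed (simp add: kappa_def)

lemma opH_wt: "opH k (\<lambda>u. wt \<sigma> u * f u) w = wt \<sigma> w * opH k f w"
proof (induction k f w rule: opH.induct)
  case (1 f a b w)
  then show ?case by (simp add: hh_def wt_simps algebra_simps)
next
  case (4 k f a w)
  then show ?case by (simp add: wt_simps opH_scale mult.assoc)
qed simp_all

lemma opE_wt: "dw \<sigma> j * opE j (\<lambda>u. wt \<sigma> u * f u) w = dw \<sigma> (Suc j) * (wt \<sigma> w * opE j f w)"
proof (induction w arbitrary: f)
  case (Cons a w)
  have ih: "dw \<sigma> j * opE j (\<lambda>u. wt \<sigma> (a # u) * f (a # u)) w = dw \<sigma> a * (dw \<sigma> (Suc j) * (wt \<sigma> w * opE j (\<lambda>u. f (a # u)) w))"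
    unfolding Cons.IH[symmetric] wt_simps mult.assoc opE_scale by (simp add: mult.left_commute)
  have "dw \<sigma> j * opE j (\<lambda>u. wt \<sigma> u * f u) (a # w) = (if a = j then dw \<sigma> j * (wt \<sigma> (Suc j # w) * f (Suc j # w)) else 0)
      + kw j a * (dw \<sigma> j * opE j (\<lambda>u. wt \<sigma> (a # u) * f (a # u)) w)"
    by (simp add: distrib_left mult.left_commute)
  then show ?case
    unfolding ih by (simp add: wt_simps algebra_simps)
qed simp

lemma opF_wt: "dw \<sigma> (Suc j) * opF j (\<lambda>u. wt \<sigma> u * f u) w = dw \<sigma> j * (wt \<sigma> w * opF j f w)"
proof (induction w arbitrary: f)
  case (Cons a w)
  have ih: "dw \<sigma> (Suc j) * opF j (\<lambda>u. wt \<sigma> (a # u) * f (a # u)) w = dw \<sigma> a * (dw \<sigma> j * (wt \<sigma> w * opF j (\<lambda>u. f (a # u)) w))"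
    unfolding Cons.IH[symmetric] wt_simps mult.assoc opF_scale by (simp add: mult.left_commute)
  have "dw \<sigma> (Suc j) * opF j (\<lambda>u. wt \<sigma> u * f u) (a # w) = (if a = Suc j then dw \<sigma> (Suc j) * (inverse (Kw j w) * (wt \<sigma> (j # w) * f (j # w))) else 0)
      + dw \<sigma> (Suc j) * opF j (\<lambda>u. wt \<sigma> (a # u) * f (a # u)) w"
    by (simp add: distrib_left mult.left_commute)
  then show ?case
    unfolding ih by (simp add: wt_simps algebra_simps)
qed simp

lemma opY_wt:
  assumes "dw \<sigma> p \<noteq> 0" "dw \<sigma> (Suc p) \<noteq> 0" "dw \<sigma> (Suc (Suc p)) \<noteq> 0"
  shows "opY p (\<lambda>u. wt \<sigma> u * f u) w = (dw \<sigma> (Suc (Suc (Suc p))) / dw \<sigma> p) * (wt \<sigma> w * opY p f w)"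
proof -
  have E: "opE j (\<lambda>u. wt \<sigma> u * g u) = (\<lambda>w. (dw \<sigma> (Suc j) / dw \<sigma> j) * (wt \<sigma> w * opE j g w))"
    if "j \<in> {p, Suc p, Suc (Suc p)}" for j g
    using opE_wt[of \<sigma> j g] assms that by (auto simp: fun_eq_iff field_simps)
  have K: "opKi j (\<lambda>u. wt \<sigma> u * g u) = (\<lambda>w. wt \<sigma> w * opKi j g w)" for j g
    by (simp add: opKi_def fun_eq_iff)
  have r: "(dw \<sigma> (Suc (Suc (Suc p))) / dw \<sigma> p)
    = (dw \<sigma> (Suc (Suc (Suc p))) / dw \<sigma> (Suc (Suc p))) * ((dw \<sigma> (Suc (Suc p)) / dw \<sigma> (Suc p)) * (dw \<sigma> (Suc p) / dw \<sigma> p))"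
    using assms by simp
  show ?thesis
    unfolding opY_def K r by (simp only: E insertI1 insertI2 opE_fun(1)) (simp only: algebra_simps)
qed

context brauer_action
begin

lemma gauge_nz: "j \<le> m \<Longrightarrow> gauge \<sigma> j \<noteq> 0"
proof (induction j rule: induct_nat_012)
  case (ge2 j)
  have "\<sigma> (2 * Suc j) \<noteq> 0" using ge2(3) by (intro \<sigma>) auto
  then show ?case using ge2 by simp
qed simp_all

lemma dw_nz: "a \<le> 2 * m + 1 \<Longrightarrow> dw \<sigma> a \<noteq> 0"
  unfolding dw_def by (rule gauge_nz) simp

lemma wt_nz: "w \<in> indices m n \<Longrightarrow> wt \<sigma> w \<noteq> 0"
proof -
  have "set w \<subseteq> letters_upto m \<Longrightarrow> wt \<sigma> w \<noteq> 0" for w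
    by (induction w) (auto simp: wt_simps dw_nz)
  then show "w \<in> indices m n \<Longrightarrow> wt \<sigma> w \<noteq> 0" by (simp add: indices_def)
qed

lemma opB_wt:
  assumes "1 \<le> j" "j < m"
  shows "opB \<sigma> (2*j) (\<lambda>u. wt \<sigma> u * f u) w = wt \<sigma> w * opB (\<lambda>_. - 1) (2*j) f w"
proof -
  obtain p where p: "2 * j = Suc p" "odd p" "1 \<le> p" "p + 3 \<le> 2*m" "2 * j \<le> 2*m - 2"
    using assms by (rule even_index)
  have nz: "dw \<sigma> a \<noteq> 0" if "a \<le> Suc (Suc (Suc p))" for a
    using that p by (intro dw_nz) auto
  have nz': "dw \<sigma> p \<noteq> 0" "dw \<sigma> (Suc p) \<noteq> 0" "dw \<sigma> (Suc (Suc p)) \<noteq> 0"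
    by (rule nz; simp)+
  have s: "\<sigma> (2*j) \<noteq> 0" using assms by (intro \<sigma>) auto
  have d: "p div 2 = j - 1" "Suc p div 2 = j" "Suc (Suc p) div 2 = j" "Suc (Suc (Suc p)) div 2 = Suc j"
    using p(1,2) assms by presburger+
  have "gauge \<sigma> (Suc j) = - gauge \<sigma> (j - 1) / \<sigma> (2*j)"
    using assms by (cases j) simp_all
  then have ratio: "\<sigma> (2*j) * (dw \<sigma> (Suc (Suc (Suc p))) / dw \<sigma> p) = - 1"
    using s nz[of p] by (simp add: dw_def d)
  have Y: "\<sigma> (Suc p) * opY p (\<lambda>u. wt \<sigma> u * f u) w = - (wt \<sigma> w * opY p f w)"
    unfolding opY_wt[OF nz'] using ratio unfolding p(1) by (metis mult.assoc mult_minus1)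
  have "dw \<sigma> (Suc (Suc p)) = dw \<sigma> (Suc p)" unfolding dw_def d ..
  then have "opF (Suc p) (\<lambda>u. wt \<sigma> u * f u) w = wt \<sigma> w * opF (Suc p) f w"
    using opF_wt[of \<sigma> "Suc p" f w] nz[of "Suc p"] by simp
  then show ?thesis
    unfolding p(1) opB_def using Y by (simp add: algebra_simps)
qed

lemma coeffs_gauge:
  assumes "a \<in> letters_upto m"
  shows "u_coeff \<sigma> a = dw \<sigma> a * dw \<sigma> (partner a) * u_coeff (\<lambda>_. - 1) a"
    and "dw \<sigma> a * dw \<sigma> (partner a) * t_coeff m \<sigma> a = t_coeff m (\<lambda>_. - 1) a"
proof -
  obtain i where i: "i \<in> {1..m}" "a = 2*i - 1 \<and> partner a = 2*i \<or> a = 2*i \<and> partner a = 2*i - 1"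
    using assms by (metis C.letter_cases)
  have d: "(2*i - 1) div 2 = i - 1" "2*i div 2 = i" "(2*i - 1 + 1) div 2 = i" "(2*i + 1) div 2 = i"
    using i(1) by auto
  have h: "(a + 1) div 2 = i" using i(2) d by auto
  have "dw \<sigma> a * dw \<sigma> (partner a) = gauge \<sigma> (i - 1) * gauge \<sigma> i"
    using i(2) d by (auto simp: dw_def mult.commute)
  also have "\<dots> = inverse (kappa \<sigma> i)"
    using gauge_kappa[of \<sigma> "i - 1"] i(1) by simp
  finally have p: "dw \<sigma> a * dw \<sigma> (partner a) = inverse (kappa \<sigma> i)" .
  show "u_coeff \<sigma> a = dw \<sigma> a * dw \<sigma> (partner a) * u_coeff (\<lambda>_. - 1) a"
    and "dw \<sigma> a * dw \<sigma> (partner a) * t_coeff m \<sigma> a = t_coeff m (\<lambda>_. - 1) a"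
    unfolding p u_coeff_def t_coeff_def h Let_def kappa_normal
    using kappa_nz[of i] i(1) by (simp_all add: mult.left_commute mult.commute)
qed

end

context brauer_action
begin

interpretation N: brauer_action m n "\<lambda>_. - 1"
  using m n by unfold_locales auto

lemma index_Cons2:
  assumes "w \<in> indices m n"
  obtains a b v where "w = a # b # v" "a \<in> letters_upto m"
  using assms n by (cases w; cases "tl w") (auto simp: indices_def)

lemma e_op_wt:
  assumes "w \<in> indices m n"
  shows "e_op m \<sigma> (\<lambda>u. wt \<sigma> u * f u) w = wt \<sigma> w * e_op m (\<lambda>_. - 1) f w"
proof -
  obtain a b v where w: "w = a # b # v" using assms by (rule index_Cons2)
  have U: "C.U a b = dw \<sigma> a * (dw \<sigma> b * N.C.U a b)"
    using coeffs_gauge(1)[of a] by (simp add: C.U_def N.C.U_def mult.assoc)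
  have th: "C.theta (\<lambda>u. wt \<sigma> u * f u) v = wt \<sigma> v * N.C.theta f v"
    unfolding C.theta_def N.C.theta_def sum_distrib_left
  proof (rule sum.cong[OF refl])
    fix x assume x: "x \<in> letters_upto m"
    show "t_coeff m \<sigma> x * (wt \<sigma> (x # partner x # v) * f (x # partner x # v))
        = wt \<sigma> v * (t_coeff m (\<lambda>_. - 1) x * f (x # partner x # v))"
      unfolding coeffs_gauge(2)[OF x, symmetric] wt_simps by (simp only: ac_simps)
  qed
  show ?thesis
    unfolding w e_op_ope N.e_op_ope C.ope.simps N.C.ope.simps U th wt_simps by (simp only: ac_simps)
qed

lemma spec_e_op:
  assumes "w \<in> indices m n" and f: "\<And>v. spec (f v) (r v)"
  shows "spec (e_op m (\<lambda>_. - 1) f w) (contr_op m r w)"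
proof -
  obtain a b v where w: "w = a # b # v" "a \<in> letters_upto m" using assms(1) by (rule index_Cons2)
  have "spec (N.C.U a b) (form a b)"
    using w(2) by (simp add: N.C.U_def form_def spec_coeffs spec_0)
  moreover have "spec (N.C.theta f v) (\<Sum>y\<in>letters_upto m. eps y * r (y # partner y # v))"
    unfolding N.C.theta_def by (intro spec_sum spec_mult spec_coeffs f)
  ultimately show ?thesis
    unfolding w N.e_op_ope N.C.ope.simps contr_op.simps by (rule spec_mult)
qed

lemma i_ops_specialise:
  assumes "a \<in> sp_gens m n"
  shows "\<exists>g \<in> malg (indices m n) (opmat (indices m n) ` i_ops m \<sigma>). \<forall>x. spec (conj_mat (wt \<sigma>) g x) (a x)"
proof -
  let ?X = "indices m n"
  consider j where "odd j" "j < 2*m" "a = opmat ?X (dE j (j + 1))"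
    | j where "odd j" "j < 2*m" "a = opmat ?X (dE (j + 1) j)"
    | j where "1 \<le> j" "j < m" "a = opmat ?X (sp_elem (2*j + 1) (2*j - 1))"
    using assms unfolding sp_gens_def by blast
  then show ?thesis
  proof cases
    case (1 j)
    show ?thesis unfolding 1(3)
      by (rule opmat_specialises[where op = "opE j" and op' = "opE j" and c = "dw \<sigma> j" and c' = "dw \<sigma> (Suc j)"])
        (use 1 in \<open>auto simp: wt_nz opE_scale opE_wt dw_nz spec_opE intro: i_E\<close>)
  next
    case (2 j)
    show ?thesis unfolding 2(3)
      by (rule opmat_specialises[where op = "opF j" and op' = "opF j" and c = "dw \<sigma> (Suc j)" and c' = "dw \<sigma> j"])
        (use 2 in \<open>auto simp: wt_nz opF_scale opF_wt dw_nz spec_opF intro: i_F\<close>)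
  next
    case (3 j)
    have s: "opB \<sigma> (2*j) (\<lambda>v. c * f v) u = c * opB \<sigma> (2*j) f u" for c f u
      by (simp add: opB_def opF_scale opY_scale algebra_simps)
    show ?thesis unfolding 3(3)
      by (rule opmat_specialises[where op = "opB \<sigma> (2*j)" and op' = "opB (\<lambda>_. - 1) (2*j)" and c = 1 and c' = 1])
        (use 3 in \<open>simp_all only: wt_nz s opB_wt spec_opB image_eqI[OF refl i_B] mult_1 zero_neq_one one_neq_zero not_False_eq_True\<close>)
  qed
qed

lemma b_ops_specialise:
  assumes "a \<in> brauer_mats m n"
  shows "\<exists>g \<in> malg (indices m n) (opmat (indices m n) ` b_ops m n \<sigma>). \<forall>x. spec (conj_mat (wt \<sigma>) g x) (a x)"
proof -
  let ?X = "indices m n"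
  consider "a = opmat ?X (contr_op m)" | k where "Suc k < n" "a = opmat ?X (perm_op (Suc k))"
  proof -
    have "a = opmat ?X (contr_op m) \<or> (\<exists>k. 1 \<le> k \<and> k < n \<and> a = opmat ?X (perm_op k))"
      using assms unfolding brauer_mats_def by blast
    then show ?thesis
    proof (elim disjE exE conjE)
      fix k assume k: "1 \<le> k" "k < n" "a = opmat ?X (perm_op k)"
      show ?thesis by (rule that(2)[of "k - 1"]) (use k in auto)
    qed (rule that(1))
  qed
  then show ?thesis
  proof cases
    case 1
    have s: "e_op m \<sigma> (\<lambda>v. c * f v) u = c * e_op m \<sigma> f u" for c f u
      using C.ope_comb[of "\<lambda>_. 0" c f u] by (simp add: e_op_ope C.ope_zero)
    show ?thesis unfolding 1
      by (rule opmat_specialises[where op = "e_op m \<sigma>" and op' = "e_op m (\<lambda>_. - 1)" and c = 1 and c' = 1])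
        (auto simp: wt_nz s e_op_wt spec_e_op intro: b_e)
  next
    case (2 k)
    have len: "u \<in> ?X \<Longrightarrow> length u = n" for u by (simp add: indices_def)
    show ?thesis unfolding 2(2)
      by (rule opmat_specialises[where op = "opH k" and op' = "opH k" and c = 1 and c' = 1])
        (use 2 in \<open>auto simp: wt_nz opH_scale opH_wt spec_opH len intro: b_H\<close>)
  qed
qed

text \<open>
  The two halves are instances of one statement, with the roles of the two families exchanged.
\<close>

theorem quantum_duality:
  "mcomm (indices m n) (opmat (indices m n) ` b_ops m n \<sigma>) \<subseteq> malg (indices m n) (opmat (indices m n) ` i_ops m \<sigma>)"
  "mcomm (indices m n) (opmat (indices m n) ` i_ops m \<sigma>) \<subseteq> malg (indices m n) (opmat (indices m n) ` b_ops m n \<sigma>)"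
proof -
  let ?X = "indices m n"
  have mats: "opmat ?X ` i_ops m \<sigma> \<subseteq> mats ?X" "opmat ?X ` b_ops m n \<sigma> \<subseteq> mats ?X"
    by (auto simp: opmat_mats)
  have comm: "mmul ?X g h = mmul ?X h g" if gh: "g \<in> opmat ?X ` i_ops m \<sigma>" "h \<in> opmat ?X ` b_ops m n \<sigma>" for g h
  proof -
    obtain T R where T: "T \<in> i_ops m \<sigma>" "g = opmat ?X T" and R: "R \<in> b_ops m n \<sigma>" "h = opmat ?X R"
      using gh by blast
    show ?thesis
      unfolding T(2) R(2) endo_mmul[OF i_ops_endo[OF T(1)] b_ops_endo[OF R(1)]]
        endo_mmul[OF b_ops_endo[OF R(1)] i_ops_endo[OF T(1)]]
      by (rule opmat_eqI) (rule ops_commute[OF T(1) R(1)])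
  qed
  show "mcomm ?X (opmat ?X ` b_ops m n \<sigma>) \<subseteq> malg ?X (opmat ?X ` i_ops m \<sigma>)"
    by (rule duality_specialises[OF finite_indices wt_nz mats comm i_ops_specialise b_ops_specialise classical_duality(1)])
  show "mcomm ?X (opmat ?X ` i_ops m \<sigma>) \<subseteq> malg ?X (opmat ?X ` b_ops m n \<sigma>)"
    by (rule duality_specialises[OF finite_indices wt_nz mats(2,1) comm[symmetric] b_ops_specialise i_ops_specialise classical_duality(2)])
qed

end

section \<open>From operators to the actions of the algebras\<close>

lemma endo_scale:
  assumes "endo m n T" "f \<in> tens m n"
  shows "T (\<lambda>u. c * f u) = (\<lambda>u. c * T f u)"
  by (simp add: fun_eq_iff endo_expand[OF assms(1)] tens_scale assms(2) sum_distrib_left mult.left_commute)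

lemma endo_sum:
  assumes "endo m n T" "\<And>i. i \<in> A \<Longrightarrow> g i \<in> tens m n"
  shows "T (\<lambda>u. \<Sum>i\<in>A. c i * g i u) = (\<lambda>u. \<Sum>i\<in>A. c i * T (g i) u)"
proof
  fix u
  let ?X = "indices m n"
  have "T (\<lambda>u. \<Sum>i\<in>A. c i * g i u) u = (\<Sum>w\<in>?X. T (unit_vec w) u * (\<Sum>i\<in>A. c i * g i w))"
    by (intro endo_expand[OF assms(1)] tens_sum assms(2))
  also have "\<dots> = (\<Sum>i\<in>A. \<Sum>w\<in>?X. c i * (T (unit_vec w) u * g i w))"
    unfolding sum_distrib_left by (subst sum.swap) (simp add: mult.left_commute)
  also have "\<dots> = (\<Sum>i\<in>A. c i * T (g i) u)"
    by (intro sum.cong refl) (simp add: endo_expand[OF assms(1,2)] sum_distrib_left)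
  finally show "T (\<lambda>u. \<Sum>i\<in>A. c i * g i u) u = (\<Sum>i\<in>A. c i * T (g i) u)" .
qed

lemma iB_act:
  assumes j: "1 \<le> j" "j < m" and f: "f \<in> tens m n"
  shows "uact m n (iB \<sigma> (2*j)) f = opB \<sigma> (2*j) f"
proof -
  obtain p where p: "2 * j = Suc p" "odd p" "1 \<le> p" "p + 3 \<le> 2*m"
    using j by (rule even_index)
  have i: "2*j - 1 = p" "2*j + 1 = Suc (Suc p)" "2 \<le> 2*j" using p by auto
  have E: "uact m n (EE k) g = opE k g" if "k \<in> {p, Suc p, Suc (Suc p)}" "g \<in> tens m n" for k g
    unfolding uact_basic(7) using that p by (intro tens_rep_gens) auto
  have Et: "opE k g \<in> tens m n" if "k \<in> {p, Suc p, Suc (Suc p)}" "g \<in> tens m n" for k g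
    using that p by (intro opE_tens) auto
  have F: "uact m n (FF (Suc p)) f = opF (Suc p) f" "uact m n (KKinv (Suc p)) f = opKi (Suc p) f"
    unfolding uact_basic(7) using p f by (intro tens_rep_gens; simp)+
  have K: "opKi (Suc p) f \<in> tens m n" by (rule opK_tens(2)[OF f])
  have sc: "opE k (\<lambda>u. c * g u) = (\<lambda>w. c * opE k g w)" for k c g by (rule opE_fun(1))
  show ?thesis
    unfolding iB_def unfolding braid_explicit[OF i(3)] unfolding i unfolding p(1)
    by (simp add: uact_basic(1-6) uact_mult E F K Et opB_def opY_def fun_eq_iff tens_scale power2_eq_square scal_mult[symmetric])
qed

lemma Psi_uact: "Psi m n = class_act m n (uact m n)"
  by (simp add: Psi_def uact_def)

text \<open>
  Representatives in the free algebra of the generators of the iquantum group, scalars included.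
\<close>

abbreviation i_gens :: "nat \<Rightarrow> (nat \<Rightarrow> qfield) \<Rightarrow> ugen free set" where
  "i_gens m \<sigma> \<equiv> range scal \<union> (\<Union>j \<in> {j. odd j \<and> 1 \<le> j \<and> j \<le> 2*m-1}. {EE j, FF j, KK j, KKinv j}) \<union>
      {iB \<sigma> i | i. even i \<and> 2 \<le> i \<and> i \<le> 2*m-2}"

lemma iB_carrier:
  assumes "2 \<le> i" "i \<le> 2*m - 2"
  shows "iB \<sigma> i \<in> carrier (free_alg (ugens m))"
proof -
  have g: "EE (i - 1) \<in> carrier (free_alg (ugens m))" "EE i \<in> carrier (free_alg (ugens m))"
    "EE (i + 1) \<in> carrier (free_alg (ugens m))" "FF i \<in> carrier (free_alg (ugens m))"
    "KKinv i \<in> carrier (free_alg (ugens m))"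
    using assms by (auto intro!: free_alg_closed(4) simp: ugens_def)
  show ?thesis
    unfolding iB_def braid_explicit[OF assms(1)]
    by (intro free_alg_closed(5,6,8) free_alg_closed(3) free_alg_closed(9) g)
qed

lemma i_gens_carrier: "i_gens m \<sigma> \<subseteq> carrier (free_alg (ugens m))"
proof -
  have "{EE j, FF j, KK j, KKinv j} \<subseteq> carrier (free_alg (ugens m))" if "1 \<le> j" "j \<le> 2*m - 1" for j
    using that by (auto intro!: free_alg_closed(4) simp: ugens_def)
  then show ?thesis
    using iB_carrier free_alg_closed(3) by blast
qed

lemma Uq_ring: "ring (Uq m)"
  unfolding Uq_def pres_alg_def
  by (rule ideal.quotient_is_ring[OF presented_module.ideal_pres[OF Uq_module]])

lemma Ui_gens_carrier: "Uq_class m ` i_gens m \<sigma> \<subseteq> carrier (Uq m)"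
  using i_gens_carrier[of m \<sigma>] presented_module.pres_carrier[OF Uq_module, of m]
  unfolding Uq_def Uq_class_def by blast

lemma Ui_carrier: "Ui m \<sigma> \<subseteq> carrier (Uq m)"
  unfolding Ui_def by (rule ring.generate_ring_incl[OF Uq_ring Ui_gens_carrier])

lemma Psi_class:
  assumes "p \<in> carrier (free_alg (ugens m))"
  shows "Psi m n (Uq_class m p) = (\<lambda>f \<in> tens m n. uact m n p f)"
  unfolding Psi_uact Uq_class_def by (rule presented_module.class_act_class[OF Uq_module assms])

lemma Uq_class_ops:
  assumes "p \<in> carrier (free_alg (ugens m))" "r \<in> carrier (free_alg (ugens m))"
  shows "Uq_class m p \<otimes>\<^bsub>Uq m\<^esub> Uq_class m r = Uq_class m (p * r)"
    "Uq_class m p \<oplus>\<^bsub>Uq m\<^esub> Uq_class m r = Uq_class m (p + r)"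
    "\<one>\<^bsub>Uq m\<^esub> = Uq_class m 1" "\<ominus>\<^bsub>Uq m\<^esub> Uq_class m p = Uq_class m (- p)"
  unfolding Uq_def Uq_class_def
  by (rule presented_module.pres_ops[OF Uq_module assms] presented_module.pres_minus[OF Uq_module assms(1)])+

lemma Ui_representative:
  assumes "u \<in> Ui m \<sigma>"
  obtains p where "p \<in> carrier (free_alg (ugens m))" "u = Uq_class m p"
  using assms Ui_carrier[of m \<sigma>] presented_module.pres_carrier[OF Uq_module, of m]
  unfolding Uq_def Uq_class_def by blast

lemma Ui_closed:
  assumes "Uq_class m p \<in> Ui m \<sigma>" "Uq_class m r \<in> Ui m \<sigma>"
    and "p \<in> carrier (free_alg (ugens m))" "r \<in> carrier (free_alg (ugens m))"
  shows "Uq_class m (p * r) \<in> Ui m \<sigma>" "Uq_class m (p + scal c * r) \<in> Ui m \<sigma>" "Uq_class m 1 \<in> Ui m \<sigma>"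
proof -
  have m: "Uq_class m (p * r) \<in> Ui m \<sigma>"
    if "Uq_class m p \<in> Ui m \<sigma>" "Uq_class m r \<in> Ui m \<sigma>"
      "p \<in> carrier (free_alg (ugens m))" "r \<in> carrier (free_alg (ugens m))" for p r
    using generate_ring.eng_mult[OF that(1,2)[unfolded Ui_def]] Uq_class_ops(1)[OF that(3,4)] by (simp add: Ui_def)
  show "Uq_class m (p * r) \<in> Ui m \<sigma>" by (rule m) fact+
  have c: "Uq_class m (scal c) \<in> Ui m \<sigma>"
    unfolding Ui_def by (intro generate_ring.incl imageI) blast
  have cr: "Uq_class m (scal c * r) \<in> Ui m \<sigma>"
    by (intro m c assms free_alg_closed)
  have "scal c * r \<in> carrier (free_alg (ugens m))"
    by (intro free_alg_closed assms)
  from generate_ring.eng_add[OF assms(1)[unfolded Ui_def] cr[unfolded Ui_def]] Uq_class_ops(2)[OF assms(3) this]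
  show "Uq_class m (p + scal c * r) \<in> Ui m \<sigma>" by (simp add: Ui_def)
  show "Uq_class m 1 \<in> Ui m \<sigma>"
    using generate_ring.one[of "Uq m"] Uq_class_ops(3)[OF assms(3,4)] by (simp add: Ui_def)
qed

context brauer_action
begin

lemma i_gens_commute:
  assumes p: "p \<in> i_gens m \<sigma>" and R: "R \<in> b_ops m n \<sigma>" and f: "f \<in> tens m n"
  shows "uact m n p (R f) = R (uact m n p f)"
proof -
  note Re = b_ops_endo[OF R]
  have Rf: "R f \<in> tens m n" using Re f by (simp add: endo_def)
  consider c where "p = scal c" | j where "odd j" "j < 2*m" "p = EE j" | j where "odd j" "j < 2*m" "p = FF j"
    | j where "odd j" "j < 2*m" "p \<in> {KK j, KKinv j}" | j where "1 \<le> j" "j < m" "p = iB \<sigma> (2*j)"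
  proof -
    have "(\<exists>c. p = scal c) \<or> (\<exists>j. odd j \<and> j < 2*m \<and> p \<in> {EE j, FF j, KK j, KKinv j})
      \<or> (\<exists>j. 1 \<le> j \<and> j < m \<and> p = iB \<sigma> (2*j))"
    proof -
      have "j < 2*m" if "1 \<le> j" "j \<le> 2*m - 1" for j using that by auto
      moreover have "\<exists>j. 1 \<le> j \<and> j < m \<and> i = 2*j" if "even i" "2 \<le> i" "i \<le> 2*m - 2" for i
        using that by (intro exI[of _ "i div 2"]) auto
      ultimately show ?thesis using p by blast
    qed
    then show thesis using that by blast
  qed
  then show ?thesis
  proof cases
    case (1 c)
    then show ?thesis using endo_scale[OF Re f] by (simp add: uact_basic)
  next
    case (2 j)
    then have "1 \<le> j" "j \<le> 2*m - 1" by (auto intro: odd_pos Suc_leI)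
    then show ?thesis
      unfolding 2(3) uact_basic(7) using ops_commute[OF i_E[OF 2(1,2)] R f] by (simp add: tens_rep_gens f Rf)
  next
    case (3 j)
    then have "1 \<le> j" "j \<le> 2*m - 1" by (auto intro: odd_pos Suc_leI)
    then show ?thesis
      unfolding 3(3) uact_basic(7) using ops_commute[OF i_F[OF 3(1,2)] R f] by (simp add: tens_rep_gens f Rf)
  next
    case (4 j)
    then have j: "1 \<le> j" "j \<le> 2*m - 1" by (auto intro: odd_pos Suc_leI)
    have "opK j (R f) = R (opK j f)" "opKi j (R f) = R (opKi j f)"
    proof -
      have "opK j (R f) = R (opK j f) \<and> opKi j (R f) = R (opKi j f)"
        using R
      proof cases
        case b_e
        show ?thesis
          unfolding b_e e_op_ope using C.opK_ope[OF 4(1,2)] by (intro conjI commutes_eI opK_tens f) auto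
      next
        case (b_H k)
        show ?thesis unfolding b_H by (simp add: fun_eq_iff opH_opK)
      qed
      then show "opK j (R f) = R (opK j f)" "opKi j (R f) = R (opKi j f)" by auto
    qed
    then show ?thesis
      using 4(3) j by (auto simp: uact_basic(7) tens_rep_gens f Rf)
  next
    case (5 j)
    show ?thesis
      unfolding 5(3) using ops_commute[OF i_B[OF 5(1,2)] R f] by (simp add: iB_act[OF 5(1,2)] f Rf)
  qed
qed

text \<open>
  The elements with a representative in the free algebra that commutes with \<open>H\<^sub>k\<close> and \<open>e\<close> form a subalgebra.
\<close>

lemma Ui_commute:
  assumes "u \<in> Ui m \<sigma>" "R \<in> b_ops m n \<sigma>" "f \<in> tens m n"
  shows "Psi m n u (R f) = R (Psi m n u f)"
proof -
  have Rt: "R f \<in> tens m n" if "R \<in> b_ops m n \<sigma>" "f \<in> tens m n" for R f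
    using b_ops_endo[OF that(1)] that(2) by (simp add: endo_def)
  have "\<exists>p \<in> carrier (free_alg (ugens m)). u = Uq_class m p \<and>
      (\<forall>R \<in> b_ops m n \<sigma>. \<forall>f \<in> tens m n. uact m n p (R f) = R (uact m n p f))"
    using assms(1) unfolding Ui_def
  proof induction
    case one
    have "\<one>\<^bsub>Uq m\<^esub> = Uq_class m 1"
      using Uq_class_ops(3)[OF free_alg_closed(1,1)] .
    then show ?case
      by (intro bexI[of _ 1]) (auto simp: uact_basic free_alg_closed)
  next
    case (incl h)
    then obtain p where "p \<in> i_gens m \<sigma>" "h = Uq_class m p" by blast
    then show ?case
      using i_gens_commute[of p] i_gens_carrier[of m \<sigma>] by blast
  next
    case (a_inv h)
    then obtain p where p: "p \<in> carrier (free_alg (ugens m))" "h = Uq_class m p"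
      "\<forall>R \<in> b_ops m n \<sigma>. \<forall>f \<in> tens m n. uact m n p (R f) = R (uact m n p f)" by blast
    have "uact m n (- p) (R f) = R (uact m n (- p) f)" if "R \<in> b_ops m n \<sigma>" "f \<in> tens m n" for R f
      using endo_scale[OF b_ops_endo[OF that(1)] uact_tens[OF p(1) that(2)], of "- 1"] p(3) that
      by (simp add: uact_basic)
    then show ?case
      using p Uq_class_ops(4)[OF p(1) p(1)] by (intro bexI[of _ "- p"]) (auto simp: free_alg_closed)
  next
    case (eng_add h k)
    then obtain p r where p: "p \<in> carrier (free_alg (ugens m))" "h = Uq_class m p"
      "\<forall>R \<in> b_ops m n \<sigma>. \<forall>f \<in> tens m n. uact m n p (R f) = R (uact m n p f)"
      and r: "r \<in> carrier (free_alg (ugens m))" "k = Uq_class m r"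
      "\<forall>R \<in> b_ops m n \<sigma>. \<forall>f \<in> tens m n. uact m n r (R f) = R (uact m n r f)" by blast
    have "uact m n (p + r) (R f) = R (uact m n (p + r) f)" if "R \<in> b_ops m n \<sigma>" "f \<in> tens m n" for R f
    proof -
      have "R (\<lambda>u. uact m n p f u + 1 * uact m n r f u) = (\<lambda>u. R (uact m n p f) u + 1 * R (uact m n r f) u)"
        using b_ops_endo[OF that(1)] uact_tens[OF p(1) that(2)] uact_tens[OF r(1) that(2)]
        unfolding endo_def by blast
      then show ?thesis using p(3) r(3) that by (simp add: uact_basic)
    qed
    then show ?case
      using p r Uq_class_ops(2)[OF p(1) r(1)] by (intro bexI[of _ "p + r"]) (auto simp: free_alg_closed)
  next
    case (eng_mult h k)
    then obtain p r where p: "p \<in> carrier (free_alg (ugens m))" "h = Uq_class m p"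
      "\<forall>R \<in> b_ops m n \<sigma>. \<forall>f \<in> tens m n. uact m n p (R f) = R (uact m n p f)"
      and r: "r \<in> carrier (free_alg (ugens m))" "k = Uq_class m r"
      "\<forall>R \<in> b_ops m n \<sigma>. \<forall>f \<in> tens m n. uact m n r (R f) = R (uact m n r f)" by blast
    have "uact m n (p * r) (R f) = R (uact m n (p * r) f)" if "R \<in> b_ops m n \<sigma>" "f \<in> tens m n" for R f
      using p(3) r(3) that uact_tens[OF r(1) that(2)] by (simp add: uact_mult)
    then show ?case
      using p r Uq_class_ops(1)[OF p(1) r(1)] by (intro bexI[of _ "p * r"]) (auto simp: free_alg_closed)
  qed
  then obtain p where "p \<in> carrier (free_alg (ugens m))" "u = Uq_class m p"
    "uact m n p (R f) = R (uact m n p f)" using assms(2,3) by blast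
  then show ?thesis
    using Rt[OF assms(2,3)] assms(3) by (simp add: Psi_class)
qed

abbreviation (input) "BB \<equiv> qBrauer n (- inverse qq) (qq ^ (2*m))"

abbreviation (input) "Bcls \<equiv> pres_class (bgens n) (brels n (- inverse qq) (qq ^ (2*m)))"

lemma Phi_bact: "Phi m n \<sigma> = class_act m n bact"
  by (simp add: Phi_def bact_def)

lemma Phi_class:
  assumes "p \<in> carrier (free_alg (bgens n))"
  shows "Phi m n \<sigma> (Bcls p) = (\<lambda>f \<in> tens m n. bact p f)"
  unfolding Phi_bact by (rule presented_module.class_act_class[OF brauer_module assms])

lemma qBrauer_carrier: "carrier BB = Bcls ` carrier (free_alg (bgens n))"
  unfolding qBrauer_def by (rule presented_module.pres_carrier[OF brauer_module])

lemma Phi_End: "b \<in> carrier BB \<Longrightarrow> Phi m n \<sigma> b \<in> carrier (End_tens m n)"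
  unfolding qBrauer_carrier Phi_bact using presented_module.class_act_End[OF brauer_module] by blast

lemma Psi_End: "u \<in> Ui m \<sigma> \<Longrightarrow> Psi m n u \<in> carrier (End_tens m n)"
  unfolding Psi_uact Uq_class_def
  by (erule Ui_representative) (simp add: Uq_class_def presented_module.class_act_End[OF Uq_module])

lemma brauer_op_b_ops:
  assumes "g \<in> bgens n"
  obtains R where "R \<in> b_ops m n \<sigma>" "\<And>f. f \<in> tens m n \<Longrightarrow> brauer_op m n \<sigma> g f = R f"
  using assms
proof (cases rule: bgens_cases)
  case 1
  then show ?thesis
    by (intro that[OF b_e]) (simp add: brauer_op_e e_op_ope del: brauer_op.simps)
next
  case (2 k)
  then show ?thesis
    by (intro that[OF b_H]) (simp_all add: brauer_op_H del: brauer_op.simps)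
qed

lemma bact_commute:
  assumes T: "endo m n T" and comm: "\<And>R f. R \<in> b_ops m n \<sigma> \<Longrightarrow> f \<in> tens m n \<Longrightarrow> T (R f) = R (T f)"
    and p: "p \<in> carrier (free_alg (bgens n))" and f: "f \<in> tens m n"
  shows "T (bact p f) = bact p (T f)"
proof -
  have Tt: "T f \<in> tens m n" if "f \<in> tens m n" for f using T that by (simp add: endo_def)
  have gen: "T (brauer_op m n \<sigma> g f) = brauer_op m n \<sigma> g (T f)" if "g \<in> bgens n" "f \<in> tens m n" for g f
    using that(1) by (rule brauer_op_b_ops) (simp add: comm Tt that(2) del: brauer_op.simps)
  have word: "fold (brauer_op m n \<sigma>) xs f \<in> tens m n \<and> T (fold (brauer_op m n \<sigma>) xs f) = fold (brauer_op m n \<sigma>) xs (T f)"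
    if "set xs \<subseteq> bgens n" "f \<in> tens m n" for xs f
    using that by (induction xs arbitrary: f) (auto simp: brauer_op_tens gen simp del: brauer_op.simps)
  have keys: "set (letters w) \<subseteq> bgens n" if "w \<in> Poly_Mapping.keys p" for w
    using p that by (simp add: free_alg_simps)
  show ?thesis
    unfolding bact_def free_ract_word word_act_def
    using word[OF keys f] by (subst endo_sum[OF T]) auto
qed

lemma actions_commute:
  assumes u: "u \<in> Ui m \<sigma>" and b: "b \<in> carrier BB" and f: "f \<in> tens m n"
  shows "Phi m n \<sigma> b (Psi m n u f) = Psi m n u (Phi m n \<sigma> b f)"
proof -
  note T = End_tens_endo[OF Psi_End[OF u]]
  obtain p where p: "p \<in> carrier (free_alg (bgens n))" "b = Bcls p" using b qBrauer_carrier by blast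
  have "Psi m n u f \<in> tens m n" using T f by (simp add: endo_def)
  then show ?thesis
    using bact_commute[OF T Ui_commute[OF u] p(1) f] f by (simp add: p(2) Phi_class[OF p(1)])
qed

lemma i_ops_Psi:
  assumes "T \<in> i_ops m \<sigma>"
  shows "\<exists>u \<in> Ui m \<sigma>. \<forall>f \<in> tens m n. Psi m n u f = T f"
proof -
  have g: "\<exists>u \<in> Ui m \<sigma>. \<forall>f \<in> tens m n. Psi m n u f = T f"
    if p: "p \<in> i_gens m \<sigma>" "\<And>f. f \<in> tens m n \<Longrightarrow> uact m n p f = T f" for p
  proof (intro bexI ballI)
    show "Uq_class m p \<in> Ui m \<sigma>" unfolding Ui_def by (intro generate_ring.incl imageI p(1))
    have "p \<in> carrier (free_alg (ugens m))" using p(1) i_gens_carrier by blast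
    then show "Psi m n (Uq_class m p) f = T f" if "f \<in> tens m n" for f
      using that p(2) by (simp add: Psi_class)
  qed
  show ?thesis
    using assms
  proof cases
    case (i_E j)
    then have "1 \<le> j" "j \<le> 2*m - 1" by (auto intro: odd_pos Suc_leI)
    then show ?thesis
      using i_E by (intro g[of "EE j"]) (auto simp: uact_basic(7) tens_rep_gens)
  next
    case (i_F j)
    then have "1 \<le> j" "j \<le> 2*m - 1" by (auto intro: odd_pos Suc_leI)
    then show ?thesis
      using i_F by (intro g[of "FF j"]) (auto simp: uact_basic(7) tens_rep_gens)
  next
    case (i_B j)
    have "even (2*j)" "2 \<le> 2*j" "2*j \<le> 2*m - 2" using i_B(2,3) by auto
    then show ?thesis
      using i_B by (intro g[of "iB \<sigma> (2*j)"]) (auto simp: iB_act)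
  qed
qed

lemma b_ops_Phi:
  assumes "R \<in> b_ops m n \<sigma>"
  shows "\<exists>b \<in> carrier BB. \<forall>f \<in> tens m n. Phi m n \<sigma> b f = R f"
proof -
  have "\<exists>g \<in> bgens n. \<forall>f \<in> tens m n. brauer_op m n \<sigma> g f = R f"
    using assms
  proof cases
    case b_e
    then show ?thesis
      by (intro bexI[of _ Be]) (simp_all add: brauer_op_e e_op_ope bgens_def del: brauer_op.simps)
  next
    case (b_H k)
    then have "BH (Suc k) \<in> bgens n" by (auto simp: bgens_def)
    then show ?thesis
      using b_H by (intro bexI[of _ "BH (Suc k)"]) (simp_all add: brauer_op_H del: brauer_op.simps)
  qed
  then obtain g where g: "g \<in> bgens n" "\<forall>f \<in> tens m n. brauer_op m n \<sigma> g f = R f" by blast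
  have c: "gen g \<in> carrier (free_alg (bgens n))" by (rule free_alg_closed(4)[OF g(1)])
  show ?thesis
  proof (intro bexI ballI)
    show "Bcls (gen g) \<in> carrier BB" unfolding qBrauer_carrier by (intro imageI c)
    show "Phi m n \<sigma> (Bcls (gen g)) f = R f" if "f \<in> tens m n" for f
      using that g(2) by (simp add: Phi_class[OF c] bact_basic(6) del: brauer_op.simps)
  qed
qed

theorem Psi_image: "Psi m n ` Ui m \<sigma> = End_commuting m n (carrier BB) (Phi m n \<sigma>)"
proof (intro equalityI subsetI)
  fix T assume "T \<in> Psi m n ` Ui m \<sigma>"
  then show "T \<in> End_commuting m n (carrier BB) (Phi m n \<sigma>)"
    using Psi_End actions_commute by (auto simp: End_commuting_def)
next
  fix T assume T: "T \<in> End_commuting m n (carrier BB) (Phi m n \<sigma>)"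
  show "T \<in> Psi m n ` Ui m \<sigma>"
  proof (rule image_of_commutant[OF Psi_End _ _ _ _ _ _ quantum_duality(1) T])
    show "\<exists>a\<in>Ui m \<sigma>. \<forall>f\<in>tens m n. Psi m n a f = f"
    proof (intro bexI ballI)
      show "Uq_class m 1 \<in> Ui m \<sigma>"
        using generate_ring.one[of "Uq m"] Uq_class_ops(3)[OF free_alg_closed(1,1)] by (simp add: Ui_def)
      show "Psi m n (Uq_class m 1) f = f" if "f \<in> tens m n" for f
        using that by (simp add: Psi_class free_alg_closed uact_basic)
    qed
    fix a b c assume "a \<in> Ui m \<sigma>" "b \<in> Ui m \<sigma>"
    then obtain p r where p: "p \<in> carrier (free_alg (ugens m))" "a = Uq_class m p"
      and r: "r \<in> carrier (free_alg (ugens m))" "b = Uq_class m r" and ab: "Uq_class m p \<in> Ui m \<sigma>" "Uq_class m r \<in> Ui m \<sigma>"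
      by (metis Ui_representative)
    note closed = Ui_closed(1)[OF ab p(1) r(1)] Ui_closed(2)[where c = c, OF ab p(1) r(1)]
    have cs: "scal c * r \<in> carrier (free_alg (ugens m))" "p * r \<in> carrier (free_alg (ugens m))"
      by (intro free_alg_closed p r)+
    have cs': "p + scal c * r \<in> carrier (free_alg (ugens m))"
      by (intro free_alg_closed(5) p cs)
    show "\<exists>d\<in>Ui m \<sigma>. \<forall>f\<in>tens m n. Psi m n d f = (\<lambda>u. Psi m n a f u + c * Psi m n b f u)"
      unfolding p(2) r(2)
      by (intro bexI[OF _ closed(2)]) (simp add: Psi_class p(1) r(1) cs' uact_basic(1,6) uact_mult)
    show "\<exists>d\<in>Ui m \<sigma>. \<forall>f\<in>tens m n. Psi m n d f = Psi m n a (Psi m n b f)"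
      unfolding p(2) r(2)
      by (intro bexI[OF _ closed(1)]) (simp add: Psi_class p(1) r(1) cs uact_mult uact_tens)
  next
    fix g assume "g \<in> opmat (indices m n) ` i_ops m \<sigma>"
    then obtain S where S: "S \<in> i_ops m \<sigma>" "g = opmat (indices m n) S" by blast
    obtain u where u: "u \<in> Ui m \<sigma>" "\<forall>f \<in> tens m n. Psi m n u f = S f" using i_ops_Psi[OF S(1)] by blast
    have "g = opmat (indices m n) (Psi m n u)"
      unfolding S(2) by (rule opmat_eqI) (simp add: u(2))
    then show "\<exists>a\<in>Ui m \<sigma>. g = opmat (indices m n) (Psi m n a)" using u(1) by blast
  next
    show "endo m n (Phi m n \<sigma> b)" if "b \<in> carrier BB" for b
      by (rule End_tens_endo[OF Phi_End[OF that]])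
  next
    fix h assume "h \<in> opmat (indices m n) ` b_ops m n \<sigma>"
    then obtain R where R: "R \<in> b_ops m n \<sigma>" "h = opmat (indices m n) R" by blast
    obtain b where b: "b \<in> carrier BB" "\<forall>f \<in> tens m n. Phi m n \<sigma> b f = R f" using b_ops_Phi[OF R(1)] by blast
    have "h = opmat (indices m n) (Phi m n \<sigma> b)"
      unfolding R(2) by (rule opmat_eqI) (simp add: b(2))
    then show "\<exists>b\<in>carrier BB. h = opmat (indices m n) (Phi m n \<sigma> b)" using b(1) by blast
  qed
qed

theorem Phi_image: "Phi m n \<sigma> ` carrier BB = End_commuting m n (Ui m \<sigma>) (Psi m n)"
proof (intro equalityI subsetI)
  fix T assume "T \<in> Phi m n \<sigma> ` carrier BB"
  then show "T \<in> End_commuting m n (Ui m \<sigma>) (Psi m n)"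
    using Phi_End actions_commute by (auto simp: End_commuting_def)
next
  fix T assume T: "T \<in> End_commuting m n (Ui m \<sigma>) (Psi m n)"
  show "T \<in> Phi m n \<sigma> ` carrier BB"
  proof (rule image_of_commutant[OF Phi_End _ _ _ _ _ _ quantum_duality(2) T])
    show "\<exists>a\<in>carrier BB. \<forall>f\<in>tens m n. Phi m n \<sigma> a f = f"
    proof (intro bexI ballI)
      show "Bcls 1 \<in> carrier BB" unfolding qBrauer_carrier by (intro imageI free_alg_closed)
      show "Phi m n \<sigma> (Bcls 1) f = f" if "f \<in> tens m n" for f
        using that by (simp add: Phi_class free_alg_closed bact_basic)
    qed
    fix a b c assume "a \<in> carrier BB" "b \<in> carrier BB"
    then obtain p r where p: "p \<in> carrier (free_alg (bgens n))" "a = Bcls p"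
      and r: "r \<in> carrier (free_alg (bgens n))" "b = Bcls r"
      unfolding qBrauer_carrier by blast
    have cs: "r * scal c \<in> carrier (free_alg (bgens n))" "r * p \<in> carrier (free_alg (bgens n))"
      by (intro free_alg_closed p r)+
    have cs': "p + r * scal c \<in> carrier (free_alg (bgens n))"
      by (intro free_alg_closed(5) p cs)
    show "\<exists>d\<in>carrier BB. \<forall>f\<in>tens m n. Phi m n \<sigma> d f = (\<lambda>u. Phi m n \<sigma> a f u + c * Phi m n \<sigma> b f u)"
      unfolding p(2) r(2) qBrauer_carrier
      by (intro bexI[OF _ imageI[OF cs']]) (simp add: Phi_class p(1) r(1) cs' bact_basic(1,5) bact_mult)
    show "\<exists>d\<in>carrier BB. \<forall>f\<in>tens m n. Phi m n \<sigma> d f = Phi m n \<sigma> a (Phi m n \<sigma> b f)"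
      unfolding p(2) r(2) qBrauer_carrier
      by (intro bexI[OF _ imageI[OF cs(2)]]) (simp add: Phi_class p(1) r(1) cs bact_mult bact_tens)
  next
    fix h assume "h \<in> opmat (indices m n) ` b_ops m n \<sigma>"
    then obtain R where R: "R \<in> b_ops m n \<sigma>" "h = opmat (indices m n) R" by blast
    obtain b where b: "b \<in> carrier BB" "\<forall>f \<in> tens m n. Phi m n \<sigma> b f = R f" using b_ops_Phi[OF R(1)] by blast
    have "h = opmat (indices m n) (Phi m n \<sigma> b)"
      unfolding R(2) by (rule opmat_eqI) (simp add: b(2))
    then show "\<exists>b\<in>carrier BB. h = opmat (indices m n) (Phi m n \<sigma> b)" using b(1) by blast
  next
    show "endo m n (Psi m n u)" if "u \<in> Ui m \<sigma>" for u
      by (rule End_tens_endo[OF Psi_End[OF that]])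
  next
    fix g assume "g \<in> opmat (indices m n) ` i_ops m \<sigma>"
    then obtain S where S: "S \<in> i_ops m \<sigma>" "g = opmat (indices m n) S" by blast
    obtain u where u: "u \<in> Ui m \<sigma>" "\<forall>f \<in> tens m n. Psi m n u f = S f" using i_ops_Psi[OF S(1)] by blast
    have "g = opmat (indices m n) (Psi m n u)"
      unfolding S(2) by (rule opmat_eqI) (simp add: u(2))
    then show "\<exists>a\<in>Ui m \<sigma>. g = opmat (indices m n) (Psi m n a)" using u(1) by blast
  qed
qed

end

theorem theorem5p4:
  fixes m n :: nat and \<sigma> :: "nat \<Rightarrow> qfield"
  assumes "m \<ge> 1" and "n \<ge> 2"
    and "\<And>i. \<lbrakk>even i; 2 \<le> i; i \<le> 2*m-2\<rbrakk> \<Longrightarrow> \<sigma> i \<in> laurent_int \<and> \<sigma> i \<noteq> 0"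
  shows "let B = qBrauer n (- inverse qq) (qq ^ (2*m));
             \<Psi> = Psi m n; \<Phi> = Phi m n \<sigma> in
           \<Psi> \<in> ring_hom (Uq m) (End_tens m n) \<and>
           \<Phi> \<in> ring_hom B (opposite (End_tens m n)) \<and>
           (\<forall>u \<in> Ui m \<sigma>. \<forall>b \<in> carrier B. \<forall>f \<in> tens m n. \<Phi> b (\<Psi> u f) = \<Psi> u (\<Phi> b f)) \<and>
           \<Psi> ` Ui m \<sigma> = End_commuting m n (carrier B) \<Phi> \<and>
           \<Phi> ` carrier B = End_commuting m n (Ui m \<sigma>) \<Psi>"
proof -
  interpret brauer_action m n \<sigma>
    using assms by unfold_locales auto
  have "Psi m n \<in> ring_hom (Uq m) (End_tens m n)"
    unfolding Psi_uact Uq_def by (rule presented_module.class_act_hom_left[OF Uq_module uact_mult])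
  moreover have "Phi m n \<sigma> \<in> ring_hom BB (opposite (End_tens m n))"
    unfolding Phi_bact qBrauer_def by (rule presented_module.class_act_hom_right[OF brauer_module bact_mult])
  ultimately show ?thesis
    unfolding Let_def using actions_commute Psi_image Phi_image by blast
qed

end
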